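(* Let $U\subset\mathbb{R}^n$ be a definable closed subspace of $\mathbb{R}^n$ such that $U^\infty$ is a compact connected surface with boundary. Let $f:U\to U$ be a homeomorphism such that $\varLambda_{\mathrm{comb}}(f,U)\geq 1$. Then $f$ must have a fixed point.
   Context: Fix an o-minimal structure on $\mathbb{R}$ containing all semilinear sets; "definable" refers to this structure. Simplicial complexes are finite (geometric, in some $\mathbb{R}^n$) and are identified with their underlying compact polyhedra. $U^\infty$ denotes the Alexandroff (one-point) compactification of $U$. A definable compactification $X$ of a definable space $U$ is a compactification such that $X$ and the inclusion of $U$ in $X$ are definable. Combinatorial Lefschetz number. Let $Z$ be a simplicial complex (or a compact definable set), $D\subset Z$ definable and $l:Z\to Z$ a continuous map. By the definable triangulation theorem there are a simplicial complex $K$ and a definable homeomorphism $\tau:K\to Z$ such that $A=\tau^{-1}(D)$ is a union of open simplices (interiors of simplices) of $K$; put $\varphi=\tau^{-1}\circ l\circ\tau$. Let $\varphi^{\mathrm{simp}}:K'\to K$ be a simplicial approximation of $\varphi$, where $K'$ is a subdivision of $K$, and let $M_p(\varphi^{\mathrm{simp}},K)$ be the matrix, in the basis of (oriented) $p$-simplices of $K$, of the composite $C_p(K;\mathbb{Q})\to C_p(K';\mathbb{Q})\to C_p(K;\mathbb{Q})$ of the subdivision operator with the chain map induced by $\varphi^{\mathrm{simp}}$. Let $M_p(\varphi^{\mathrm{simp}},K)_{|A}$ be the submatrix with rows and columns indexed by the $p$-simplices whose interior is contained in $A$. Define $$\varLambda(l,D)_Z:=\sum_p(-1)^p\,\mathrm{tr}\bigl(M_p(\varphi^{\mathrm{simp}},K)_{|A}\bigr).$$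 It is independent of the choices when $l$ is open, $l(D)\subset D$ and $l(Z\setminus D)\subset Z\setminus D$. The number $\varLambda_{\mathrm{comb}}$. Let $U\subset\mathbb{R}^n$ be definable and $f:U\to U$ continuous. If there exist a definable compactification $X$ of $U$ and an open extension $f':X\to X$ of $f$ with $f'(X\setminus U)\subset X\setminus U$, define $\varLambda_{\mathrm{comb}}(f,U)=\varLambda(f',U)_X$. This is independent of the choice of $X$ and $f'$. If $U$ is definable, closed in $\mathbb{R}^n$ and unbounded and $f:U\to U$ is a homeomorphism, then $\varLambda_{\mathrm{comb}}(f,U)$ is always defined, by taking $X=U^\infty$ and the extension of $f$ fixing $\infty$. *)

theory Defs
  imports "HOL-Analysis.Analysis" "HOL-Library.Function_Algebras"
begin

text \<open>
  Throughout, real n-space is the library's \<^term>\<open>Euclidean_space n\<close>: its points are the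
  sequences \<open>x :: nat \<Rightarrow> real\<close> with \<open>x i = 0\<close> for \<open>i \<ge> n\<close>, the coordinates being \<open>x 0, ..., x (n-1)\<close>.
  This makes all dimensions available inside one formula. The pointwise vector space structure
  below makes the library's \<open>convex hull\<close> and \<^const>\<open>affine_dependent\<close> applicable to these points.
\<close>

instantiation "fun" :: (type, real_vector) real_vector
begin

definition scaleR_fun :: "real \<Rightarrow> ('a \<Rightarrow> 'b) \<Rightarrow> 'a \<Rightarrow> 'b"
  where "scaleR_fun r f = (\<lambda>x. r *\<^sub>R f x)"

instance
  by standard (simp_all add: scaleR_fun_def fun_eq_iff scaleR_add_right scaleR_add_left)

end

abbreviation Rn :: "nat \<Rightarrow> (nat \<Rightarrow> real) set"
  where "Rn n \<equiv> topspace (Euclidean_space n)"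

abbreviation subspace_of_Rn :: "nat \<Rightarrow> (nat \<Rightarrow> real) set \<Rightarrow> (nat \<Rightarrow> real) topology"
  where "subspace_of_Rn n A \<equiv> subtopology (Euclidean_space n) A"


section \<open>O-minimal structures\<close>

text \<open>A pair \<open>(c, b)\<close> stands for the affine function \<open>x \<mapsto> c 0 * x 0 + ... + c (n-1) * x (n-1) + b\<close>.\<close>

definition affine_eval :: "nat \<Rightarrow> (nat \<Rightarrow> real) \<times> real \<Rightarrow> (nat \<Rightarrow> real) \<Rightarrow> real"
  where "affine_eval n g x = (\<Sum>i<n. fst g i * x i) + snd g"

definition basic_semilinear :: "nat \<Rightarrow> (nat \<Rightarrow> real) set \<Rightarrow> bool"
  where "basic_semilinear n A \<longleftrightarrow>
    (\<exists>F G. finite F \<and> finite G \<and>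
       A = {x \<in> Rn n. (\<forall>g\<in>F. affine_eval n g x = 0) \<and> (\<forall>g\<in>G. affine_eval n g x > 0)})"

definition semilinear :: "nat \<Rightarrow> (nat \<Rightarrow> real) set \<Rightarrow> bool"
  where "semilinear n A \<longleftrightarrow>
    (\<exists>\<A>. finite \<A> \<and> (\<forall>B\<in>\<A>. basic_semilinear n B) \<and> A = \<Union>\<A>)"

text \<open>
  \<open>D n\<close> is the collection of definable subsets of n-space. The usual requirements that the order
  and the diagonals be definable, and that conversely every finite union of points and intervals
  of the line be definable, are instances of \<open>semilinear_definable\<close>.
\<close>

locale o_minimal_structure =
  fixes D :: "nat \<Rightarrow> (nat \<Rightarrow> real) set set"
  assumes definable_subset: "A \<in> D n \<Longrightarrow> A \<subseteq> Rn n"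
    and definable_Un: "A \<in> D n \<Longrightarrow> B \<in> D n \<Longrightarrow> A \<union> B \<in> D n"
    and definable_Compl: "A \<in> D n \<Longrightarrow> Rn n - A \<in> D n"
    and definable_times_line: "A \<in> D n \<Longrightarrow> {x \<in> Rn (Suc n). x(n := 0) \<in> A} \<in> D (Suc n)"
    and definable_line_times: "A \<in> D n \<Longrightarrow> {x \<in> Rn (Suc n). (\<lambda>i. x (Suc i)) \<in> A} \<in> D (Suc n)"
    and definable_projection: "A \<in> D (Suc n) \<Longrightarrow> (\<lambda>x. x(n := 0)) ` A \<in> D n"
    and semilinear_definable: "semilinear n A \<Longrightarrow> A \<in> D n"
    and o_minimal: "A \<in> D 1 \<Longrightarrow>
      \<exists>\<I>. finite \<I> \<and> (\<forall>I\<in>\<I>. is_interval I) \<and> (\<lambda>x. x 0) ` A = \<Union>\<I>"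

definition join_points :: "nat \<Rightarrow> (nat \<Rightarrow> real) \<Rightarrow> (nat \<Rightarrow> real) \<Rightarrow> (nat \<Rightarrow> real)"
  where "join_points n x y = (\<lambda>i. if i < n then x i else y (i - n))"

definition definable_map ::
    "(nat \<Rightarrow> (nat \<Rightarrow> real) set set) \<Rightarrow> nat \<Rightarrow> nat \<Rightarrow> (nat \<Rightarrow> real) set \<Rightarrow> ((nat \<Rightarrow> real) \<Rightarrow> (nat \<Rightarrow> real)) \<Rightarrow> bool"
  where "definable_map D n m A f \<longleftrightarrow>
    A \<in> D n \<and> f ` A \<subseteq> Rn m \<and> (\<lambda>x. join_points n x (f x)) ` A \<in> D (n + m)"


section \<open>Geometric simplicial complexes\<close>

text \<open>
  A simplex is given by its finite nonempty set \<open>s\<close> of vertices; the closed simplex is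
  \<open>convex hull s\<close>. (The library's \<^const>\<open>simplicial_complex\<close> is restricted to
  a fixed Euclidean space type.)
\<close>

type_synonym complex_of_points = "(nat \<Rightarrow> real) set set"

definition geometric_complex :: "nat \<Rightarrow> complex_of_points \<Rightarrow> bool"
  where "geometric_complex k K \<longleftrightarrow>
    finite K \<and>
    (\<forall>s\<in>K. finite s \<and> s \<noteq> {} \<and> s \<subseteq> Rn k \<and> \<not> affine_dependent s) \<and>
    (\<forall>s\<in>K. \<forall>t. t \<noteq> {} \<and> t \<subseteq> s \<longrightarrow> t \<in> K) \<and>
    (\<forall>s\<in>K. \<forall>t\<in>K. convex hull s \<inter> convex hull t = convex hull (s \<inter> t))"

definition polyhedron_of :: "complex_of_points \<Rightarrow> (nat \<Rightarrow> real) set"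
  where "polyhedron_of K = (\<Union>s\<in>K. convex hull s)"

definition open_simplex :: "(nat \<Rightarrow> real) set \<Rightarrow> (nat \<Rightarrow> real) set"
  where "open_simplex s =
    {x. \<exists>u. (\<forall>v\<in>s. 0 < u v) \<and> sum u s = 1 \<and> x = (\<Sum>v\<in>s. u v *\<^sub>R v)}"

definition open_star :: "complex_of_points \<Rightarrow> (nat \<Rightarrow> real) \<Rightarrow> (nat \<Rightarrow> real) set"
  where "open_star K v = (\<Union>s\<in>{s \<in> K. v \<in> s}. open_simplex s)"

definition subdivision_of :: "nat \<Rightarrow> complex_of_points \<Rightarrow> complex_of_points \<Rightarrow> bool"
  where "subdivision_of k K' K \<longleftrightarrow>
    geometric_complex k K' \<and> polyhedron_of K' = polyhedron_of K \<and>
    (\<forall>s\<in>K'. \<exists>t\<in>K. convex hull s \<subseteq> convex hull t)"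

definition simplicial_map ::
    "complex_of_points \<Rightarrow> complex_of_points \<Rightarrow> ((nat \<Rightarrow> real) \<Rightarrow> (nat \<Rightarrow> real)) \<Rightarrow> bool"
  where "simplicial_map K' K \<psi> \<longleftrightarrow> (\<forall>s\<in>K'. \<psi> ` s \<in> K)"

definition simplicial_approximation ::
    "complex_of_points \<Rightarrow> complex_of_points \<Rightarrow> ((nat \<Rightarrow> real) \<Rightarrow> (nat \<Rightarrow> real))
      \<Rightarrow> ((nat \<Rightarrow> real) \<Rightarrow> (nat \<Rightarrow> real)) \<Rightarrow> bool"
  where "simplicial_approximation K' K \<phi> \<psi> \<longleftrightarrow>
    simplicial_map K' K \<psi> \<and> (\<forall>v\<in>\<Union>K'. \<phi> ` open_star K' v \<subseteq> open_star K (\<psi> v))"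


section \<open>Oriented simplicial chains with rational coefficients\<close>

text \<open>
  An oriented p-chain is represented by its alternating coefficient function: \<open>c [v0,...,vp]\<close> is
  the coefficient of the oriented simplex \<open>[v0,...,vp]\<close>, so it changes by the sign of
  a permutation when the vertices are permuted, and it vanishes on tuples that do not enumerate
  the vertices of a p-simplex without repetition.
\<close>

type_synonym 'v chain = "'v list \<Rightarrow> rat"

definition simplicial_chains :: "'v set set \<Rightarrow> nat \<Rightarrow> 'v chain set"
  where "simplicial_chains K p = {c.
    (\<forall>xs. c xs \<noteq> 0 \<longrightarrow> distinct xs \<and> set xs \<in> K \<and> length xs = Suc p) \<and>
    (\<forall>xs \<pi>. \<pi> permutes set xs \<longrightarrow> c (map \<pi> xs) = of_int (sign \<pi>) * c xs)}"

text \<open>The elementary chain of an oriented simplex; the sum has at most one term.\<close>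

definition oriented_chain :: "'v list \<Rightarrow> 'v chain"
  where "oriented_chain xs = (\<lambda>ys. \<Sum>\<pi> | \<pi> permutes set xs \<and> map \<pi> xs = ys. of_int (sign \<pi>))"

text \<open>
  The boundary of a chain of positive dimension. The coefficient of \<open>[w1,...,wp]\<close> in the alternating
  sum of the faces of \<open>c\<close> is the sum over all \<open>v\<close> of the coefficient of \<open>[v,w1,...,wp]\<close> in \<open>c\<close>.
\<close>

definition simplicial_boundary :: "'v set set \<Rightarrow> 'v chain \<Rightarrow> 'v chain"
  where "simplicial_boundary K c = (\<lambda>ys. \<Sum>v\<in>\<Union>K. c (v # ys))"

definition augmentation :: "'v set set \<Rightarrow> 'v chain \<Rightarrow> rat"
  where "augmentation K c = (\<Sum>v\<in>\<Union>K. c [v])"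

text \<open>
  The chain map of a simplicial map \<open>\<psi>\<close> on \<open>K'\<close>, sending \<open>[v0,...,vp]\<close> to \<open>[\<psi> v0,...,\<psi> vp]\<close>,
  or to 0 if these vertices are not distinct.  For each simplex of \<open>K'\<close> mapped
  bijectively onto the simplex with vertices \<open>ys\<close>, exactly one of its orderings \<open>xs\<close> is mapped to \<open>ys\<close>.
\<close>

definition induced_chain_map :: "'v set set \<Rightarrow> ('v \<Rightarrow> 'w) \<Rightarrow> 'v chain \<Rightarrow> 'w chain"
  where "induced_chain_map K' \<psi> c = (\<lambda>ys. if distinct ys
    then \<Sum>xs | set xs \<in> K' \<and> length xs = length ys \<and> map \<psi> xs = ys. c xs else 0)"

text \<open>
  The subdivision operator is the unique augmentation-preserving chain map that sends
  every simplex \<open>\<sigma>\<close> of \<open>K\<close> to a chain of \<open>K'\<close> carried by \<open>\<sigma>\<close>.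
\<close>

definition subdivision_operator ::
    "complex_of_points \<Rightarrow> complex_of_points \<Rightarrow> (nat \<Rightarrow> (nat \<Rightarrow> real) chain \<Rightarrow> (nat \<Rightarrow> real) chain) \<Rightarrow> bool"
  where "subdivision_operator K K' sd \<longleftrightarrow>
    (\<forall>p. \<forall>c\<in>simplicial_chains K p. sd p c \<in> simplicial_chains K' p) \<and>
    (\<forall>p a b. \<forall>c\<in>simplicial_chains K p. \<forall>d\<in>simplicial_chains K p.
       sd p (\<lambda>xs. a * c xs + b * d xs) = (\<lambda>xs. a * sd p c xs + b * sd p d xs)) \<and>
    (\<forall>p. \<forall>c\<in>simplicial_chains K (Suc p). simplicial_boundary K' (sd (Suc p) c) = sd p (simplicial_boundary K c)) \<and>
    (\<forall>c\<in>simplicial_chains K 0. augmentation K' (sd 0 c) = augmentation K c) \<and>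
    (\<forall>p xs ys. distinct xs \<and> set xs \<in> K \<and> length xs = Suc p \<and> sd p (oriented_chain xs) ys \<noteq> 0
       \<longrightarrow> convex hull (set ys) \<subseteq> convex hull (set xs))"

text \<open>A choice of orientation of every simplex, i.e. of the basis of each chain group.\<close>

definition orientation :: "'v set set \<Rightarrow> ('v set \<Rightarrow> 'v list) \<Rightarrow> bool"
  where "orientation K ord \<longleftrightarrow> (\<forall>s\<in>K. distinct (ord s) \<and> set (ord s) = s)"

text \<open>
  The entry in row \<open>s\<close> and column \<open>t\<close> of the matrix of the composite of the subdivision operator and
  the chain map of \<open>\<psi>\<close> in degree \<open>p\<close>: the coefficient of the basis element \<open>s\<close> in the image of \<open>t\<close>.
\<close>

definition simplicial_matrix ::
    "complex_of_points \<Rightarrow> (nat \<Rightarrow> (nat \<Rightarrow> real) chain \<Rightarrow> (nat \<Rightarrow> real) chain) \<Rightarrow> ((nat \<Rightarrow> real) \<Rightarrow> (nat \<Rightarrow> real))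
      \<Rightarrow> ((nat \<Rightarrow> real) set \<Rightarrow> (nat \<Rightarrow> real) list) \<Rightarrow> nat \<Rightarrow> (nat \<Rightarrow> real) set \<Rightarrow> (nat \<Rightarrow> real) set \<Rightarrow> rat"
  where "simplicial_matrix K' sd \<psi> ord p s t =
    induced_chain_map K' \<psi> (sd p (oriented_chain (ord t))) (ord s)"

text \<open>A p-simplex has p+1 vertices, so only \<open>p < card (\<Union>K)\<close> contributes.\<close>

definition alternating_trace ::
    "complex_of_points \<Rightarrow> (nat \<Rightarrow> real) set \<Rightarrow> (nat \<Rightarrow> (nat \<Rightarrow> real) set \<Rightarrow> (nat \<Rightarrow> real) set \<Rightarrow> rat) \<Rightarrow> rat"
  where "alternating_trace K A M =
    (\<Sum>p<card (\<Union>K). (-1) ^ p * (\<Sum>s | s \<in> K \<and> card s = Suc p \<and> open_simplex s \<subseteq> A. M p s s))"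


section \<open>Combinatorial Lefschetz numbers\<close>

text \<open>
  As with \<^const>\<open>has_integral\<close>, the number is given relationally: \<open>has_Lambda D m Z A l z\<close> says
  that some admissible choice of triangulation, subdivision and
  simplicial approximation computes the value \<open>z\<close>.
\<close>

definition has_Lambda ::
    "(nat \<Rightarrow> (nat \<Rightarrow> real) set set) \<Rightarrow> nat \<Rightarrow> (nat \<Rightarrow> real) set \<Rightarrow> (nat \<Rightarrow> real) set
      \<Rightarrow> ((nat \<Rightarrow> real) \<Rightarrow> (nat \<Rightarrow> real)) \<Rightarrow> rat \<Rightarrow> bool"
  where "has_Lambda D m Z A l z \<longleftrightarrow>
    Z \<in> D m \<and> compactin (Euclidean_space m) Z \<and> A \<in> D m \<and> A \<subseteq> Z \<and>
    continuous_map (subspace_of_Rn m Z) (subspace_of_Rn m Z) l \<and>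
    (\<exists>k K \<tau> K' \<psi> sd ord.
       geometric_complex k K \<and>
       homeomorphic_map (subspace_of_Rn k (polyhedron_of K)) (subspace_of_Rn m Z) \<tau> \<and>
       definable_map D k m (polyhedron_of K) \<tau> \<and>
       (\<exists>T\<subseteq>K. {x \<in> polyhedron_of K. \<tau> x \<in> A} = (\<Union>s\<in>T. open_simplex s)) \<and>
       subdivision_of k K' K \<and>
       simplicial_approximation K' K (inv_into (polyhedron_of K) \<tau> \<circ> l \<circ> \<tau>) \<psi> \<and>
       subdivision_operator K K' sd \<and>
       orientation K ord \<and>
       z = alternating_trace K {x \<in> polyhedron_of K. \<tau> x \<in> A} (simplicial_matrix K' sd \<psi> ord))"

definition definable_compactification ::
    "(nat \<Rightarrow> (nat \<Rightarrow> real) set set) \<Rightarrow> nat \<Rightarrow> (nat \<Rightarrow> real) set \<Rightarrow> nat \<Rightarrow> (nat \<Rightarrow> real) set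
      \<Rightarrow> ((nat \<Rightarrow> real) \<Rightarrow> (nat \<Rightarrow> real)) \<Rightarrow> bool"
  where "definable_compactification D n U m X i \<longleftrightarrow>
    X \<in> D m \<and> compactin (Euclidean_space m) X \<and>
    embedding_map (subspace_of_Rn n U) (subspace_of_Rn m X) i \<and>
    subspace_of_Rn m X closure_of (i ` U) = X \<and>
    definable_map D n m U i"

text \<open>
  \<open>has_Lambda_comb D n U f z\<close>: the number is defined for \<open>f\<close> and \<open>U\<close>, with value \<open>z\<close>.
  Here \<open>U\<close> is identified with its image \<open>i ` U\<close> in the compactification \<open>X\<close>.
\<close>

definition has_Lambda_comb ::
    "(nat \<Rightarrow> (nat \<Rightarrow> real) set set) \<Rightarrow> nat \<Rightarrow> (nat \<Rightarrow> real) set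
      \<Rightarrow> ((nat \<Rightarrow> real) \<Rightarrow> (nat \<Rightarrow> real)) \<Rightarrow> rat \<Rightarrow> bool"
  where "has_Lambda_comb D n U f z \<longleftrightarrow>
    U \<in> D n \<and> continuous_map (subspace_of_Rn n U) (subspace_of_Rn n U) f \<and>
    (\<exists>m X i f'.
       definable_compactification D n U m X i \<and>
       continuous_map (subspace_of_Rn m X) (subspace_of_Rn m X) f' \<and>
       open_map (subspace_of_Rn m X) (subspace_of_Rn m X) f' \<and>
       (\<forall>x\<in>U. f' (i x) = i (f x)) \<and>
       f' ` (X - i ` U) \<subseteq> X - i ` U \<and>
       has_Lambda D m X (i ` U) f' z)"


section \<open>Surfaces with boundary\<close>

text \<open>Charts take values in the closed upper half plane.\<close>

definition half_plane_chart :: "'a topology \<Rightarrow> 'a set \<Rightarrow> ('a \<Rightarrow> complex) \<Rightarrow> bool"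
  where "half_plane_chart X W h \<longleftrightarrow> openin X W \<and>
    (\<exists>V. openin (top_of_set {z. 0 \<le> Im z}) V \<and> homeomorphic_map (subtopology X W) (top_of_set V) h)"

definition surface_boundary :: "'a topology \<Rightarrow> 'a set"
  where "surface_boundary X = {x. \<exists>W h. half_plane_chart X W h \<and> x \<in> W \<and> Im (h x) = 0}"

text \<open>
  The boundary is required to be nonempty. (The sphere must be excluded below: a translation of the
  plane has no fixed point, although its combinatorial Lefschetz number is 1.)
\<close>

definition surface_with_boundary :: "'a topology \<Rightarrow> bool"
  where "surface_with_boundary X \<longleftrightarrow>
    Hausdorff_space X \<and> second_countable X \<and>
    (\<forall>x\<in>topspace X. \<exists>W h. half_plane_chart X W h \<and> x \<in> W) \<and>
    surface_boundary X \<noteq> {}"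

end

(*
Triangulate the compactification of U and cone off the subcomplex at infinity; this triangulates the
one-point compactification of U, with the cone point om at infinity. Since the boundary of the surface
is nonempty, the triangulation collapses to a graph. Hence its universal cover is described by edge
labels in a free group, on which f induces an endomorphism phi. Computing traces in a cochain basis adapted to a
spanning tree gives Lambda = - sum_i eps_i(phi(a_i)), with eps_i the exponent sum of the generator a_i.

If this number is at least 1, count sources and sinks in the graph with an edge from each d to
a_i^-1 d phi(a_i): its components are the twisted conjugacy classes, and in one with more sinks than sources,
which cannot contain 1, the map g |-> gamma phi(g) moves points inwards near the ends of the tree.
The lift of f belonging to this class moves all lifts of om, and it can be retracted to a map of a large
finite piece of the cover. That piece is an absolute extensor, so Brouwer's theorem gives a
fixed point of the lift, and this projects to a fixed point of f in U.
*)
theory Submission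
  imports Defs "HOL-Library.Sublist"
begin

text \<open>The point at infinity is always fixed, and this is the obstacle: on the coned complex
  the extended map has Lefschetz number Lambda + 1, of which the contractible cone accounts for 1,
  but a total count does not say where the remaining fixed points are. Fixed points are therefore
  sorted by the lift of the map that fixes a point above them, and a lift is useful if it fixes no
  lift of the cone point. The graph decides which lift to take. Give a vertex d the signpost leading
  across the edge named by the first letter of d; a source is an edge crossed by neither signpost at
  its ends, a sink one crossed by both. A ball in a component has at most one vertex more than
  edges, and an excess of sinks makes the edges fewer than the signposts. So the component is a tree
  and all its vertices have signposts, which 1, the empty word, has not. Inward motion is known for
  group elements only; for points of the cover it holds up to a bounded error, so it is proved with
  an arbitrary margin k, and the finite piece is chosen after the error constants that determine the
  margin.\<close>

section \<open>Reduced words and the free group of countable rank\<close>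

type_synonym letter = "nat \<times> bool"

definition linv :: "letter => letter"
 where "linv l = (fst l, \<not> snd l)"

lemma linv_linv [simp]: "linv (linv l) = l"
 and linv_neq [simp]: "linv l ~= l" "l ~= linv l"
 and fst_linv [simp]: "fst (linv l) = fst l"
 and snd_linv [simp]: "snd (linv l) \<longleftrightarrow> \<not> snd l" by (auto simp: linv_def prod_eq_iff)

lemma linv_pair [simp]: "linv (i, b) = (i, \<not> b)" by (simp add: linv_def)

lemma linv_inject [simp]: "linv a = linv b \<longleftrightarrow> a = b" by (metis linv_linv)

fun reduced :: "letter list => bool" where
 "reduced [] = True"
| "reduced [x] = True"
| "reduced (x # y # w) = (y ~= linv x \<and> reduced (y # w))"

lemma reduced_Cons: "reduced (x # w) \<longleftrightarrow> reduced w \<and> (w ~= [] --> hd w ~= linv x)" by (cases w) auto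

lemma reduced_append:
 "reduced (u @ v) \<longleftrightarrow> reduced u \<and> reduced v \<and> (u ~= [] \<and> v ~= [] --> hd v ~= linv (last u))"
 by (induction u) (auto simp: reduced_Cons)

definition lact :: "letter => letter list => letter list"
 where "lact l w = (if w ~= [] \<and> hd w = linv l then tl w else l # w)"

lemma reduced_lact: "reduced w ==> reduced (lact l w)" by (cases w) (auto simp: lact_def reduced_Cons)

lemma lact_lact: "reduced w ==> lact (linv l) (lact l w) = w" by (cases w; cases "tl w") (auto simp: lact_def reduced_Cons)

definition wact :: "letter list => letter list => letter list"
 where "wact u w = foldr lact u w"

lemma wact_simps [simp]: "wact [] w = w" "wact (l # u) w = lact l (wact u w)" by (simp_all add: wact_def)

lemma reduced_wact: "reduced w ==> reduced (wact u w)" by (induction u) (auto simp: reduced_lact)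

lemma wact_append: "wact (u @ v) w = wact u (wact v w)" by (simp add: wact_def)

lemma wact_reduced: "reduced (u @ w) ==> wact u w = u @ w" by (induction u) (auto simp: lact_def reduced_Cons)

text \<open>The only case in which \<open>lact l u\<close> is not \<open>l # u\<close> cancels a
  leading inverse letter of \<open>u\<close>, and there the action of \<open>l\<close> undoes the
  action of that letter.\<close>

lemma wact_lact:
 assumes "reduced u" "reduced w" shows "wact (lact l u) w = lact l (wact u w)"
proof (cases "u ~= [] \<and> hd u = linv l")
 case True
 then obtain u' where "u = linv l # u'" by (cases u) auto
 thus ?thesis using lact_lact[OF reduced_wact[OF assms(2)], of "linv l"] by (simp add: lact_def)
next
 case False
 thus ?thesis by (auto simp: lact_def)
qed

lemma wact_assoc: "reduced v ==> reduced w ==> wact (wact u v) w = wact u (wact v w)"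
 by (induction u) (auto simp: wact_lact reduced_wact)

definition winv :: "letter list => letter list"
 where "winv u = rev (map linv u)"

lemma reduced_winv: "reduced u ==> reduced (winv u)"
 by (induction u) (auto simp: winv_def reduced_Cons reduced_append last_rev hd_map)

lemma wact_winv: "reduced w ==> wact (winv u) (wact u w) = w"
 by (induction u arbitrary: w) (auto simp: winv_def wact_append lact_lact reduced_wact)

text \<open>The free group on the natural numbers, written additively although it is not commutative.\<close>

typedef fgrp = "{w. reduced w}"
 morphisms word Abs_fgrp by (rule exI[of _ "[]"]) simp

setup_lifting type_definition_fgrp

instantiation fgrp :: group_add
begin

lift_definition zero_fgrp :: fgrp is "[]" by simp
lift_definition plus_fgrp :: "fgrp => fgrp => fgrp" is wact by (simp add: reduced_wact)
lift_definition uminus_fgrp :: "fgrp => fgrp" is winv by (simp add: reduced_winv)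
definition minus_fgrp :: "fgrp => fgrp => fgrp" where "minus_fgrp a b = a + - b"

instance
proof
 fix a b c :: fgrp
 show "a + b + c = a + (b + c)" by transfer (simp add: wact_assoc)
 show "0 + a = a" by transfer simp
 show "a + 0 = a" by transfer (use wact_reduced[of _ "[]"] in simp)
 show "- a + a = 0" by transfer (metis wact_winv wact_reduced append_Nil2 reduced.simps(1))
 show "a + - b = a - b" by (simp add: minus_fgrp_def)
qed

end

instance fgrp :: countable by (rule countable_classI[of "to_nat \<circ> word"]) (simp add: word_inject)

lift_definition lt :: "letter => fgrp" is "\<lambda>l. [l]" by simp

definition len :: "fgrp => nat" where "len x = length (word x)"

lemma reduced_word [simp]: "reduced (word x)" using word by auto

lemma word_zero [simp]: "word 0 = []" by (simp add: zero_fgrp.rep_eq)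

lemma word_lt [simp]: "word (lt l) = [l]" by (simp add: lt.rep_eq)

lemma word_eq_Nil [simp]: "word x = [] \<longleftrightarrow> x = 0" by (metis word_zero word_inject)

lemma len_zero [simp]: "len 0 = 0" and len_lt [simp]: "len (lt l) = 1" by (simp_all add: len_def)

lemma uminus_lt [simp]: "- lt l = lt (linv l)" by transfer (simp add: winv_def)

lemma lt_inject [simp]: "lt l = lt l' \<longleftrightarrow> l = l'" by (simp flip: word_inject)

lemma lt_neq_zero [simp]: "lt l ~= 0" by (simp flip: word_inject)

lemma lt_cancel [simp]: "lt l + lt (linv l) = 0" "lt (linv l) + lt l = 0" by (metis uminus_lt right_minus left_minus)+

lemma lt_cancel' [simp]: "lt (i, True) + lt (i, False) = 0" "lt (i, False) + lt (i, True) = 0"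
 using lt_cancel[of "(i, True)"] by simp_all

lemma word_plus: "reduced (word x @ word y) ==> word (x + y) = word x @ word y" by (simp add: plus_fgrp.rep_eq wact_reduced)

lemma word_lt_plus: "word (lt l + x) = (if x ~= 0 \<and> hd (word x) = linv l then tl (word x) else l # word x)"
 by (simp add: plus_fgrp.rep_eq lact_def)

lemma word_plus_lt:
 "word (x + lt l) = (if x ~= 0 \<and> last (word x) = linv l then butlast (word x) else word x @ [l])"
proof (cases "x ~= 0 \<and> last (word x) = linv l")
 case True
 hence eq: "word x = butlast (word x) @ [linv l]" by (metis append_butlast_last_id word_eq_Nil)
 have r: "reduced (butlast (word x) @ [linv l])" using eq by (metis reduced_word)
 have "word (x + lt l) = wact (butlast (word x) @ [linv l]) [l]" using eq by (simp add: plus_fgrp.rep_eq)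
 also have "... = wact (butlast (word x)) []" by (simp add: wact_append lact_def)
 also have "... = butlast (word x)" using r by (simp add: wact_reduced reduced_append)
 finally show ?thesis using True by simp
next
 case False
 hence "reduced (word x @ [l])" by (auto simp: reduced_append)
 with False show ?thesis by (auto simp: word_plus[of x "lt l"])
qed

lemma word_split:
 assumes "word x = u @ v" obtains y z where "word y = u" "word z = v" "x = y + z"
proof -
 have r: "reduced (u @ v)" using assms by (metis reduced_word)
 hence w: "word (Abs_fgrp u) = u" "word (Abs_fgrp v) = v" by (auto simp: Abs_fgrp_inverse reduced_append)
 thus thesis using that[OF w] r assms by (metis word_inject word_plus)
qed

lemma fgrp_snoc_cases:
 assumes "x ~= 0"
 obtains y l where "x = y + lt l" "word x = word y @ [l]"
proof -
 define l where "l = last (word x)"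
 have "word x = butlast (word x) @ [l]" using assms by (simp add: l_def)
 then obtain y z where y: "word y = butlast (word x)" and z: "word z = [l]" and x: "x = y + z" by (rule word_split)
 have "z = lt l" using z by (simp flip: word_inject)
 moreover have "word x = word y @ [l]" unfolding y using \<open>word x = _\<close> .
 ultimately show thesis using that x by blast
qed

lemma fgrp_snoc_induct [case_names zero snoc]:
 assumes "P 0" "!!y l. P y ==> word (y + lt l) = word y @ [l] ==> P (y + lt l)"
 shows "P x"
proof (induction "len x" arbitrary: x)
 case 0 thus ?case using assms by (simp add: len_def)
next
 case (Suc n)
 hence "x ~= 0" by auto
 thus ?case using assms(2) Suc fgrp_snoc_cases by (force simp: len_def)
qed

lemma fgrp_cons_induct [case_names zero cons]:
 assumes "P 0" "!!y l. P y ==> word (lt l + y) = l # word y ==> P (lt l + y)"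
 shows "P x"
proof (induction "len x" arbitrary: x)
 case 0 thus ?case using assms by (simp add: len_def)
next
 case (Suc n)
 then obtain l w where w: "word x = [l] @ w" by (cases "word x") (auto simp: len_def)
 then obtain y z where y: "word y = [l]" "word z = w" "x = y + z" by (rule word_split)
 hence "y = lt l" by (simp flip: word_inject)
 with y w show ?case using assms(2)[of z l] Suc by (auto simp: len_def)
qed

lemma len_plus: "len (x + y) \<le> len x + len y"
proof (induction x rule: fgrp_cons_induct)
 case (cons x l)
 have "len (lt l + (x + y)) \<le> Suc (len (x + y))" by (auto simp: len_def word_lt_plus)
 thus ?case using cons by (simp add: add.assoc) (simp add: len_def)
qed simp

lemma len_uminus [simp]: "len (- x) = len x" by (simp add: len_def uminus_fgrp.rep_eq winv_def)

lemma word_uminus: "word (- x) = rev (map linv (word x))" by (simp add: uminus_fgrp.rep_eq winv_def)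

subsection \<open>Homomorphisms from generators\<close>

definition gen :: "nat => fgrp" where "gen i = lt (i, True)"

definition lift_word :: "(nat => 'a::group_add) => letter list => 'a"
 where "lift_word c w = sum_list (map (\<lambda>(i, b). if b then c i else - c i) w)"

definition hom_ext :: "(nat => 'a::group_add) => fgrp => 'a"
 where "hom_ext c x = lift_word c (word x)"

lemma hom_ext_lt: "hom_ext c (lt (i, b)) = (if b then c i else - c i)" by (simp add: hom_ext_def lift_word_def)

lemma hom_ext_gen [simp]: "hom_ext c (gen i) = c i" by (simp add: gen_def hom_ext_lt)

lemma hom_ext_zero [simp]: "hom_ext c 0 = 0" by (simp add: hom_ext_def lift_word_def)

lemma hom_ext_plus: "hom_ext c (x + y) = hom_ext c x + hom_ext c y"
proof (induction x rule: fgrp_cons_induct)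
 case (cons x l)
 have *: "hom_ext c (lt l + z) = hom_ext c (lt l) + hom_ext c z" for z
 proof (cases "z ~= 0 \<and> hd (word z) = linv l")
  case True
  define t where "t = tl (word z)"
  have "word z = linv l # t" unfolding t_def using True by (metis list.collapse word_eq_Nil)
  hence "hom_ext c z = hom_ext c (lt (linv l)) + lift_word c t" by (simp add: hom_ext_def lift_word_def)
  moreover have "hom_ext c (lt l) + hom_ext c (lt (linv l)) = 0" by (cases l) (auto simp: hom_ext_lt)
  ultimately show ?thesis using True t_def by (simp add: hom_ext_def[of _ "lt l + z"] word_lt_plus flip: add.assoc)
 qed (auto simp: hom_ext_def word_lt_plus lift_word_def)
 show ?case using cons * by (simp add: add.assoc)
qed simp

lemma hom_uminus:
 fixes f :: "'a::group_add => 'b::group_add"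
 assumes "!!x y. f (x + y) = f x + f y"
 shows "f (- x) = - f x" and "f 0 = 0"
proof -
 have "- f 0 + f 0 = - f 0 + (f 0 + f 0)" using assms[of 0 0] by simp
 thus "f 0 = 0" by simp
 thus "f (- x) = - f x" using assms[of "- x" x] by (simp add: eq_neg_iff_add_eq_0)
qed

definition eps :: "nat => fgrp => int"
 where "eps i = hom_ext (\<lambda>j. if j = i then 1 else 0)"

lemma eps_plus: "eps i (x + y) = eps i x + eps i y" by (simp add: eps_def hom_ext_plus)

lemma eps_zero [simp]: "eps i 0 = 0" by (simp add: eps_def)

lemma eps_uminus [simp]: "eps i (- x) = - eps i x" using hom_uminus(1)[of "eps i"] eps_plus by blast

lemma eps_lt: "eps i (lt l) = (if fst l = i then if snd l then 1 else -1 else 0)" by (cases l) (simp add: eps_def hom_ext_lt)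

lemma eps_gen [simp]: "eps i (gen j) = (if i = j then 1 else 0)" by (simp add: gen_def eps_lt)

subsection \<open>Finitely generated subgroups\<close>

text \<open>The rank depends on the triangulation, so it cannot be part of a type: there is one
  group of infinite rank, and the group of rank \<open>n\<close> is a subset of it.\<close>

definition FG :: "nat => fgrp set" where "FG n = {x. \<forall>l\<in>set (word x). fst l < n}"

lemma FG_zero [simp]: "0 \<in> FG n" by (simp add: FG_def)

lemma FG_lt [simp]: "lt l \<in> FG n \<longleftrightarrow> fst l < n" by (simp add: FG_def)

lemma FG_gen [simp]: "gen i \<in> FG n \<longleftrightarrow> i < n" by (simp add: gen_def)

lemma FG_uminus [simp]: "- x \<in> FG n \<longleftrightarrow> x \<in> FG n" by (auto simp: FG_def word_uminus)

lemma set_wact: "set (wact u v) \<subseteq> set u \<union> set v"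
proof (induction u)
 case (Cons l u)
 have "set (lact l w) \<subseteq> insert l (set w)" for w by (cases w) (auto simp: lact_def)
 thus ?case using Cons by fastforce
qed simp

lemma FG_plus: "x \<in> FG n ==> y \<in> FG n ==> x + y \<in> FG n"
 using set_wact[of "word x" "word y"] by (auto simp: FG_def plus_fgrp.rep_eq)

lemma finite_FG_ball: "finite {x \<in> FG n. len x \<le> N}"
proof -
 have "finite {w. set w \<subseteq> {..<n} \<times> (UNIV::bool set) \<and> length w \<le> N}"
  by (rule finite_lists_length_le) simp
 moreover have "word ` {x \<in> FG n. len x \<le> N} \<subseteq> {w. set w \<subseteq> {..<n} \<times> UNIV \<and> length w \<le> N}"
  by (auto simp: FG_def len_def)
 ultimately have "finite (word ` {x \<in> FG n. len x \<le> N})" by (rule rev_finite_subset)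
 thus ?thesis by (rule finite_imageD) (simp add: inj_on_def word_inject)
qed

lemma hom_ext_FG:
 assumes "!!i. c i \<in> FG n" shows "hom_ext c x \<in> FG n"
proof (induction x rule: fgrp_cons_induct)
 case (cons x l)
 have "hom_ext c (lt l) \<in> FG n" using assms by (cases l) (simp add: hom_ext_lt)
 with cons.IH show ?case unfolding hom_ext_plus by (metis FG_plus)
qed simp

definition starts :: "fgrp => letter => bool"
 where "starts d l \<longleftrightarrow> d ~= 0 \<and> hd (word d) = l"

lemma starts_unique: "starts d l ==> starts d l' ==> l = l'" by (simp add: starts_def)

lemma starts_zero [simp]: "\<not> starts 0 l" and starts_lt [simp]: "starts (lt l) l' \<longleftrightarrow> l = l'"
 by (auto simp: starts_def)

text \<open>Left multiplication by \<open>l\<close> puts \<open>l\<close> in front or cancels a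
  leading inverse, and reducedness prevents the cancellation from uncovering another
  \<open>l\<close>.\<close>

lemma starts_lt_plus: "starts (lt l + x) l \<longleftrightarrow> \<not> starts x (linv l)"
proof -
 have "word (lt l + x) = [] \<or> hd (word (lt l + x)) ~= l" if "starts x (linv l)"
 proof -
  define w where "w = tl (word x)"
  have "word x ~= []" using that by (simp add: starts_def)
  hence w: "word x = linv l # w" using that unfolding starts_def w_def by (metis list.collapse)
  thus ?thesis using reduced_word[of x] by (auto simp: word_lt_plus reduced_Cons)
 qed
 thus ?thesis by (auto simp: starts_def word_lt_plus simp flip: word_eq_Nil)
qed

section \<open>Twisted conjugacy classes of an endomorphism of a free group\<close>

locale twisted =
 fixes n :: nat and fi :: "fgrp => fgrp"
 assumes hom: "fi (x + y) = fi x + fi y" and range: "fi x \<in> FG n"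
begin

lemma hom_um: "fi (- x) = - fi x" and hom_0 [simp]: "fi 0 = 0" using hom_uminus[of fi] hom by auto

text \<open>A move along the letter \<open>l\<close> in the graph of twisted conjugacy. By
  \<open>disp_snoc\<close> it is also what happens to the displacement when \<open>x\<close> is
  extended by \<open>l\<close>, so the Cayley tree maps onto each component of the graph.\<close>

definition step :: "letter => fgrp => fgrp" where "step l d = - lt l + d + fi (lt l)"

text \<open>The displacement of the tree vertex \<open>x\<close> under the map sending
  \<open>x\<close> to \<open>ga + fi x\<close>: the element leading from \<open>x\<close> to its
  image by right multiplication. Its first letter is the direction in which the geodesic to the
  image leaves \<open>x\<close>, and it is 0 at a fixed vertex.\<close>

definition disp :: "fgrp => fgrp => fgrp" where "disp ga x = - x + ga + fi x"

text \<open>A name for the unoriented edge between \<open>d\<close> and \<open>step l d\<close> by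
  its tail and its generator, so that both ends produce the same name
  (\<open>edge_linv\<close>).\<close>

definition edge :: "letter => fgrp => fgrp \<times> nat"
 where "edge l d = (if snd l then (d, fst l) else (step l d, fst l))"

definition nb :: "fgrp \<times> nat => fgrp" where "nb e = step (snd e, True) (fst e)"

lemma step_linv [simp]: "step (linv l) (step l d) = d"
proof -
 have "fi (lt l) + fi (lt (linv l)) = 0" by (metis hom hom_0 uminus_lt right_minus)
 moreover have "step (linv l) (step l d) = (lt l + lt (linv l)) + d + (fi (lt l) + fi (lt (linv l)))"
  by (simp only: step_def uminus_lt linv_linv add.assoc)
 ultimately show ?thesis by simp
qed

lemma step_linv' [simp]: "step l (step (linv l) d) = d" using step_linv[of "linv l"] by simp

lemma disp_zero [simp]: "disp ga 0 = ga" by (simp add: disp_def)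

lemma disp_snoc: "disp ga (x + lt l) = step l (disp ga x)"
 unfolding disp_def step_def hom minus_add by (simp only: add.assoc)

lemma step_FG: "d \<in> FG n ==> fst l < n ==> step l d \<in> FG n" unfolding step_def by (intro FG_plus) (auto simp: range)

lemma disp_FG: "ga \<in> FG n ==> x \<in> FG n ==> disp ga x \<in> FG n"
 unfolding disp_def by (intro FG_plus) (auto simp: range)

lemma edge_linv: "edge (linv l) (step l d) = edge l d" by (auto simp: edge_def)

lemma nb_edge: "nb (edge l d) = (if snd l then step l d else d)" using step_linv[of l d] by (cases l) (auto simp: nb_def edge_def)

lemma snd_edge [simp]: "snd (edge l d) = fst l" by (simp add: edge_def)

lemma edge_ends: "{fst (edge l d), nb (edge l d)} = {d, step l d}" by (auto simp: nb_edge) (auto simp: edge_def)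

lemma edge_eq_same:
 assumes "edge l v = edge l' v" shows "l = l' \<or> step l v = v"
proof (cases "snd l = snd l'")
 case True
 thus ?thesis using assms by (simp add: prod_eq_iff)
next
 case False
 hence "l' = linv l" using assms by (simp add: prod_eq_iff)
 hence "step l v = v \<or> step (linv l) v = v" using assms by (auto simp: edge_def split: if_splits)
 thus ?thesis by (metis step_linv')
qed

lemma edge_eq_other: "edge l v = edge l' w ==> v ~= w ==> w = step l v \<and> v = step l' w"
 using edge_ends[of l v] edge_ends[of l' w] by (auto simp: doubleton_eq_iff)

text \<open>Read in the tree, the two ends of a source are carried apart and those of a sink towards
  each other. Every other edge is crossed by exactly one of the two signposts at its ends.\<close>

definition Src :: "(fgrp \<times> nat) set"
 where "Src = {e. snd e < n \<and> fst e \<in> FG n \<and> \<not> starts (fst e) (snd e, True) \<and> \<not> starts (nb e) (snd e, False)}"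

definition Snk :: "(fgrp \<times> nat) set"
 where "Snk = {e. snd e < n \<and> fst e \<in> FG n \<and> starts (fst e) (snd e, True) \<and> starts (nb e) (snd e, False)}"

subsection \<open>Counting sources and sinks\<close>

definition flux :: "nat => fgrp => fgrp => int"
 where "flux i w d = of_bool (starts (d + w) (i, True)) - of_bool (starts d (i, True))"

lemma flux_add: "flux i (v + w) d = flux i w (d + v) + flux i v d" by (simp add: flux_def add.assoc)

text \<open>Right multiplication by a letter touches the end of a word, so the first letter can
  change only for words of length at most one.\<close>

lemma flux_lt:
 "flux i (lt l) d = (if l = (i, True) \<and> d = 0 then 1 else if l = (i, False) \<and> d = gen i then -1 else 0)"
proof (cases "d = 0")
 case True
 thus ?thesis by (auto simp: flux_def gen_def)
next
 case False
 show ?thesis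
 proof (cases "last (word d) = linv l")
  case True
  show ?thesis
  proof (cases "word d = [linv l]")
   case one: True
   hence "d = lt (linv l)" by (simp flip: word_inject)
   thus ?thesis by (cases l; cases "snd l") (auto simp: flux_def gen_def)
  next
   case more: False
   hence b: "butlast (word d) ~= []" "hd (butlast (word d)) = hd (word d)"
    using True False by (cases "word d"; auto split: if_splits)+
   hence "word (d + lt l) = butlast (word d)" "d + lt l ~= 0" using True by (auto simp: word_plus_lt simp flip: word_eq_Nil)
   moreover have "l = (i, False) ==> d ~= gen i" using more by (auto simp: gen_def)
   ultimately show ?thesis using b by (auto simp: flux_def starts_def)
  qed
 next
  case F: False
  hence "word (d + lt l) = word d @ [l]" "d + lt l ~= 0" by (auto simp: word_plus_lt simp flip: word_eq_Nil)
  moreover have "l = (i, False) ==> d ~= gen i" using F by (auto simp: gen_def)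
  ultimately show ?thesis using False by (auto simp: flux_def starts_def)
 qed
qed

text \<open>The elements beginning with generator \<open>i\<close> form an infinite set, which
  translation by \<open>w\<close> changes in finitely many places only. By \<open>flux_add\<close>
  the signed number of changes is additive in \<open>w\<close>, and on letters it has the values of
  the exponent sum.\<close>

lemma flux_eps:
 assumes "w \<in> FG n" "i < n"
 shows "finite {d \<in> FG n. flux i w d ~= 0} \<and> (\<Sum>d | d \<in> FG n \<and> flux i w d ~= 0. flux i w d) = eps i w"
 using assms(1)
proof (induction w rule: fgrp_snoc_induct)
 case zero
 thus ?case by (simp add: flux_def)
next
 case (snoc v l)
 have v: "v \<in> FG n" and l: "fst l < n" using snoc by (auto simp: FG_def)
 let ?A = "{d \<in> FG n. flux i v d ~= 0}" and ?B = "{d \<in> FG n. flux i (lt l) d ~= 0}"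
 let ?C = "{d \<in> FG n. flux i (v + lt l) d ~= 0}"
 \<comment> \<open>The support of \<open>flux i (lt l)\<close> translated by \<open>v\<close>: this
   is where the first summand of \<open>flux_add\<close> lives.\<close>
 define B' where "B' = (\<lambda>d. d - v) ` ?B"
 have B: "finite ?B" "(\<Sum>d\<in>?B. flux i (lt l) d) = eps i (lt l)"
 proof -
  have *: "?B = (if l = (i, True) then {0} else if l = (i, False) then {gen i} else {})" using assms(2) by (auto simp: flux_lt)
  thus "finite ?B" by simp
  show "(\<Sum>d\<in>?B. flux i (lt l) d) = eps i (lt l)" unfolding * by (cases l) (auto simp: flux_lt eps_lt)
 qed
 have fin: "finite ?A" "finite B'" using snoc.IH v B by (auto simp: B'_def)
 have B'FG: "B' \<subseteq> FG n" unfolding B'_def using v FG_plus[of _ n "- v"] by auto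
 have sub: "?C \<subseteq> ?A \<union> B'"
 proof
  fix d assume d: "d \<in> ?C"
  show "d \<in> ?A \<union> B'"
  proof (cases "flux i v d = 0")
   case True
   hence "d + v \<in> ?B" using d v by (auto simp: flux_add FG_plus)
   hence "d \<in> B'" unfolding B'_def by (intro image_eqI[of d _ "d + v"]) auto
   thus ?thesis by simp
  qed (use d in auto)
 qed
 have "(\<Sum>d\<in>?C. flux i (v + lt l) d) = (\<Sum>d\<in>?A \<union> B'. flux i (v + lt l) d)"
  using fin B'FG by (intro sum.mono_neutral_left) (use sub in auto)
 also have "... = (\<Sum>d\<in>?A \<union> B'. flux i (lt l) (d + v)) + (\<Sum>d\<in>?A \<union> B'. flux i v d)"
  by (simp add: flux_add sum.distrib)
 also have "(\<Sum>d\<in>?A \<union> B'. flux i v d) = (\<Sum>d\<in>?A. flux i v d)"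
  using fin B'FG by (intro sum.mono_neutral_right) auto
 also have "(\<Sum>d\<in>?A \<union> B'. flux i (lt l) (d + v)) = (\<Sum>d\<in>B'. flux i (lt l) (d + v))"
 proof (intro sum.mono_neutral_right)
  show "\<forall>d\<in>?A \<union> B' - B'. flux i (lt l) (d + v) = 0"
  proof
   fix d assume d: "d \<in> ?A \<union> B' - B'"
   hence "d + v \<in> FG n" using v by (auto intro: FG_plus)
   moreover have "d + v \<notin> ?B"
   proof
    assume "d + v \<in> ?B"
    hence "d \<in> B'" unfolding B'_def by (intro image_eqI[of d _ "d + v"]) auto
    with d show False by simp
   qed
   ultimately show "flux i (lt l) (d + v) = 0" by auto
  qed
 qed (use fin in auto)
 also have "... = (\<Sum>d\<in>?B. flux i (lt l) d)" unfolding B'_def by (subst sum.reindex) (auto simp: inj_on_def)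
 finally have "(\<Sum>d\<in>?C. flux i (v + lt l) d) = eps i (v + lt l)" using snoc.IH v B by (simp add: eps_plus)
 moreover have "finite ?C" using fin sub by (meson finite_UnI finite_subset)
 ultimately show ?case by simp
qed

text \<open>The far end is \<open>d + fi (gen i)\<close> with the inverse generator multiplied on
  the left, and that letter stays in front unless it cancels. This turns the conditions for sources
  and sinks into conditions on \<open>flux\<close>.\<close>

lemma nb_starts: "starts (nb (d, i)) (i, False) \<longleftrightarrow> \<not> starts (d + fi (gen i)) (i, True)"
 using starts_lt_plus[of "(i, False)" "d + fi (gen i)"] by (simp add: nb_def step_def gen_def add.assoc)

text \<open>By \<open>nb_starts\<close>, \<open>(d, i)\<close> is a source exactly where
  \<open>flux i (fi (gen i)) d\<close> is 1 and a sink exactly where it is -1; summing the flux over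
  all \<open>d\<close> gives the exponent sum.\<close>

lemma Src_Snk:
 shows "finite Src" "finite Snk" "int (card Src) - int (card Snk) = (\<Sum>i<n. eps i (fi (gen i)))"
proof -
 define F where "F i = {d \<in> FG n. flux i (fi (gen i)) d ~= 0}" for i
 have fin: "finite (F i)" and sum: "(\<Sum>d\<in>F i. flux i (fi (gen i)) d) = eps i (fi (gen i))" if "i < n" for i
  using flux_eps[OF range that] unfolding F_def by auto
 let ?E = "Sigma {..<n} F"
 have finE: "finite ?E" using fin by auto
 define P where "P = {(i, d). i < n \<and> d \<in> F i \<and> flux i (fi (gen i)) d = 1}"
 define M where "M = {(i, d). i < n \<and> d \<in> F i \<and> flux i (fi (gen i)) d = -1}"
 have fPM: "finite P" "finite M" unfolding P_def M_def by (rule finite_subset[OF _ finE]; auto)+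
 have sw: "A = prod.swap ` B" if "!!d i. (d, i) \<in> A \<longleftrightarrow> (i, d) \<in> B" for A :: "(fgrp \<times> nat) set" and B
  by (auto simp: that)
 have S: "Src = prod.swap ` P" "Snk = prod.swap ` M"
  by (rule sw; simp add: Src_def Snk_def P_def M_def F_def nb_starts flux_def of_bool_def; blast)+
 thus "finite Src" "finite Snk" using fPM by auto
 have c: "card Src = card P" "card Snk = card M" unfolding S by (auto intro!: card_image)
 have "(\<Sum>i<n. eps i (fi (gen i))) = (\<Sum>i<n. \<Sum>d\<in>F i. flux i (fi (gen i)) d)" using sum by auto
 also have "... = (\<Sum>(i, d)\<in>?E. flux i (fi (gen i)) d)" using fin by (subst sum.Sigma) auto
 also have "... = (\<Sum>x\<in>?E. of_bool (x \<in> P) - of_bool (x \<in> M))"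
  by (intro sum.cong) (auto simp: P_def M_def F_def flux_def split: if_splits)
 also have "... = int (card (?E \<inter> P)) - int (card (?E \<inter> M))" using finE by (simp add: sum_subtractf)
 also have "?E \<inter> P = P" by (auto simp: P_def)
 also have "?E \<inter> M = M" by (auto simp: M_def)
 finally show "int (card Src) - int (card Snk) = (\<Sum>i<n. eps i (fi (gen i)))" using c by simp
qed

subsection \<open>Counting edges of balls in a twisted conjugacy class\<close>

definition R :: "fgrp => fgrp set" where "R ga = disp ga ` FG n"

definition dist :: "fgrp => fgrp => nat"
 where "dist ga v = (LEAST m. \<exists>x\<in>FG n. len x = m \<and> disp ga x = v)"

definition E :: "fgrp set => (fgrp \<times> nat) set"
 where "E D = {e. snd e < n \<and> fst e \<in> D \<and> nb e \<in> D}"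

definition D' :: "fgrp set => fgrp set"
 where "D' D = {d \<in> D. d ~= 0 \<and> step (hd (word d)) d \<in> D}"

lemma R_self [simp]: "ga \<in> R ga" unfolding R_def by (rule image_eqI[of _ _ 0]) auto

lemma R_step: assumes "v \<in> R ga" "fst l < n" shows "step l v \<in> R ga"
proof -
 obtain x where "x \<in> FG n" "v = disp ga x" using assms by (auto simp: R_def)
 thus ?thesis unfolding R_def using assms by (intro image_eqI[of _ _ "x + lt l"]) (auto simp: disp_snoc FG_plus)
qed

lemma R_FG: "ga \<in> FG n ==> R ga \<subseteq> FG n" by (auto simp: R_def disp_FG)

lemma dist_witness:
 assumes "v \<in> R ga" obtains x where "x \<in> FG n" "len x = dist ga v" "disp ga x = v"
proof -
 have "\<exists>m. \<exists>x\<in>FG n. len x = m \<and> disp ga x = v" using assms by (auto simp: R_def)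
 from LeastI_ex[OF this] show thesis using that unfolding dist_def by blast
qed

lemma dist_le: "x \<in> FG n ==> dist ga (disp ga x) \<le> len x" unfolding dist_def by (rule Least_le) auto

lemma parent_ex:
 assumes "v \<in> R ga" "v ~= ga"
 shows "\<exists>l. fst l < n \<and> dist ga (step l v) < dist ga v"
proof -
 obtain x where x: "x \<in> FG n" "len x = dist ga v" "disp ga x = v" using assms dist_witness by blast
 have "x ~= 0" using x assms by auto
 then obtain y l where y: "x = y + lt l" "word x = word y @ [l]" by (rule fgrp_snoc_cases)
 hence "y \<in> FG n" "fst l < n" using x by (auto simp: FG_def)
 moreover have "step (linv l) v = disp ga y" using x y by (auto simp: disp_snoc)
 moreover have "dist ga (disp ga y) < dist ga v"
  using dist_le[OF \<open>y \<in> FG n\<close>, of ga] x y by (simp add: len_def)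
 ultimately show ?thesis by (intro exI[of _ "linv l"]) simp
qed

definition pl :: "fgrp => fgrp => letter"
 where "pl ga v = (SOME l. fst l < n \<and> dist ga (step l v) < dist ga v)"

definition pe :: "fgrp => fgrp => fgrp \<times> nat"
 where "pe ga v = edge (pl ga v) v"

lemma pl:
 assumes "v \<in> R ga" "v ~= ga"
 shows "fst (pl ga v) < n" "dist ga (step (pl ga v) v) < dist ga v"
 using someI_ex[OF parent_ex[OF assms]] unfolding pl_def by auto

text \<open>If an edge were the parent edge of both its ends, the distance to \<open>ga\<close>
  would decrease in both directions.\<close>

lemma pe_inj: "inj_on (pe ga) (R ga - {ga})"
proof (rule inj_onI, rule ccontr)
 fix v w assume *: "v \<in> R ga - {ga}" "w \<in> R ga - {ga}" "pe ga v = pe ga w" "v ~= w"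
 hence "w = step (pl ga v) v" "v = step (pl ga w) w" using edge_eq_other unfolding pe_def by blast+
 thus False using pl(2)[of v ga] pl(2)[of w ga] * by auto
qed

definition ball :: "fgrp => nat => fgrp set"
 where "ball ga N = {v \<in> R ga. dist ga v \<le> N}"

lemma finite_ball: "finite (ball ga N)"
proof (rule finite_subset)
 show "ball ga N \<subseteq> disp ga ` {x \<in> FG n. len x \<le> N}"
 proof
  fix v assume "v \<in> ball ga N"
  hence "v \<in> R ga" "dist ga v \<le> N" by (auto simp: ball_def)
  from dist_witness[OF this(1)] this(2) show "v \<in> disp ga ` {x \<in> FG n. len x \<le> N}"
   by (metis (mono_tags, lifting) image_eqI mem_Collect_eq)
 qed
qed (simp add: finite_FG_ball)

lemma finite_E: assumes "finite D" shows "finite (E D)"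
proof (rule finite_subset)
 show "E D \<subseteq> D \<times> {..<n}" by (auto simp: E_def)
qed (use assms in simp)

lemma edge_in_E:
 assumes "fst l < n" "v \<in> D" "step l v \<in> D" shows "edge l v \<in> E D"
 using assms edge_ends[of l v] by (auto simp: E_def doubleton_eq_iff)

lemma pe_E: "v \<in> ball ga N - {ga} ==> pe ga v \<in> E (ball ga N)"
 unfolding pe_def using pl[of v ga] R_step[of v ga "pl ga v"] by (intro edge_in_E) (auto simp: ball_def)

text \<open>The parent edges of the vertices other than \<open>ga\<close> are distinct edges of the
  ball; this is the Euler inequality of a connected graph.\<close>

lemma card_ball_le: "card (ball ga N) \<le> card (E (ball ga N)) + 1"
proof -
 have "card (ball ga N - {ga}) = card (pe ga ` (ball ga N - {ga}))"
  using inj_on_subset[OF pe_inj, of "ball ga N - {ga}" ga] by (simp add: card_image ball_def Diff_mono)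
 also have "... \<le> card (E (ball ga N))" using pe_E finite_E[OF finite_ball] by (intro card_mono) blast+
 finally have "card (ball ga N - {ga}) \<le> card (E (ball ga N))" .
 moreover have "card (ball ga N) \<le> card (ball ga N - {ga}) + 1" by (auto simp: card_Diff_singleton_if)
 ultimately show ?thesis by linarith
qed

text \<open>An edge that is nobody's parent edge closes a cycle and improves the inequality by
  one.\<close>

lemma card_ball_le_extra:
 assumes "e \<in> E (ball ga N)" "e \<notin> pe ga ` (R ga - {ga})"
 shows "card (ball ga N) \<le> card (E (ball ga N))"
proof -
 have "card (ball ga N - {ga}) = card (pe ga ` (ball ga N - {ga}))"
  using inj_on_subset[OF pe_inj, of "ball ga N - {ga}" ga] by (simp add: card_image ball_def Diff_mono)
 also have "... \<le> card (E (ball ga N) - {e})"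
 by (rule card_mono; use pe_E[of _ ga N] assms(2) finite_E finite_ball in \<open>auto simp: ball_def\<close>)
 also have "... = card (E (ball ga N)) - 1" using assms by simp
 finally have "card (ball ga N - {ga}) \<le> card (E (ball ga N)) - 1" .
 moreover have "card (E (ball ga N)) > 0" using assms finite_E[OF finite_ball] by auto
 moreover have "card (ball ga N) \<le> card (ball ga N - {ga}) + 1" by (auto simp: card_Diff_singleton_if)
 ultimately show ?thesis by linarith
qed

lemma Snk_sig:
 assumes "e \<in> Snk"
 shows "step (hd (word (nb e))) (nb e) = fst e" "edge (hd (word (nb e))) (nb e) = e" "nb e ~= 0"
  "step (hd (word (fst e))) (fst e) = nb e" "edge (hd (word (fst e))) (fst e) = e" "fst e ~= 0"
 using assms step_linv[of "(snd e, True)" "fst e"] by (auto simp: Snk_def starts_def nb_def edge_def)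

lemma card_E_le:
 assumes "finite D" "D \<subseteq> FG n" "finite S" "Src \<inter> E D \<subseteq> S" "Sk \<subseteq> Snk" "fst ` Sk \<subseteq> D" "nb ` Sk \<subseteq> D"
 shows "card (E D) + card Sk \<le> card S + card (D' D)"
proof -
 define out where "out d = edge (hd (word d)) d" for d
 have sub: "nb ` Sk \<subseteq> D' D"
 proof
  fix d assume "d \<in> nb ` Sk"
  then obtain e where e: "e \<in> Sk" "d = nb e" by auto
  thus "d \<in> D' D" using Snk_sig(1,3)[of e] e assms(5-7) by (auto simp: D'_def)
 qed
 have inj: "inj_on nb Sk" by (rule inj_onI; use assms(5) Snk_sig(2) subsetD in \<open>metis\<close>)
 have fD: "finite (D' D)" using assms by (simp add: D'_def)
 have "E D \<subseteq> S \<union> out ` (D' D - nb ` Sk)"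
 proof
  fix e assume e: "e \<in> E D"
  obtain d i where ei: "e = (d, i)" by (cases e)
  have A: "e \<in> out ` (D' D - nb ` Sk)" if s: "starts d (i, True)"
  proof (rule image_eqI[of _ _ d])
   show "e = out d" using s by (simp add: out_def ei starts_def edge_def)
   \<comment> \<open>A far end of a sink begins with an inverse generator, while \<open>d\<close>
     begins with a generator.\<close>
   have "d \<notin> nb ` Sk"
   proof
    assume "d \<in> nb ` Sk"
    then obtain e' where "e' \<in> Snk" "d = nb e'" using assms by auto
    hence "starts d (snd e', False)" by (auto simp: Snk_def)
    with s show False using starts_unique by blast
   qed
   moreover have "d \<in> D' D" using e s by (auto simp: D'_def ei E_def starts_def nb_def)
   ultimately show "d \<in> D' D - nb ` Sk" by simp
  qed
  show "e \<in> S \<union> out ` (D' D - nb ` Sk)"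
  proof (cases "starts d (i, True)")
   case False
   show ?thesis
   proof (cases "starts (nb e) (i, False)")
    case True
    have out: "out (nb e) = e" using True step_linv[of "(i, True)" d] by (simp add: out_def starts_def ei edge_def nb_def)
    have "nb e \<in> D' D" using True e step_linv[of "(i, True)" d] by (auto simp: D'_def ei E_def starts_def nb_def)
    moreover have "nb e \<notin> nb ` Sk" using assms out Snk_sig(2) False ei by (auto simp: out_def Snk_def)
    ultimately have "out (nb e) \<in> out ` (D' D - nb ` Sk)" by (intro imageI) simp
    thus ?thesis unfolding out by simp
   next
    case no: False
    thus ?thesis using e assms False by (fastforce simp: Src_def ei E_def)
   qed
  qed (use A in simp)
 qed
 hence "card (E D) \<le> card (S \<union> out ` (D' D - nb ` Sk))" using assms(3) fD by (intro card_mono) auto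
 also have "... \<le> card S + card (out ` (D' D - nb ` Sk))" by (rule card_Un_le)
 also have "card (out ` (D' D - nb ` Sk)) \<le> card (D' D - nb ` Sk)" using fD by (intro card_image_le) auto
 also have "... = card (D' D) - card Sk" using sub fD inj by (simp add: card_Diff_subset card_image finite_subset)
 finally have "card (E D) \<le> card S + (card (D' D) - card Sk)" by simp
 moreover have "card Sk \<le> card (D' D)" using card_mono[OF fD sub] inj by (simp add: card_image)
 ultimately show ?thesis by linarith
qed

end

context twisted
begin

subsection \<open>A class in which the flow points inwards at infinity\<close>

lemma R_sym:
 assumes "ga' \<in> R ga" shows "R ga' = R ga"
proof -
 obtain y where y: "y \<in> FG n" "ga' = disp ga y" using assms by (auto simp: R_def)
 have 1: "disp ga' x = disp ga (y + x)" for x unfolding y disp_def hom minus_add by (simp only: add.assoc)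
 have 2: "disp ga x = disp ga' (- y + x)" for x unfolding 1 by simp
 show ?thesis
 proof
  show "R ga' \<subseteq> R ga" using y FG_plus 1 unfolding R_def by blast
  show "R ga \<subseteq> R ga'"
  proof
   fix v assume "v \<in> R ga"
   then obtain x where x: "x \<in> FG n" "v = disp ga x" by (auto simp: R_def)
   have "- y + x \<in> FG n" using x y by (intro FG_plus) auto
   thus "v \<in> R ga'" using 2 x(2) by (simp add: R_def)
  qed
 qed
qed

lemma excess_class:
 assumes "card Src < card Snk"
 obtains ga where "ga \<in> FG n" "card {e \<in> Src. fst e \<in> R ga} < card {e \<in> Snk. fst e \<in> R ga}"
proof -
have "\<exists>ga\<in>FG n. card {e \<in> Src. fst e \<in> R ga} < card {e \<in> Snk. fst e \<in> R ga}"
proof (rule ccontr)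
 assume no: "\<not> (\<exists>ga\<in>FG n. card {e \<in> Src. fst e \<in> R ga} < card {e \<in> Snk. fst e \<in> R ga})"
 have *: "card {e \<in> Snk. fst e \<in> R ga} \<le> card {e \<in> Src. fst e \<in> R ga}" if "ga \<in> FG n" for ga
  using no that by auto
 let ?C = "(\<lambda>e. R (fst e)) ` (Src \<union> Snk)"
 have fC: "finite ?C" using Src_Snk by simp
 have eq: "card S = (\<Sum>r\<in>?C. card {e \<in> S. R (fst e) = r})" if "S \<subseteq> Src \<union> Snk" "finite S" for S
 proof -
  have "(\<lambda>e. R (fst e)) ` S \<subseteq> ?C" using that by blast
  from sum.group[OF that(2) fC this, of "\<lambda>_. 1::nat"] show ?thesis by simp
 qed
 have "(\<Sum>r\<in>?C. card {e \<in> Snk. R (fst e) = r}) \<le> (\<Sum>r\<in>?C. card {e \<in> Src. R (fst e) = r})"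
 proof (rule sum_mono)
  fix r assume "r \<in> ?C"
  then obtain e where e: "e \<in> Src \<union> Snk" "r = R (fst e)" by blast
  define ga where "ga = fst e"
  have ga: "ga \<in> FG n" "r = R ga" using e unfolding ga_def Src_def Snk_def by blast+
  have "R d = r \<longleftrightarrow> d \<in> R ga" for d using R_sym[of d ga] R_self[of d] ga(2) by metis
  thus "card {e \<in> Snk. R (fst e) = r} \<le> card {e \<in> Src. R (fst e) = r}" using *[OF ga(1)] by simp
 qed
 hence "card Snk \<le> card Src" unfolding eq[OF Un_upper2 Src_Snk(2)] eq[OF Un_upper1 Src_Snk(1)] .
 thus False using assms by simp
qed
thus thesis using that by blast
qed

lemma dist_zero: "dist ga ga = 0" using dist_le[of 0 ga] by simp

lemma finite_subset_ball:
 assumes "finite X" "X \<subseteq> R ga" obtains N where "X \<subseteq> ball ga N"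
proof
 show "X \<subseteq> ball ga (Max (insert 0 (dist ga ` X)))" using assms by (auto simp: ball_def)
qed

lemma ball_mono: "N \<le> N' ==> ball ga N \<subseteq> ball ga N'" by (auto simp: ball_def)

lemma nb_R: "fst e \<in> R ga ==> snd e < n ==> nb e \<in> R ga" by (simp add: nb_def R_step)

text \<open>In a large ball the edges plus the sinks are at most the sources plus \<open>D'\<close>,
  and \<open>D'\<close> has at most as many elements as the ball, hence at most one more than there
  are edges. The excess of sinks uses up this slack of one. So no vertex is missing from
  \<open>D'\<close>, and a further edge closing a cycle is impossible.\<close>

lemma excess_class_props:
 assumes ga: "ga \<in> FG n" and less: "card {e \<in> Src. fst e \<in> R ga} < card {e \<in> Snk. fst e \<in> R ga}"
 obtains N0 where "!!N. N \<ge> N0 ==> D' (ball ga N) = ball ga N"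
  and "!!e. snd e < n ==> fst e \<in> R ga ==> e \<in> pe ga ` (R ga - {ga})"
proof -
 let ?S = "{e \<in> Src. fst e \<in> R ga}" and ?K = "{e \<in> Snk. fst e \<in> R ga}"
 have "finite (fst ` ?K \<union> nb ` ?K)" using Src_Snk(2) by simp
 moreover have "fst ` ?K \<union> nb ` ?K \<subseteq> R ga" by (auto intro!: nb_R simp: Snk_def)
 ultimately obtain N0 where N0: "fst ` ?K \<union> nb ` ?K \<subseteq> ball ga N0" by (rule finite_subset_ball)
 have le: "card (E (ball ga N)) + card ?K \<le> card ?S + card (D' (ball ga N))" if "N \<ge> N0" for N
 proof (rule card_E_le)
  show "finite (ball ga N)" by (rule finite_ball)
  show "ball ga N \<subseteq> FG n" using R_FG[OF ga] by (auto simp: ball_def)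
  show "Src \<inter> E (ball ga N) \<subseteq> ?S" by (auto simp: E_def ball_def)
  show "fst ` ?K \<subseteq> ball ga N" "nb ` ?K \<subseteq> ball ga N"
   using N0 ball_mono[OF that, of ga] by auto
 qed (use Src_Snk in auto)
 have sub: "D' D \<subseteq> D" for D by (auto simp: D'_def)
 have eq: "D' (ball ga N) = ball ga N" if "N \<ge> N0" for N
 proof (rule ccontr)
  assume "D' (ball ga N) ~= ball ga N"
  hence "card (D' (ball ga N)) < card (ball ga N)" using sub finite_ball by (intro psubset_card_mono) auto
  thus False using card_ball_le[of ga N] le[OF that] less by linarith
 qed
 have "e \<in> pe ga ` (R ga - {ga})" if e: "snd e < n" "fst e \<in> R ga" for e
 proof (rule ccontr)
  assume no: "e \<notin> pe ga ` (R ga - {ga})"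
  have "finite {fst e, nb e}" "{fst e, nb e} \<subseteq> R ga" using e nb_R by auto
  then obtain M where M: "{fst e, nb e} \<subseteq> ball ga M" by (rule finite_subset_ball)
  define N where "N = max M N0"
  have "e \<in> E (ball ga N)" using M e ball_mono[of M N ga] by (auto simp: E_def N_def)
  hence "card (ball ga N) \<le> card (E (ball ga N))" using no by (rule card_ball_le_extra)
  moreover have "card (E (ball ga N)) + card ?K \<le> card ?S + card (D' (ball ga N))" by (rule le) (simp add: N_def)
  moreover have "card (D' (ball ga N)) \<le> card (ball ga N)" by (intro card_mono finite_ball sub)
  ultimately show False using less by linarith
 qed
 with eq show thesis by (rule that)
qed

text \<open>If all edges of the class are parent edges, then a reduced word can never turn back.\<close>

lemma disp_tree:
 assumes ga: "ga \<in> FG n" and pe: "!!e. snd e < n ==> fst e \<in> R ga ==> e \<in> pe ga ` (R ga - {ga})"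
  and "x \<in> FG n"
 shows "dist ga (disp ga x) = len x \<and> (x ~= 0 --> disp ga x ~= ga \<and> last (word x) = linv (pl ga (disp ga x)))"
 using assms(3)
proof (induction x rule: fgrp_snoc_induct)
 case zero
 thus ?case by (simp add: dist_zero)
next
 case (snoc y l)
 let ?v = "disp ga y" and ?w = "disp ga (y + lt l)"
 have y: "y \<in> FG n" and l: "fst l < n" using snoc by (auto simp: FG_def)
 have w: "?w = step l ?v" by (rule disp_snoc)
 have v: "?v \<in> R ga" using y by (simp add: R_def)
 hence wR: "?w \<in> R ga" unfolding w using l by (rule R_step)
 have IH: "dist ga ?v = len y" "y ~= 0 ==> ?v ~= ga \<and> last (word y) = linv (pl ga ?v)"
  using snoc.IH y by auto
 have "edge l ?v \<in> pe ga ` (R ga - {ga})"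
  using edge_ends[of l ?v] v wR w l by (intro pe) (auto simp: doubleton_eq_iff)
 then obtain u where u: "u \<in> R ga - {ga}" "edge l ?v = edge (pl ga u) u" by (auto simp: pe_def)
 have du: "dist ga (step (pl ga u) u) < dist ga u" using pl(2) u by auto
 have "u ~= ?v" using u IH(2) edge_eq_same[of "pl ga u" u l] du snoc(2) reduced_word[of "y + lt l"] reduced_append by auto
 hence uw: "u = ?w" "step (pl ga u) u = ?v" using edge_ends[of l ?v] edge_ends[of "pl ga u" u] u w by (auto simp: doubleton_eq_iff)
 have "pl ga u = linv l" using edge_eq_same[of "linv l" u "pl ga u"] edge_linv[of l ?v] u(2) w du uw by auto
 moreover have "dist ga ?w = len (y + lt l)" using du uw IH(1) dist_le[of "y + lt l" ga] snoc by (simp add: len_def)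
 ultimately show ?case using uw(1) u(1) snoc(2) by simp
qed

text \<open>Along a reduced word the walk moves away from \<open>ga\<close> at every step, so the
  last letter of \<open>x\<close> can be recovered from \<open>disp ga x\<close> as the reverse of
  the parent letter, and the walk is undone letter by letter.\<close>

lemma disp_inj:
 assumes ga: "ga \<in> FG n" and pe: "!!e. snd e < n ==> fst e \<in> R ga ==> e \<in> pe ga ` (R ga - {ga})"
 shows "inj_on (disp ga) (FG n)"
proof (rule inj_onI)
 fix x x' assume "x \<in> FG n" "x' \<in> FG n" "disp ga x = disp ga x'"
 thus "x = x'"
 proof (induction x arbitrary: x' rule: fgrp_snoc_induct)
  case zero
  thus ?case using disp_tree[OF ga pe zero(2)] by simp
 next
  case (snoc y l)
  have d: "len x' = len (y + lt l)" "x' ~= 0 ==> last (word x') = l"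
   using disp_tree[OF ga pe snoc.prems(1)] disp_tree[OF ga pe snoc.prems(2)] snoc by auto
  hence "x' ~= 0" using snoc by (auto simp: len_def)
  then obtain y' l' where y': "x' = y' + lt l'" "word x' = word y' @ [l']" by (rule fgrp_snoc_cases)
  hence "l' = l" using d(2) \<open>x' ~= 0\<close> by simp
  have "y \<in> FG n" "y' \<in> FG n" using snoc y' by (auto simp: FG_def)
  thus ?case using \<open>l' = l\<close> snoc.IH step_linv snoc.prems(3) y'(1) disp_snoc by metis
 qed
qed

text \<open>Take a ball that contains all sources of the class and that no signpost leaves. If the
  displacement at \<open>y + lt l\<close> does not point back across \<open>l\<close>, then either
  the one at \<open>y\<close> points forward, in which case that of \<open>y\<close> lies in the
  ball by induction and its signpost leads to that of \<open>y + lt l\<close>, or the edge between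
  them is a source. Either way the displacement lies in a finite set, and \<open>disp ga\<close> is
  injective.\<close>

lemma finite_outward:
 assumes ga: "ga \<in> FG n" and pe: "!!e. snd e < n ==> fst e \<in> R ga ==> e \<in> pe ga ` (R ga - {ga})"
  and N0: "!!N. N \<ge> N0 ==> D' (ball ga N) = ball ga N"
 shows "finite {x \<in> FG n. x ~= 0 \<and> \<not> starts (disp ga x) (linv (last (word x)))}"
proof -
 let ?S = "{e \<in> Src. fst e \<in> R ga}"
 have "finite (insert ga (fst ` ?S \<union> nb ` ?S))" using Src_Snk(1) by simp
 moreover have "insert ga (fst ` ?S \<union> nb ` ?S) \<subseteq> R ga" by (auto intro!: nb_R simp: Src_def)
 ultimately obtain M where M: "insert ga (fst ` ?S \<union> nb ` ?S) \<subseteq> ball ga M" by (rule finite_subset_ball)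
 define N where "N = max M N0"
 have N: "insert ga (fst ` ?S \<union> nb ` ?S) \<subseteq> ball ga N" using M ball_mono[of M N ga] by (auto simp: N_def)
 have sig: "d ~= 0 \<and> step (hd (word d)) d \<in> ball ga N" if "d \<in> ball ga N" for d
  using N0[of N] that by (auto simp: N_def D'_def)
 have "disp ga x \<in> ball ga N" if "x \<in> FG n" "x ~= 0 --> \<not> starts (disp ga x) (linv (last (word x)))" for x
  using that
 proof (induction x rule: fgrp_snoc_induct)
  case zero
  thus ?case using N by simp
 next
  case (snoc y l)
  let ?v = "disp ga y" and ?w = "disp ga (y + lt l)"
  have y: "y \<in> FG n" and l: "fst l < n" using snoc by (auto simp: FG_def)
  have w: "?w = step l ?v" by (rule disp_snoc)
  have v: "?v \<in> R ga" using y by (simp add: R_def)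
  hence wR: "?w \<in> R ga" unfolding w using l by (rule R_step)
  have nw: "\<not> starts ?w (linv l)" using snoc by auto
  show ?case
  proof (cases "starts ?v l")
   case True
   have "?v \<in> ball ga N" using snoc.IH y snoc(2) reduced_word[of "y + lt l"] True reduced_append starts_unique by fastforce
   thus ?thesis using sig[of ?v] True w by (simp add: starts_def)
  next
   case False
   have "?v \<in> FG n" "?w \<in> FG n" using v wR R_FG[OF ga] by auto
   hence "edge l ?v \<in> ?S"
    using False nw l v wR w step_linv[of l ?v] by (cases l; cases "snd l") (auto simp: Src_def edge_def nb_def)
   hence "?w \<in> fst ` ?S \<union> nb ` ?S"
   proof -
    have "?w \<in> {fst (edge l ?v), nb (edge l ?v)}" unfolding edge_ends w by simp
    thus ?thesis using \<open>edge l ?v \<in> ?S\<close> by blast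
   qed
   thus ?thesis using N by blast
  qed
 qed
 hence "disp ga ` {x \<in> FG n. x ~= 0 \<and> \<not> starts (disp ga x) (linv (last (word x)))} \<subseteq> ball ga N"
  by auto
 hence "finite (disp ga ` {x \<in> FG n. x ~= 0 \<and> \<not> starts (disp ga x) (linv (last (word x)))})"
  using finite_ball finite_subset by blast
 thus ?thesis by (rule finite_imageD) (rule inj_on_subset[OF disp_inj[OF ga pe]], auto)
qed

lemma len_hom: obtains C where "!!v. v \<in> FG n ==> len (fi v) \<le> C * len v"
proof -
 define C where "C = Max (insert 0 ((\<lambda>l. len (fi (lt l))) ` ({..<n} \<times> UNIV)))"
 have C: "len (fi (lt l)) \<le> C" if "fst l < n" for l
  unfolding C_def using that by (intro Max_ge) (auto intro!: image_eqI[of _ _ l] simp: mem_Times_iff)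
 have "len (fi v) \<le> C * len v" if "v \<in> FG n" for v using that
 proof (induction v rule: fgrp_snoc_induct)
  case (snoc y l)
  have y: "y \<in> FG n" and l: "fst l < n" using snoc by (auto simp: FG_def)
  have "len (fi (y + lt l)) \<le> len (fi y) + len (fi (lt l))" unfolding hom by (rule len_plus)
  also have "... \<le> C * len y + C" using snoc.IH[OF y] C[OF l] by linarith
  finally show ?case using snoc(2) by (simp add: len_def)
 qed simp
 thus thesis by (rule that)
qed

text \<open>Far out in the tree the displacement at \<open>u\<close> is long and starts by going
  back. If the image of \<open>x = u + v\<close> still had the prefix \<open>u\<close>, then
  \<open>fi v\<close> would be the inverse of this displacement followed without cancellation by
  another word, hence too long for a short \<open>v\<close>. The margin \<open>k\<close> serves
  points of the cover, where sheets are controlled only up to a bounded error.\<close>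

theorem inward_class:
 assumes "(\<Sum>i<n. eps i (fi (gen i))) \<le> -1"
 obtains ga where "ga \<in> FG n" "!!g. g \<in> FG n ==> ga + fi g ~= g"
  "!!k. \<exists>N. \<forall>x\<in>FG n. N \<le> len x --> \<not> prefix (take (len x - k) (word x)) (word (ga + fi x))"
proof -
 obtain ga where ga: "ga \<in> FG n" "card {e \<in> Src. fst e \<in> R ga} < card {e \<in> Snk. fst e \<in> R ga}" using excess_class Src_Snk(3) assms by auto
 obtain N0 where N0: "!!N. N \<ge> N0 ==> D' (ball ga N) = ball ga N"
  and pe: "!!e. snd e < n ==> fst e \<in> R ga ==> e \<in> pe ga ` (R ga - {ga})"
  using excess_class_props[OF ga] by blast
 have inj: "inj_on (disp ga) (FG n)" by (rule disp_inj[OF ga(1) pe])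
 have nz: "disp ga g ~= 0" if "g \<in> FG n" for g
 proof
  assume z: "disp ga g = 0"
  have "finite {0::fgrp}" "{0} \<subseteq> R ga" using imageI[OF that, of "disp ga"] z by (auto simp: R_def)
  then obtain M where "{0} \<subseteq> ball ga M" by (rule finite_subset_ball)
  thus False using N0[of "max M N0"] ball_mono[of M "max M N0" ga] by (auto simp: D'_def)
 qed
 obtain C where C: "!!v. v \<in> FG n ==> len (fi v) \<le> C * len v" by (rule len_hom) blast
 have main: "\<exists>N. \<forall>x\<in>FG n. N \<le> len x --> \<not> prefix (take (len x - k) (word x)) (word (ga + fi x))" for k
 proof -
  \<comment> \<open>Two kinds of exceptions: vertices whose displacement does not point back, and
    vertices whose displacement is not longer than \<open>k * C\<close>, a bound for the length of
    \<open>fi v\<close> when \<open>v\<close> has length at most \<open>k\<close>.\<close>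
  define X where "X = {x \<in> FG n. x ~= 0 \<and> \<not> starts (disp ga x) (linv (last (word x)))}
   \<union> {x \<in> FG n. len (disp ga x) \<le> k * C}"
  have "finite {x \<in> FG n. len (disp ga x) \<le> k * C}"
  proof (rule finite_imageD)
   have "disp ga ` {x \<in> FG n. len (disp ga x) \<le> k * C} \<subseteq> {x \<in> FG n. len x \<le> k * C}"
    using disp_FG[OF ga(1)] by auto
   thus "finite (disp ga ` {x \<in> FG n. len (disp ga x) \<le> k * C})" using finite_FG_ball finite_subset by blast
  qed (rule inj_on_subset[OF inj], auto)
  hence "finite X" unfolding X_def using finite_outward[OF ga(1) pe N0] by simp
  define N1 where "N1 = Max (insert 0 (len ` X))"
  have N1: "x \<notin> X" if "len x > N1" for x
  proof
   assume "x \<in> X"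
   hence "len x \<le> N1" unfolding N1_def using \<open>finite X\<close> by (intro Max_ge) auto
   with that show False by simp
  qed
  have "\<not> prefix (take (len x - k) (word x)) (word (ga + fi x))" if x: "x \<in> FG n" "N1 + k + 1 \<le> len x" for x
  proof
   assume pre: "prefix (take (len x - k) (word x)) (word (ga + fi x))"
   have "word x = take (len x - k) (word x) @ drop (len x - k) (word x)" by simp
   then obtain u v where u: "word u = take (len x - k) (word x)" and v: "word v = drop (len x - k) (word x)"
    and xuv: "x = u + v" by (rule word_split)
   have uF: "u \<in> FG n" and vF: "v \<in> FG n" using x u v by (auto simp: FG_def dest: in_set_takeD in_set_dropD)
   have lv: "len v \<le> k" using v by (simp add: len_def)
   have lu: "len u > N1" using u x by (simp add: len_def)
   hence uX: "u \<notin> X" by (rule N1)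
   have u0: "u ~= 0" using lu by auto
   obtain l where l: "last (word u) = l" by blast
   have st: "starts (disp ga u) (linv l)" "len (disp ga u) > k * C" using uX u0 uF l by (auto simp: X_def)
   obtain z where z: "word (ga + fi x) = word u @ z" using pre u by (auto simp: prefix_def)
   then obtain u' w where uw: "word u' = word u" "word w = z" "ga + fi x = u' + w" by (rule word_split)
   hence gw: "ga + fi x = u + w" using word_inject by auto
   have "fi v = - fi u + (- ga + (ga + fi x))" by (simp add: xuv hom)
   also have "... = - disp ga u + w" unfolding gw by (simp add: disp_def minus_add add.assoc del: add_uminus_conv_diff)
   finally have eq: "fi v = - disp ga u + w" .
   have "last (word (- disp ga u)) = l" "word (- disp ga u) ~= []"
    using st(1) by (auto simp: word_uminus starts_def last_rev hd_map)
   \<comment> \<open>Nothing cancels: the inverse displacement ends with the last letter of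
     \<open>u\<close>, and \<open>z\<close> continues a reduced word after that letter.\<close>
   hence "reduced (word (- disp ga u) @ word w)" using u0 l z uw reduced_word[of "ga + fi x"] by (simp add: reduced_append)
   hence "len (fi v) = len (disp ga u) + len w"
    unfolding eq by (simp add: len_def word_plus flip: len_uminus[unfolded len_def, of "disp ga u"])
   moreover have "len (fi v) \<le> k * C" using C[OF vF] lv by (metis le_trans mult.commute mult_le_mono1)
   ultimately show False using st(2) by linarith
  qed
  thus ?thesis by (intro exI[of _ "N1 + k + 1"]) blast
 qed
 show thesis
 proof (rule that[OF ga(1) _ main])
  fix g assume "g \<in> FG n"
  from nz[OF this] show "ga + fi g ~= g" by (auto simp: disp_def add.assoc)
 qed
qed

end

section \<open>Brouwer's theorem, absolute extensors and finite polyhedra\<close>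

section \<open>Brouwer's theorem for cubes in function spaces\<close>

definition cube :: "'v set => ('v => real) set"
 where "cube J = {x. \<forall>v. 0 \<le> x v \<and> x v \<le> 1 \<and> (v \<notin> J --> x v = 0)}"

lemma compact_cube: "compact (cube (J::'v set))"
proof -
 have eq: "cube J = PiE UNIV (\<lambda>v. if v \<in> J then {0..1} else {0})"
  by (auto simp: cube_def PiE_iff split: if_splits) (metis (full_types) atLeastAtMost_iff singletonD order_refl zero_le_one)+
 have "compactin (product_topology (\<lambda>i. euclidean) UNIV) (PiE UNIV (\<lambda>v::'v. if v \<in> J then {0..1::real} else {0}))"
  by (subst compactin_PiE) auto
 thus ?thesis unfolding eq euclidean_product_topology by simp
qed

lemma LIMSEQ_fun_coord:
 fixes X :: "nat => 'v => real"
 assumes "X \<longlonglongrightarrow> x" shows "(\<lambda>m. X m v) \<longlonglongrightarrow> x v"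
 using continuous_on_tendsto_compose[OF continuous_on_product_coordinates assms] by simp

lemma LIMSEQ_fun_iff:
 fixes X :: "nat => 'v => real"
 shows "X \<longlonglongrightarrow> x \<longleftrightarrow> (\<forall>v. (\<lambda>m. X m v) \<longlonglongrightarrow> x v)"
 using limitin_componentwise[of "\<lambda>_. euclidean" UNIV X x sequentially] by (simp add: euclidean_product_topology)

text \<open>Kuhn's combinatorial lemma on finer and finer grids, followed by a limit along a
  subsequence. For each coordinate the grid cell has a corner where \<open>F\<close> does not lower
  it and a corner where \<open>F\<close> does not raise it, and all corners converge to the same
  point.\<close>

lemma brouwer_fun_cube:
 fixes F :: "('v::countable => real) => 'v => real"
 assumes J: "finite J" and cont: "continuous_on (cube J) F" and into: "F ` cube J \<subseteq> cube J"
 shows "\<exists>x\<in>cube J. F x = x"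
proof -
 define n where "n = card J"
 obtain b where b: "bij_betw b {..<n} J" using ex_bij_betw_nat_finite[OF J] unfolding n_def lessThan_atLeast0 by blast
 define idx where "idx = inv_into {..<n} b"
 have idx: "idx (b i) = i" if "i < n" for i using b that by (simp add: idx_def bij_betw_inv_into_left)
 have bJ: "b i \<in> J" if "i < n" for i using b that by (auto simp: bij_betw_def)
 have idxJ: "idx v < n" "b (idx v) = v" if "v \<in> J" for v using b that by (auto simp: idx_def bij_betw_def)
 define pt where "pt p x = (\<lambda>v. if v \<in> J then real (x (idx v)) / real p else 0)" for p and x :: "nat => nat"
 have pt: "pt p x \<in> cube J" if "0 < p" "\<forall>i<n. x i \<le> p" for p x using that idxJ by (auto simp: cube_def pt_def)
 have F01: "0 \<le> F y v" "F y v \<le> 1" if "y \<in> cube J" for y v using into that by (auto simp: cube_def)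
 have step: "\<exists>q r s. (\<forall>i<n. q i < p) \<and> (\<forall>i<n. (\<forall>j<n. q j \<le> r i j \<and> r i j \<le> q j + 1) \<and> (\<forall>j<n. q j \<le> s i j \<and> s i j \<le> q j + 1)
   \<and> pt p (r i) (b i) \<le> F (pt p (r i)) (b i) \<and> F (pt p (s i)) (b i) \<le> pt p (s i) (b i))"
  if p: "0 < p" for p
 proof -
  \<comment> \<open>Label 0 stands for "not lowered". On the faces \<open>x i = 0\<close> and
    \<open>x i = p\<close> the label is the one that Kuhn's lemma prescribes, and it still has its
    meaning there because \<open>F\<close> maps into the cube.\<close>
  define label where "label x i = (if x i = 0 then 0 else if x i = p then 1 else
   if pt p x (b i) \<le> F (pt p x) (b i) then 0 else (1::nat))" for x i
  obtain q where q: "\<forall>i<n. q i < p" and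
   rs: "\<forall>i<n. \<exists>r s. (\<forall>j<n. q j \<le> r j \<and> r j \<le> q j + 1) \<and> (\<forall>j<n. q j \<le> s j \<and> s j \<le> q j + 1) \<and> label r i ~= label s i"
   by (rule kuhn_lemma[of p n label]) (use p in \<open>auto simp: label_def\<close>)
  have low: "pt p x (b i) \<le> F (pt p x) (b i)" if "i < n" "\<forall>i<n. x i \<le> p" "label x i = 0" for x i
   using that F01(1)[OF pt[OF p that(2)], of "b i"] by (auto simp: label_def pt_def idx split: if_splits)
  have high: "F (pt p x) (b i) \<le> pt p x (b i)" if "i < n" "\<forall>i<n. x i \<le> p" "label x i = 1" for x i
   using that F01(2)[OF pt[OF p that(2)], of "b i"] bJ by (auto simp: label_def pt_def idx split: if_splits)
  have lab: "label x i = 0 \<or> label x i = 1" for x i by (auto simp: label_def)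
  have "\<exists>r s. (\<forall>j<n. q j \<le> r j \<and> r j \<le> q j + 1) \<and> (\<forall>j<n. q j \<le> s j \<and> s j \<le> q j + 1)
   \<and> pt p r (b i) \<le> F (pt p r) (b i) \<and> F (pt p s) (b i) \<le> pt p s (b i)" if i: "i < n" for i
  proof -
   obtain r s where r: "\<forall>j<n. q j \<le> r j \<and> r j \<le> q j + 1" and s: "\<forall>j<n. q j \<le> s j \<and> s j \<le> q j + 1"
    and ne: "label r i ~= label s i" using rs i by blast
   have rp: "\<forall>j<n. r j \<le> p" and sp: "\<forall>j<n. s j \<le> p" using q r s by fastforce+
   show ?thesis
   proof (cases "label r i = 0")
    case True
    thus ?thesis using r s low[OF i rp True] high[OF i sp] ne lab[of s i] by auto
   next
    case False
    thus ?thesis using r s low[OF i sp] high[OF i rp] ne lab[of s i] lab[of r i] by auto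
   qed
  qed
  then obtain r s where "!!i. i < n ==> (\<forall>j<n. q j \<le> r i j \<and> r i j \<le> q j + 1) \<and> (\<forall>j<n. q j \<le> s i j \<and> s i j \<le> q j + 1)
   \<and> pt p (r i) (b i) \<le> F (pt p (r i)) (b i) \<and> F (pt p (s i)) (b i) \<le> pt p (s i) (b i)" by metis
  with q show ?thesis by blast
 qed
 define good where "good p q r s \<longleftrightarrow> (\<forall>i<n. q i < Suc p) \<and>
   (\<forall>i<n. (\<forall>j<n. q j \<le> r i j \<and> r i j \<le> q j + 1) \<and> (\<forall>j<n. q j \<le> s i j \<and> s i j \<le> q j + 1)
   \<and> pt (Suc p) (r i) (b i) \<le> F (pt (Suc p) (r i)) (b i) \<and> F (pt (Suc p) (s i)) (b i) \<le> pt (Suc p) (s i) (b i))" for p q r s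
 have "\<forall>p. \<exists>q r s. good p q r s" unfolding good_def using step by simp
 then obtain q r s where "!!p. good p (q p) (r p) (s p)" by metis
 hence q: "!!p i. i < n ==> q p i < Suc p"
  and r: "!!p i j. i < n ==> j < n ==> q p j \<le> r p i j \<and> r p i j \<le> q p j + 1"
  and s: "!!p i j. i < n ==> j < n ==> q p j \<le> s p i j \<and> s p i j \<le> q p j + 1"
  and low: "!!p i. i < n ==> pt (Suc p) (r p i) (b i) \<le> F (pt (Suc p) (r p i)) (b i)"
  and high: "!!p i. i < n ==> F (pt (Suc p) (s p i)) (b i) \<le> pt (Suc p) (s p i) (b i)" unfolding good_def by blast+
 define Q where "Q p = pt (Suc p) (q p)" for p
 have QC: "Q p \<in> cube J" for p unfolding Q_def by (rule pt) (auto intro!: less_imp_le q)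
 obtain x sg where x: "x \<in> cube J" and sg: "strict_mono (sg::nat=>nat)" and lim: "(Q \<circ> sg) \<longlonglongrightarrow> x"
  using compact_imp_seq_compact[OF compact_cube] QC unfolding seq_compact_def by metis
 have near: "(\<lambda>m. pt (Suc (sg m)) (t (sg m))) \<longlonglongrightarrow> x"
  if t: "!!p j. j < n ==> q p j \<le> t p j \<and> t p j \<le> q p j + 1" for t unfolding LIMSEQ_fun_iff
 proof
  fix v
  have a: "(\<lambda>m. (Q \<circ> sg) m v) \<longlonglongrightarrow> x v" by (rule LIMSEQ_fun_coord[OF lim])
  have b: "(\<lambda>m. pt (Suc (sg m)) (t (sg m)) v - (Q \<circ> sg) m v) \<longlonglongrightarrow> 0"
  proof (rule Lim_null_comparison)
   show "\<forall>\<^sub>F m in sequentially. norm (pt (Suc (sg m)) (t (sg m)) v - (Q \<circ> sg) m v) \<le> inverse (real (Suc m))"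
   proof (intro always_eventually allI)
    fix m
    have "\<bar>pt (Suc (sg m)) (t (sg m)) v - Q (sg m) v\<bar> \<le> 1 / real (Suc (sg m))"
    proof (cases "v \<in> J")
     case True
     have "real (t (sg m) (idx v)) - real (q (sg m) (idx v)) \<le> 1" "real (q (sg m) (idx v)) \<le> real (t (sg m) (idx v))"
      using t[OF idxJ(1)[OF True], of "sg m"] by auto
     thus ?thesis by (simp add: Q_def pt_def divide_right_mono flip: diff_divide_distrib)
    qed (simp add: Q_def pt_def)
    also have "... \<le> 1 / real (Suc m)" using seq_suble[OF sg, of m] by (intro divide_left_mono) auto
    finally show "norm (pt (Suc (sg m)) (t (sg m)) v - (Q \<circ> sg) m v) \<le> inverse (real (Suc m))"
     by (simp add: inverse_eq_divide)
   qed
   show "(\<lambda>m. inverse (real (Suc m))) \<longlonglongrightarrow> 0" by (rule LIMSEQ_inverse_real_of_nat)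
  qed
  from tendsto_add[OF b a] show "(\<lambda>m. pt (Suc (sg m)) (t (sg m)) v) \<longlonglongrightarrow> x v" by simp
 qed
 have tC: "pt (Suc p) (t p) \<in> cube J" if "!!p j. j < n ==> q p j \<le> t p j \<and> t p j \<le> q p j + 1" for t p
 proof (rule pt)
  show "\<forall>i<n. t p i \<le> Suc p"
  proof (intro allI impI)
   fix i assume "i < n"
   thus "t p i \<le> Suc p" using that[of i p] q[of i p] by linarith
  qed
 qed simp
 have Flim: "(\<lambda>m. F (pt (Suc (sg m)) (t (sg m))) v) \<longlonglongrightarrow> F x v"
  if t: "!!p j. j < n ==> q p j \<le> t p j \<and> t p j \<le> q p j + 1" for t v
  by (rule LIMSEQ_fun_coord[OF continuous_on_tendsto_compose[OF cont near[OF t] x]]) (use tC[OF t] in auto)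
 have "F x v = x v" for v
 proof (cases "v \<in> J")
  case True
  define i where "i = idx v"
  have i: "i < n" "b i = v" using idxJ[OF True] by (auto simp: i_def)
  have rt: "!!p j. j < n ==> q p j \<le> r p i j \<and> r p i j \<le> q p j + 1" using r i by blast
  have st: "!!p j. j < n ==> q p j \<le> s p i j \<and> s p i j \<le> q p j + 1" using s i by blast
  show ?thesis using LIMSEQ_le[OF LIMSEQ_fun_coord[OF near[OF rt]] Flim[OF rt], of v v] low[OF i(1)] i(2) LIMSEQ_le[OF Flim[OF st] LIMSEQ_fun_coord[OF near[OF st]], of v v] high[OF i(1)] by simp
 next
  case False
  show ?thesis using False x into by (auto simp: cube_def)
 qed
 thus ?thesis using x by blast
qed

section \<open>Absolute extensors\<close>

text \<open>Absolute extensors relative to the spaces of one type: a predicate cannot quantify over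
  types, so the type is an argument. Product types are used for it later, where a homotopy parameter
  is needed.\<close>

definition AEx :: "'z::{metric_space,second_countable_topology} itself => 'p::topological_space set => bool"
 where "AEx _ P \<longleftrightarrow> P ~= {} \<and> (\<forall>A (f::'z => 'p). closed A \<and> continuous_on A f \<and> f ` A \<subseteq> P -->
  (\<exists>g. continuous_on UNIV g \<and> range g \<subseteq> P \<and> (\<forall>x\<in>A. g x = f x)))"

lemma AExE:
 fixes f :: "'z::{metric_space,second_countable_topology} => 'p::topological_space"
 assumes "AEx TYPE('z) P" "closed A" "continuous_on A f" "f ` A \<subseteq> P"
 obtains g where "continuous_on UNIV g" "range g \<subseteq> P" "\<forall>x\<in>A. g x = f x"
using assms(1)[unfolded AEx_def, THEN conjunct2, rule_format, of A f] assms(2-) that by auto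

text \<open>Borsuk's gluing argument. Divide the space into the points nearer to \<open>A1\<close>
  and those nearer to \<open>A2\<close>. The common frontier meets \<open>A1\<close> and
  \<open>A2\<close> only in \<open>A1 \<inter> A2\<close>, so an extension into
  \<open>P \<inter> Q\<close> settles the frontier, and two independent extensions into
  \<open>P\<close> and into \<open>Q\<close> remain.\<close>

lemma AEx_Un:
 fixes P Q :: "'p::topological_space set"
 assumes P: "AEx TYPE('z::{metric_space,second_countable_topology}) P" and Q: "AEx TYPE('z) Q"
  and PQ: "AEx TYPE('z) (P \<inter> Q)"
  and cP: "closed P" and cQ: "closed Q"
 shows "AEx TYPE('z) (P \<union> Q)" unfolding AEx_def
proof (intro conjI allI impI)
 show "P \<union> Q ~= {}" using P by (auto simp: AEx_def)
 fix A and f :: "'z => 'p"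
 assume "closed A \<and> continuous_on A f \<and> f ` A \<subseteq> P \<union> Q"
 hence A: "closed A" and f: "continuous_on A f" and fA: "f ` A \<subseteq> P \<union> Q" by auto
 define A1 where "A1 = A \<inter> f -` P"
 define A2 where "A2 = A \<inter> f -` Q"
 have cA: "closed A1" "closed A2" unfolding A1_def A2_def using A f cP cQ by (auto intro: continuous_closed_preimage)
 have A12: "A = A1 \<union> A2" using fA by (auto simp: A1_def A2_def)
 have f1: "continuous_on A1 f" "f ` A1 \<subseteq> P" and f2: "continuous_on A2 f" "f ` A2 \<subseteq> Q"
  using f by (auto simp: A1_def A2_def intro: continuous_on_subset)
 show "\<exists>g. continuous_on UNIV g \<and> range g \<subseteq> P \<union> Q \<and> (\<forall>x\<in>A. g x = f x)"
 proof (cases "A1 = {} \<or> A2 = {}")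
  case True
  thus ?thesis
  proof
   assume "A1 = {}"
   hence "A = A2" using A12 by auto
   obtain g where "continuous_on UNIV g" "range g \<subseteq> Q" "\<forall>x\<in>A2. g x = f x" by (rule AExE[OF Q cA(2) f2])
   thus ?thesis using \<open>A = A2\<close> by blast
  next
   assume "A2 = {}"
   hence "A = A1" using A12 by auto
   obtain g where "continuous_on UNIV g" "range g \<subseteq> P" "\<forall>x\<in>A1. g x = f x" by (rule AExE[OF P cA(1) f1])
   thus ?thesis using \<open>A = A1\<close> by blast
  qed
 next
  case False
  hence ne: "A1 ~= {}" "A2 ~= {}" by auto
  have in1: "infdist x A1 = 0 \<longleftrightarrow> x \<in> A1" and in2: "infdist x A2 = 0 \<longleftrightarrow> x \<in> A2" for x
   using ne cA in_closed_iff_infdist_zero by blast+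
  define Z1 where "Z1 = {x. infdist x A1 \<le> infdist x A2}"
  define Z2 where "Z2 = {x. infdist x A2 \<le> infdist x A1}"
  have cZ: "closed Z1" "closed Z2" unfolding Z1_def Z2_def by (intro closed_Collect_le continuous_intros)+
  have ZU: "Z1 \<union> Z2 = UNIV" by (auto simp: Z1_def Z2_def)
  have "x \<in> A2" if "x \<in> A1" "x \<in> Z2" for x using in2[of x] that infdist_nonneg[of x A2] by (simp add: Z2_def)
  hence A1Z: "A1 \<subseteq> Z1" "A1 \<inter> Z2 \<subseteq> A2" by (auto simp: Z1_def infdist_nonneg)
  have "x \<in> A1" if "x \<in> A2" "x \<in> Z1" for x using in1[of x] that infdist_nonneg[of x A1] by (simp add: Z1_def)
  hence A2Z: "A2 \<subseteq> Z2" "A2 \<inter> Z1 \<subseteq> A1" by (auto simp: Z2_def infdist_nonneg)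
  have f12: "continuous_on (A1 \<inter> A2) f" by (rule continuous_on_subset[OF f1(1)]) simp
  have f12': "f ` (A1 \<inter> A2) \<subseteq> P \<inter> Q" by (auto simp: A1_def A2_def)
  obtain g0 where g0: "continuous_on UNIV g0" "range g0 \<subseteq> P \<inter> Q" "\<forall>x\<in>A1 \<inter> A2. g0 x = f x"
   by (rule AExE[OF PQ closed_Int[OF cA] f12 f12'])
  have ext: "\<exists>g. continuous_on UNIV g \<and> range g \<subseteq> P' \<and> (\<forall>x\<in>B. g x = f x) \<and> (\<forall>x\<in>Z1 \<inter> Z2. g x = g0 x)"
   if P': "AEx TYPE('z) P'" and B: "closed B" "continuous_on B f" "f ` B \<subseteq> P'" "B \<inter> (Z1 \<inter> Z2) \<subseteq> A1 \<inter> A2" and "P \<inter> Q \<subseteq> P'" for P' B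
  proof -
   \<comment> \<open>On the frontier the values of \<open>g0\<close> are prescribed; they agree with
     \<open>f\<close> because \<open>B\<close> meets the frontier inside
     \<open>A1 \<inter> A2\<close>.\<close>
   define h where "h x = (if x \<in> B then f x else g0 x)" for x
   have agree: "f x = g0 x" if "x \<in> B" "x \<in> Z1 \<inter> Z2" for x using that B(4) g0(3) by fastforce
   have "continuous_on (B \<union> (Z1 \<inter> Z2)) h" unfolding h_def
   by (rule continuous_on_cases; use continuous_on_subset[OF g0(1)] B cZ agree in \<open>auto\<close>)
   moreover have "h x \<in> P'" if "x \<in> B \<union> (Z1 \<inter> Z2)" for x
   proof (cases "x \<in> B")
    case False
    show ?thesis using \<open>P \<inter> Q \<subseteq> P'\<close> False g0(2) by (fastforce simp: h_def)
   qed (use B(3) in \<open>auto simp: h_def\<close>)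
   hence "h ` (B \<union> (Z1 \<inter> Z2)) \<subseteq> P'" by blast
   moreover have "closed (B \<union> (Z1 \<inter> Z2))" using B(1) cZ by (intro closed_Un closed_Int)
   ultimately obtain g where g: "continuous_on UNIV g" "range g \<subseteq> P'" "\<forall>x\<in>B \<union> (Z1 \<inter> Z2). g x = h x"
    using AExE[OF P', of "B \<union> (Z1 \<inter> Z2)" h] by metis
   have "g x = g0 x" if "x \<in> Z1 \<inter> Z2" for x using g(3) that agree[of x] by (auto simp: h_def)
   moreover have "\<forall>x\<in>B. g x = f x" using g(3) unfolding h_def by simp
   ultimately show ?thesis using g(1,2) by blast
  qed
  have B1: "A1 \<inter> (Z1 \<inter> Z2) \<subseteq> A1 \<inter> A2" and B2: "A2 \<inter> (Z1 \<inter> Z2) \<subseteq> A1 \<inter> A2"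
   using A1Z A2Z by blast+
  obtain g1 where g1: "continuous_on UNIV g1" "range g1 \<subseteq> P" "\<forall>x\<in>A1. g1 x = f x" "\<forall>x\<in>Z1 \<inter> Z2. g1 x = g0 x"
   using ext[OF P cA(1) f1 B1 Int_lower1] by metis
  obtain g2 where g2: "continuous_on UNIV g2" "range g2 \<subseteq> Q" "\<forall>x\<in>A2. g2 x = f x" "\<forall>x\<in>Z1 \<inter> Z2. g2 x = g0 x"
   using ext[OF Q cA(2) f2 B2 Int_lower2] by metis
  define g where "g x = (if x \<in> Z1 then g1 x else g2 x)" for x
  have "continuous_on (Z1 \<union> Z2) g" unfolding g_def
  by (rule continuous_on_cases[OF cZ]; use g1(1) g2(1) continuous_on_subset g1(4) g2(4) in \<open>auto\<close>)
  moreover have "range g \<subseteq> P \<union> Q" using g1(2) g2(2) by (auto simp: g_def)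
  moreover have "g x = f x" if "x \<in> A" for x using that A12 A2Z g1(3) A1Z g2(3) by (auto simp: g_def)
  ultimately show ?thesis using ZU by (intro exI[of _ g]) auto
 qed
qed

lemma AEx_imp_connected:
 assumes "AEx TYPE(real) P" shows "connected P"
proof (rule path_connected_imp_connected)
 show "path_connected P" unfolding path_connected_def
 proof (intro ballI)
  fix x y assume xy: "x \<in> P" "y \<in> P"
  define f where "f = (\<lambda>t::real. if t = 0 then x else y)"
  have "continuous_on {0,1} f" using continuous_on_finite by force
  moreover have "closed {0,1::real}" "f ` {0,1} \<subseteq> P" using xy by (auto simp: f_def)
  ultimately obtain g where g: "continuous_on UNIV g" "range g \<subseteq> P" "\<forall>t\<in>{0,1}. g t = f t"
   using AExE[OF assms, of "{0,1}" f] by metis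
  have "path g" unfolding path_def by (rule continuous_on_subset[OF g(1)]) simp
  moreover have "path_image g \<subseteq> P" using g(2) by (auto simp: path_image_def)
  moreover have "pathstart g = x" "pathfinish g = y" using g(3) by (auto simp: pathstart_def pathfinish_def f_def)
  ultimately show "\<exists>g. path g \<and> path_image g \<subseteq> P \<and> pathstart g = x \<and> pathfinish g = y" by blast
 qed
qed

text \<open>Extending the identity of \<open>P\<close> gives a retraction \<open>r\<close>, and
  Brouwer applies to \<open>h \<circ> r\<close> on the cube.\<close>

lemma AEx_fixpoint:
 fixes P :: "('v::countable => real) set"
 assumes AE: "AEx TYPE('v => real) P" and "closed P" and J: "finite J" "P \<subseteq> cube J"
  and h: "continuous_on P h" "h ` P \<subseteq> P"
 shows "\<exists>x\<in>P. h x = x"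
proof -
 obtain r where r: "continuous_on UNIV r" "range r \<subseteq> P" "\<forall>x\<in>P. r x = x"
  by (rule AExE[OF AE \<open>closed P\<close> continuous_on_id]) simp_all
 have "continuous_on (cube J) (h \<circ> r)"
 proof (rule continuous_on_compose)
  show "continuous_on (cube J) r" by (rule continuous_on_subset[OF r(1)]) simp
  show "continuous_on (r ` cube J) h" by (rule continuous_on_subset[OF h(1)]) (use r(2) in auto)
 qed
 moreover have hr: "h (r x) \<in> P" for x using r(2) h(2) by blast
 hence "(h \<circ> r) ` cube J \<subseteq> cube J" using J(2) by auto
 ultimately obtain x where x: "h (r x) = x" using brouwer_fun_cube[OF J(1)] by fastforce
 thus ?thesis using r(3) hr[of x] by auto
qed

section \<open>Realizations of finite simplicial complexes\<close>

definition supp :: "('v => real) => 'v set" where "supp x = {v. x v ~= 0}"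

text \<open>Points are given by their barycentric coordinates, extended by 0 to all vertices. For a
  finite complex the product topology on functions induces the usual topology.\<close>

definition realiz :: "'v set set => ('v => real) set"
 where "realiz K = {x. (\<forall>v. 0 \<le> x v) \<and> supp x \<in> K \<and> sum x (supp x) = 1}"

definition scomplex :: "'v set set => bool"
 where "scomplex K \<longleftrightarrow> (\<forall>s\<in>K. finite s \<and> s ~= {} \<and> (\<forall>t. t \<subseteq> s \<and> t ~= {} --> t \<in> K))"

definition faces :: "'v set => 'v set set" where "faces s = {t. t \<subseteq> s \<and> t ~= {}}"

lemma scomplexD: "scomplex K ==> s \<in> K ==> t \<subseteq> s ==> t ~= {} ==> t \<in> K"
 and scomplex_finite: "scomplex K ==> s \<in> K ==> finite s"
 and scomplex_nonempty: "scomplex K ==> s \<in> K ==> s ~= {}" unfolding scomplex_def by blast+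

lemma scomplex_faces: "finite s ==> scomplex (faces s)" by (auto simp: scomplex_def faces_def dest: finite_subset)

lemma finite_faces: "finite s ==> finite (faces s)" by (simp add: faces_def)

lemma scomplex_Un: "scomplex K ==> scomplex L ==> scomplex (K \<union> L)" by (auto simp: scomplex_def)

lemma realiz_Un: "realiz (K \<union> L) = realiz K \<union> realiz L"
 and realiz_Int: "realiz (K \<inter> L) = realiz K \<inter> realiz L" by (auto simp: realiz_def)

lemma realiz_mono: "K \<subseteq> L ==> realiz K \<subseteq> realiz L" by (auto simp: realiz_def)

lemma realiz_le_1:
 assumes "x \<in> realiz K" "scomplex K" shows "x v \<le> 1"
proof (cases "x v = 0")
 case False
 have fin: "finite (supp x)" using assms by (auto simp: realiz_def dest: scomplex_finite)
 have "x v \<le> sum x (supp x)" using assms False fin by (intro member_le_sum) (auto simp: realiz_def supp_def)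
 thus ?thesis using assms by (simp add: realiz_def)
qed simp

lemma realiz_sum:
 assumes "x \<in> realiz K" "finite S" "supp x \<subseteq> S" shows "sum x S = 1"
proof -
 have "sum x S = sum x (supp x)" using assms by (intro sum.mono_neutral_right) (auto simp: supp_def)
 thus ?thesis using assms by (simp add: realiz_def)
qed

lemma realiz_faces:
 assumes "finite s"
 shows "realiz (faces s) = {x. (\<forall>v. 0 \<le> x v) \<and> (\<forall>v. v \<notin> s --> x v = 0) \<and> sum x s = 1}"
proof -
 have "sum x (supp x) = sum x s" if "supp x \<subseteq> s" for x
  using that assms by (intro sum.mono_neutral_left) (auto simp: supp_def)
 moreover have "supp x ~= {}" if "sum x s = 1" for x
 proof
  assume "supp x = {}"
  hence "sum x s = 0" by (simp add: supp_def)
  with that show False by simp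
 qed
 moreover have "(\<forall>v. v \<notin> s --> x v = 0) \<longleftrightarrow> supp x \<subseteq> s" for x by (auto simp: supp_def)
 ultimately show ?thesis by (auto simp: realiz_def faces_def)
qed

lemma closed_realiz_faces: assumes "finite s" shows "closed (realiz (faces s))"
proof -
 have c: "continuous_on UNIV (\<lambda>x::'a => real. x v)" for v by simp
 have "realiz (faces s) = (\<Inter>v. {x. 0 \<le> x v}) \<inter> (\<Inter>v\<in>-s. {x. x v = 0}) \<inter> {x. sum x s = 1}"
  unfolding realiz_faces[OF assms] by auto
 also have "closed ..."
  by (intro closed_Int closed_INT ballI closed_Collect_le closed_Collect_eq continuous_on_const c continuous_on_sum)
 finally show ?thesis .
qed

lemma realiz_eq_UN: "scomplex K ==> realiz K = (\<Union>s\<in>K. realiz (faces s))"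
 by (auto simp: realiz_def faces_def dest: scomplexD scomplex_nonempty)

lemma closed_realiz: assumes "finite K" "scomplex K" shows "closed (realiz K)" unfolding realiz_eq_UN[OF assms(2)] using assms
 by (intro closed_UN ballI closed_realiz_faces) (auto dest: scomplex_finite)

lemma realiz_cube: assumes "scomplex K" shows "realiz K \<subseteq> cube (\<Union>K)"
 using realiz_le_1[OF _ assms] by (auto simp: cube_def realiz_def supp_def)

lemma compact_realiz: assumes "finite K" "scomplex K" shows "compact (realiz K)"
 using closed_realiz[OF assms] realiz_cube[OF assms(2)] compact_cube by (metis compact_Int_closed inf.absorb_iff2)

text \<open>Each coordinate is extended by Tietze; adding the distance to \<open>A\<close> makes the
  sum of the coordinates positive off \<open>A\<close> without changing anything on
  \<open>A\<close>, and then the sum can be divided out.\<close>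

lemma AEx_simplex:
 fixes s :: "'v set"
 assumes s: "finite s" "s ~= {}"
 shows "AEx TYPE('z::{metric_space,second_countable_topology}) (realiz (faces s))" unfolding AEx_def
proof (intro conjI allI impI)
 obtain v0 where v0: "v0 \<in> s" using s by auto
 define e where "e = (\<lambda>v. if v = v0 then 1 else (0::real))"
 have e: "e \<in> realiz (faces s)" unfolding realiz_faces[OF s(1)] using v0 s by (simp add: e_def)
 thus "realiz (faces s) ~= {}" by auto
 fix A and f :: "'z => 'v => real"
 assume "closed A \<and> continuous_on A f \<and> f ` A \<subseteq> realiz (faces s)"
 hence A: "closed A" and f: "continuous_on A f" and fA: "!!x. x \<in> A ==> f x \<in> realiz (faces s)" by auto
 show "\<exists>g. continuous_on UNIV g \<and> range g \<subseteq> realiz (faces s) \<and> (\<forall>x\<in>A. g x = f x)"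
 proof (cases "A = {}")
  case True
  thus ?thesis using e by (intro exI[of _ "\<lambda>_. e"]) auto
 next
  case ne: False
  have "\<exists>g. continuous_on UNIV g \<and> (\<forall>x\<in>A. g x = f x v) \<and> (\<forall>x. 0 \<le> g x)" for v
  proof -
   have "f x v \<in> cbox 0 1" if "x \<in> A" for x
    using fA[OF that] realiz_le_1[OF fA[OF that] scomplex_faces[OF s(1)]] by (auto simp: realiz_def)
   then obtain g where "continuous_on UNIV g" "!!x. x \<in> A ==> g x = f x v" "!!x. x \<in> UNIV ==> g x \<in> cbox 0 1" using Tietze_closed_interval_1[of A "\<lambda>x. f x v" UNIV 0 1] A continuous_on_product_then_coordinatewise[OF f] by auto
   thus ?thesis by (intro exI[of _ g]) auto
  qed
  then obtain g where gc: "!!v. continuous_on UNIV (g v)" and gA: "!!v x. x \<in> A ==> g v x = f x v" and g0: "!!v x. 0 \<le> g v x"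
   by metis
  define u where "u v x = g v x + infdist x A" for v x
  have u: "continuous_on UNIV (u v)" "0 \<le> u v x" "x \<in> A ==> u v x = f x v" for v x
   unfolding u_def using gc g0 gA by (auto intro!: continuous_on_add continuous_on_infdist simp: infdist_nonneg)
  have upos: "0 < (\<Sum>v\<in>s. u v x)" for x
  proof (cases "x \<in> A")
   case True
   thus ?thesis using u fA[OF True] by (simp add: realiz_faces s)
  next
   case False
   hence "0 < u v x" for v using g0[of v x] A ne infdist_nonneg[of x A] in_closed_iff_infdist_zero[of A x] by (simp add: u_def)
   thus ?thesis using s by (intro sum_pos) auto
  qed
  define h where "h x = (\<lambda>v. if v \<in> s then u v x / (\<Sum>v\<in>s. u v x) else 0)" for x
  have "continuous_on UNIV h"
  proof (intro continuous_on_coordinatewise_then_product)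
   fix v
   have "continuous_on UNIV (\<lambda>x. u v x / (\<Sum>v\<in>s. u v x))"
    using u upos by (intro continuous_on_divide continuous_on_sum) (auto simp: less_imp_neq[symmetric])
   thus "continuous_on UNIV (\<lambda>x. h x v)" by (cases "v \<in> s") (auto simp: h_def)
  qed
  moreover have "h x \<in> realiz (faces s)" for x unfolding realiz_faces[OF s(1)] using u(2)[of _ x] upos[of x]
   by (auto simp: h_def simp flip: sum_divide_distrib)
  moreover have "h x = f x" if "x \<in> A" for x using u(3)[OF that] fA[OF that] by (auto simp: h_def realiz_faces s)
  ultimately show ?thesis by (intro exI[of _ h]) auto
 qed
qed

lemma AEx_realiz_Un:
 fixes P Q :: "'v set set"
 assumes "finite P" "scomplex P" "finite Q" "scomplex Q"
  and "AEx TYPE('z::{metric_space,second_countable_topology}) (realiz P)" "AEx TYPE('z) (realiz Q)"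
  and "AEx TYPE('z) (realiz (P \<inter> Q))"
 shows "AEx TYPE('z) (realiz (P \<union> Q))"
 unfolding realiz_Un using assms by (intro AEx_Un closed_realiz) (auto simp: realiz_Int)

section \<open>The universal cover as a labelled complex, and the fixed point theorem on it\<close>

section \<open>Covering complexes given by labels in a free group\<close>

text \<open>The covering space of an edge cocycle with values in the group: vertices carry a sheet,
  and crossing an edge multiplies the sheet on the right by the label. Left multiplication commutes
  with this and gives the deck transformations \<open>shift\<close>.\<close>

definition cover :: "nat => ('v => 'v => fgrp) => 'v set set => ('v \<times> fgrp) set set"
 where "cover n lam K = {s. finite s \<and> fst ` s \<in> K \<and> snd ` s \<subseteq> FG n \<and>
  (\<forall>x\<in>s. \<forall>y\<in>s. snd y = snd x + lam (fst x) (fst y))}"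

lemma coverI:
 assumes "finite s" "fst ` s \<in> K" "!!v g. (v, g) \<in> s ==> g \<in> FG n"
  "!!v g w h. (v, g) \<in> s ==> (w, h) \<in> s ==> h = g + lam v w"
 shows "s \<in> cover n lam K" unfolding cover_def using assms(1,2)
by (intro CollectI conjI ballI; use assms(3) assms(4) in \<open>auto\<close>)

lemma coverD:
 assumes "s \<in> cover n lam K"
 shows "finite s" "fst ` s \<in> K" "(v, g) \<in> s ==> g \<in> FG n"
  "(v, g) \<in> s ==> (w, h) \<in> s ==> h = g + lam v w"
proof -
 have s: "finite s" "fst ` s \<in> K" "snd ` s \<subseteq> FG n"
  "\<forall>x\<in>s. \<forall>y\<in>s. snd y = snd x + lam (fst x) (fst y)" using assms unfolding cover_def by blast+
 show "finite s" "fst ` s \<in> K" by fact+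
 show "(v, g) \<in> s ==> g \<in> FG n" using s(3) by force
 assume "(v, g) \<in> s" "(w, h) \<in> s"
 from s(4)[rule_format, OF this] show "h = g + lam v w" by simp
qed

lemma idem_zero: "(a::'a::group_add) = a + a ==> a = 0" by (metis add.assoc add_0_left left_minus)

text \<open>A sum over sheets; at a point of the cover at most one sheet contributes for each vertex
  (\<open>proj_at\<close>).\<close>

definition proj :: "('v \<times> fgrp => real) => 'v => real"
 where "proj x = (\<lambda>v. \<Sum>g | x (v, g) ~= 0. x (v, g))"

definition shift :: "fgrp => ('v \<times> fgrp => real) => 'v \<times> fgrp => real"
 where "shift ga x = (\<lambda>(v, g). x (v, - ga + g))"

lemma shift_apply [simp]: "shift ga x (v, g) = x (v, - ga + g)" by (simp add: shift_def)

lemma shift_zero [simp]: "shift 0 x = x" by (auto simp: fun_eq_iff)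

lemma shift_shift: "shift ga (shift de x) = shift (ga + de) x"
 by (auto simp: fun_eq_iff minus_add add.assoc simp del: add_uminus_conv_diff)

lemma continuous_on_shift: "continuous_on S G ==> continuous_on S (\<lambda>x. shift ga (G x))"
 unfolding shift_def case_prod_beta
 by (rule continuous_on_coordinatewise_then_product, rule continuous_on_product_then_coordinatewise)

lemma proj_shift: "proj (shift ga x) = proj x"
proof
 fix v
 have "{g. x (v, - ga + g) ~= 0} = (+) ga ` {g. x (v, g) ~= 0}"
 proof safe
  fix g assume "x (v, - ga + g) ~= 0"
  thus "g \<in> (+) ga ` {g. x (v, g) ~= 0}" by (intro image_eqI[of _ _ "- ga + g"]) (auto simp flip: add.assoc)
 qed (simp flip: add.assoc)
 hence "proj (shift ga x) v = (\<Sum>g\<in>(+) ga ` {g. x (v, g) ~= 0}. x (v, - ga + g))"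
  by (simp add: proj_def)
 also have "... = proj x v" by (subst sum.reindex) (auto simp: proj_def simp flip: add.assoc)
 finally show "proj (shift ga x) v = proj x v" .
qed

locale labelled =
 fixes K :: "'v::countable set set" and lam :: "'v => 'v => fgrp" and n :: nat
 assumes scK: "scomplex K" and finK: "finite K"
  and cocycle: "{u, v, w} \<in> K ==> lam u w = lam u v + lam v w"
  and lam_FG: "lam u v \<in> FG n"
begin

abbreviation Kt where "Kt \<equiv> cover n lam K"

text \<open>The lift of \<open>y\<close> for which \<open>v\<close> lies on sheet \<open>g\<close>.
  One formula serves all vertices, since those outside the support of \<open>y\<close> receive the
  coordinate 0 anyway.\<close>

definition lift_at :: "'v => fgrp => ('v => real) => 'v \<times> fgrp => real"
 where "lift_at v g y = (\<lambda>(w, h). if h = g + lam v w then y w else 0)"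

lemma lift_at_apply [simp]: "lift_at v g y (w, h) = (if h = g + lam v w then y w else 0)" by (simp add: lift_at_def)

lemma lam_trans:
 assumes "s \<in> K" "u \<in> s" "v \<in> s" "w \<in> s" shows "lam u w = lam u v + lam v w"
 using scomplexD[OF scK assms(1), of "{u, v, w}"] assms by (intro cocycle) auto

lemma lam_self: "s \<in> K ==> v \<in> s ==> lam v v = 0" using lam_trans[of s v v v] by (intro idem_zero) simp

lemma lam_sym: "s \<in> K ==> u \<in> s ==> v \<in> s ==> lam v u = - lam u v"
 using lam_trans[of s u v u] lam_self[of s u] by (metis minus_unique)

lemma scomplex_cover: "scomplex Kt" unfolding scomplex_def
proof (intro ballI conjI allI impI)
 fix s assume s: "s \<in> Kt"
 show fin: "finite s" by (rule coverD(1)[OF s])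
 show "s ~= {}" using coverD(2)[OF s] scomplex_nonempty[OF scK] by blast
 fix t assume t: "t \<subseteq> s \<and> t ~= {}"
 show "t \<in> Kt"
 proof (rule coverI)
  show "finite t" using t fin finite_subset by blast
  show "fst ` t \<in> K" using t by (intro scomplexD[OF scK coverD(2)[OF s]]) auto
 qed (use t coverD(3,4)[OF s] in blast)+
qed

lemma supp_lift_at: "supp (lift_at v g y) = (\<lambda>w. (w, g + lam v w)) ` supp y" by (auto simp: supp_def split: if_splits)

lemma realizD: "y \<in> realiz K ==> supp y \<in> K" "y \<in> realiz K ==> finite (supp y)"
 using scomplex_finite[OF scK] by (auto simp: realiz_def)

lemma lift_at_realiz:
 assumes y: "y \<in> realiz K" "y v ~= 0" and g: "g \<in> FG n"
 shows "lift_at v g y \<in> realiz Kt"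
proof -
 let ?s = "(\<lambda>w. (w, g + lam v w)) ` supp y"
 have v: "v \<in> supp y" using y by (simp add: supp_def)
 have "?s \<in> Kt"
 proof (rule coverI)
  show "fst ` ?s \<in> K" using realizD(1)[OF y(1)] by (simp add: image_image)
  fix w h assume w: "(w, h) \<in> ?s"
  hence h: "h = g + lam v w" by auto
  thus "h \<in> FG n" using FG_plus[OF g lam_FG] by simp
  fix w' h' assume w': "(w', h') \<in> ?s"
  show "h' = h + lam w w'" using lam_trans[OF realizD(1)[OF y(1)] v, of w w'] h w w' by (auto simp: add.assoc)
 qed (use realizD(2)[OF y(1)] in simp)
 moreover have "sum (lift_at v g y) ?s = 1"
 proof -
  have "sum (lift_at v g y) ?s = sum (lift_at v g y \<circ> (\<lambda>w. (w, g + lam v w))) (supp y)"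
   by (rule sum.reindex) (simp add: inj_on_def)
  also have "... = sum y (supp y)" by (rule sum.cong) auto
  finally show ?thesis using y(1) by (simp add: realiz_def)
 qed
 moreover have "0 \<le> lift_at v g y p" for p using y(1) by (cases p) (simp add: realiz_def)
 ultimately show ?thesis using y(1) by (simp add: realiz_def supp_lift_at)
qed

lemma proj_lift_at: "proj (lift_at v g y) = y" by (auto simp: proj_def)

lemma cover_pt:
 assumes "x \<in> realiz Kt" "x (v, g) ~= 0" "x (w, h) ~= 0"
 shows "h = g + lam v w" "g \<in> FG n" "\<exists>s\<in>K. v \<in> s \<and> w \<in> s"
proof -
 have s: "supp x \<in> Kt" using assms by (simp add: realiz_def)
 have i: "(v, g) \<in> supp x" "(w, h) \<in> supp x" using assms by (auto simp: supp_def)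
 show "h = g + lam v w" "g \<in> FG n" using coverD(3,4)[OF s] i by blast+
 show "\<exists>s\<in>K. v \<in> s \<and> w \<in> s" using i fst_conv imageI coverD(2)[OF s] by metis
qed

lemma proj_at:
 assumes "x \<in> realiz Kt" "x (v, g) ~= 0" shows "proj x v = x (v, g)"
proof -
 have "h = g" if "x (v, h) ~= 0" for h using cover_pt(1)[OF assms that] cover_pt(3)[OF assms that] lam_self by auto
 hence "{h. x (v, h) ~= 0} = {g}" using assms(2) by blast
 thus ?thesis by (simp add: proj_def)
qed

lemma proj_zero: "proj x v ~= 0 ==> \<exists>g. x (v, g) ~= 0" by (rule ccontr) (simp add: proj_def)

lemma eq_lift_at:
 assumes "x \<in> realiz Kt" "x (v, g) ~= 0" shows "x = lift_at v g (proj x)"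
proof
 fix p :: "'v \<times> fgrp"
 obtain w h where p: "p = (w, h)" by (cases p)
 show "x p = lift_at v g (proj x) p"
 proof (cases "x (w, h) = 0")
  case False
  thus ?thesis using cover_pt(1)[OF assms False] proj_at[OF assms(1) False] p by simp
 next
  case True
  have "proj x w = 0" if "h = g + lam v w"
  proof (rule ccontr)
   assume "proj x w ~= 0"
   then obtain h' where h': "x (w, h') ~= 0" using proj_zero[of x w] by blast
   hence "h' = h" using cover_pt(1)[OF assms h'] that by simp
   with h' True show False by simp
  qed
  thus ?thesis using True p by simp
 qed
qed

lemma cover_pt_ex:
 assumes "x \<in> realiz Kt" obtains v g where "x (v, g) ~= 0" "g \<in> FG n" "proj x v ~= 0"
using assms scomplex_nonempty[OF scomplex_cover] that cover_pt(2) proj_at by (fastforce simp: realiz_def supp_def)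

lemma proj_realiz:
 assumes x: "x \<in> realiz Kt" shows "proj x \<in> realiz K"
proof -
 have s: "supp x \<in> Kt" using x by (simp add: realiz_def)
 have eq: "supp (proj x) = fst ` supp x"
 proof
  show "supp (proj x) \<subseteq> fst ` supp x"
  proof
   fix v assume "v \<in> supp (proj x)"
   then obtain g where "(v, g) \<in> supp x" using proj_zero[of x v] by (auto simp: supp_def)
   thus "v \<in> fst ` supp x" by (metis fst_conv imageI)
  qed
  show "fst ` supp x \<subseteq> supp (proj x)" using proj_at[OF x] by (auto simp: supp_def)
 qed
 have inj: "inj_on fst (supp x)"
 proof (rule inj_onI)
  fix p q assume pq: "p \<in> supp x" "q \<in> supp x" "fst p = fst q"
  have "x (fst p, snd q) ~= 0" using pq(2) unfolding pq(3) by (simp add: supp_def)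
  hence "snd q = snd p" using cover_pt(1,3)[OF x, of "fst p" "snd p" "fst p" "snd q"] lam_self pq(1) by (auto simp: supp_def)
  thus "p = q" using pq by (simp add: prod_eq_iff)
 qed
 have "sum (proj x) (fst ` supp x) = sum x (supp x)"
  using proj_at[OF x] by (subst sum.reindex[OF inj]) (auto simp: supp_def intro!: sum.cong)
 moreover have "0 \<le> proj x v" for v unfolding proj_def using x by (intro sum_nonneg) (simp add: realiz_def)
 ultimately show ?thesis using x coverD(2)[OF s] by (simp add: realiz_def eq)
qed

lemma lift_at_change:
 assumes "y \<in> realiz K" "y v ~= 0" "y w ~= 0"
 shows "lift_at w (g + lam v w) y = lift_at v g y"
proof
 fix p :: "'v \<times> fgrp"
 obtain u h where p: "p = (u, h)" by (cases p)
 show "lift_at w (g + lam v w) y p = lift_at v g y p"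
 proof (cases "y u = 0")
  case False
  hence "lam v u = lam v w + lam w u" using assms realizD(1)[OF assms(1)] by (intro lam_trans) (auto simp: supp_def)
  thus ?thesis by (simp add: p add.assoc)
 qed (simp add: p)
qed

lemma shift_lift_at: "shift ga (lift_at v g y) = lift_at v (ga + g) y"
proof
 fix p :: "'v \<times> fgrp"
 obtain u h where p: "p = (u, h)" by (cases p)
 have "- ga + h = g + lam v u \<longleftrightarrow> h = ga + g + lam v u" by (metis add.assoc add_minus_cancel)
 thus "shift ga (lift_at v g y) p = lift_at v (ga + g) y p" by (simp add: p)
qed

lemma shift_realiz:
 assumes "x \<in> realiz Kt" "ga \<in> FG n" shows "shift ga x \<in> realiz Kt"
proof -
 obtain v g where vg: "x (v, g) ~= 0" "g \<in> FG n" "proj x v ~= 0" using cover_pt_ex[OF assms(1)] .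
 show ?thesis using lift_at_realiz[OF proj_realiz[OF assms(1)] vg(3)] FG_plus[OF assms(2) vg(2)] eq_lift_at[OF assms(1) vg(1)] shift_lift_at by metis
qed

lemma continuous_on_lift_at: "continuous_on S F ==> continuous_on S (\<lambda>x. lift_at v g (F x))"
proof (rule continuous_on_coordinatewise_then_product)
 fix p :: "'v \<times> fgrp"
 assume "continuous_on S F"
 hence "continuous_on S (\<lambda>x. F x (fst p))" by (rule continuous_on_product_then_coordinatewise)
 thus "continuous_on S (\<lambda>x. lift_at v g (F x) p)"
  by (cases "snd p = g + lam v (fst p)") (simp_all add: lift_at_def case_prod_beta)
qed

subsection \<open>Lifting maps\<close>

text \<open>The lift of \<open>y\<close> that shares a vertex with \<open>xx\<close>.\<close>

definition transport :: "('v \<times> fgrp => real) => ('v => real) => 'v \<times> fgrp => real"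
 where "transport xx y = (let p = SOME p. xx p ~= 0 \<and> y (fst p) ~= 0 in lift_at (fst p) (snd p) y)"

lemma transport_eq:
 assumes "xx \<in> realiz Kt" "y \<in> realiz K" "xx (v, g) ~= 0" "y v ~= 0"
 shows "transport xx y = lift_at v g y"
proof -
 define p where "p = (SOME p. xx p ~= 0 \<and> y (fst p) ~= 0)"
 have "\<exists>p. xx p ~= 0 \<and> y (fst p) ~= 0" using assms by (intro exI[of _ "(v, g)"]) simp
 from someI_ex[OF this] have p: "xx p ~= 0" "y (fst p) ~= 0" by (auto simp: p_def)
 thus ?thesis using lift_at_change[OF assms(2,4) p(2), of g] cover_pt(1)[OF assms(1,3), of "fst p" "snd p"] by (simp add: transport_def p_def[symmetric])
qed

lemma transport_lift:
 assumes "xx \<in> realiz Kt" "y \<in> realiz K" "\<exists>v. proj xx v ~= 0 \<and> y v ~= 0"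
 shows "transport xx y \<in> realiz Kt" "proj (transport xx y) = y"
proof -
 obtain v where v: "proj xx v ~= 0" "y v ~= 0" using assms(3) by blast
 obtain g where "xx (v, g) ~= 0" using proj_zero[OF v(1)] by blast
 hence vg: "xx (v, g) ~= 0" "y v ~= 0" using v by auto
 have "g \<in> FG n" using cover_pt(2)[OF assms(1) vg(1) vg(1)] .
 thus "transport xx y \<in> realiz Kt" "proj (transport xx y) = y"
  using transport_eq[OF assms(1,2) vg] lift_at_realiz[OF assms(2) vg(2)] by (simp_all add: proj_lift_at)
qed

lemma eventually_nonzero:
 fixes G :: "'p::topological_space => 'a => real"
 assumes "continuous_on S G" "x \<in> S" "G x p ~= 0"
 shows "\<forall>\<^sub>F z in at x within S. G z p ~= 0"
using continuous_on_product_then_coordinatewise[OF assms(1)] assms(2) assms(3) tendsto_imp_eventually_ne by (metis continuous_on_def)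

text \<open>Near a given point one shared vertex with its sheet stays shared, so the transport is
  there \<open>lift_at\<close> with constant \<open>v\<close> and \<open>g\<close>.\<close>

lemma continuous_on_transport:
 fixes G :: "'p::topological_space => 'v \<times> fgrp => real"
 assumes G: "continuous_on S G" "!!x. x \<in> S ==> G x \<in> realiz Kt"
  and F: "continuous_on S F" "!!x. x \<in> S ==> F x \<in> realiz K"
  and near: "!!x. x \<in> S ==> \<exists>v. proj (G x) v ~= 0 \<and> F x v ~= 0"
 shows "continuous_on S (\<lambda>x. transport (G x) (F x))" unfolding continuous_on_def
proof
 fix x assume x: "x \<in> S"
 obtain v where v: "proj (G x) v ~= 0" "F x v ~= 0" using near[OF x] by blast
 obtain g where "G x (v, g) ~= 0" using proj_zero[OF v(1)] by blast
 hence vg: "G x (v, g) ~= 0" "F x v ~= 0" using v by auto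
 have "((\<lambda>z. lift_at v g (F z)) \<longlongrightarrow> lift_at v g (F x)) (at x within S)"
  using continuous_on_lift_at[OF F(1)] x by (simp add: continuous_on_def)
 moreover have "\<forall>\<^sub>F z in at x within S. lift_at v g (F z) = transport (G z) (F z)"
 proof -
  have "\<forall>\<^sub>F z in at x within S. z \<in> S" by (simp add: eventually_at_filter)
  thus ?thesis using eventually_nonzero[OF G(1) x vg(1)] eventually_nonzero[OF F(1) x vg(2)]
   by eventually_elim (use transport_eq G(2) F(2) in auto)
 qed
 ultimately show "((\<lambda>x. transport (G x) (F x)) \<longlongrightarrow> transport (G x) (F x)) (at x within S)"
  using transport_eq[OF G(2)[OF x] F(2)[OF x] vg] by (simp add: Lim_transform_eventually)
qed

text \<open>Whether two lifts of the same point agree is decided by the sheet over a single vertex,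
  and that sheet is locally constant; so agreement and disagreement are both open
  conditions.\<close>

lemma lift_unique:
 fixes G G' :: "'p::topological_space => 'v \<times> fgrp => real"
 assumes S: "connected S" and G: "continuous_on S G" "!!x. x \<in> S ==> G x \<in> realiz Kt"
  and G': "continuous_on S G'" "!!x. x \<in> S ==> G' x \<in> realiz Kt"
  and eq: "!!x. x \<in> S ==> proj (G x) = proj (G' x)"
  and x0: "x0 \<in> S" "G x0 = G' x0" and x: "x \<in> S"
 shows "G x = G' x"
proof -
 have loc: "\<forall>\<^sub>F z in at x within S. G z = G' z \<longleftrightarrow> G x = G' x" if x: "x \<in> S" for x
 proof -
  obtain v g where vg: "G x (v, g) ~= 0" "g \<in> FG n" "proj (G x) v ~= 0" using cover_pt_ex[OF G(2)[OF x]] .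
  then obtain g' where g': "G' x (v, g') ~= 0" using proj_zero eq[OF x] by metis
  have *: "G z = G' z \<longleftrightarrow> g = g'" if z: "z \<in> S" "G z (v, g) ~= 0" "G' z (v, g') ~= 0" for z
  proof
   assume "g = g'"
   thus "G z = G' z" using eq_lift_at[OF G(2)[OF z(1)] z(2)] eq_lift_at[OF G'(2)[OF z(1)] z(3)] eq[OF z(1)] by simp
  next
   assume "G z = G' z"
   hence "G z (v, g') ~= 0" using z(3) by simp
   from cover_pt(1,3)[OF G(2)[OF z(1)] z(2) this] lam_self show "g = g'" by auto
  qed
  have "\<forall>\<^sub>F z in at x within S. z \<in> S" by (simp add: eventually_at_filter)
  thus ?thesis using eventually_nonzero[OF G(1) x vg(1)] eventually_nonzero[OF G'(1) x g']
   by eventually_elim (use * x vg(1) g' in auto)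
 qed
 have op: "openin (top_of_set S) {x \<in> S. Q (G x = G' x)}" for Q
 proof (subst openin_subopen, intro ballI)
  fix x assume "x \<in> {x \<in> S. Q (G x = G' x)}"
  hence x: "x \<in> S" "Q (G x = G' x)" by auto
  obtain T where "open T" "x \<in> T" "\<forall>z\<in>T. z ~= x --> z \<in> S --> (G z = G' z \<longleftrightarrow> G x = G' x)"
   using loc[OF x(1)] unfolding eventually_at_topological by blast
  thus "\<exists>T. openin (top_of_set S) T \<and> x \<in> T \<and> T \<subseteq> {x \<in> S. Q (G x = G' x)}"
   using x by (intro exI[of _ "S \<inter> T"]) (auto intro: openin_open_Int)
 qed
 let ?E = "{x \<in> S. G x = G' x}" and ?N = "{x \<in> S. G x ~= G' x}"
 have "openin (top_of_set S) ?E" "openin (top_of_set S) ?N" using op[of "\<lambda>b. b"] op[of Not] by auto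
 moreover have "S \<subseteq> ?E \<union> ?N" "?E \<inter> ?N = {}" "?E ~= {}" using x0 by auto
 ultimately have "?N = {}" using S unfolding connected_openin by (metis (no_types, lifting))
 thus ?thesis using x by auto
qed

text \<open>A Lebesgue number argument in barycentric coordinates. As they sum to 1, one of them is
  at least \<open>ep\<close>, the reciprocal of one more than the number of vertices, and uniform
  continuity keeps this coordinate positive for a short time.\<close>

lemma lift_step:
 fixes P :: "'p::metric_space set"
 assumes P: "compact P" and H: "continuous_on (P \<times> {0..1::real}) H" and HK: "!!x t. x \<in> P ==> t \<in> {0..1} ==> H (x, t) \<in> realiz K"
 obtains m where "m > 0" "!!x s t. x \<in> P ==> s \<in> {0..1} ==> t \<in> {0..1} ==> \<bar>s - t\<bar> \<le> 1 / real m ==> \<exists>v. H (x, s) v ~= 0 \<and> H (x, t) v ~= 0"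
proof -
 let ?V = "\<Union>K"
 have fV: "finite ?V" using finK scomplex_finite[OF scK] by auto
 define ep where "ep = 1 / (real (card ?V) + 1)"
 have ep: "ep > 0" by (simp add: ep_def)
 have "\<exists>de>0. \<forall>p\<in>P \<times> {0..1}. \<forall>q\<in>P \<times> {0..1}. dist q p < de --> dist (H q v) (H p v) < ep" for v
 proof -
  have "uniformly_continuous_on (P \<times> {0..1}) (\<lambda>p. H p v)"
   by (intro compact_uniformly_continuous continuous_on_product_then_coordinatewise[OF H] compact_Times P) simp
  thus ?thesis using ep unfolding uniformly_continuous_on_def by blast
 qed
 then obtain de where de: "!!v. de v > 0" "!!v p q. p \<in> P \<times> {0..1} ==> q \<in> P \<times> {0..1} ==> dist q p < de v ==> dist (H q v) (H p v) < ep"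
  by metis
 define d where "d = Min (insert 1 (de ` ?V))"
 have d: "d > 0" "!!v. v \<in> ?V ==> d \<le> de v" unfolding d_def using fV de(1) by auto
 obtain m0 where m0: "inverse (real (Suc m0)) < d" using reals_Archimedean[OF d(1)] by blast
 show thesis
 proof (rule that[of "Suc m0"])
  fix x s t assume x: "x \<in> P" and s: "s \<in> {0..1::real}" and t: "t \<in> {0..1::real}" and st: "\<bar>s - t\<bar> \<le> 1 / real (Suc m0)"
  have y: "H (x, s) \<in> realiz K" by (rule HK[OF x s])
  have "\<exists>v\<in>?V. H (x, s) v \<ge> ep"
  proof (rule ccontr)
   assume "\<not> ?thesis"
   hence "sum (H (x, s)) ?V \<le> (\<Sum>v\<in>?V. ep)" by (intro sum_mono) (auto simp: not_le intro: less_imp_le)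
   also have "... < 1" by (simp add: ep_def)
   finally show False using realiz_sum[OF y fV] realizD(1)[OF y] by auto
  qed
  then obtain v where v: "v \<in> ?V" "H (x, s) v \<ge> ep" by blast
  have "dist (x, t) (x, s) < de v" using d(2)[OF v(1)] st m0 by (simp add: dist_Pair_Pair dist_real_def inverse_eq_divide)
  hence "dist (H (x, t) v) (H (x, s) v) < ep" using x s t by (intro de(2)) auto
  hence "H (x, t) v ~= 0" using v(2) by auto
  moreover have "H (x, s) v ~= 0" using v(2) ep by auto
  ultimately show "\<exists>v. H (x, s) v ~= 0 \<and> H (x, t) v ~= 0" by blast
 qed simp
qed

text \<open>Extending over the cylinder contracts \<open>P\<close> inside itself to
  \<open>x0\<close>. At the constant end the map obviously lifts, and \<open>transport\<close>
  carries the lift to the other end in \<open>m\<close> short steps.\<close>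

lemma lift_exists:
 fixes P :: "'p::{metric_space,second_countable_topology} set"
 assumes P: "compact P" "AEx TYPE('p \<times> real) P"
  and F: "continuous_on P F" "!!x. x \<in> P ==> F x \<in> realiz K"
 obtains G where "continuous_on P G" "\<forall>x\<in>P. G x \<in> realiz Kt \<and> proj (G x) = F x"
proof -
 obtain x0 where x0: "x0 \<in> P" using P by (auto simp: AEx_def)
 have cP: "closed P" using P compact_imp_closed by blast
 define f where "f p = (if snd p = (0::real) then x0 else fst p)" for p :: "'p \<times> real"
 have "continuous_on (P \<times> {0} \<union> P \<times> {1}) f"
  unfolding f_def using cP by (intro continuous_on_cases closed_Times) (auto intro!: continuous_intros)
 moreover have "closed (P \<times> {0} \<union> P \<times> {1::real})" using cP by (intro closed_Un closed_Times) auto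
 moreover have "f ` (P \<times> {0} \<union> P \<times> {1}) \<subseteq> P" using x0 by (auto simp: f_def)
 ultimately obtain H0 where H0: "continuous_on UNIV H0" "range H0 \<subseteq> P" "\<forall>p\<in>P \<times> {0} \<union> P \<times> {1}. H0 p = f p"
  using AExE[OF P(2)] by metis
 define H where "H p = F (H0 p)" for p
 have H: "continuous_on (P \<times> {0..1}) H"
  unfolding H_def using H0 by (intro continuous_on_compose2[OF F(1)] continuous_on_subset[OF H0(1)]) auto
 have HK: "H p \<in> realiz K" for p unfolding H_def using H0(2) F(2) by auto
 have Hx: "H (x, 0) = F x0" "H (x, 1) = F x" if "x \<in> P" for x using H0(3) that by (auto simp: H_def f_def)
 obtain m where m: "m > 0" "!!x s t. x \<in> P ==> s \<in> {0..1} ==> t \<in> {0..1} ==> \<bar>s - t\<bar> \<le> 1 / real m ==> \<exists>v. H (x, s) v ~= 0 \<and> H (x, t) v ~= 0"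
  using lift_step[OF P(1) H HK] by blast
 have "j \<le> m ==> \<exists>G. continuous_on P G \<and> (\<forall>x\<in>P. G x \<in> realiz Kt \<and> proj (G x) = H (x, real j / real m))" for j
 proof (induction j)
  case 0
  obtain v where v: "F x0 v ~= 0" using realizD(1)[OF F(2)[OF x0]] scomplex_nonempty[OF scK] by (auto simp: supp_def)
  show ?case using lift_at_realiz[OF F(2)[OF x0] v FG_zero] Hx(1)
   by (intro exI[of _ "\<lambda>_. lift_at v 0 (F x0)"]) (simp add: proj_lift_at)
 next
  case (Suc j)
  then obtain G where G: "continuous_on P G" "\<forall>x\<in>P. G x \<in> realiz Kt \<and> proj (G x) = H (x, real j / real m)" by auto
  have near: "\<exists>v. proj (G x) v ~= 0 \<and> H (x, real (Suc j) / real m) v ~= 0" if "x \<in> P" for x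
   using G(2) that Suc.prems m(2)[OF that, of "real j / real m" "real (Suc j) / real m"] by (simp flip: diff_divide_distrib)
  have c: "continuous_on P (\<lambda>x. H (x, real (Suc j) / real m))"
   using Suc.prems m(1) by (intro continuous_on_compose2[OF H]) (auto intro!: continuous_intros simp: divide_le_eq_1)
  show ?case using continuous_on_transport[OF G(1) _ c HK near] G(2) transport_lift[OF _ HK near] by auto
 qed
 from this[of m] obtain G where "continuous_on P G" "\<forall>x\<in>P. G x \<in> realiz Kt \<and> proj (G x) = H (x, 1)"
  using m(1) by auto
 thus thesis using that[of G] Hx(2) by simp
qed

end

section \<open>Contractible pieces of the covering complex\<close>

lemma AEx_fst:
 assumes "AEx TYPE('a::{metric_space,second_countable_topology} \<times> 'b::{metric_space,second_countable_topology}) P"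
 shows "AEx TYPE('a) P" unfolding AEx_def
proof (intro conjI allI impI)
 show "P ~= {}" using assms by (simp add: AEx_def)
 fix A and f :: "'a => 'c" assume A: "closed A \<and> continuous_on A f \<and> f ` A \<subseteq> P"
 obtain b :: 'b where True by blast
 have "continuous_on (A \<times> {b}) (\<lambda>p. f (fst p))"
  using A by (intro continuous_on_compose2[of A f _ fst] continuous_on_fst continuous_on_id) auto
 moreover have "closed (A \<times> {b})" using A by (intro closed_Times) auto
 moreover have "(\<lambda>p. f (fst p)) ` (A \<times> {b}) \<subseteq> P" using A by auto
 ultimately obtain g where g: "continuous_on UNIV g" "range g \<subseteq> P" "\<forall>p\<in>A \<times> {b}. g p = f (fst p)"
  using AExE[OF assms] by metis
 have "continuous_on UNIV (\<lambda>x. g (x, b))" by (rule continuous_on_compose2[OF g(1)]) (auto intro!: continuous_intros)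
 thus "\<exists>g. continuous_on UNIV g \<and> range g \<subseteq> P \<and> (\<forall>x\<in>A. g x = f x)"
  using g(2,3) by (intro exI[of _ "\<lambda>x. g (x, b)"]) auto
qed

lemma AEx_snd:
 assumes "AEx TYPE('a::{metric_space,second_countable_topology} \<times> 'b::{metric_space,second_countable_topology}) P"
 shows "AEx TYPE('b) P" unfolding AEx_def
proof (intro conjI allI impI)
 show "P ~= {}" using assms by (simp add: AEx_def)
 fix A and f :: "'b => 'c" assume A: "closed A \<and> continuous_on A f \<and> f ` A \<subseteq> P"
 obtain b :: 'a where True by blast
 have "continuous_on ({b} \<times> A) (\<lambda>p. f (snd p))"
  using A by (intro continuous_on_compose2[of A f _ snd] continuous_on_snd continuous_on_id) auto
 moreover have "closed ({b} \<times> A)" using A by (intro closed_Times) auto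
 moreover have "(\<lambda>p. f (snd p)) ` ({b} \<times> A) \<subseteq> P" using A by auto
 ultimately obtain g where g: "continuous_on UNIV g" "range g \<subseteq> P" "\<forall>p\<in>{b} \<times> A. g p = f (snd p)"
  using AExE[OF assms] by metis
 have "continuous_on UNIV (\<lambda>x. g (b, x))" by (rule continuous_on_compose2[OF g(1)]) (auto intro!: continuous_intros)
 thus "\<exists>g. continuous_on UNIV g \<and> range g \<subseteq> P \<and> (\<forall>x\<in>A. g x = f x)"
  using g(2,3) by (intro exI[of _ "\<lambda>x. g (b, x)"]) auto
qed

text \<open>Elementary expansions, the inverses of collapses: \<open>{a, b}\<close> is the free edge
  of the new triangle.\<close>

inductive expands :: "'v set set => 'v set set => bool" for K0 where
 base: "expands K0 K0"
| step: "expands K0 K ==> {a, c} \<in> K ==> {c, b} \<in> K ==> {a, b} \<notin> K ==> a ~= b ==> b ~= c ==> a ~= c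
  ==> expands K0 (insert {a, b} (insert {a, b, c} K))"

text \<open>The vertex sets of subtrees of the Cayley tree that contain the identity.\<close>

definition pclosed :: "fgrp set => bool"
 where "pclosed W \<longleftrightarrow> 0 \<in> W \<and> (\<forall>x\<in>W. \<forall>y. prefix (word y) (word x) --> y \<in> W)"

definition tshift :: "fgrp => ('v \<times> fgrp) set => ('v \<times> fgrp) set"
 where "tshift ga s = (\<lambda>(v, g). (v, ga + g)) ` s"

lemma expands_scomplex:
 assumes "expands K0 K" "scomplex K0" shows "scomplex K \<and> K0 \<subseteq> K" using assms
proof (induction rule: expands.induct)
 case (step K a c b)
 hence K: "scomplex K" "K0 \<subseteq> K" by auto
 have sub: "t = {a} \<or> t = {b} \<or> t = {c} \<or> t = {a,b} \<or> t = {a,c} \<or> t = {c,b} \<or> t = {a,b,c}" if "t \<subseteq> {a,b,c}" "t ~= {}" for t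
 proof -
  have "t \<in> Pow {a, b, c}" using that(1) by simp
  thus ?thesis using that(2) unfolding Pow_insert Pow_empty by auto
 qed
 show ?case unfolding scomplex_def
 proof (intro conjI ballI allI impI)
  fix s t assume s: "s \<in> insert {a, b} (insert {a, b, c} K)" and t: "t \<subseteq> s \<and> t ~= {}"
  show "t \<in> insert {a, b} (insert {a, b, c} K)"
  proof (cases "s \<in> K")
   case True
   thus ?thesis using scomplexD[OF K(1) True] t by blast
  next
   case False
   thus ?thesis using sub[of t] t step.hyps s scomplexD[OF K(1) \<open>{a, c} \<in> K\<close>] scomplexD[OF K(1) \<open>{c, b} \<in> K\<close>] by auto
  qed
 next
  fix s assume "s \<in> insert {a, b} (insert {a, b, c} K)"
  thus "finite s" "s ~= {}" using scomplex_finite[OF K(1)] scomplex_nonempty[OF K(1)] by auto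
 qed (use K in auto)
qed auto

lemma faces_subset: "scomplex K ==> s \<in> K ==> faces s \<subseteq> K" unfolding scomplex_def faces_def by blast

context labelled
begin

definition lf :: "'v => fgrp => 'v set => ('v \<times> fgrp) set"
 where "lf v g t = (\<lambda>w. (w, g + lam v w)) ` t"

lemma cover_eq_lf:
 assumes "s \<in> cover n lam K1" "(v, g) \<in> s" shows "s = lf v g (fst ` s)"
proof -
 have "h = g + lam v w" if "(w, h) \<in> s" for w h using coverD(4)[OF assms that] .
 thus ?thesis unfolding lf_def by force
qed

lemma lf_cover:
 assumes "K1 \<subseteq> K" "t \<in> K1" "v \<in> t" "g \<in> FG n" shows "lf v g t \<in> cover n lam K1"
proof (rule coverI)
 have tK: "t \<in> K" using assms by auto
 show "finite (lf v g t)" using scomplex_finite[OF scK tK] by (simp add: lf_def)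
 show "fst ` lf v g t \<in> K1" using assms by (simp add: lf_def image_image)
 fix w h assume w: "(w, h) \<in> lf v g t"
 hence h: "h = g + lam v w" "w \<in> t" by (auto simp: lf_def)
 thus "h \<in> FG n" using FG_plus[OF assms(4) lam_FG] by simp
 fix w' h' assume "(w', h') \<in> lf v g t"
 thus "h' = h + lam w w'" using lam_trans[OF tK assms(3), of w w'] h by (auto simp: add.assoc lf_def)
qed

lemma scomplex_cover_sub:
 assumes "scomplex K1" shows "scomplex (cover n lam K1)" unfolding scomplex_def
proof (intro ballI conjI allI impI)
 fix s assume s: "s \<in> cover n lam K1"
 show fin: "finite s" by (rule coverD(1)[OF s])
 show "s ~= {}" using coverD(2)[OF s] scomplex_nonempty[OF assms] by blast
 fix t assume t: "t \<subseteq> s \<and> t ~= {}"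
 show "t \<in> cover n lam K1"
 proof (rule coverI)
  show "finite t" using t fin finite_subset by blast
  show "fst ` t \<in> K1" using t by (intro scomplexD[OF assms coverD(2)[OF s]]) auto
 qed (use t coverD(3,4)[OF s] in blast)+
qed

lemma cover_mono: "K1 \<subseteq> K2 ==> cover n lam K1 \<subseteq> cover n lam K2"
 by (rule subsetI, rule coverI) (auto dest: coverD)

abbreviation AEp :: "('v \<times> fgrp) set set => bool"
 where "AEp P \<equiv> AEx TYPE(('v \<times> fgrp => real) \<times> real) (realiz P)"

lemma AEp_faces: "finite s ==> s ~= {} ==> AEp (faces s)" by (rule AEx_simplex)

lemma scomplex_UN: "(!!i. i \<in> I ==> scomplex (F i)) ==> scomplex (\<Union>i\<in>I. F i)" unfolding scomplex_def by blast

lemma faces_Int: "faces s \<inter> faces t = faces (s \<inter> t)" by (auto simp: faces_def)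

lemma faces_pair: "faces {p, q} = {{p}, {q}, {p, q}}"
proof -
 have "t \<in> {{p}, {q}, {p, q}}" if "t \<subseteq> {p, q}" "t ~= {}" for t
  using that by (cases "p \<in> t"; cases "q \<in> t"; blast)
 thus ?thesis unfolding faces_def by blast
qed

text \<open>\<open>P W\<close> is a contractible piece of the cover on the sheets in
  \<open>W\<close>. All simplices on these sheets together would not do: an edge created by an
  expansion may have both ends on sheets in \<open>W\<close> while the triangle which it bounds has
  not, and then it closes a loop. The clause with the radius \<open>r\<close> says that only
  simplices near the rim of \<open>W\<close> are left out.\<close>

definition family :: "'v set set => 'v set set => (fgrp set => ('v \<times> fgrp) set set) => bool"
 where "family K0 K1 P \<longleftrightarrow>
  (\<forall>W. P W \<subseteq> cover n lam K1 \<and> scomplex (P W) \<and> (\<forall>s\<in>P W. snd ` s \<subseteq> W)) \<and>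
  (\<forall>W W'. W \<subseteq> W' --> P W \<subseteq> P W') \<and>
  (\<forall>ga\<in>FG n. \<forall>W. \<forall>s\<in>P W. tshift ga s \<in> P ((+) ga ` W)) \<and>
  (\<forall>W. finite W \<and> pclosed W \<and> W \<subseteq> FG n --> AEp (P W)) \<and>
  (\<exists>r. \<forall>W. \<forall>s\<in>cover n lam K1. \<forall>v g. (v, g) \<in> s \<and> (\<forall>h\<in>FG n. len (- g + h) \<le> r --> h \<in> W) --> s \<in> P W) \<and>
  (\<forall>W. \<forall>s\<in>cover n lam K0. snd ` s \<subseteq> W --> s \<in> P W)"

lemma familyD:
 assumes "family K0 K1 P"
 shows "P W \<subseteq> cover n lam K1" "scomplex (P W)" "s \<in> P W ==> snd ` s \<subseteq> W"
  "W \<subseteq> W' ==> P W \<subseteq> P W'" "ga \<in> FG n ==> s \<in> P W ==> tshift ga s \<in> P ((+) ga ` W)"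
  "finite W ==> pclosed W ==> W \<subseteq> FG n ==> AEp (P W)"
  "\<exists>r. \<forall>W. \<forall>s\<in>cover n lam K1. \<forall>v g. (v, g) \<in> s \<and> (\<forall>h\<in>FG n. len (- g + h) \<le> r --> h \<in> W) --> s \<in> P W"
  "s \<in> cover n lam K0 ==> snd ` s \<subseteq> W ==> s \<in> P W"
proof -
 from assms have f1: "\<forall>W. P W \<subseteq> cover n lam K1 \<and> scomplex (P W) \<and> (\<forall>s\<in>P W. snd ` s \<subseteq> W)"
  unfolding family_def by (elim conjE)
 thus "P W \<subseteq> cover n lam K1" "scomplex (P W)" "s \<in> P W ==> snd ` s \<subseteq> W" by simp_all
 from assms have f2: "\<forall>W W'. W \<subseteq> W' --> P W \<subseteq> P W'" unfolding family_def by (elim conjE)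
 thus "W \<subseteq> W' ==> P W \<subseteq> P W'" by simp
 from assms have f3: "\<forall>ga\<in>FG n. \<forall>W. \<forall>s\<in>P W. tshift ga s \<in> P ((+) ga ` W)"
  unfolding family_def by (elim conjE)
 thus "ga \<in> FG n ==> s \<in> P W ==> tshift ga s \<in> P ((+) ga ` W)" by simp
 from assms have f4: "\<forall>W. finite W \<and> pclosed W \<and> W \<subseteq> FG n --> AEp (P W)"
  unfolding family_def by (elim conjE)
 thus "finite W ==> pclosed W ==> W \<subseteq> FG n ==> AEp (P W)" by simp
 from assms show "\<exists>r. \<forall>W. \<forall>s\<in>cover n lam K1. \<forall>v g. (v, g) \<in> s \<and> (\<forall>h\<in>FG n. len (- g + h) \<le> r --> h \<in> W) --> s \<in> P W"
  unfolding family_def by (elim conjE)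
 from assms have f6: "\<forall>W. \<forall>s\<in>cover n lam K0. snd ` s \<subseteq> W --> s \<in> P W"
  unfolding family_def by (elim conjE)
 thus "s \<in> cover n lam K0 ==> snd ` s \<subseteq> W ==> s \<in> P W" by simp
qed

lemma family_finite:
 assumes "family K0 K1 P" "K1 \<subseteq> K" "finite W" shows "finite (P W)"
proof (rule finite_subset)
 show "P W \<subseteq> Pow (\<Union>K \<times> W)"
 proof
  fix s assume s: "s \<in> P W"
  have "snd ` s \<subseteq> W" using familyD(3)[OF assms(1) s] .
  moreover have "fst ` s \<in> K" using coverD(2)[of s n lam K1] assms(2) familyD(1)[OF assms(1), of W] s by auto
  ultimately show "s \<in> Pow (\<Union>K \<times> W)" unfolding mem_Times_iff Pow_iff subset_iff by blast
 qed
 show "finite (Pow (\<Union>K \<times> W))" using assms(3) finK scomplex_finite[OF scK] by simp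
qed

text \<open>The lifted triangle \<open>T g\<close> is added, together with its free edge, exactly
  when both its old edges are already present. It then meets the rest in an arc, which is an
  absolute extensor, and gluing applies.\<close>

lemma family_step:
 assumes P: "family K0 K1 P" and K1: "scomplex K1" and sub: "insert {a, b} (insert {a, b, c} K1) \<subseteq> K"
  and e: "{a, c} \<in> K1" "{c, b} \<in> K1" "{a, b} \<notin> K1" "a ~= b" "b ~= c" "a ~= c"
 shows "\<exists>P'. family K0 (insert {a, b} (insert {a, b, c} K1)) P'"
proof -
 let ?K2 = "insert {a, b} (insert {a, b, c} K1)"
 have K1K: "K1 \<subseteq> K" using sub by auto
 have K2: "scomplex ?K2" using expands_scomplex[OF expands.step[OF expands.base e], OF K1] by simp
 define A where "A g = (a, g + lam c a)" for g
 define B where "B g = (b, g + lam c b)" for g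
 define T where "T g = {A g, B g, (c, g)}" for g
 define G where "G W = {g \<in> FG n. {A g, (c, g)} \<in> P W \<and> {(c, g), B g} \<in> P W}" for W
 define P' where "P' W = P W \<union> (\<Union>g\<in>G W. faces (T g))" for W
 have abcK: "{a, b, c} \<in> K" using sub by auto
 have lcc: "lam c c = 0" using lam_self[OF abcK] by simp
 have T_lf: "T g = lf c g {a, b, c}" for g using lcc by (auto simp: T_def lf_def A_def B_def)
 have Tcov: "T g \<in> cover n lam ?K2" if "g \<in> FG n" for g unfolding T_lf using that sub by (intro lf_cover) auto
 have fT: "finite (T g)" for g by (simp add: T_def)
 have AB: "A g ~= B h" "A g ~= (c, h)" "B g ~= (c, h)" for g h using e by (auto simp: A_def B_def)
 have snd_T: "snd ` T g \<subseteq> W" if "g \<in> G W" for g W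
 proof -
  have 1: "{A g, (c, g)} \<in> P W" "{(c, g), B g} \<in> P W" using that by (simp_all add: G_def)
  show ?thesis using familyD(3)[OF P 1(1)] familyD(3)[OF P 1(2)] by (simp add: T_def)
 qed
 have faces_sub: "t \<in> faces s ==> snd ` s \<subseteq> W ==> snd ` t \<subseteq> W" for s t :: "('v \<times> fgrp) set" and W
  by (auto simp: faces_def)
 have 1: "P' W \<subseteq> cover n lam ?K2" for W
 proof -
  have "faces (T g) \<subseteq> cover n lam ?K2" if "g \<in> G W" for g
   using scomplexD[OF scomplex_cover_sub[OF K2] Tcov[of g]] that by (auto simp: faces_def G_def)
  thus ?thesis unfolding P'_def using familyD(1)[OF P, of W] cover_mono[of K1 ?K2] by blast
 qed
 have 2: "scomplex (P' W)" for W unfolding P'_def by (intro scomplex_Un scomplex_UN familyD(2)[OF P] scomplex_faces fT)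
 have 3: "snd ` s \<subseteq> W" if sW: "s \<in> P' W" for s W
 proof (cases "s \<in> P W")
  case False
  thus ?thesis using faces_sub[OF _ snd_T] sW by (fastforce simp: P'_def)
 qed (use familyD(3)[OF P] in blast)
 have Gm: "G W \<subseteq> G W'" if "W \<subseteq> W'" for W W' using familyD(4)[OF P that] by (auto simp: G_def)
 have 4: "P' W \<subseteq> P' W'" if "W \<subseteq> W'" for W W' using familyD(4)[OF P that] Gm[OF that] unfolding P'_def by blast
 have 5: "tshift ga s \<in> P' ((+) ga ` W)" if ga: "ga \<in> FG n" and s: "s \<in> P' W" for ga W s
 proof (cases "s \<in> P W")
  case True
  thus ?thesis using familyD(5)[OF P ga, of s W] by (simp add: P'_def)
 next
  case False
  then obtain g where g: "g \<in> G W" "s \<in> faces (T g)" using s unfolding P'_def by blast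
  have "ga + g \<in> G ((+) ga ` W)" using g(1) FG_plus[OF ga] familyD(5)[OF P ga] by (fastforce simp: G_def A_def B_def add.assoc tshift_def case_prod_beta)
  moreover have "tshift ga s \<in> faces (T (ga + g))"
  proof -
   have "tshift ga s \<subseteq> tshift ga (T g)" "tshift ga s ~= {}"
    using g(2) unfolding faces_def tshift_def by (blast intro: image_mono)+
   thus ?thesis by (simp add: faces_def tshift_def T_def A_def B_def add.assoc)
  qed
  ultimately show ?thesis by (auto simp: P'_def)
 qed
 have 6: "AEp (P' W)" if W: "finite W" "pclosed W" "W \<subseteq> FG n" for W
 proof -
  have GW: "G W \<subseteq> W" using snd_T by (force simp: T_def)
  have "AEp (P W \<union> (\<Union>g\<in>G'. faces (T g))) \<and> finite (P W \<union> (\<Union>g\<in>G'. faces (T g))) \<and> scomplex (P W \<union> (\<Union>g\<in>G'. faces (T g)))"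
   if "finite G'" "G' \<subseteq> G W" for G' using that
  proof (induction G' rule: finite_induct)
   case empty
   thus ?case using familyD(6)[OF P W] familyD(2)[OF P] family_finite[OF P K1K W(1)] by simp
  next
   case (insert g G')
   let ?Q = "P W \<union> (\<Union>g\<in>G'. faces (T g))"
   have g: "g \<in> G W" and Q: "AEp ?Q" "finite ?Q" "scomplex ?Q" using insert by auto
   \<comment> \<open>The lifted free edge is new in both respects: \<open>{a, b}\<close> is not in
     \<open>K1\<close>, and triangles anchored on different sheets of \<open>c\<close> have
     different lifts of \<open>a\<close>.\<close>
   have notin: "t \<notin> ?Q" if t: "{A g, B g} \<subseteq> t" "t \<subseteq> T g" for t
   proof
    assume "t \<in> ?Q"
    thus False
    proof
     assume "t \<in> P W"
     hence "fst ` {A g, B g} \<in> K1" using familyD(1)[OF P] coverD(2) scomplexD[OF familyD(2)[OF P]] t by blast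
     thus False using e(3) by (simp add: A_def B_def)
    next
     assume "t \<in> (\<Union>g\<in>G'. faces (T g))"
     then obtain g' where g': "g' \<in> G'" "t \<subseteq> T g'" by (auto simp: faces_def)
     thus False using insert.hyps(2) AB(1)[of g g'] AB(2)[of g g'] t by (auto simp: A_def T_def)
    qed
   qed
   have eq: "?Q \<inter> faces (T g) = faces {A g, (c, g)} \<union> faces {(c, g), B g}"
   proof
    have inQ: "{A g, (c, g)} \<in> ?Q" "{(c, g), B g} \<in> ?Q" using g by (auto simp: G_def)
    have "faces {A g, (c, g)} \<subseteq> ?Q" "faces {(c, g), B g} \<subseteq> ?Q"
     by (rule faces_subset[OF Q(3) inQ(1)], rule faces_subset[OF Q(3) inQ(2)])
    moreover have "faces {A g, (c, g)} \<subseteq> faces (T g)" "faces {(c, g), B g} \<subseteq> faces (T g)"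
     unfolding faces_def T_def by blast+
    ultimately show "faces {A g, (c, g)} \<union> faces {(c, g), B g} \<subseteq> ?Q \<inter> faces (T g)" by blast
    show "?Q \<inter> faces (T g) \<subseteq> faces {A g, (c, g)} \<union> faces {(c, g), B g}"
    proof
     fix t assume t: "t \<in> ?Q \<inter> faces (T g)"
     hence tt: "t \<subseteq> T g" "t ~= {}" by (auto simp: faces_def)
     hence "A g \<notin> t \<or> B g \<notin> t" using notin[of t] t by auto
     thus "t \<in> faces {A g, (c, g)} \<union> faces {(c, g), B g}" using tt by (auto simp: faces_def T_def)
    qed
   qed
   have "faces {A g, (c, g)} \<inter> faces {(c, g), B g} = faces {(c, g)}"
    using AB[of g g] unfolding faces_Int by (intro arg_cong[where f = faces]) blast
   hence "AEp (faces {A g, (c, g)} \<inter> faces {(c, g), B g})" by (simp add: AEp_faces)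
   hence "AEp (faces {A g, (c, g)} \<union> faces {(c, g), B g})"
    by (intro AEx_realiz_Un scomplex_faces finite_faces AEp_faces) simp_all
   hence "AEp (?Q \<inter> faces (T g))" by (simp only: eq)
   moreover have "T g ~= {}" by (simp add: T_def)
   ultimately have "AEp (?Q \<union> faces (T g))"
    using AEx_realiz_Un[OF Q(2,3) finite_faces[OF fT] scomplex_faces[OF fT] Q(1) AEp_faces[OF fT]] by blast
   moreover have "?Q \<union> faces (T g) = P W \<union> (\<Union>g\<in>insert g G'. faces (T g))" by blast
   moreover have "finite (?Q \<union> faces (T g))" "scomplex (?Q \<union> faces (T g))"
    using Q fT by (auto intro!: scomplex_Un scomplex_faces finite_faces)
   ultimately show ?case by metis
  qed
  from this[of "G W"] GW W(1) show ?thesis unfolding P'_def by (auto intro: finite_subset)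
 qed
 from familyD(7)[OF P] obtain r where
  r': "\<forall>W. \<forall>s\<in>cover n lam K1. \<forall>v g. (v, g) \<in> s \<and> (\<forall>h\<in>FG n. len (- g + h) \<le> r --> h \<in> W) --> s \<in> P W"
  by (rule exE)
 hence r: "s \<in> P W" if "s \<in> cover n lam K1" "(v, g) \<in> s" "\<forall>h\<in>FG n. len (- g + h) \<le> r --> h \<in> W" for W s v g
  using that by blast
 \<comment> \<open>The radius must grow by the length of a label, because \<open>s\<close> may be
   given by a vertex other than the lift of \<open>c\<close> on which its triangle is
   anchored.\<close>
 define m where "m = len (lam a c) + len (lam b c) + len (lam c c)"
 have 7: "s \<in> P' W" if s: "s \<in> cover n lam ?K2" "(v, g) \<in> s" and W: "\<forall>h\<in>FG n. len (- g + h) \<le> r + m --> h \<in> W" for W s v g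
 proof (cases "fst ` s \<in> K1")
  case True
  hence "s \<in> cover n lam K1" using s(1) by (intro coverI) (auto dest: coverD)
  thus ?thesis using r[of s v g W] s(2) W by (auto simp: P'_def)
 next
  case False
  hence fs: "fst ` s \<subseteq> {a, b, c}" "v \<in> {a, b, c}" "s ~= {}" using coverD(2)[OF s(1)] s(2) by force+
  define g0 where "g0 = g + lam v c"
  have gF: "g \<in> FG n" using coverD(3)[OF s] .
  hence g0: "g0 \<in> FG n" unfolding g0_def by (intro FG_plus lam_FG)
  have W0: "h \<in> W" if h: "h \<in> FG n" "len (- g0 + h) \<le> r" for h
  proof -
   have "- g + h = lam v c + (- g0 + h)" by (simp add: g0_def minus_add add.assoc del: add_uminus_conv_diff)
   thus ?thesis using W h(1) len_plus[of "lam v c" "- g0 + h"] h(2) fs(2) by (auto simp: m_def)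
  qed
  have "lf c g0 {a, c} \<in> cover n lam K1" "lf c g0 {c, b} \<in> cover n lam K1" using lf_cover[OF K1K _ _ g0] e by auto
  moreover have "(c, g0) \<in> lf c g0 {a, c}" "(c, g0) \<in> lf c g0 {c, b}" using lcc by (auto simp: lf_def)
  ultimately have "lf c g0 {a, c} \<in> P W" "lf c g0 {c, b} \<in> P W" using r W0 by blast+
  moreover have "lf c g0 {a, c} = {A g0, (c, g0)}" "lf c g0 {c, b} = {(c, g0), B g0}" using lcc by (auto simp: lf_def A_def B_def)
  ultimately have "g0 \<in> G W" using g0 by (simp add: G_def)
  moreover have "s \<subseteq> T g0"
  proof
   fix p assume p: "p \<in> s"
   obtain w h where ph: "p = (w, h)" by (cases p)
   have w: "w \<in> {a, b, c}" using fs(1) p ph by force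
   have "lam v w = lam v c + lam c w" using lam_trans[OF abcK fs(2), of c w] w by simp
   thus "p \<in> T g0" using w image_eqI coverD(4)[OF s] p ph g0_def add.assoc by (smt (verit) T_lf lf_def)
  qed
  hence "s \<in> faces (T g0)" using fs(3) by (simp add: faces_def)
  ultimately show ?thesis by (auto simp: P'_def)
 qed
 have "family K0 ?K2 P'" unfolding family_def
 proof (intro conjI allI impI ballI)
  show "P' W \<subseteq> cover n lam ?K2" "scomplex (P' W)" for W by (rule 1, rule 2)
  show "snd ` s \<subseteq> W" if "s \<in> P' W" for s W using that by (rule 3)
  show "P' W \<subseteq> P' W'" if "W \<subseteq> W'" for W W' using that by (rule 4)
  show "tshift ga s \<in> P' ((+) ga ` W)" if "ga \<in> FG n" "s \<in> P' W" for ga W s using that by (rule 5)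
  show "AEp (P' W)" if "finite W \<and> pclosed W \<and> W \<subseteq> FG n" for W using that by (intro 6) simp_all
  show "s \<in> P' W" if "s \<in> cover n lam K0" "snd ` s \<subseteq> W" for s W using that familyD(8)[OF P that] by (simp add: P'_def)
  show "\<exists>r. \<forall>W. \<forall>s\<in>cover n lam ?K2. \<forall>v g. (v, g) \<in> s \<and> (\<forall>h\<in>FG n. len (- g + h) \<le> r --> h \<in> W) --> s \<in> P' W"
   by (intro exI[of _ "r + m"] allI ballI impI) (elim conjE, rule 7)
 qed
 thus ?thesis by blast
qed

lemma family_expands:
 assumes "expands K0 K1" "scomplex K0" "family K0 K0 P0" "K1 \<subseteq> K"
 shows "\<exists>P. family K0 K1 P" using assms
proof (induction rule: expands.induct)
 case (step K1 a c b)
 then obtain P where "family K0 K1 P" by auto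
 thus ?case using family_step[of K0 K1 P a b c] step expands_scomplex[OF step.hyps(1)] by blast
qed blast

lemma tshift_cover:
 assumes s: "s \<in> cover n lam K1" and ga: "ga \<in> FG n" shows "tshift ga s \<in> cover n lam K1"
proof (rule coverI)
 show "finite (tshift ga s)" using coverD(1)[OF s] by (simp add: tshift_def)
 have "fst ` tshift ga s = fst ` s" by (force simp: tshift_def)
 thus "fst ` tshift ga s \<in> K1" using coverD(2)[OF s] by simp
 fix v g assume "(v, g) \<in> tshift ga s"
 then obtain g0 where g: "g = ga + g0" "(v, g0) \<in> s" by (auto simp: tshift_def)
 thus "g \<in> FG n" using coverD(3)[OF s] FG_plus[OF ga] by simp
 fix w h assume "(w, h) \<in> tshift ga s"
 then obtain h0 where h: "h = ga + h0" "(w, h0) \<in> s" by (auto simp: tshift_def)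
 show "h = g + lam v w" using coverD(4)[OF s g(2) h(2)] g(1) h(1) by (simp add: add.assoc)
qed

lemma finite_max_nat:
 fixes f :: "'a => nat"
 assumes "finite W" "W ~= {}" obtains x where "x \<in> W" "\<forall>y\<in>W. f y \<le> f x"
proof -
 have "Max (f ` W) \<in> f ` W" using assms by (intro Max_in) auto
 then obtain x where "x \<in> W" "f x = Max (f ` W)" by auto
 thus thesis using that[of x] assms(1) by simp
qed

text \<open>One copy of the spanning tree: tree edges have label 0, so each copy stays on one
  sheet.\<close>

definition tcopy :: "'v => ('v => 'v) => 'v set => fgrp => ('v \<times> fgrp) set set"
 where "tcopy om par V g = (\<lambda>v. {(v, g)}) ` V \<union> (\<lambda>v. {(v, g), (par v, g)}) ` (V - {om})"

text \<open>A vertex of greatest height is a leaf, and its edge is glued to the rest of the tree at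
  a single point.\<close>

lemma tcopy_AE:
 fixes ht :: "'v => nat"
 assumes "finite V" "om \<in> V" "!!v. v \<in> V - {om} ==> par v \<in> V \<and> ht (par v) < ht v"
 shows "AEp (tcopy om par V g) \<and> finite (tcopy om par V g) \<and> scomplex (tcopy om par V g)" using assms
proof (induction "card V" arbitrary: V)
 case (Suc k)
 show ?case
 proof (cases "V = {om}")
  case True
  hence "tcopy om par V g = faces {(om, g)}" by (auto simp: tcopy_def faces_def)
  thus ?thesis by (simp add: AEp_faces finite_faces scomplex_faces)
 next
  case False
  hence ne: "V - {om} ~= {}" "finite (V - {om})" using Suc.prems by auto
  obtain v where v: "v \<in> V - {om}" "\<forall>u\<in>V - {om}. ht u \<le> ht v"
   using finite_max_nat[OF ne(2,1)] by blast
  let ?V = "V - {v}" and ?E = "{(v, g), (par v, g)}"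
  have pv: "par v \<in> V" "par v ~= v" using Suc.prems(3)[OF v(1)] by auto
  have cl: "par u \<in> ?V \<and> ht (par u) < ht u" if "u \<in> ?V - {om}" for u
   using Suc.prems(3)[of u] bspec[OF v(2), of u] that by auto
  have IH: "AEp (tcopy om par ?V g)" "finite (tcopy om par ?V g)" "scomplex (tcopy om par ?V g)"
   using Suc.hyps(1)[of ?V] Suc.hyps(2) Suc.prems v(1) cl by auto
  have eq: "tcopy om par V g = tcopy om par ?V g \<union> faces ?E"
  using v(1) pv faces_pair by (fastforce simp: tcopy_def)
  have no: "t \<notin> tcopy om par ?V g" if "(v, g) \<in> t" for t
  proof
   assume "t \<in> tcopy om par ?V g"
   then consider (1) u where "u \<in> ?V" "t = {(u, g)}" | (2) u where "u \<in> ?V - {om}" "t = {(u, g), (par u, g)}"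
    unfolding tcopy_def by blast
   thus False by (cases; use False that cl in \<open>auto\<close>)
  qed
  have "tcopy om par ?V g \<inter> faces ?E = faces {(par v, g)}"
  proof -
   have "{(par v, g)} \<in> tcopy om par ?V g" using pv by (simp add: tcopy_def)
   moreover have "{(v, g)} \<notin> tcopy om par ?V g" "?E \<notin> tcopy om par ?V g" using no by auto
   moreover have "faces {(par v, g)} = {{(par v, g)}}" by (auto simp: faces_def)
   ultimately show ?thesis by (simp add: faces_pair)
  qed
  hence i: "AEp (tcopy om par ?V g \<inter> faces ?E)" by (simp add: AEp_faces)
  have fE: "finite ?E" "?E ~= {}" by auto
  show ?thesis unfolding eq
   using AEx_realiz_Un[OF IH(2,3) finite_faces[OF fE(1)] scomplex_faces[OF fE(1)] IH(1) AEp_faces[OF fE] i]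
    IH finite_faces[OF fE(1)] scomplex_Un[OF IH(3) scomplex_faces[OF fE(1)]] by simp
 qed
qed auto

text \<open>Over the graph the cover is the Cayley tree with every vertex replaced by a copy of the
  spanning tree. A longest word \<open>x\<close> of \<open>W\<close> is a leaf of the subtree: its
  copy is joined to the others by a single lifted generator edge, so the piece for \<open>W\<close>
  arises from the piece for \<open>W - {x}\<close> by gluing at points.\<close>

lemma family_base:
 fixes ht :: "'v => nat"
 assumes V: "finite V" "om \<in> V"
  and par: "!!v. v \<in> V - {om} ==> par v \<in> V \<and> ht (par v) < ht v \<and> lam v (par v) = 0"
  and gens: "!!i. i < n ==> src i \<in> V \<and> tgt i \<in> V \<and> src i ~= tgt i \<and> lam (src i) (tgt i) = gen i"
  and K0: "K0 = (\<lambda>v. {v}) ` V \<union> (\<lambda>v. {v, par v}) ` (V - {om}) \<union> (\<lambda>i. {src i, tgt i}) ` {..<n}"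
  and sc: "scomplex K0" and sub: "K0 \<subseteq> K"
 shows "family K0 K0 (\<lambda>W. {s \<in> cover n lam K0. snd ` s \<subseteq> W})"
proof -
 define P where "P W = {s \<in> cover n lam K0. snd ` s \<subseteq> W}" for W
 have scP: "scomplex (P W)" for W using scomplex_cover_sub[OF sc] unfolding scomplex_def P_def by blast
 have K0V: "t \<subseteq> V" if "t \<in> K0" for t using that unfolding K0 by (elim UnE imageE) (simp_all add: par gens)
 have finP: "finite (P W)" if "finite W" for W
 proof (rule finite_subset)
  show "P W \<subseteq> Pow (V \<times> W)"
  proof
   fix s assume s: "s \<in> P W"
   have "fst ` s \<in> K0" using s coverD(2) unfolding P_def by blast
   thus "s \<in> Pow (V \<times> W)" using s K0V by (fastforce simp: P_def)
  qed
 qed (use V that in simp)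
 have lab: "s = {(v, g), (w, g + lam v w)}" if "s \<in> cover n lam K0" "fst ` s = {v, w}" "(v, g) \<in> s" for s v w g
 using coverD(2) that sub lam_self cover_eq_lf by (fastforce simp: lf_def)
 have AE: "AEp (P W)" if "finite W" "pclosed W" "W \<subseteq> FG n" for W using that
 proof (induction "card W" arbitrary: W)
  case 0
  thus ?case by (auto simp: pclosed_def)
 next
  case (Suc k)
  have zW: "0 \<in> W" using Suc.prems by (simp add: pclosed_def)
  then obtain x where x: "x \<in> W" "\<forall>y\<in>W. len y \<le> len x" using finite_max_nat[OF Suc.prems(1), of len] by blast
  have xF: "x \<in> FG n" using x Suc.prems by auto
  have T: "AEp (tcopy om par V g)" "finite (tcopy om par V g)" "scomplex (tcopy om par V g)" for g
   using tcopy_AE[OF V, of par ht g] par by auto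
  have tree: "t \<in> tcopy om par V x" if "t \<in> cover n lam K0" "(v, x) \<in> t" "fst ` t = {u} \<and> u \<in> V \<or> fst ` t = {u, par u} \<and> u \<in> V - {om}" for t u v
   using that(3)
  proof
   assume u: "fst ` t = {u} \<and> u \<in> V"
   hence "t = {(u, x), (u, x + lam u u)}" using lab[of t u u x] that u that(2) by force
   moreover have "x + lam u u = x" using lam_self[of "{u}" u] u coverD(2)[OF that(1)] sub by auto
   ultimately show ?thesis using u by (simp add: tcopy_def)
  next
   assume u: "fst ` t = {u, par u} \<and> u \<in> V - {om}"
   hence lz: "lam u (par u) = 0" "{u, par u} \<in> K" using par coverD(2)[OF that(1)] sub by auto
   hence lz': "lam (par u) u = 0" using lam_sym[of "{u, par u}" u "par u"] by simp
   have "v = u \<or> v = par u" using that(2) u by force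
   hence "t = {(u, x), (par u, x)}" using lab[of t u "par u" x] lab[of t "par u" u x] that u lz lz' by auto
   thus ?thesis using u by (auto simp: tcopy_def)
  qed
  have edge: "\<exists>g. t = {(src j, g), (tgt j, g + gen j)}" if "t \<in> cover n lam K0" "fst ` t = {src j, tgt j}" "j < n" for t j
  proof -
   have "src j \<in> fst ` t" using that by simp
   then obtain g where g: "(src j, g) \<in> t" by force
   show ?thesis using lab[OF that(1,2) g] gens[OF that(3)] by (intro exI[of _ g]) simp
  qed
  have K0_cases: "(\<exists>u\<in>V. t = {u}) \<or> (\<exists>u\<in>V - {om}. t = {u, par u}) \<or> (\<exists>j<n. t = {src j, tgt j})" if "t \<in> K0" for t
   using that unfolding K0 by blast
  have tc: "t \<in> cover n lam K0 \<and> snd ` t = {g}" if t: "t \<in> tcopy om par V g" and g: "g \<in> FG n" for t g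
  proof -
   from t consider (1) u where "u \<in> V" "t = {(u, g)}" | (2) u where "u \<in> V - {om}" "t = {(u, g), (par u, g)}"
    unfolding tcopy_def by blast
   thus ?thesis
   proof cases
    case 1
    thus ?thesis using lf_cover[OF sub, of "{u}" u g] g 1 lam_self[of "{u}" u] sub by (force simp: lf_def K0)
   next
    case 2
    hence "{u, par u} \<in> K0" by (simp add: K0)
    moreover from this have "lam u u = 0" using lam_self sub by blast
    ultimately show ?thesis using lf_cover[OF sub, of "{u, par u}" u g] g 2 par[OF 2(1)] by (simp add: lf_def)
   qed
  qed
  have Vc: "{(u, g)} \<in> cover n lam K0" if "u \<in> V" "g \<in> FG n" for u g
   using tc[of "{(u, g)}" g] that by (simp add: tcopy_def)
  show ?case
  proof (cases "x = 0")
   case True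
   hence W0: "W = {0}" using x by (auto simp: len_def)
   have "P W = tcopy om par V 0"
   proof
    show "tcopy om par V 0 \<subseteq> P W" using tc[of _ 0] unfolding P_def W0 by auto
    show "P W \<subseteq> tcopy om par V 0"
    proof
     fix t assume "t \<in> P W"
     hence t: "t \<in> cover n lam K0" "snd ` t \<subseteq> {0}" by (auto simp: P_def W0)
     have "t ~= {}" using scomplex_nonempty[OF scomplex_cover_sub[OF sc] t(1)] .
     then obtain v where v: "(v, 0) \<in> t" using t(2) by force
     consider (1) "(\<exists>u\<in>V. fst ` t = {u}) \<or> (\<exists>u\<in>V - {om}. fst ` t = {u, par u})" | (2) j where "j < n" "fst ` t = {src j, tgt j}"
      using K0_cases[OF coverD(2)[OF t(1)]] by blast
     thus "t \<in> tcopy om par V 0"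
     by (cases; use tree[of t v] t(1) v True edge t(2) in \<open>fastforce simp: gen_def\<close>)
    qed
   qed
   thus ?thesis using T(1) by simp
  next
   case False
   then obtain y l where y: "x = y + lt l" "word x = word y @ [l]" by (rule fgrp_snoc_cases)
   define i where "i = fst l"
   have yF: "y \<in> FG n" and i: "i < n" using xF y by (auto simp: FG_def i_def)
   \<comment> \<open>The generator edge between the sheets \<open>y\<close> and \<open>x\<close>
     runs forwards or backwards according to the sign of the last letter \<open>l\<close> of
     \<open>x\<close>.\<close>
   define p where "p = (if snd l then src i else tgt i)"
   define q where "q = (if snd l then tgt i else src i)"
   have pq: "p \<in> V" "q \<in> V" using gens[OF i] by (auto simp: p_def q_def)
   let ?W = "W - {x}" and ?e = "{(p, y), (q, x)}"
   have lenx: "len x = Suc (len y)" using y by (simp add: len_def)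
   hence yW: "y \<in> ?W" using Suc.prems(2) x(1) y(2) unfolding pclosed_def by auto
   have pcl: "pclosed ?W" unfolding pclosed_def
   proof (intro conjI ballI allI impI)
    show "0 \<in> ?W" using zW False by simp
    fix z w assume z: "z \<in> ?W" "prefix (word w) (word z)"
    show "w \<in> ?W" using Suc.prems(2) x(2) z(1) z(2) word_inject by (auto simp: pclosed_def len_def prefix_def)
   qed
   have IH: "AEp (P ?W)" using Suc.hyps(1)[of ?W] Suc.prems(1,3) pcl Suc.hyps(2) x(1) by fastforce
   have e_eq: "\<exists>g\<in>FG n. ?e = {(src i, g), (tgt i, g + gen i)}"
   proof (cases "snd l")
    case True
    hence "l = (i, True)" by (simp add: i_def prod_eq_iff)
    thus ?thesis using yF y(1) by (intro bexI[of _ y]) (simp_all add: p_def q_def gen_def)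
   next
    case False
    hence "l = (i, False)" by (simp add: i_def prod_eq_iff)
    hence "x + gen i = y" using y(1) by (simp add: gen_def add.assoc)
    thus ?thesis using xF False by (intro bexI[of _ x]) (simp_all add: p_def q_def insert_commute)
   qed
   have ecov: "?e \<in> cover n lam K0"
   proof -
    obtain g where g: "g \<in> FG n" "?e = {(src i, g), (tgt i, g + gen i)}" using e_eq by blast
    have m: "{src i, tgt i} \<in> K0" using i by (simp add: K0)
    thus ?thesis using lf_cover[OF sub m _ g(1), of "src i"] gens[OF i] lam_self sub by (auto simp: g(2) lf_def)
   qed
   have main: "P W = P ?W \<union> (tcopy om par V x \<union> faces ?e)"
   proof
    have "faces ?e \<subseteq> P W" by (rule faces_subset[OF scP]; use ecov x(1) yW in \<open>auto simp: P_def\<close>)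
    moreover have "t \<in> P W" if "t \<in> tcopy om par V x" for t using tc[OF that xF] x(1) by (simp add: P_def)
    hence "tcopy om par V x \<subseteq> P W" by blast
    moreover have "P ?W \<subseteq> P W" unfolding P_def by auto
    ultimately show "P ?W \<union> (tcopy om par V x \<union> faces ?e) \<subseteq> P W" by blast
    show "P W \<subseteq> P ?W \<union> (tcopy om par V x \<union> faces ?e)"
    proof
     fix t assume "t \<in> P W"
     hence t: "t \<in> cover n lam K0" "snd ` t \<subseteq> W" by (auto simp: P_def)
     show "t \<in> P ?W \<union> (tcopy om par V x \<union> faces ?e)"
     proof (cases "x \<in> snd ` t")
      case False
      thus ?thesis using t by (auto simp: P_def)
     next
      case True
      then obtain v where v: "(v, x) \<in> t" by force
      consider (1) "(\<exists>u\<in>V. fst ` t = {u}) \<or> (\<exists>u\<in>V - {om}. fst ` t = {u, par u})" | (2) j where "j < n" "fst ` t = {src j, tgt j}"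
       using K0_cases[OF coverD(2)[OF t(1)]] by blast
      thus ?thesis
      proof cases
       case 1
       thus ?thesis using tree[of t v] t(1) v by blast
      next
       case 2
       then obtain g where g: "t = {(src j, g), (tgt j, g + gen j)}" using edge[OF t(1)] by blast
       hence gW: "g \<in> W" "g + gen j \<in> W" using t(2) by auto
       \<comment> \<open>Any other letter would make \<open>x\<close> longer, against its
         maximality; so the prefix \<open>y\<close> is the only neighbour of \<open>x\<close> in
         \<open>W\<close>.\<close>
       have up: "l = linv l'" if "x + lt l' \<in> W" for l'
       proof (rule ccontr)
        assume "l ~= linv l'"
        thus False using x(2) that y(2) by (auto simp: len_def word_plus_lt)
       qed
       have "t = ?e"
       proof (cases "g = x")
        case True
        hence "l = (j, False)" using up[of "(j, True)"] gW by (simp add: gen_def)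
        moreover from this have "x + gen j = y" using y(1) by (simp add: gen_def add.assoc)
        ultimately show ?thesis using g True by (auto simp: p_def q_def i_def)
       next
        case False
        hence xg: "x = g + gen j" using v g by auto
        hence gx: "g = x + lt (j, False)" by (simp add: gen_def add.assoc)
        hence "l = (j, True)" using up[of "(j, False)"] gW by simp
        moreover from this have "g = y" using y(1) gx by (simp add: add.assoc)
        ultimately show ?thesis using g xg by (auto simp: p_def q_def i_def)
       qed
       thus ?thesis by (simp add: faces_def)
      qed
     qed
    qed
   qed
   have xy: "y ~= x" using lenx by auto
   have f1: "faces {z} = {{z}}" for z :: "'v \<times> fgrp" by (auto simp: faces_def)
   have i1: "tcopy om par V x \<inter> faces ?e = faces {(q, x)}"
   proof -
    have "{(p, y)} \<notin> tcopy om par V x" "?e \<notin> tcopy om par V x" using tc[OF _ xF] xy by force+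
    thus ?thesis using pq by (simp add: faces_pair f1 tcopy_def)
   qed
   have i2: "P ?W \<inter> (tcopy om par V x \<union> faces ?e) = faces {(p, y)}"
   proof -
    have "{(p, y)} \<in> P ?W" using Vc[OF pq(1) yF] yW by (simp add: P_def)
    moreover have "{(q, x)} \<notin> P ?W" "?e \<notin> P ?W" by (auto simp: P_def)
    moreover have "t \<notin> P ?W" if "t \<in> tcopy om par V x" for t using tc[OF that xF] by (auto simp: P_def)
    ultimately show ?thesis unfolding faces_pair f1 by blast
   qed
   have fe: "finite ?e" "?e ~= {}" by auto
   have Q: "AEp (tcopy om par V x \<union> faces ?e)"
    using AEx_realiz_Un[OF T(2)[of x] T(3) finite_faces[OF fe(1)] scomplex_faces[OF fe(1)] T(1) AEp_faces[OF fe]]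
    unfolding i1 using AEp_faces[of "{(q, x)}"] by simp
   have Qf: "finite (tcopy om par V x \<union> faces ?e)" "scomplex (tcopy om par V x \<union> faces ?e)"
    using T(2) finite_faces[OF fe(1)] scomplex_Un[OF T(3) scomplex_faces[OF fe(1)]] by auto
   show ?thesis using AEx_realiz_Un[OF finP scP Qf IH Q] Suc.prems(1) AEp_faces[of "{(p, y)}"] by (simp add: main i2)
  qed
 qed
 define r where "r = Max (insert 0 ((\<lambda>(u, v). len (lam u v)) ` (V \<times> V)))"
 have r: "len (lam u v) \<le> r" if "u \<in> V" "v \<in> V" for u v unfolding r_def using V(1) that by (intro Max_ge) auto
 have rad: "s \<in> P W" if s: "s \<in> cover n lam K0" "(v, g) \<in> s" and W: "\<forall>h\<in>FG n. len (- g + h) \<le> r --> h \<in> W" for s v g W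
 proof -
  have "h \<in> W" if h: "(w, h) \<in> s" for w h
  using K0V coverD(2)[OF s(1)] s(2) h coverD(4)[OF s h] W coverD(3)[OF s(1) h] r by fastforce
  thus ?thesis using s(1) unfolding P_def by auto
 qed
 have "family K0 K0 P" unfolding family_def
 proof (intro conjI allI impI ballI)
  show "scomplex (P W)" for W by (rule scP)
  show "P W \<subseteq> cover n lam K0" for W by (auto simp: P_def)
  show "snd ` s \<subseteq> W" if "s \<in> P W" for s W using that by (simp add: P_def)
  show "P W \<subseteq> P W'" if "W \<subseteq> W'" for W W' using that by (auto simp: P_def)
  show "tshift ga s \<in> P ((+) ga ` W)" if "ga \<in> FG n" "s \<in> P W" for ga W s using that tshift_cover by (auto simp: tshift_def P_def)
  show "AEp (P W)" if "finite W \<and> pclosed W \<and> W \<subseteq> FG n" for W using that by (intro AE) simp_all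
  show "s \<in> P W" if "s \<in> cover n lam K0" "snd ` s \<subseteq> W" for s W using that by (simp add: P_def)
  show "\<exists>r. \<forall>W. \<forall>s\<in>cover n lam K0. \<forall>v g. (v, g) \<in> s \<and> (\<forall>h\<in>FG n. len (- g + h) \<le> r --> h \<in> W) --> s \<in> P W"
   by (intro exI[of _ r] allI ballI impI) (elim conjE, rule rad)
 qed
 thus ?thesis unfolding P_def .
qed

end

section \<open>A fixed point theorem on the covering complex\<close>

definition pt :: "'v => 'v => real" where "pt v = (\<lambda>w. if w = v then 1 else 0)"

lemma supp_pt [simp]: "supp (pt v) = {v}" by (auto simp: supp_def pt_def)

lemma pt_self [simp]: "pt v v = 1" and pt_other: "w ~= v ==> pt v w = 0" by (simp_all add: pt_def)

lemma pt_realiz: "pt v \<in> realiz K \<longleftrightarrow> {v} \<in> K" by (auto simp: realiz_def) (auto simp: pt_def)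

lemma pt_inj: "pt v = pt w ==> v = w" by (metis pt_other pt_self zero_neq_one)

lemma proj_pt [simp]: "proj (pt (v, g)) = pt v" by (auto simp: proj_def pt_def)

lemma shift_pt [simp]: "shift ga (pt (v, g)) = pt (v, ga + g)"
using add_minus_cancel minus_add_cancel by (fastforce simp: pt_def)

text \<open>Right multiplication by \<open>d\<close> cancels at most \<open>len d\<close> letters
  from the end of \<open>g\<close>.\<close>

lemma prefix_word_plus: "prefix (take (len g - len d) (word g)) (word (g + d))"
proof (induction d rule: fgrp_snoc_induct)
 case (snoc d l)
 let ?p = "take (len g - Suc (len d)) (word g)"
 have IH: "prefix (take (len g - len d) (word g)) (word (g + d))" by fact
 have pp: "prefix ?p (take (len g - len d) (word g))"
 proof -
  have "?p = take (len g - Suc (len d)) (take (len g - len d) (word g))" by simp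
  thus ?thesis by (metis take_is_prefix)
 qed
 have "prefix ?p (word (g + d + lt l))"
 proof (cases "g + d ~= 0 \<and> last (word (g + d)) = linv l")
  case False
  thus ?thesis using IH pp by (auto simp: word_plus_lt)
 next
  case True
  hence w: "word (g + d + lt l) = butlast (word (g + d))" by (simp add: word_plus_lt)
  show ?thesis
  proof (cases "len g - len d = 0")
   case False
   have "?p = butlast (take (len g - len d) (word g))" by (simp add: butlast_take len_def)
   moreover have "prefix (butlast (take (len g - len d) (word g))) (butlast (word (g + d)))"
   proof -
    obtain zs where zs: "word (g + d) = take (len g - len d) (word g) @ zs" using IH by (auto simp: prefix_def)
    show ?thesis
    proof (cases "zs = []")
     case True
     thus ?thesis using zs by simp
    next
     case False
     show ?thesis using zs by (simp add: butlast_append prefixeq_butlast)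
    qed
   qed
   ultimately show ?thesis using w by simp
  qed simp
 qed
 thus ?case using snoc(2) by (simp add: add.assoc len_def)
qed (simp add: take_is_prefix)

lemma hom_ext_eq:
 assumes "!!x y. x \<in> FG n ==> y \<in> FG n ==> f (x + y) = f x + f y" and "x \<in> FG n"
  and c: "!!i. i < n ==> c i = f (gen i)"
 shows "hom_ext c x = (f x :: 'a::group_add)"
proof -
 have f0: "f 0 = 0" using assms(1)[of 0 0] by (intro idem_zero) simp
 have l: "hom_ext c (lt l) = f (lt l)" if "fst l < n" for l
 proof (cases "snd l")
  case True
  hence "lt l = gen (fst l)" by (simp add: gen_def prod_eq_iff)
  thus ?thesis using c[OF that] by simp
 next
  case False
  hence eq: "lt l = - gen (fst l)" by (simp add: gen_def prod_eq_iff)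
  have "f (lt l) = - c (fst l)" using assms(1)[of "- gen (fst l)" "gen (fst l)"] that f0 by (simp add: eq c[OF that] eq_neg_iff_add_eq_0)
  thus ?thesis using False by (cases l) (simp add: hom_ext_lt)
 qed
 show ?thesis using assms(2)
 proof (induction x rule: fgrp_snoc_induct)
  case zero
  thus ?case using f0 by simp
 next
  case (snoc y m)
  show ?case using snoc.IH l[of m] assms(1)[of y "lt m"] snoc by (simp add: hom_ext_plus FG_def)
 qed
qed

text \<open>\<open>C\<close> will be the cone at infinity: connected, mapped to itself, with trivial
  labels. The aim is a fixed point outside it.\<close>

locale lifted_map = labelled K lam n for K :: "'v::countable set set" and lam and n +
 fixes K0 C :: "'v set set" and P :: "fgrp set => ('v \<times> fgrp) set set" and om :: 'v
  and F :: "('v => real) => 'v => real"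
 assumes fam: "family K0 K P"
  and om0: "{om} \<in> K0" and K0K: "K0 \<subseteq> K"
  and CK: "C \<subseteq> K" and omC: "{om} \<in> C" and lamC: "s \<in> C ==> u \<in> s ==> v \<in> s ==> lam u v = 0"
  and connC: "connected (realiz C)"
  and contF: "continuous_on (realiz K) F" and FK: "x \<in> realiz K ==> F x \<in> realiz K"
  and FC: "x \<in> realiz C ==> F x \<in> realiz C" and Fom: "F (pt om) = pt om"
begin

definition B :: "nat => fgrp set" where "B N = {x \<in> FG n. len x \<le> N}"
definition Q :: "nat => ('v \<times> fgrp => real) set" where "Q N = realiz (P (B N))"

lemma B_props: "finite (B N)" "pclosed (B N)" "B N \<subseteq> FG n" "N \<le> M ==> B N \<subseteq> B M"
proof -
 show "finite (B N)" unfolding B_def by (rule finite_FG_ball)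
 show "pclosed (B N)" unfolding pclosed_def using set_mono_prefix prefix_length_le by (fastforce simp: B_def FG_def len_def)
qed (auto simp: B_def)

lemma finP: "finite W ==> finite (P W)" by (rule family_finite[OF fam order_refl])
lemma scP: "scomplex (P W)" by (rule familyD(2)[OF fam])

lemma realizP_sub: "realiz (P W) \<subseteq> realiz Kt" by (rule realiz_mono[OF familyD(1)[OF fam]])

lemma Q_AE: "AEx TYPE(('v \<times> fgrp => real) \<times> real) (Q N)" unfolding Q_def using familyD(6)[OF fam B_props(1-3)] .

lemma Q_props: "compact (Q N)" "closed (Q N)" "connected (Q N)"
 using compact_realiz[OF finP[OF B_props(1)] scP] closed_realiz[OF finP[OF B_props(1)] scP]
  AEx_imp_connected[OF AEx_snd[OF Q_AE[of N]]] unfolding Q_def by auto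

lemma Q_sub: "x \<in> Q N ==> x \<in> realiz Kt" using realizP_sub unfolding Q_def by blast

lemma Q_mono: "N \<le> M ==> Q N \<subseteq> Q M" unfolding Q_def by (intro realiz_mono familyD(4)[OF fam] B_props(4))

lemma pt_Q: assumes "g \<in> FG n" "len g \<le> N" shows "pt (om, g) \<in> Q N"
using lam_self[of "{om}" om] om0 K0K lf_cover[OF K0K om0 _ assms(1), of om] pt_realiz assms familyD(8)[OF fam] by (fastforce simp: lf_def Q_def B_def)

lemma continuous_proj: assumes "finite W" shows "continuous_on (realiz (P W)) proj"
proof -
 have eq: "proj x v = (\<Sum>g\<in>W. x (v, g))" if "x \<in> realiz (P W)" for x v
 proof -
  have "{g. x (v, g) ~= 0} \<subseteq> W" using that familyD(3)[OF fam] by (fastforce simp: supp_def realiz_def)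
  thus ?thesis unfolding proj_def using assms by (intro sum.mono_neutral_left) auto
 qed
 have "continuous_on (realiz (P W)) (\<lambda>x. \<lambda>v. \<Sum>g\<in>W. x (v, g))"
  by (intro continuous_on_coordinatewise_then_product continuous_on_sum continuous_on_subset[OF continuous_on_product_coordinates]) simp
 thus ?thesis using eq by (subst continuous_on_cong[OF refl]) auto
qed

lemma proj_Q: "x \<in> Q N ==> proj x \<in> realiz K" by (rule proj_realiz[OF Q_sub])

lemma lift_of_pt:
 assumes "x \<in> realiz Kt" "proj x = pt v" obtains g where "g \<in> FG n" "x = pt (v, g)"
proof -
 obtain w g where wg: "x (w, g) ~= 0" "g \<in> FG n" "proj x w ~= 0" using cover_pt_ex[OF assms(1)] .
 hence w: "w = v" using assms(2) pt_other by metis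
 have "lam v v = 0" using lam_self proj_realiz[OF assms(1)] assms(2) pt_realiz by fastforce
 thus thesis using that wg(2) eq_lift_at[OF assms(1) wg(1)] w assms(2) by (simp add: fun_eq_iff pt_def)
qed

definition lift_ok :: "nat => (('v \<times> fgrp => real) => 'v \<times> fgrp => real) => bool"
 where "lift_ok N G \<longleftrightarrow> continuous_on (Q N) G \<and> (\<forall>x\<in>Q N. G x \<in> realiz Kt \<and> proj (G x) = F (proj x))"

lemma lift_ok_unique:
 assumes "lift_ok N G" "lift_ok N G'" "x0 \<in> Q N" "G x0 = G' x0" "x \<in> Q N" shows "G x = G' x"
 by (rule lift_unique[OF Q_props(3), of N G G' x0]) (use assms in \<open>auto simp: lift_ok_def\<close>)

text \<open>The lift is normalised to fix the lift of the base point on sheet 0. Hence the lifts for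
  different \<open>N\<close> agree (\<open>fl_agree\<close>) and \<open>ph\<close> becomes a
  homomorphism.\<close>

definition fl :: "nat => ('v \<times> fgrp => real) => 'v \<times> fgrp => real"
 where "fl N = (SOME G. lift_ok N G \<and> G (pt (om, 0)) = pt (om, 0))"

lemma fl: "lift_ok N (fl N)" "fl N (pt (om, 0)) = pt (om, 0)"
proof -
 have "continuous_on (Q N) (\<lambda>x. F (proj x))"
  by (rule continuous_on_compose2[OF contF continuous_proj[OF B_props(1), of N, folded Q_def]]) (auto simp: proj_Q)
 then obtain G where G: "continuous_on (Q N) G" "\<forall>x\<in>Q N. G x \<in> realiz Kt \<and> proj (G x) = F (proj x)"
  using lift_exists[OF Q_props(1) Q_AE, of N "\<lambda>x. F (proj x)"] FK[OF proj_Q] by blast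
 have p0: "pt (om, 0) \<in> Q N" by (rule pt_Q) auto
 have "proj (G (pt (om, 0))) = pt om" using G(2) p0 Fom by simp
 then obtain g where g: "g \<in> FG n" "G (pt (om, 0)) = pt (om, g)" using lift_of_pt G(2) p0 by metis
 have "lift_ok N (\<lambda>x. shift (- g) (G x))"
  unfolding lift_ok_def using G g(1) shift_realiz by (auto intro: continuous_on_shift simp: proj_shift)
 moreover have "shift (- g) (G (pt (om, 0))) = pt (om, 0)" by (simp add: g(2))
 ultimately have "\<exists>G. lift_ok N G \<and> G (pt (om, 0)) = pt (om, 0)" by blast
 from someI_ex[OF this] show "lift_ok N (fl N)" "fl N (pt (om, 0)) = pt (om, 0)" by (auto simp: fl_def)
qed

lemma fl_cont: "continuous_on (Q N) (fl N)"
 and fl_realiz: "x \<in> Q N ==> fl N x \<in> realiz Kt"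
 and fl_proj: "x \<in> Q N ==> proj (fl N x) = F (proj x)" using fl(1)[of N] by (auto simp: lift_ok_def)

lemma fl_agree:
 assumes "N \<le> M" "x \<in> Q N" shows "fl M x = fl N x"
proof (rule lift_ok_unique[OF _ fl(1) _ _ assms(2)])
 show "lift_ok N (fl M)" using fl(1)[of M] Q_mono[OF assms(1)] unfolding lift_ok_def by (auto intro: continuous_on_subset)
 show "pt (om, 0) \<in> Q N" by (rule pt_Q) auto
qed (simp add: fl)

lemma shift_Q:
 assumes "x \<in> Q N" "y \<in> FG n" "len y + N \<le> M" shows "shift y x \<in> Q M"
proof -
 have eq: "supp (shift y x) = tshift y (supp x)"
 proof
  show "supp (shift y x) \<subseteq> tshift y (supp x)"
  proof
   fix p assume p: "p \<in> supp (shift y x)"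
   obtain v g where vg: "p = (v, g)" by (cases p)
   hence "(v, - y + g) \<in> supp x" using p by (simp add: supp_def)
   moreover have "p = (\<lambda>(v, g). (v, y + g)) (v, - y + g)" by (simp add: vg)
   ultimately show "p \<in> tshift y (supp x)" unfolding tshift_def by (rule image_eqI[rotated])
  qed
  show "tshift y (supp x) \<subseteq> supp (shift y x)" by (auto simp: tshift_def supp_def)
 qed
 have "tshift y (supp x) \<in> P ((+) y ` B N)" using familyD(5)[OF fam assms(2)] assms(1) by (simp add: Q_def realiz_def)
 moreover have "y + z \<in> B M" if "z \<in> B N" for z using that assms(2) FG_plus assms(3) len_plus[of y z] by (simp add: B_def)
 hence "(+) y ` B N \<subseteq> B M" by auto
 ultimately have "supp (shift y x) \<in> P (B M)" unfolding eq using familyD(4)[OF fam] by blast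
 moreover have "shift y x \<in> realiz Kt" by (rule shift_realiz[OF Q_sub[OF assms(1)] assms(2)])
 ultimately show ?thesis by (simp add: Q_def realiz_def)
qed

text \<open>The endomorphism induced on the deck group, read off from the sheet to which the lift
  carries the base point of sheet \<open>y\<close>.\<close>

definition ph :: "fgrp => fgrp" where "ph y = (SOME ka. ka \<in> FG n \<and> fl (len y) (pt (om, y)) = pt (om, ka))"

lemma ph:
 assumes "y \<in> FG n" shows "ph y \<in> FG n" "len y \<le> N ==> fl N (pt (om, y)) = pt (om, ph y)"
proof -
 have p: "pt (om, y) \<in> Q (len y)" by (rule pt_Q[OF assms]) simp
 have "\<exists>ka. ka \<in> FG n \<and> fl (len y) (pt (om, y)) = pt (om, ka)" using lift_of_pt[OF fl_realiz[OF p]] fl_proj[OF p] Fom by auto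
 from someI_ex[OF this] have *: "ph y \<in> FG n" "fl (len y) (pt (om, y)) = pt (om, ph y)" by (auto simp: ph_def)
 thus "ph y \<in> FG n" by simp
 show "fl N (pt (om, y)) = pt (om, ph y)" if "len y \<le> N" using fl_agree[OF that p] * by simp
qed

text \<open>Both sides lift the same map and agree at the base point of sheet 0, so uniqueness of
  lifts applies.\<close>

lemma fl_shift:
 assumes y: "y \<in> FG n" "len y + N \<le> M" and x: "x \<in> Q N"
 shows "fl M (shift y x) = shift (ph y) (fl N x)"
proof (rule lift_ok_unique[of N "\<lambda>x. fl M (shift y x)" "\<lambda>x. shift (ph y) (fl N x)" "pt (om, 0)", OF _ _ _ _ x])
 show "lift_ok N (\<lambda>x. fl M (shift y x))" unfolding lift_ok_def
 proof (intro conjI ballI)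
  show "continuous_on (Q N) (\<lambda>x. fl M (shift y x))"
   by (rule continuous_on_compose2[OF fl_cont[of M] continuous_on_shift[OF continuous_on_id]])
    (use shift_Q[OF _ y] in auto)
  fix x assume "x \<in> Q N"
  thus "fl M (shift y x) \<in> realiz Kt" "proj (fl M (shift y x)) = F (proj x)" using fl_realiz fl_proj shift_Q[OF _ y] by (auto simp: proj_shift)
 qed
 show "lift_ok N (\<lambda>x. shift (ph y) (fl N x))" unfolding lift_ok_def using fl_cont fl_realiz fl_proj ph(1)[OF y(1)]
  by (auto intro: continuous_on_shift shift_realiz simp: proj_shift)
 show "pt (om, 0) \<in> Q N" by (rule pt_Q) auto
 show "fl M (shift y (pt (om, 0))) = shift (ph y) (fl N (pt (om, 0)))"
  using ph(2)[OF y(1), of M] y(2) by (simp add: fl(2))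
qed

lemma ph_plus:
 assumes "y \<in> FG n" "z \<in> FG n" shows "ph (y + z) = ph y + ph z"
proof -
 have p: "pt (om, z) \<in> Q (len z)" by (rule pt_Q[OF assms(2)]) simp
 have "pt (om, ph (y + z)) = fl (len y + len z) (shift y (pt (om, z)))"
  using ph(2)[OF FG_plus[OF assms] len_plus] by simp
 also have "... = pt (om, ph y + ph z)" using fl_shift[OF assms(1) le_refl p] ph(2)[OF assms(2)] by simp
 finally have "(om, ph (y + z)) = (om, ph y + ph z)" by (rule pt_inj)
 thus ?thesis by simp
qed

text \<open>The sets on which a given coordinate of the lift is nonzero are open, and finitely many
  of them cover the compact piece. The other sheets of an image point differ from the chosen one by
  one of finitely many labels.\<close>

lemma label_bound: obtains c where "!!x w h. x \<in> Q N ==> fl N x (w, h) ~= 0 ==> len h \<le> c"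
proof -
 define U where "U p = {x \<in> Q N. fl N x p ~= 0}" for p
 have op: "openin (top_of_set (Q N)) (U p)" for p
 proof -
  have "continuous_on (Q N) (\<lambda>x. fl N x p)" by (rule continuous_on_product_then_coordinatewise[OF fl_cont])
  hence "openin (top_of_set (Q N)) (Q N \<inter> (\<lambda>x. fl N x p) -` (- {0}))" by (rule continuous_openin_preimage_gen) auto
  moreover have "Q N \<inter> (\<lambda>x. fl N x p) -` (- {0}) = U p" by (auto simp: U_def)
  ultimately show ?thesis by simp
 qed
 hence "\<forall>p. \<exists>T. open T \<and> U p = Q N \<inter> T" by (meson openin_open)
 then obtain T where T: "!!p. open (T p)" "!!p. U p = Q N \<inter> T p" by metis
 have "Q N \<subseteq> (\<Union>p. T p)"
 proof
  fix x assume x: "x \<in> Q N"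
  obtain v g where "fl N x (v, g) ~= 0" using cover_pt_ex[OF fl_realiz[OF x]] by metis
  thus "x \<in> (\<Union>p. T p)" using T(2) x by (fastforce simp: U_def)
 qed
 then obtain S where S: "finite S" "Q N \<subseteq> (\<Union>p\<in>S. T p)"
  using compactE_image[OF Q_props(1), of UNIV T N] T(1) by metis
 define V where "V = \<Union>K"
 have fV: "finite V" using finK scomplex_finite[OF scK] by (auto simp: V_def)
 define c where "c = Max (insert 0 ((\<lambda>((v, g), w). len (g + lam v w)) ` (S \<times> V)))"
 have "len h \<le> c" if x: "x \<in> Q N" and h: "fl N x (w, h) ~= 0" for x w h
 proof -
  obtain p where p: "p \<in> S" "x \<in> T p" using S(2) x by blast
  obtain v g where vg: "p = (v, g)" by (cases p)
  have "fl N x (v, g) ~= 0" using T(2) p(2) x by (auto simp: U_def vg)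
  from cover_pt[OF fl_realiz[OF x] this h] have "h = g + lam v w" "w \<in> V" by (auto simp: V_def)
  thus ?thesis unfolding c_def using S(1) fV p(1) vg by (intro Max_ge) (auto intro!: image_eqI[of _ _ "((v, g), w)"])
 qed
 thus thesis using that by blast
qed

lemma lam_bound: obtains c where "!!s u v. s \<in> K ==> u \<in> s ==> v \<in> s ==> len (lam u v) \<le> c"
proof -
 define V where "V = \<Union>K"
 have fV: "finite V" using finK scomplex_finite[OF scK] by (auto simp: V_def)
 have "len (lam u v) \<le> Max (insert 0 ((\<lambda>(u, v). len (lam u v)) ` (V \<times> V)))" if "s \<in> K" "u \<in> s" "v \<in> s" for s u v
  using fV that by (intro Max_ge) (auto simp: V_def intro!: image_eqI[of _ _ "(u, v)"])
 thus thesis using that by blast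
qed

lemma realizP_I:
 assumes "x \<in> realiz Kt" "supp x \<in> P W" shows "x \<in> realiz (P W)" using assms by (simp add: realiz_def)

lemma radius: obtains r where "!!W s v g. s \<in> Kt ==> (v, g) \<in> s ==> \<forall>h\<in>FG n. len (- g + h) \<le> r --> h \<in> W ==> s \<in> P W"
using familyD(7)[OF fam] exE that by metis

text \<open>Equivariance moves \<open>x\<close> back to the fixed piece \<open>Q r\<close> around
  the identity, where \<open>label_bound\<close> applies; this is why the constant does not depend
  on \<open>N\<close>.\<close>

lemma ph_label:
 obtains c where "!!x N v g w h. x \<in> Q N ==> x (v, g) ~= 0 ==> fl N x (w, h) ~= 0 ==> len (- ph g + h) \<le> c"
proof -
 obtain r where r: "!!W s v g. s \<in> Kt ==> (v, g) \<in> s ==> \<forall>h\<in>FG n. len (- g + h) \<le> r --> h \<in> W ==> s \<in> P W"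
  by (rule radius) blast
 obtain c where c: "!!x w h. x \<in> Q r ==> fl r x (w, h) ~= 0 ==> len h \<le> c" by (rule label_bound) blast
 have "len (- ph g + h) \<le> c" if x: "x \<in> Q N" "x (v, g) ~= 0" and h: "fl N x (w, h) ~= 0" for x N v g w h
 proof -
  have g: "g \<in> FG n" using cover_pt(2)[OF Q_sub[OF x(1)] x(2) x(2)] .
  define y where "y = shift (- g) x"
  have y: "y \<in> realiz Kt" unfolding y_def using g by (intro shift_realiz[OF Q_sub[OF x(1)]]) simp
  have "y (v, 0) ~= 0" using x(2) by (simp add: y_def)
  hence "supp y \<in> P (B r)" using y by (intro r[of "supp y" v 0]) (auto simp: realiz_def B_def supp_def)
  hence yQ: "y \<in> Q r" unfolding Q_def by (rule realizP_I[OF y])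
  define M where "M = max N (len g + r)"
  have xy: "x = shift g y" by (simp add: y_def shift_shift)
  have "fl N x = fl M x" by (rule fl_agree[symmetric]) (use x in \<open>simp_all add: M_def\<close>)
  also have "... = shift (ph g) (fl r y)" unfolding xy by (rule fl_shift[OF g _ yQ]) (simp add: M_def)
  finally have "fl r y (w, - ph g + h) ~= 0" using h by simp
  thus ?thesis by (rule c[OF yQ])
 qed
 thus thesis by (rule that)
qed

lemma common_prefix:
 assumes x: "s \<in> Kt" "(v, g) \<in> s" and m: "!!u v. {u, v} \<subseteq> fst ` s ==> len (lam u v) \<le> m" and wh: "(w, h) \<in> s"
  and "k \<le> len g - m"
 shows "prefix (take k (word g)) (word h)"
proof -
 have "k \<le> len g - len (lam v w)" using assms(5) m x(2) wh by fastforce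
 thus ?thesis using prefix_word_plus prefix_order.trans coverD(4)[OF x wh] take_is_prefix take_take min.absorb1 by metis
qed

text \<open>The lift \<open>h\<close> belonging to \<open>ga\<close> maps \<open>Q N\<close> only
  into a larger piece \<open>Q N'\<close>. Beyond \<open>Q N\<close> that piece falls into branches,
  one for each word \<open>u\<close> of a fixed length, and inwardness makes \<open>h\<close> carry
  the part of \<open>Q N\<close> inside the branch of \<open>u\<close> off the branch. So on each
  branch \<open>h\<close> can be replaced by an extension whose values avoid the branch. The
  resulting self-map of \<open>Q N'\<close> has a fixed point, which cannot lie in a branch, and on
  \<open>Q N\<close> the map is still \<open>h\<close>.\<close>

theorem fixed_point_of_inward_lift:
 assumes ga: "ga \<in> FG n" and nofix: "!!g. g \<in> FG n ==> ga + ph g ~= g"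
  and inward: "!!k. \<exists>N. \<forall>x\<in>FG n. N \<le> len x --> \<not> prefix (take (len x - k) (word x)) (word (ga + ph x))"
 shows "\<exists>x\<in>realiz K - realiz C. F x = x"
proof -
 obtain r where r: "!!W s v g. s \<in> Kt ==> (v, g) \<in> s ==> \<forall>h\<in>FG n. len (- g + h) \<le> r --> h \<in> W ==> s \<in> P W"
  by (rule radius) blast
 obtain lm where lm: "!!s u v. s \<in> K ==> u \<in> s ==> v \<in> s ==> len (lam u v) \<le> lm" by (rule lam_bound) blast
 obtain c1 where c1: "!!x N v g w h. x \<in> Q N ==> x (v, g) ~= 0 ==> fl N x (w, h) ~= 0 ==> len (- ph g + h) \<le> c1"
  by (rule ph_label) blast
 \<comment> \<open>\<open>r\<close> is the depth at which all simplices belong to a piece,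
   \<open>lm\<close> the spread of the sheets within a simplex: the vertices of a simplex outside
   \<open>P (B N)\<close> then share a prefix of length \<open>N - m\<close>.\<close>
 define m where "m = r + lm"
 \<comment> \<open>\<open>c1\<close> bounds how far the sheets of an image stray from
   \<open>ph g\<close>, and \<open>r\<close> is the radius needed for membership in
   \<open>P (W u)\<close>.\<close>
 define c2 where "c2 = c1 + r"
 obtain N0 where N0: "\<forall>x\<in>FG n. N0 \<le> len x --> \<not> prefix (take (len x - (m + c2)) (word x)) (word (ga + ph x))"
  using inward by blast
 \<comment> \<open>This makes the branch words \<open>u\<close> nonempty, of length
   \<open>N0 + 1\<close>, and every vertex in their branches long enough for the choice of
   \<open>N0\<close>.\<close>
 define N where "N = N0 + m + 1"
 obtain cN where cN: "!!x w h. x \<in> Q N ==> fl N x (w, h) ~= 0 ==> len h \<le> cN" by (rule label_bound) blast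
 \<comment> \<open>The sheets of \<open>h x\<close> have length at most \<open>len ga + cN\<close>;
   with \<open>r\<close> added, the image of \<open>Q N\<close> lies in \<open>Q N'\<close>.\<close>
 define N' where "N' = N + len ga + cN + r"
 define h where "h x = shift ga (fl N x)" for x
 have hcont: "continuous_on (Q N) h" unfolding h_def by (rule continuous_on_shift[OF fl_cont])
 have hR: "h x \<in> realiz Kt" if "x \<in> Q N" for x unfolding h_def by (rule shift_realiz[OF fl_realiz[OF that] ga])
 have hlab: "len p \<le> len ga + cN" if "x \<in> Q N" "h x (w, p) ~= 0" for x w p
 using that cN len_plus[of ga "- ga + p"] by (fastforce simp: h_def)
 have lenr: "len z \<le> len p + q" if "len (- p + z) \<le> q" for z p :: fgrp and q using len_plus[of p "- p + z"] that by simp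
 have hQ: "h x \<in> Q N'" if x: "x \<in> Q N" for x
 proof -
  obtain w p where wp: "h x (w, p) ~= 0" using cover_pt_ex[OF hR[OF x]] by metis
  have "supp (h x) \<in> P (B N')"
  by (rule r[of _ w p]; use hR[OF x] wp hlab[OF x wp] lenr in \<open>fastforce simp: realiz_def supp_def B_def N'_def\<close>)
  thus ?thesis unfolding Q_def by (rule realizP_I[OF hR[OF x]])
 qed
 define Us where "Us = {u \<in> FG n. len u = N - m}"
 have fUs: "finite Us" unfolding Us_def by (rule finite_subset[OF _ finite_FG_ball[of n "N - m"]]) auto
 define far where "far u = {t \<in> P (B N') - P (B N). \<forall>(v, g)\<in>t. prefix (word u) (word g)}" for u
 define Bs where "Bs u = (\<Union>t\<in>far u. faces t)" for u
 have farKt: "t \<in> Kt" "finite t" if "t \<in> far u" for t u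
  using that familyD(1)[OF fam] coverD(1) unfolding far_def by blast+
 have scBs: "scomplex (Bs u)" for u unfolding Bs_def by (intro scomplex_UN scomplex_faces farKt(2))
 have BsP: "Bs u \<subseteq> P (B N')" for u unfolding Bs_def far_def using faces_subset[OF scP] by blast
 hence finBs: "finite (Bs u)" for u using finP[OF B_props(1)] finite_subset by blast
 have Bs_lab: "prefix (word u) (word g)" if "s \<in> Bs u" "(v, g) \<in> s" for s u v g
  using that unfolding Bs_def far_def faces_def by blast
 have far_ex: "\<exists>u\<in>Us. t \<in> far u" if t: "t \<in> P (B N')" "t \<notin> P (B N)" for t
 proof -
  have tK: "t \<in> Kt" using t(1) familyD(1)[OF fam] by blast
  hence fK: "fst ` t \<in> K" and "t ~= {}" using coverD(2) scomplex_nonempty[OF scomplex_cover] by blast+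
  then obtain v g where vg: "(v, g) \<in> t" by auto
  have "N - r < len g"
  proof (rule ccontr)
   assume "\<not> N - r < len g"
   hence "\<forall>z\<in>FG n. len (- g + z) \<le> r --> z \<in> B N" using lenr[of g] by (fastforce simp: B_def N_def m_def)
   thus False using r[OF tK vg] t(2) by blast
  qed
  hence k: "N - m \<le> len g - lm" by (simp add: m_def)
  obtain u z where u: "word u = take (N - m) (word g)" "word z = drop (N - m) (word g)" "g = u + z"
   by (rule word_split[of g "take (N - m) (word g)" "drop (N - m) (word g)"]) simp
  have "u \<in> Us" using u(1) k in_set_takeD coverD(3)[OF tK vg] by (fastforce simp: Us_def FG_def len_def)
  moreover have "prefix (word u) (word h)" if "(w, h) \<in> t" for w h
   unfolding u(1) using lm[OF fK] by (intro common_prefix[OF tK vg _ that k]) blast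
  ultimately show ?thesis using t by (intro bexI[of _ u]) (auto simp: far_def)
 qed
 \<comment> \<open>The ball without the branch of \<open>u\<close> is still prefix-closed and
   contains 0, since \<open>u\<close> is nonempty; so the piece on it is an absolute
   extensor.\<close>
 define W where "W u = {x \<in> B N'. \<not> prefix (word u) (word x)}" for u
 have W: "finite (W u)" "W u \<subseteq> FG n" for u using B_props(1,3) by (auto simp: W_def)
 have Wcl: "pclosed (W u)" if "u \<in> Us" for u using that B_props(2)[of N'] by (auto simp: Us_def N_def pclosed_def W_def)
 have into: "h x \<in> realiz (P (W u))" if u: "u \<in> Us" and x: "x \<in> Q N" "x \<in> realiz (Bs u)" for u x
 proof -
  have sx: "supp x \<in> Bs u" "supp x \<in> P (B N)" using x by (auto simp: Q_def realiz_def)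
  obtain v g where vg: "x (v, g) ~= 0" "g \<in> FG n" using cover_pt_ex[OF Q_sub[OF x(1)]] by metis
  hence vs: "(v, g) \<in> supp x" by (simp add: supp_def)
  have gB: "len g \<le> N" using familyD(3)[OF fam sx(2)] vs by (force simp: B_def)
  have ug: "prefix (word u) (word g)" by (rule Bs_lab[OF sx(1) vs])
  have lu: "len u = N - m" using u by (simp add: Us_def)
  obtain w p where wp: "h x (w, p) ~= 0" "p \<in> FG n" using cover_pt_ex[OF hR[OF x(1)]] by metis
  have dist: "len (- (ga + ph g) + p) \<le> c1"
   using c1[OF x(1) vg(1), of w "- ga + p"] wp(1) by (simp add: h_def minus_add add.assoc del: add_uminus_conv_diff)
  have "supp (h x) \<in> P (W u)"
  proof (rule r[of _ w p])
   show "supp (h x) \<in> Kt" using hR[OF x(1)] by (simp add: realiz_def)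
   show "(w, p) \<in> supp (h x)" using wp by (simp add: supp_def)
   show "\<forall>z\<in>FG n. len (- p + z) \<le> r --> z \<in> W u"
   proof (intro ballI impI)
    fix z assume z: "z \<in> FG n" "len (- p + z) \<le> r"
    \<comment> \<open>Since \<open>z\<close> is within \<open>c2\<close> of
      \<open>ga + ph g\<close>, a common prefix \<open>u\<close> of \<open>z\<close> and
      \<open>g\<close> would leave the image of \<open>g\<close> with all but \<open>m + c2\<close>
      letters of \<open>g\<close>, which inwardness forbids.\<close>
    have "\<not> prefix (word u) (word z)"
    proof
     assume uz: "prefix (word u) (word z)"
     define d where "d = - z + (ga + ph g)"
     have "len d = len (- (ga + ph g) + z)" unfolding d_def by (metis len_uminus minus_add minus_minus)
     also have "- (ga + ph g) + z = (- (ga + ph g) + p) + (- p + z)" by (simp add: add.assoc)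
     also have "len ... \<le> c2" using len_plus[of "- (ga + ph g) + p" "- p + z"] dist z(2) by (simp add: c2_def)
     finally have d: "len d \<le> c2" .
     have zd: "ga + ph g = z + d" by (simp add: d_def)
     have "prefix (take (len z - len d) (word z)) (word (ga + ph g))" unfolding zd by (rule prefix_word_plus)
     moreover have "take (len g - (m + c2)) (word g) = take (len g - (m + c2)) (word u)"
      using ug lu gB by (auto simp: prefix_def len_def)
     moreover have "take (len g - (m + c2)) (word u) = take (len g - (m + c2)) (word z)"
      using uz lu gB by (auto simp: prefix_def len_def)
     moreover have "prefix (take (len g - (m + c2)) (word z)) (take (len z - len d) (word z))"
     proof -
      have "len g - (m + c2) \<le> len z - len d" using lu gB d prefix_length_le[OF uz] by (simp add: len_def)
      thus ?thesis by (metis take_is_prefix take_take min.absorb1)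
     qed
     ultimately have "prefix (take (len g - (m + c2)) (word g)) (word (ga + ph g))" using prefix_order.trans by metis
     thus False using N0 vg(2) prefix_length_le[OF ug] lu by (simp add: len_def N_def)
    qed
    thus "z \<in> W u" using hlab[OF x(1) wp(1)] lenr[OF z(2)] z(1) by (simp add: W_def B_def N'_def)
   qed
  qed
  thus ?thesis by (rule realizP_I[OF hR[OF x(1)]])
 qed
 have "\<exists>g. continuous_on UNIV g \<and> range g \<subseteq> realiz (P (W u)) \<and> (\<forall>x\<in>Q N \<inter> realiz (Bs u). g x = h x)" if u: "u \<in> Us" for u
 proof -
  have "AEx TYPE('v \<times> fgrp => real) (realiz (P (W u)))" by (rule AEx_fst[OF familyD(6)[OF fam W(1) Wcl[OF u] W(2)]])
  moreover have "closed (Q N \<inter> realiz (Bs u))" using Q_props(2) closed_realiz[OF finBs scBs] by blast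
  moreover have "continuous_on (Q N \<inter> realiz (Bs u)) h" by (rule continuous_on_subset[OF hcont]) simp
  moreover have "h ` (Q N \<inter> realiz (Bs u)) \<subseteq> realiz (P (W u))" using into[OF u] by auto
  ultimately show ?thesis using AExE by metis
 qed
 then obtain hu where hu: "!!u. u \<in> Us ==> continuous_on UNIV (hu u)" "!!u. u \<in> Us ==> range (hu u) \<subseteq> realiz (P (W u))"
  "!!u x. u \<in> Us ==> x \<in> Q N \<inter> realiz (Bs u) ==> hu u x = h x" by metis
 have uniq: "u = u'" if u: "u \<in> Us" "u' \<in> Us" "x \<in> realiz (Bs u)" "x \<in> realiz (Bs u')" for u u' x
 proof -
  have s: "supp x \<in> Bs u" "supp x \<in> Bs u'" using u by (auto simp: realiz_def)
  then obtain v g where vg: "(v, g) \<in> supp x" using scomplex_nonempty[OF scBs] by (metis ex_in_conv surj_pair)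
  have "prefix (word u) (word g)" "prefix (word u') (word g)" using Bs_lab s vg by blast+
  moreover have "length (word u) = length (word u')" using u by (simp add: Us_def len_def)
  ultimately have "word u = word u'" by (auto simp: prefix_def)
  thus ?thesis by (simp add: word_inject)
 qed
 define H where "H x = (if x \<in> Q N then h x else hu (THE u. u \<in> Us \<and> x \<in> realiz (Bs u)) x)" for x
 have H1: "H x = hu u x" if "u \<in> Us" "x \<in> realiz (Bs u)" for u x
 proof (cases "x \<in> Q N")
  case True
  thus ?thesis using hu(3)[OF that(1), of x] that(2) by (simp add: H_def)
 next
  case False
  have "(THE u. u \<in> Us \<and> x \<in> realiz (Bs u)) = u" using that uniq by blast
  thus ?thesis using False by (simp add: H_def)
 qed
 have cov: "Q N' = Q N \<union> (\<Union>u\<in>Us. realiz (Bs u))"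
 proof
  show "Q N \<union> (\<Union>u\<in>Us. realiz (Bs u)) \<subseteq> Q N'"
   using Q_mono[of N N'] realiz_mono[OF BsP] unfolding Q_def by (auto simp: N'_def)
  show "Q N' \<subseteq> Q N \<union> (\<Union>u\<in>Us. realiz (Bs u))"
  proof
   fix x assume x: "x \<in> Q N'"
   hence sx: "supp x \<in> P (B N')" "supp x ~= {}" by (auto simp: Q_def realiz_def)
   show "x \<in> Q N \<union> (\<Union>u\<in>Us. realiz (Bs u))"
   using x far_ex by (fastforce simp: Q_def realiz_def Bs_def faces_def)
  qed
 qed
 have "continuous_on (Q N') H" unfolding cov
 proof (rule continuous_on_closed_Un)
  show "continuous_on (Q N) H" using hcont by (subst continuous_on_cong[OF refl, of _ _ h]) (auto simp: H_def)
  show "continuous_on (\<Union>u\<in>Us. realiz (Bs u)) H"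
  proof (rule continuous_on_closed_Union[OF fUs])
   show "closed (realiz (Bs u))" for u by (rule closed_realiz[OF finBs scBs])
   show "continuous_on (realiz (Bs u)) H" if u: "u \<in> Us" for u
    using continuous_on_subset[OF hu(1)[OF u]] H1[OF u] by (subst continuous_on_cong[OF refl, of _ _ "hu u"]) auto
  qed
  show "closed (\<Union>u\<in>Us. realiz (Bs u))" by (intro closed_UN fUs ballI closed_realiz finBs scBs)
 qed (rule Q_props)
 moreover have PW: "realiz (P (W u)) \<subseteq> Q N'" for u
  unfolding Q_def by (intro realiz_mono familyD(4)[OF fam]) (auto simp: W_def)
 have "H x \<in> Q N'" if x: "x \<in> Q N'" for x
 proof (cases "x \<in> Q N")
  case True
  thus ?thesis using hQ by (simp add: H_def)
 next
  case False
  then obtain u where "u \<in> Us" "x \<in> realiz (Bs u)" using x cov by blast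
  thus ?thesis using H1 hu(2) PW by (metis rangeI subsetD)
 qed
 hence "H ` Q N' \<subseteq> Q N'" by blast
 moreover have "finite (\<Union>(P (B N')))" using finP[OF B_props(1)] scomplex_finite[OF scP] by auto
 moreover have "Q N' \<subseteq> cube (\<Union>(P (B N')))" unfolding Q_def by (rule realiz_cube[OF scP])
 ultimately obtain x where x: "x \<in> Q N'" "H x = x" using AEx_fixpoint[OF AEx_fst[OF Q_AE] Q_props(2)] by metis
 have xN: "x \<in> Q N"
 proof (rule ccontr)
  assume "x \<notin> Q N"
  then obtain u where u: "u \<in> Us" "x \<in> realiz (Bs u)" using x(1) cov by blast
  hence "x \<in> realiz (P (W u))" using H1 hu(2) x(2) by (metis rangeI subsetD)
  hence s: "supp x \<in> P (W u)" "supp x \<in> Bs u" using u(2) by (auto simp: realiz_def)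
  obtain v g where vg: "(v, g) \<in> supp x" using s(2) scomplex_nonempty[OF scBs] by (metis ex_in_conv surj_pair)
  show False using Bs_lab[OF s(2) vg] familyD(3)[OF fam s(1)] vg by (auto simp: W_def)
 qed
 hence fx: "shift ga (fl N x) = x" using x(2) by (simp add: H_def h_def)
 define y where "y = proj x"
 have Fy: "F y = y" unfolding y_def using fl_proj[OF xN] arg_cong[OF fx, of proj] by (simp add: proj_shift)
 \<comment> \<open>Labels are trivial on \<open>C\<close>, so each sheet \<open>g\<close> contains a
   copy \<open>cl g\<close> of it, and the normalised lift carries this copy to the one on sheet
   \<open>ph g\<close>. A fixed point of \<open>h\<close> in such a copy would give
   \<open>ga + ph g = g\<close>.\<close>
 have "y \<notin> realiz C"
 proof
  assume yC: "y \<in> realiz C"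
  obtain v g where vg: "x (v, g) ~= 0" "g \<in> FG n" "y v ~= 0" using cover_pt_ex[OF Q_sub[OF xN]] unfolding y_def by metis
  define cl where "cl g z = (\<lambda>(w, h). if h = g then z w else (0::real))" for g :: fgrp and z :: "'v => real"
  have cl_lift: "cl g z = lift_at v g z" if "z \<in> realiz C" "z v ~= 0" for g z v
  using lamC that by (fastforce simp: realiz_def supp_def cl_def)
  have CKr: "realiz C \<subseteq> realiz K" by (rule realiz_mono[OF CK])
  have zex: "\<exists>v. z v ~= 0" if "z \<in> realiz C" for z
   using that CKr scomplex_nonempty[OF scK] unfolding realiz_def supp_def by fastforce
  have cl_realiz: "cl g z \<in> realiz Kt \<and> proj (cl g z) = z \<and> (\<exists>v. cl g z (v, g) ~= 0)" if z: "z \<in> realiz C" and g: "g \<in> FG n" for g z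
  using zex[OF z] cl_lift z CKr g lift_at_realiz proj_lift_at by (auto simp: cl_def)
  have cl_cont: "continuous_on S G ==> continuous_on S (\<lambda>x. cl g (G x))" for g S and G :: "('v => real) => 'v => real"
  proof (rule continuous_on_coordinatewise_then_product)
   fix q :: "'v \<times> fgrp"
   assume "continuous_on S G"
   hence "continuous_on S (\<lambda>x. G x (fst q))" by (rule continuous_on_product_then_coordinatewise)
   thus "continuous_on S (\<lambda>x. cl g (G x) q)" by (cases "snd q = g") (simp_all add: cl_def case_prod_beta)
  qed
  define M where "M = max N (len g + r)"
  have clQ: "cl g z \<in> Q M" if z: "z \<in> realiz C" for z
  proof -
   obtain v where v: "cl g z (v, g) ~= 0" using cl_realiz[OF z vg(2)] by blast
   have "supp (cl g z) \<in> P (B M)"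
   by (rule r[of _ v g]; use lenr[of g] cl_realiz[OF z vg(2)] v in \<open>fastforce simp: B_def M_def realiz_def supp_def\<close>)
   thus ?thesis unfolding Q_def using cl_realiz[OF z vg(2)] by (intro realizP_I) auto
  qed
  have cl_pt: "cl g (pt om) = pt (om, g)" for g by (auto simp: cl_def pt_def)
  have "fl M (cl g y) = cl (ph g) (F y)"
  proof (rule lift_unique[OF connC, where ?x0.0 = "pt om" and G = "\<lambda>z. fl M (cl g z)" and G' = "\<lambda>z. cl (ph g) (F z)", OF _ _ _ _ _ _ _ yC])
   show "continuous_on (realiz C) (\<lambda>z. fl M (cl g z))"
    by (rule continuous_on_compose2[OF fl_cont[of M] cl_cont[OF continuous_on_id]]) (use clQ in auto)
   show "continuous_on (realiz C) (\<lambda>z. cl (ph g) (F z))" by (rule cl_cont, rule continuous_on_subset[OF contF CKr])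
   show "fl M (cl g z) \<in> realiz Kt" if "z \<in> realiz C" for z using fl_realiz clQ[OF that] by blast
   show "cl (ph g) (F z) \<in> realiz Kt" if "z \<in> realiz C" for z using cl_realiz[OF FC[OF that] ph(1)[OF vg(2)]] by blast
   show "proj (fl M (cl g z)) = proj (cl (ph g) (F z))" if "z \<in> realiz C" for z
    using cl_realiz[OF FC[OF that] ph(1)[OF vg(2)]] cl_realiz[OF that vg(2)] fl_proj[OF clQ[OF that]] by simp
   show "pt om \<in> realiz C" using omC by (simp add: pt_realiz)
   show "fl M (cl g (pt om)) = cl (ph g) (F (pt om))" using ph(2)[OF vg(2), of M] by (simp add: cl_pt Fom M_def)
  qed
  moreover have "x = cl g y" using eq_lift_at[OF Q_sub[OF xN] vg(1)] cl_lift[OF yC vg(3)] by (simp add: y_def)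
  moreover have "fl M x = fl N x" by (rule fl_agree[OF _ xN]) (simp add: M_def)
  ultimately have "fl N x = cl (ph g) y" using Fy by simp
  hence "cl (ph g) y (v, - ga + g) ~= 0" using vg(1) fx by auto
  hence "- ga + g = ph g" by (auto simp: cl_def split: if_splits)
  thus False using nofix[OF vg(2)] add_minus_cancel by metis
 qed
 thus ?thesis using Fy proj_Q[OF xN] by (auto simp: y_def)
qed

end

section \<open>Collapsing to a graph and computing the trace\<close>

section \<open>Collapsing two-dimensional complexes to graphs\<close>

definition edge_connected :: "'v set set => 'v => bool"
 where "edge_connected K om \<longleftrightarrow> (\<forall>v. {v} \<in> K --> (om, v) \<in> {(u, v). {u, v} \<in> K}\<^sup>*)"

text \<open>Asking this for all sets of triangles makes the property hereditary, so that triangles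
  can be collapsed one after the other. The free edge avoids \<open>om\<close> in order that the
  edges at the cone point survive.\<close>

definition free_faces :: "'v set set => 'v => bool"
 where "free_faces K om \<longleftrightarrow> (\<forall>T. T \<subseteq> {t \<in> K. card t = 3} \<and> T ~= {} -->
  (\<exists>t\<in>T. \<exists>e\<subseteq>t. card e = 2 \<and> om \<notin> e \<and> (\<forall>t'\<in>T. e \<subseteq> t' --> t' = t)))"

lemma card_3_minus_2:
 assumes "card t = 3" "e \<subseteq> t" "card e = 2"
 obtains a b c where "t = {a, b, c}" "e = {a, b}" "a ~= b" "b ~= c" "a ~= c"
proof -
 obtain a b where ab: "e = {a, b}" "a ~= b" using assms(3) by (auto simp: card_2_iff)
 have "finite t" using assms(1) by (metis card.infinite zero_neq_numeral)
 hence "card (t - e) = 1" using assms by (simp add: card_Diff_subset finite_subset)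
 thus thesis using that ab assms(2) by (auto simp: card_1_singleton_iff)
qed

lemma card_le_3_cases:
 assumes "finite t" "t ~= {}" "card t \<le> 3"
 obtains (v) a where "t = {a}" | (e) a b where "t = {a, b}" "a ~= b" | (t) "card t = 3"
proof -
 have "card t = 1 \<or> card t = 2 \<or> card t = 3" using assms by (auto simp: le_Suc_eq numeral_eq_Suc)
 thus thesis using that by (metis card_1_singletonE card_2_iff)
qed

text \<open>Collapse a triangle from its free edge and repeat until no triangle is left.
  Connectedness is kept because the two other edges of the triangle bypass the lost one.\<close>

lemma expands_from_graph:
 fixes K :: "'v set set"
 assumes "finite K" "scomplex K" "\<forall>s\<in>K. card s \<le> 3" "free_faces K om" "edge_connected K om"
 shows "\<exists>K0. expands K0 K \<and> scomplex K0 \<and> (\<forall>s\<in>K0. card s \<le> 2) \<and> edge_connected K0 om \<and>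
  (\<forall>v. {v} \<in> K --> {v} \<in> K0) \<and> (\<forall>v. {om, v} \<in> K --> {om, v} \<in> K0)" using assms
proof (induction "card K" arbitrary: K rule: less_induct)
 case less
 note fin = less.prems(1) and sc = less.prems(2) and dim = less.prems(3) and ff = less.prems(4) and ec = less.prems(5)
 show ?case
 proof (cases "{t \<in> K. card t = 3} = {}")
  case True
  have "card s \<le> 2" if "s \<in> K" for s using True that dim by fastforce
  thus ?thesis using sc ec by (intro exI[of _ K]) (auto intro: expands.base)
 next
  case False
  let ?T = "{t \<in> K. card t = 3}"
  have "?T \<subseteq> ?T \<and> ?T ~= {}" using False by simp
  from ff[unfolded free_faces_def, THEN spec, THEN mp, OF this]
  have "\<exists>t\<in>?T. \<exists>e\<subseteq>t. card e = 2 \<and> om \<notin> e \<and> (\<forall>t'\<in>?T. e \<subseteq> t' --> t' = t)" .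
  then obtain t e where te0: "t \<in> ?T" and te1: "e \<subseteq> t" "card e = 2" "om \<notin> e" and uniq0: "\<forall>t'\<in>?T. e \<subseteq> t' --> t' = t"
   by blast
  have te: "t \<in> K" "card t = 3" "e \<subseteq> t" "card e = 2" "om \<notin> e" using te0 te1 by simp_all
  obtain a b c where abc: "t = {a, b, c}" "e = {a, b}" "a ~= b" "b ~= c" "a ~= c" using card_3_minus_2[OF te(2-4)] .
  define K' where "K' = K - {t, e}"
  have KK': "K = insert {a, b} (insert {a, b, c} K')" using te(1) abc scomplexD[OF sc te(1,3)] by (auto simp: K'_def)
  have up: "s = e \<or> s = t" if "s \<in> K" "e \<subseteq> s" for s
  proof (cases "s = e")
   case False
   hence "card e < card s" using that scomplex_finite[OF sc that(1)] by (intro psubset_card_mono) auto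
   thus ?thesis using that te(4) dim uniq0 by fastforce
  qed simp
  have upt: "s = t" if "s \<in> K" "t \<subseteq> s" for s using up[OF that(1)] that te(3) by auto
  have sc': "scomplex K'" unfolding scomplex_def
  using scomplexD[OF sc] upt up scomplex_finite[OF sc] scomplex_nonempty[OF sc] by (auto simp: K'_def)
  have ac: "{a, c} \<in> K'" and cb: "{c, b} \<in> K'" and ab: "{a, b} \<notin> K'"
  proof -
   have "{a, c} ~= {a, b}" "{c, b} ~= {a, b}" "{a, c} ~= {a, b, c}" "{c, b} ~= {a, b, c}" using abc(3-5) by auto
   thus "{a, c} \<in> K'" "{c, b} \<in> K'" using scomplexD[OF sc te(1)] abc by (auto simp: K'_def abc)
   show "{a, b} \<notin> K'" by (simp add: K'_def abc)
  qed
  have "free_faces K' om" using ff unfolding free_faces_def K'_def by blast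
  moreover have "edge_connected K' om"
  proof -
   let ?R = "{(u, v). {u, v} \<in> K'}"
   have "(u, v) \<in> ?R\<^sup>*" if "{u, v} \<in> K" for u v
   proof (cases "{u, v} = {a, b}")
    case False
    moreover have "{u, v} ~= t"
    proof
     assume eq: "{u, v} = t"
     have "card {u, v} \<le> 2" by (simp add: card_insert_if)
     thus False using te(2) unfolding eq by simp
    qed
    ultimately have "(u, v) \<in> ?R" using that by (simp add: K'_def abc)
    thus ?thesis by blast
   next
    case True
    have "(a, c) \<in> ?R" "(c, b) \<in> ?R" "(b, c) \<in> ?R" "(c, a) \<in> ?R" using ac cb by (auto simp: insert_commute)
    hence "(a, b) \<in> ?R\<^sup>*" "(b, a) \<in> ?R\<^sup>*" by (meson r_into_rtrancl rtrancl_trans)+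
    thus ?thesis using True by (auto simp: doubleton_eq_iff)
   qed
   hence "{(u, v). {u, v} \<in> K} \<subseteq> ?R\<^sup>*" by auto
   hence "{(u, v). {u, v} \<in> K}\<^sup>* \<subseteq> ?R\<^sup>*" by (rule rtrancl_subset_rtrancl)
   moreover have "{v} \<in> K" if "{v} \<in> K'" for v using that by (simp add: K'_def)
   ultimately show ?thesis using ec unfolding edge_connected_def by blast
  qed
  moreover have "card K' < card K" unfolding K'_def using fin te(1) by (intro psubset_card_mono) auto
  moreover have "finite K'" "\<forall>s\<in>K'. card s \<le> 3" using fin dim by (auto simp: K'_def)
  ultimately obtain K0 where K0: "expands K0 K'" "scomplex K0" "\<forall>s\<in>K0. card s \<le> 2" "edge_connected K0 om"
   "\<forall>v. {v} \<in> K' --> {v} \<in> K0" "\<forall>v. {om, v} \<in> K' --> {om, v} \<in> K0"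
   using less.hyps[of K'] sc' by blast
  have "expands K0 K" unfolding KK' by (rule expands.step[OF K0(1) ac cb ab abc(3-5)])
  moreover have "{v} \<in> K0" if "{v} \<in> K" for v using te(2,4) that K0(5) by (auto simp: K'_def)
  moreover have "{om, v} \<in> K0" if "{om, v} \<in> K" for v
  proof -
   have "{om, v} ~= e" using te(5) by auto
   moreover have "{om, v} ~= t"
   proof
    assume eq: "{om, v} = t"
    have "card {om, v} \<le> 2" by (simp add: card_insert_if)
    thus False using te(2) unfolding eq by simp
   qed
   ultimately show ?thesis using that K0(6) by (simp add: K'_def)
  qed
  ultimately show ?thesis using K0 by blast
 qed
qed

subsection \<open>Spanning trees\<close>

text \<open>A breadth-first tree: the height is the distance from \<open>om\<close>, so neighbours
  of \<open>om\<close> are its children. This last clause later makes the labels vanish on the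
  cone.\<close>

lemma spanning_tree:
 fixes K0 :: "'v set set"
 assumes fin: "finite K0" and sc: "scomplex K0" and dim: "\<forall>s\<in>K0. card s \<le> 2" and ec: "edge_connected K0 om" and om: "{om} \<in> K0"
 obtains V and par :: "'v => 'v" and ht :: "'v => nat" and n :: nat and src tgt :: "nat => 'v"
 where "V = {v. {v} \<in> K0}" "finite V"
  "!!v. v \<in> V - {om} ==> par v \<in> V \<and> ht (par v) < ht v \<and> {v, par v} \<in> K0"
  "!!i. i < n ==> src i \<in> V \<and> tgt i \<in> V \<and> src i ~= tgt i \<and> {src i, tgt i} \<in> K0"
  "!!i v. i < n ==> v \<in> V - {om} ==> {src i, tgt i} ~= {v, par v}"
  "!!i j. i < n ==> j < n ==> {src i, tgt i} = {src j, tgt j} ==> i = j"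
  "K0 = (\<lambda>v. {v}) ` V \<union> (\<lambda>v. {v, par v}) ` (V - {om}) \<union> (\<lambda>i. {src i, tgt i}) ` {..<n}"
  "!!v. v ~= om ==> {om, v} \<in> K0 ==> par v = om"
proof -
 define V where "V = {v. {v} \<in> K0}"
 define R where "R = {(u, v). {u, v} \<in> K0}"
 have fV: "finite V"
 proof -
  have "(\<lambda>v. {v}) ` V \<subseteq> K0" by (auto simp: V_def)
  hence "finite ((\<lambda>v. {v}) ` V)" using fin finite_subset by blast
  thus ?thesis by (rule finite_imageD) simp
 qed
 have RV: "u \<in> V" "v \<in> V" if "{u, v} \<in> K0" for u v using scomplexD[OF sc that] by (auto simp: V_def)
 define ht where "ht v = (LEAST k. (om, v) \<in> R ^^ k)" for v
 have ex: "\<exists>k. (om, v) \<in> R ^^ k" if "v \<in> V" for v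
  using ec that unfolding edge_connected_def V_def R_def by (simp add: rtrancl_power)
 have ht: "(om, v) \<in> R ^^ ht v" if "v \<in> V" for v unfolding ht_def using LeastI_ex[OF ex[OF that]] .
 have ht_le: "ht v \<le> k" if "(om, v) \<in> R ^^ k" for v k unfolding ht_def using that by (rule Least_le)
 have "\<exists>u\<in>V. ht u < ht v \<and> {v, u} \<in> K0" if v: "v \<in> V - {om}" for v
 proof -
  have "ht v ~= 0" using v ht[of v] by fastforce
  then obtain k where k: "ht v = Suc k" using not0_implies_Suc by blast
  then obtain u where u: "(om, u) \<in> R ^^ k" "(u, v) \<in> R" using ht[of v] v by auto
  hence "{u, v} \<in> K0" "ht u \<le> k" using ht_le by (auto simp: R_def)
  thus ?thesis using RV k by (intro bexI[of _ u]) (auto simp: insert_commute)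
 qed
 then obtain par where par: "!!v. v \<in> V - {om} ==> par v \<in> V \<and> ht (par v) < ht v \<and> {v, par v} \<in> K0" by metis
 define E where "E = {e \<in> K0. card e = 2 \<and> e \<notin> (\<lambda>v. {v, par v}) ` (V - {om})}"
 have fE: "finite E" using fin by (simp add: E_def)
 define n where "n = card E"
 obtain b where b: "bij_betw b {..<n} E" using ex_bij_betw_nat_finite[OF fE] unfolding n_def lessThan_atLeast0 by blast
 have "\<exists>x y. b i = {x, y} \<and> x ~= y" if "i < n" for i
 proof -
  have "card (b i) = 2" using b that by (auto simp: E_def bij_betw_def)
  thus ?thesis by (simp add: card_2_iff)
 qed
 then obtain src tgt where st: "!!i. i < n ==> b i = {src i, tgt i} \<and> src i ~= tgt i" by metis
 have bE: "{src i, tgt i} \<in> E" if "i < n" for i using b st[OF that] that by (auto simp: bij_betw_def)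
 have ht0: "ht om = 0" using ht_le[of om 0] by simp
 show thesis
 proof (rule that[of V par ht n src tgt])
  show "V = {v. {v} \<in> K0}" by (rule V_def)
  show "finite V" by (rule fV)
  show "par v \<in> V \<and> ht (par v) < ht v \<and> {v, par v} \<in> K0" if "v \<in> V - {om}" for v using par that .
  show "src i \<in> V \<and> tgt i \<in> V \<and> src i ~= tgt i \<and> {src i, tgt i} \<in> K0" if "i < n" for i
   using bE[OF that] st[OF that] RV[of "src i" "tgt i"] by (simp add: E_def)
  show "{src i, tgt i} ~= {v, par v}" if "i < n" "v \<in> V - {om}" for i v
   using bE[OF that(1)] that(2) unfolding E_def by blast
  show "i = j" if "i < n" "j < n" "{src i, tgt i} = {src j, tgt j}" for i j
   using b st that unfolding bij_betw_def inj_on_def by (metis lessThan_iff)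
  show "K0 = (\<lambda>v. {v}) ` V \<union> (\<lambda>v. {v, par v}) ` (V - {om}) \<union> (\<lambda>i. {src i, tgt i}) ` {..<n}"
  proof
   show "(\<lambda>v. {v}) ` V \<union> (\<lambda>v. {v, par v}) ` (V - {om}) \<union> (\<lambda>i. {src i, tgt i}) ` {..<n} \<subseteq> K0"
    using par bE by (auto simp: V_def E_def)
   show "K0 \<subseteq> (\<lambda>v. {v}) ` V \<union> (\<lambda>v. {v, par v}) ` (V - {om}) \<union> (\<lambda>i. {src i, tgt i}) ` {..<n}"
   proof
    fix s assume s: "s \<in> K0"
    have f: "finite s" "s ~= {}" "card s \<le> 3" using s dim scomplex_finite[OF sc] scomplex_nonempty[OF sc] by fastforce+
    thus "s \<in> (\<lambda>v. {v}) ` V \<union> (\<lambda>v. {v, par v}) ` (V - {om}) \<union> (\<lambda>i. {src i, tgt i}) ` {..<n}"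
    by (cases rule: card_le_3_cases; use s b st dim in \<open>auto simp: V_def bij_betw_def E_def\<close>)
   qed
  qed
  show "par v = om" if "v ~= om" "{om, v} \<in> K0" for v
  proof -
   have v: "v \<in> V - {om}" using RV[OF that(2)] that(1) by blast
   have "ht v \<le> 1" using ht_le that(2) by (simp add: R_def)
   hence "ht (par v) = 0" "par v \<in> V" using par[OF v] by auto
   thus ?thesis using ht by fastforce
  qed
 qed
qed

subsection \<open>Extending cochains over an expansion\<close>

text \<open>Each expansion creates one triangle and one edge, and the label of the edge is forced by
  the two old sides of the triangle.\<close>

lemma expands_cocycle:
 fixes lam0 :: "'v => 'v => 'g::group_add"
 assumes "expands K0 K" "scomplex K0" "\<forall>s\<in>K0. card s \<le> 2"
  and lam0: "!!u v. lam0 v u = - lam0 u v" and G: "!!u v. lam0 u v \<in> G" "!!g h. g \<in> G ==> h \<in> G ==> g + h \<in> G" "!!g. g \<in> G ==> - g \<in> G"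
  and lam00: "!!v. lam0 v v = 0"
 shows "\<exists>lam. (\<forall>u v. {u, v} \<in> K0 --> lam u v = lam0 u v) \<and> (\<forall>u v w. {u, v, w} \<in> K --> lam u w = lam u v + lam v w) \<and> (\<forall>u v. lam u v \<in> G)
  \<and> (\<forall>u v. lam v u = - lam u v)" using assms(1)
proof (induction rule: expands.induct)
 case base
 show ?case
 proof (intro exI[of _ lam0] conjI allI impI)
  fix u v w assume uvw: "{u, v, w} \<in> K0"
  hence "card {u, v, w} \<le> 2" using assms(3) by blast
  hence "u = v \<or> v = w \<or> u = w" by (auto simp: card_insert_if split: if_splits)
  thus "lam0 u w = lam0 u v + lam0 v w" using lam00 lam0[of u v] by auto
 next
  fix u v show "lam0 u v \<in> G" by (rule G(1))
  show "lam0 v u = - lam0 u v" by (rule lam0)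
 qed simp
next
 case (step K a c b)
 then obtain lam where lam: "!!u v. {u, v} \<in> K0 ==> lam u v = lam0 u v"
  "!!u v w. {u, v, w} \<in> K ==> lam u w = lam u v + lam v w" "!!u v. lam u v \<in> G" "!!u v. lam v u = - lam u v" by metis
 have K: "scomplex K" "K0 \<subseteq> K" using expands_scomplex[OF step.hyps(1) assms(2)] by auto
 define lam' where "lam' u v = (if u = a \<and> v = b then lam a c + lam c b else if u = b \<and> v = a then - (lam a c + lam c b) else lam u v)" for u v
 have old: "lam' u v = lam u v" if "{u, v} \<in> K" for u v
 proof -
  have "(u = a \<and> v = b) = False" using that step.hyps(4) by blast
  moreover have "\<not> (u = b \<and> v = a)"
  proof
   assume "u = b \<and> v = a"
   thus False using step.hyps(4) insert_commute that by metis
  qed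
  hence "(u = b \<and> v = a) = False" by simp
  ultimately show ?thesis unfolding lam'_def by (simp only: if_False)
 qed
 have vK: "{a} \<in> K" "{b} \<in> K" "{c} \<in> K" using scomplexD[OF K(1) step.hyps(2)] scomplexD[OF K(1) step.hyps(3)] by auto
 have self: "lam v v = 0" if "{v} \<in> K" for v using lam(2)[of v v v] that by (intro idem_zero) simp
 have anti: "lam' v u = - lam' u v" for u v using lam(4)[of u v] step.hyps(5) by (auto simp: lam'_def)
 have self': "lam' v v = 0" if "{v} \<in> K" for v using old[of v v] self[OF that] that by simp
 have cyc: "lam' u w = lam' u v + lam' v w" if t: "{u, v, w} \<subseteq> {a, b, c}" for u v w
 proof -
  \<comment> \<open>A potential on the triangle measured from \<open>c\<close>: all six labels are
    differences of it, which gives the cocycle rule for every order of the vertices at once.\<close>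
  define p where "p x = (if x = c then 0 else lam' c x)" for x
  have pot: "lam' x y = - p x + p y" if xy: "x \<in> {a, b, c}" "y \<in> {a, b, c}" for x y
  proof -
   have c1: "lam' c y = p y" if "y \<in> {a, b, c}" for y using self'[OF vK(3)] by (simp add: p_def)
   have c2: "lam' y c = - p y" if "y \<in> {a, b, c}" for y using anti[of y c] c1[OF that] by simp
   have ab': "lam' a b = - p a + p b" using c1[of b] c2[of a] old[OF step.hyps(2)] old[OF step.hyps(3)] by (simp add: lam'_def)
   have "lam' b a = - p b + p a" unfolding anti[of b a] ab' by (simp add: minus_add)
   moreover have "p c = 0" by (simp add: p_def)
   moreover have "lam' a a = 0" "lam' b b = 0" "lam' c c = 0" using self' vK by auto
   ultimately show ?thesis using xy ab' c1[of a] c1[of b] c2[of a] c2[of b] by (elim insertE emptyE) simp_all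
  qed
  show ?thesis using pot[of u w] pot[of u v] pot[of v w] t by (simp add: add.assoc)
 qed
 show ?case
 proof (intro exI[of _ lam'] conjI allI impI)
  fix u v assume "{u, v} \<in> K0"
  thus "lam' u v = lam0 u v" using old[of u v] lam(1)[of u v] K(2) by auto
 next
  fix u v w assume uvw: "{u, v, w} \<in> insert {a, b} (insert {a, b, c} K)"
  show "lam' u w = lam' u v + lam' v w"
  proof (cases "{u, v, w} \<in> K")
   case True
   thus ?thesis using old lam(2)[OF True] scomplexD[OF K(1) True] by simp
  next
   case False
   thus ?thesis using cyc uvw by auto
  qed
 next
  fix u v show "lam' u v \<in> G" using lam(3) G(2,3) by (simp add: lam'_def)
 qed (rule anti)
qed

text \<open>Relative to the graph the complex is acyclic: for each new triangle the coboundary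
  equation can be solved for the value on its new edge.\<close>

lemma expands_coboundary:
 fixes be :: "'v => 'v => 'v => rat"
 assumes "expands K0 K" "scomplex K0"
  and be: "!!x y z. be y x z = - be x y z" "!!x y z. be x z y = - be x y z" and beK: "!!x y z. {x, y, z} \<in> K0 ==> be x y z = 0"
 shows "\<exists>w. (\<forall>u v. {u, v} \<in> K0 --> w u v = 0) \<and> (\<forall>u v. w v u = - w u v) \<and> (\<forall>u v. {u, v} \<notin> K --> w u v = 0)
  \<and> (\<forall>x y z. {x, y, z} \<in> K --> w x y + w y z + w z x = be x y z)" using assms(1)
proof (induction rule: expands.induct)
 case base
 show ?case using beK by (intro exI[of _ "\<lambda>u v. 0"]) auto
next
 case (step K a c b)
 then obtain w where w: "!!u v. {u, v} \<in> K0 ==> w u v = 0" "!!u v. w v u = - w u v" "!!u v. {u, v} \<notin> K ==> w u v = 0"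
  "!!x y z. {x, y, z} \<in> K ==> w x y + w y z + w z x = be x y z" by metis
 have K: "scomplex K" "K0 \<subseteq> K" using expands_scomplex[OF step.hyps(1) assms(2)] by auto
 define r where "r = be a b c - w b c - w c a"
 define w' where "w' u v = (if u = a \<and> v = b then r else if u = b \<and> v = a then - r else w u v)" for u v
 have old: "w' u v = w u v" if "{u, v} \<in> K" for u v
 proof -
  have "(u = a \<and> v = b) = False" using that step.hyps(4) by blast
  moreover have "\<not> (u = b \<and> v = a)"
  proof
   assume "u = b \<and> v = a"
   thus False using step.hyps(4) insert_commute that by metis
  qed
  hence "(u = b \<and> v = a) = False" by simp
  ultimately show ?thesis unfolding w'_def by (simp only: if_False)
 qed
 have anti: "w' v u = - w' u v" for u v using w(2)[of u v] step.hyps(5) by (auto simp: w'_def)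
 have self: "w' v v = 0" for v using anti[of v v] by simp
 have be2: "be x x z = 0" "be x z z = 0" for x z using be(1)[of x x z] be(2)[of x z z] by auto
 have be3: "be x z x = 0" for x z using be(2)[of x x z] be2 by simp
 have ab: "w' a b + w' b c + w' c a = be a b c" using step.hyps(5-7) by (simp add: w'_def r_def)
 have cyc: "w' x y + w' y z + w' z x = be x y z" if t: "{x, y, z} \<subseteq> {a, b, c}" for x y z
 proof -
  have u: "x \<in> {a, b, c}" "y \<in> {a, b, c}" "z \<in> {a, b, c}" using t by auto
  have s1: "be b a c = - be a b c" by (rule be(1))
  have s2: "be a c b = - be a b c" by (rule be(2))
  have s3: "be c a b = be a b c" unfolding be(1)[of c a b] s2 by simp
  have s4: "be b c a = be a b c" unfolding be(2)[of b c a] s1 by simp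
  have s5: "be c b a = - be a b c" unfolding be(1)[of c b a] s4 by simp
  note s = s1 s2 s3 s4 s5
  have an: "w' b a = - w' a b" "w' c b = - w' b c" "w' a c = - w' c a" by (rule anti)+
  show ?thesis using u ab s an self be2 be3 by (elim insertE emptyE) simp_all
 qed
 show ?case
 proof (intro exI[of _ w'] conjI allI impI)
  fix u v assume "{u, v} \<in> K0"
  thus "w' u v = 0" using old[of u v] w(1)[of u v] K(2) by auto
 next
  fix u v assume "{u, v} \<notin> insert {a, b} (insert {a, b, c} K)"
  thus "w' u v = 0" using w(3)[of u v] by (auto simp: w'_def)
 next
  fix x y z assume xyz: "{x, y, z} \<in> insert {a, b} (insert {a, b, c} K)"
  show "w' x y + w' y z + w' z x = be x y z"
  proof (cases "{x, y, z} \<in> K")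
   case True
   thus ?thesis using old w(4)[OF True] scomplexD[OF K(1) True] by simp
  next
   case False
   thus ?thesis using cyc xyz by auto
  qed
 qed (rule anti)
qed

text \<open>The uniqueness part of relative acyclicity: a cocycle that vanishes on the two old sides
  of a triangle vanishes on the new side.\<close>

lemma expands_cochain_zero:
 fixes w :: "'v => 'v => rat"
 assumes "expands K0 K" and "!!u v. {u, v} \<in> K0 ==> w u v = 0" and anti: "!!u v. w v u = - w u v"
  and "!!x y z. {x, y, z} \<in> K ==> w x y + w y z + w z x = 0"
 shows "{u, v} \<in> K ==> w u v = 0" using assms(1,4)
proof (induction arbitrary: u v rule: expands.induct)
 case base
 thus ?case using assms(2) by blast
next
 case (step K a c b)
 have IH: "w u v = 0" if "{u, v} \<in> K" for u v using step.IH[OF that] step.prems(2) by blast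
 show ?case
 proof (cases "{u, v} \<in> K")
  case False
  have "w a b + w b c + w c a = 0" by (rule step.prems(2)) simp
  moreover have "w b c = 0" "w c a = 0" using IH step.hyps(2,3) by (auto simp: insert_commute)
  ultimately have ab: "w a b = 0" by simp
  have "card {u, v} \<le> 2" "card {a, b, c} = 3" using step.hyps(5-7) by (auto simp: card_insert_if)
  thus ?thesis using ab anti[of a b] False step.prems(1) by (auto simp: doubleton_eq_iff)
 qed (rule IH)
qed

section \<open>Oriented simplices\<close>

lemma oriented_chain_nonzero:
 assumes "oriented_chain xs ys ~= 0"
 shows "set ys = set xs" "length ys = length xs" "distinct xs ==> distinct ys"
proof -
 have "{pm. pm permutes set xs \<and> map pm xs = ys} ~= {}" using assms by (force simp: oriented_chain_def)
 then obtain pm where p: "pm permutes set xs" "map pm xs = ys" by blast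
 show "set ys = set xs" using p permutes_image[OF p(1)] by auto
 show "length ys = length xs" using p by auto
 show "distinct ys" if "distinct xs" using p(2) that permutes_inj_on[OF p(1), of "set xs"] by (auto simp: distinct_map)
qed

lemma oriented_chain_alternating:
 assumes "rh permutes set ys"
 shows "oriented_chain xs (map rh ys) = of_int (sign rh) * oriented_chain xs ys"
proof (cases "set ys = set xs")
 case True
 have rh: "rh permutes set xs" using assms True by simp
 have eq: "{pm. pm permutes set xs \<and> map pm xs = map rh ys} = (\<lambda>pm. rh \<circ> pm) ` {pm. pm permutes set xs \<and> map pm xs = ys}"
 proof (intro equalityI subsetI)
  fix pm assume p: "pm \<in> {pm. pm permutes set xs \<and> map pm xs = map rh ys}"
  have "pm = rh \<circ> (inv rh \<circ> pm)" using permutes_inv_o(1)[OF rh] by (simp add: o_assoc)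
  moreover have "inv rh \<circ> pm permutes set xs" using p by (intro permutes_compose[OF _ permutes_inv[OF rh]]) simp
  moreover have "map (inv rh) (map pm xs) = map (inv rh) (map rh ys)" using p by (intro arg_cong[where f = "map _"]) simp
  hence "map (inv rh \<circ> pm) xs = map (inv rh \<circ> rh) ys" unfolding list.map_comp .
  hence "map (inv rh \<circ> pm) xs = ys" unfolding permutes_inv_o(2)[OF rh] by simp
  ultimately show "pm \<in> (\<lambda>pm. rh \<circ> pm) ` {pm. pm permutes set xs \<and> map pm xs = ys}" by (intro image_eqI[of _ _ "inv rh \<circ> pm"]) simp_all
 next
  fix pm assume "pm \<in> (\<lambda>pm. rh \<circ> pm) ` {pm. pm permutes set xs \<and> map pm xs = ys}"
  thus "pm \<in> {pm. pm permutes set xs \<and> map pm xs = map rh ys}"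
   using permutes_compose[OF _ rh] by auto
 qed
 have inj: "inj_on (\<lambda>pm. rh \<circ> pm) X" for X :: "('a => 'a) set"
 proof (rule inj_onI)
  fix x y :: "'a => 'a" assume "rh \<circ> x = rh \<circ> y"
  hence "inv rh \<circ> (rh \<circ> x) = inv rh \<circ> (rh \<circ> y)" by simp
  thus "x = y" using permutes_inv_o(2)[OF rh] by (simp add: o_assoc)
 qed
 have "sign (rh \<circ> pm) = sign rh * sign pm" if "pm permutes set xs" for pm
  using that rh by (intro sign_compose) (auto intro: permutation_permutes[THEN iffD2])
 thus ?thesis unfolding oriented_chain_def eq by (subst sum.reindex[OF inj]) (auto simp: sum_distrib_left intro!: sum.cong)
next
 case False
 hence "oriented_chain xs ys = 0" using oriented_chain_nonzero(1) by metis
 moreover have "oriented_chain xs (map rh ys) = 0" using oriented_chain_nonzero(1)[of xs "map rh ys"] False permutes_image[OF assms] by auto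
 ultimately show ?thesis by simp
qed

lemma oriented_chain_self: assumes "distinct xs" shows "oriented_chain xs xs = 1"
proof -
 have "{pm. pm permutes set xs \<and> map pm xs = xs} = {id}"
 proof (intro equalityI subsetI)
  fix pm assume "pm \<in> {pm. pm permutes set xs \<and> map pm xs = xs}"
  hence p: "pm permutes set xs" "!!x. x \<in> set xs ==> pm x = x" by (auto simp: map_idI map_eq_conv[of _ _ id, simplified])
  have "pm x = x" for x using p permutes_not_in[OF p(1), of x] by blast
  thus "pm \<in> {id}" by auto
 qed (auto simp: permutes_id)
 thus ?thesis by (simp add: oriented_chain_def)
qed

lemma oriented_chain_in_chains:
 assumes "distinct xs" "set xs \<in> K" "length xs = Suc p"
 shows "oriented_chain xs \<in> simplicial_chains K p" unfolding simplicial_chains_def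
 using oriented_chain_nonzero[of xs] oriented_chain_alternating[of _ _ xs] assms by fastforce

lemma length_3: assumes "length xs = 3" shows "\<exists>a b c. xs = [a, b, c]"
 using assms by (auto simp: numeral_3_eq_3 length_Suc_conv)

lemma transpose_permutes_set: "a \<in> S ==> b \<in> S ==> Transposition.transpose a b permutes S" by (rule permutes_swap_id)

lemma chain_swap2:
 assumes "c \<in> simplicial_chains K p" shows "c [y, x] = - c [x, y]"
proof (cases "x = y")
 case True
 show ?thesis using True assms by (auto simp: simplicial_chains_def)
next
 case False
 have t: "Transposition.transpose x y permutes set [x, y]" by (rule transpose_permutes_set) auto
 have "c (map (Transposition.transpose x y) [x, y]) = of_int (sign (Transposition.transpose x y)) * c [x, y]"
  using assms t unfolding simplicial_chains_def by blast
 thus ?thesis using False by (simp add: sign_swap_id)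
qed

lemma chain_swap3:
 assumes "c \<in> simplicial_chains K p"
 shows "c [y, x, z] = - c [x, y, z]" "c [x, z, y] = - c [x, y, z]"
proof -
 have nd: "c [x, y, z] = 0" if "\<not> distinct [x, y, z]" for x y z using assms that unfolding simplicial_chains_def by blast
 have sw: "c (map (Transposition.transpose a b) [x, y, z]) = - c [x, y, z]" if "a \<in> {x, y, z}" "b \<in> {x, y, z}" "a ~= b" for a b
 proof -
  have "Transposition.transpose a b permutes set [x, y, z]" using that by (intro transpose_permutes_set) auto
  hence "c (map (Transposition.transpose a b) [x, y, z]) = of_int (sign (Transposition.transpose a b)) * c [x, y, z]"
   using assms unfolding simplicial_chains_def by blast
  thus ?thesis using that(3) by (simp add: sign_swap_id)
 qed
 show "c [y, x, z] = - c [x, y, z]" using sw[of x y] nd[of x y z] nd[of y x z] by fastforce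
 show "c [x, z, y] = - c [x, y, z]" using sw[of y z] nd[of x y z] nd[of x z y] by fastforce
qed

lemma oriented_chain_swap:
 assumes "distinct [x, y]" shows "oriented_chain [y, x] = (\<lambda>ys. - oriented_chain [x, y] ys)"
proof -
 have mem: "oriented_chain [x, y] \<in> simplicial_chains {{x, y}} 1" "oriented_chain [y, x] \<in> simplicial_chains {{x, y}} 1"
  using assms by (auto intro!: oriented_chain_in_chains)
 have 1: "oriented_chain [x, y] [x, y] = 1" "oriented_chain [y, x] [y, x] = 1" using assms by (auto intro!: oriented_chain_self)
 show ?thesis
 proof
  fix ys
  show "oriented_chain [y, x] ys = - oriented_chain [x, y] ys"
  proof (cases "ys = [x, y] \<or> ys = [y, x]")
   case True
   have 2: "oriented_chain [x, y] [y, x] = -1" using chain_swap2[OF mem(1), of y x] 1 by linarith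
   have 3: "oriented_chain [y, x] [x, y] = -1" using chain_swap2[OF mem(2), of x y] 1 by linarith
   show ?thesis using True by (elim disjE) (simp_all only: 1 2 3 minus_minus)
  next
   case False
   have "oriented_chain zs ys = 0" if "zs = [x, y] \<or> zs = [y, x]" for zs
   proof (rule ccontr)
    assume nz: "oriented_chain zs ys ~= 0"
    have zs: "set zs = {x, y}" "length zs = 2" "distinct zs" using that assms by auto
    have "set ys = {x, y}" "length ys = 2" "distinct ys" using oriented_chain_nonzero[OF nz] zs by simp_all
    then obtain a b where "ys = [a, b]" "a ~= b" by (auto simp: numeral_2_eq_2 length_Suc_conv)
    thus False using False \<open>set ys = {x, y}\<close> by auto
   qed
   thus ?thesis by simp
  qed
 qed
qed

section \<open>The trace of a chain map in a tree-adapted basis\<close>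

text \<open>
 A 1-cochain is the coboundary of its primitive along the spanning tree, plus a combination of the cochains
 dual to the triangles of the expansion, plus a combination of the cochains \<open>eps i \<circ> lam\<close>.
\<close>

locale tree_basis =
 fixes K Kh K0 :: "'v set set" and om :: 'v and par :: "'v => 'v" and ht :: "'v => nat"
  and n :: nat and src tgt :: "nat => 'v" and lam :: "'v => 'v => fgrp" and V :: "'v set" and L :: "'v set set"
 assumes exp: "expands K0 Kh" and fin: "finite Kh" and scL: "scomplex L" and scK: "scomplex K"
  and V: "V = \<Union>K" and om: "om \<notin> V" and LK: "L \<subseteq> K"
  and Kh: "Kh = K \<union> {{om}} \<union> insert om ` L" and K0: "K0 = (\<lambda>v. {v}) ` insert om V \<union> (\<lambda>v. {v, par v}) ` V \<union> (\<lambda>i. {src i, tgt i}) ` {..<n}"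
  and par: "!!v. v \<in> V ==> par v \<in> insert om V \<and> ht (par v) < ht v" and par_L: "!!v. {v} \<in> L ==> par v = om"
  and gens: "!!i. i < n ==> src i ~= tgt i"
  and lam_tree: "!!v. v \<in> V ==> lam v (par v) = 0" and lam_gen: "!!i. i < n ==> lam (src i) (tgt i) = gen i"
  and lam_cocycle: "!!u v w. {u, v, w} \<in> Kh ==> lam u w = lam u v + lam v w" and lam_anti: "!!u v. lam v u = - lam u v"
begin

lemma finV: "finite V"
proof -
 have "V \<subseteq> \<Union>Kh" unfolding V Kh by blast
 moreover have "finite s" if "s \<in> Kh" for s
 proof -
  have "\<forall>s\<in>K0. finite s" unfolding K0 by auto
  with exp have "\<forall>s\<in>Kh. finite s" by (induction rule: expands.induct) auto
  thus ?thesis using that by blast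
 qed
 ultimately show ?thesis using fin by (meson finite_Union finite_subset)
qed

lemma K0_Kh: "K0 \<subseteq> Kh" using exp by (induction rule: expands.induct) auto

lemma KV: "{x, y} \<in> K ==> x \<in> V \<and> y \<in> V" unfolding V by blast

lemma Kh_K: "s \<in> Kh ==> om \<notin> s ==> s \<in> K" unfolding Kh by auto

lemma card_K0: "s \<in> K0 ==> card s \<le> 2" unfolding K0 by (auto simp: card_insert_if)

lemma scK0: "scomplex K0" unfolding scomplex_def
proof (intro ballI conjI allI impI)
 fix s assume s: "s \<in> K0"
 have "\<exists>a b. s = {a, b} \<and> {a} \<in> K0 \<and> {b} \<in> K0"
 proof (cases "\<exists>i<n. s = {src i, tgt i}")
  case True
  then obtain i where i: "i < n" "s = {src i, tgt i}" by blast
  hence "{src i, tgt i} \<in> Kh" using s K0_Kh by blast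
  hence "{src i, tgt i} \<subseteq> insert om V" unfolding Kh V using LK by blast
  thus ?thesis using i unfolding K0 by blast
 next
  case False
  thus ?thesis using s par unfolding K0 by blast
 qed
 then obtain a b where ab: "s = {a, b}" "{a} \<in> K0" "{b} \<in> K0" by blast
 thus "finite s" "s ~= {}" by auto
 fix t assume "t \<subseteq> s \<and> t ~= {}"
 hence "t = {a} \<or> t = {b} \<or> t = s" using ab(1) by blast
 thus "t \<in> K0" using ab s by blast
qed

lemma par_root: assumes "v \<in> V" "par v = om" shows "{v} \<in> L"
proof -
 have "{v, om} \<in> Kh" using K0_Kh assms unfolding K0 by (metis (no_types, lifting) UnCI imageI subsetD)
 moreover have "{v, om} \<notin> K" "{v, om} ~= {om}" using om assms(1) V by auto
 ultimately obtain s where s: "s \<in> L" "{v, om} = insert om s" unfolding Kh by blast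
 hence "om \<notin> s" "v ~= om" using LK om assms(1) V by auto
 thus ?thesis using s by (simp add: insert_eq_iff insert_commute)
qed

lemma par_edge: "v \<in> V ==> par v ~= om ==> {par v, v} \<in> K"
 using K0_Kh om unfolding K0 by (intro Kh_K) (auto simp: insert_commute)

lemma cone_edge: assumes "{v} \<in> L" shows "{om, v} \<in> K0" using assms LK V par_L K0 insert_commute by auto

text \<open>Go through the apex: \<open>x\<close> and \<open>y\<close> are children of
  \<open>om\<close>, the tree edges have label 0, and the cone over \<open>{x, y}\<close> is a
  simplex of \<open>Kh\<close>.\<close>

lemma lam_L: assumes "{x, y} \<in> L" shows "lam x y = 0"
proof -
 have "{x} \<in> L" "{y} \<in> L" using scomplexD[OF scL assms] by simp_all
 moreover from this have "x \<in> V" "y \<in> V" using LK V by auto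
 ultimately have "lam x om = 0" "lam y om = 0" using lam_tree[of x] lam_tree[of y] par_L by auto
 moreover have "{x, om, y} \<in> Kh" using assms unfolding Kh by (auto simp: insert_commute)
 ultimately show ?thesis using lam_cocycle[of x om y] lam_anti[of y om] by simp
qed

text \<open>An edge at \<open>om\<close> is a tree edge and so has label 0, whereas
  \<open>gen i\<close> is not 0.\<close>

lemma gens_K: assumes "i < n" shows "{src i, tgt i} \<in> K"
proof -
 have 1: "{src i, tgt i} \<in> Kh" using K0_Kh assms unfolding K0 by auto
 have no: "lam om v = 0 \<and> lam v om = 0" if e: "{om, v} \<in> Kh" and v: "v ~= om" for v
 proof -
  obtain s where s: "s \<in> L" "{om, v} = insert om s" using e om V v by (auto simp: Kh)
  hence "v \<in> V" "par v = om" using LK V par_L v om by (auto simp: insert_eq_iff)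
  thus ?thesis using lam_tree[of v] lam_anti[of v om] by simp
 qed
 have "gen i ~= 0"
 proof
  assume "gen i = 0" hence "eps i (gen i) = eps i 0" by simp
  thus False by simp
 qed
 hence "om ~= src i" "om ~= tgt i"
  using 1 lam_gen[OF assms] gens[OF assms] no[of "tgt i"] no[of "src i"] by (auto simp: insert_commute)
 thus ?thesis using 1 by (intro Kh_K) auto
qed

lemma primitive_ex:
 fixes w :: "'v => 'v => rat"
 shows "\<exists>P. P om = 0 \<and> (\<forall>v\<in>V. P v = P (par v) + w (par v) v)"
proof -
 have "\<exists>P. P om = 0 \<and> (\<forall>v\<in>V. ht v < N --> P v = P (par v) + w (par v) v)" for N
 proof (induction N)
  case 0
  show ?case by (intro exI[of _ "\<lambda>v. 0"]) simp
 next
  case (Suc N)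
  then obtain P where P: "P om = 0" "!!v. v \<in> V ==> ht v < N ==> P v = P (par v) + w (par v) v" by blast
  define Q where "Q v = (if v \<in> V \<and> ht v = N then P (par v) + w (par v) v else P v)" for v
  have "Q v = Q (par v) + w (par v) v" if "v \<in> V" "ht v < Suc N" for v
   using that P(2)[of v] par[of v] by (cases "ht v = N") (auto simp: Q_def)
  moreover have "Q om = 0" using P om by (simp add: Q_def)
  ultimately show ?case by blast
 qed
 from this[of "Suc (Max (ht ` V))"] obtain P where P: "P om = 0" "!!v. v \<in> V ==> ht v < Suc (Max (ht ` V)) ==> P v = P (par v) + w (par v) v" by blast
 show ?thesis using P finV by (auto simp: less_Suc_eq_le)
qed

lemma primitive_unique:
 fixes P Q :: "'v => rat"
 assumes "P om = Q om" "!!v. v \<in> V ==> P v - P (par v) = Q v - Q (par v)"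
 shows "v \<in> V ==> P v = Q v"
proof (induction "ht v" arbitrary: v rule: less_induct)
 case less
 show ?case using assms(2)[OF less.prems] less par[of v] assms(1) by auto
qed

definition prim :: "('v => 'v => rat) => 'v => rat"
 where "prim w = (SOME P. P om = 0 \<and> (\<forall>v\<in>V. P v = P (par v) + w (par v) v))"

lemma prim: "prim w om = 0" "v \<in> V ==> prim w v = prim w (par v) + w (par v) v"
 using someI_ex[OF primitive_ex[of w]] unfolding prim_def by auto

lemma prim_eq:
 assumes "Q om = 0" "!!v. v \<in> V ==> Q v = Q (par v) + w (par v) v" "v \<in> V" shows "prim w v = Q v"
 by (rule primitive_unique[OF _ _ assms(3)]; use assms(1) prim(1) assms(2) prim(2) in \<open>auto\<close>)

lemma prim_L: assumes "!!x y. {x, y} \<notin> K ==> w x y = 0" "{v} \<in> L" shows "prim w v = 0"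
proof -
 have v: "v \<in> V" "par v = om" using assms(2) LK V par_L by auto
 have "{om, v} \<notin> K" using om V by auto
 thus ?thesis using prim(1)[of w] prim(2)[OF v(1), of w] v assms(1) by simp
qed

text \<open>The tree part is determined by the values on tree edges, the coefficient of
  \<open>D t\<close> by the coboundary on \<open>t\<close>, and that of
  \<open>eps i \<circ> lam\<close> by the edge off the tree with index \<open>i\<close>. The
  difference of the two sides is then a cocycle vanishing on the graph, hence 0.\<close>

lemma decomposition:
 fixes w :: "'v => 'v => rat" and T :: "'v set set" and D :: "'v set => 'v => 'v => rat" and ord :: "'v set => 'v list"
 assumes anti: "!!x y. w y x = - w x y" and w0: "!!x y. {x, y} \<notin> K ==> w x y = 0"
  and D: "!!t x y. {x, y} \<in> K0 ==> D t x y = 0" "!!t x y. D t y x = - D t x y"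
  "!!t x y z. t \<in> T ==> {x, y, z} \<in> Kh ==> D t x y + D t y z + D t z x = oriented_chain (ord t) [x, y, z]"
  and ord: "!!t. t \<in> T ==> distinct (ord t) \<and> set (ord t) = t"
  and T: "T = {t \<in> Kh. card t = 3}" and dw: "!!x y z t. t \<in> T ==> ord t = [x, y, z] ==> dw t = w x y + w y z + w z x"
  and xy: "{x, y} \<in> Kh"
 shows "w x y = prim w y - prim w x + (\<Sum>t\<in>T. dw t * D t x y) +
  (\<Sum>i<n. (w (src i) (tgt i) - prim w (tgt i) + prim w (src i)) * of_int (eps i (lam x y)))"
proof -
 define ze where "ze i = w (src i) (tgt i) - prim w (tgt i) + prim w (src i)" for i
 define u where "u x y = w x y - (prim w y - prim w x) - (\<Sum>t\<in>T. dw t * D t x y) - (\<Sum>i<n. ze i * of_int (eps i (lam x y)))" for x y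
 have finT: "finite T" using T fin by simp
 have fin3: "finite t \<and> card t = 3" if "t \<in> T" for t using that T by (simp add: card_ge_0_finite)
 have u_anti: "u y x = - u x y" for x y
 proof -
  have "(\<Sum>t\<in>T. dw t * D t y x) = - (\<Sum>t\<in>T. dw t * D t x y)" unfolding sum_negf[symmetric] by (intro sum.cong refl) (simp add: D(2)[of _ y x])
  moreover have "(\<Sum>i<n. ze i * of_int (eps i (lam y x))) = - (\<Sum>i<n. ze i * of_int (eps i (lam x y)))"
   unfolding sum_negf[symmetric] by (intro sum.cong refl) (simp add: lam_anti[of y x])
  ultimately show ?thesis using anti[of y x] unfolding u_def by simp
 qed
 have u_K0: "u x y = 0" if "{x, y} \<in> K0" for x y
 proof -
  have sD: "(\<Sum>t\<in>T. dw t * D t x y) = 0" if "{x, y} \<in> K0" for x y :: 'v using D(1)[OF that] by simp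
  consider "x = y" | v where "v \<in> V" "{x, y} = {v, par v}" | i where "i < n" "{x, y} = {src i, tgt i}"
  proof -
   have "x = y \<or> (\<exists>v\<in>V. {x, y} = {v, par v}) \<or> (\<exists>i<n. {x, y} = {src i, tgt i})"
    using \<open>{x, y} \<in> K0\<close> unfolding K0 by (elim UnE imageE) (auto simp: singleton_insert_inj_eq')
   thus thesis using that by blast
  qed
  thus ?thesis
  proof cases
   case 1
   thus ?thesis using u_anti[of y y] by simp
  next
   case 2
   show ?thesis using u_anti[of "par v" v] prim(2)[of v w] 2 lam_tree[OF 2(1)] lam_anti[of "par v" v] sD[of "par v" v] \<open>{x, y} \<in> K0\<close> by (auto simp: doubleton_eq_iff u_def insert_commute)
  next
   case 3
   have "(\<Sum>j<n. ze j * of_int (eps j (lam (src i) (tgt i)))) = (\<Sum>j<n. if j = i then ze j else 0)"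
    by (intro sum.cong refl) (simp add: lam_gen[OF 3(1)])
   also have "... = ze i" using 3 by simp
   finally have "u (src i) (tgt i) = 0" using 3 sD[of "src i" "tgt i"] \<open>{x, y} \<in> K0\<close> by (simp only: u_def) (simp add: ze_def)
   thus ?thesis using 3(2) u_anti[of "src i" "tgt i"] by (auto simp: doubleton_eq_iff)
  qed
 qed
 have u_cocycle: "u x y + u y z + u z x = 0" if xyz: "{x, y, z} \<in> Kh" for x y z
 proof -
  have "eps i (lam z x) = - eps i (lam x z)" for i unfolding lam_anti[of x z] by simp
  hence e: "eps i (lam x y) + eps i (lam y z) + eps i (lam z x) = 0" for i using lam_cocycle[OF xyz] by (simp add: eps_plus)
  have s1: "(\<Sum>i<n. ze i * of_int (eps i (lam x y))) + (\<Sum>i<n. ze i * of_int (eps i (lam y z))) + (\<Sum>i<n. ze i * of_int (eps i (lam z x))) = 0"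
   unfolding sum.distrib[symmetric] distrib_left[symmetric] of_int_add[symmetric] e by simp
  have "(\<Sum>t\<in>T. dw t * D t x y) + (\<Sum>t\<in>T. dw t * D t y z) + (\<Sum>t\<in>T. dw t * D t z x) = (\<Sum>t\<in>T. dw t * oriented_chain (ord t) [x, y, z])"
   unfolding sum.distrib[symmetric] distrib_left[symmetric] using D(3)[OF _ xyz] by simp
  also have "... = w x y + w y z + w z x"
  proof (cases "card {x, y, z} = 3")
   case True
   define t where "t = {x, y, z}"
   have tT: "t \<in> T" using True xyz T t_def by simp
   have other: "oriented_chain (ord t') [x, y, z] = 0" if "t' \<in> T - {t}" for t'
   proof (rule ccontr)
    assume "oriented_chain (ord t') [x, y, z] ~= 0"
    thus False using that t_def oriented_chain_nonzero(1)[of "ord t'" "[x, y, z]"] ord[of t'] by simp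
   qed
   have "(\<Sum>t\<in>T. dw t * oriented_chain (ord t) [x, y, z]) = dw t * oriented_chain (ord t) [x, y, z]"
    unfolding sum.remove[OF finT tT] using other by simp
   moreover have "length (ord t) = 3" using ord[OF tT] distinct_card[of "ord t"] fin3[OF tT] by simp
   then obtain a b c where abc: "ord t = [a, b, c]" by (auto simp: numeral_3_eq_3 length_Suc_conv)
   have d: "distinct [a, b, c]" "{a, b, c} = {x, y, z}" using ord[OF tT] abc t_def by auto
   have "oriented_chain [a, b, c] \<in> simplicial_chains {{a, b, c}} 2" using d by (intro oriented_chain_in_chains) auto
   note sw = chain_swap3[OF this]
   have dis: "x ~= y" "y ~= z" "x ~= z" using True by (auto simp: card_insert_if split: if_splits)
   hence "[x, y, z] \<in> {[a, b, c], [b, a, c], [a, c, b], [b, c, a], [c, a, b], [c, b, a]}"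
   proof -
    have "x \<in> {a, b, c}" "y \<in> {a, b, c}" "z \<in> {a, b, c}" unfolding d(2) by auto
    thus ?thesis using dis by (elim insertE emptyE) simp_all
   qed
   hence "dw t * oriented_chain (ord t) [x, y, z] = w x y + w y z + w z x" using anti[of a b] anti[of b c] anti[of a c] sw(2)[of b c a] sw(1)[of b a c] sw(2)[of c b a] sw(1)[of c a b] sw(2)[of a c b] d oriented_chain_self by (fastforce simp: dw[OF tT abc] abc)
   ultimately show ?thesis by simp
  next
   case False
   have "oriented_chain (ord t) [x, y, z] = 0" if "t \<in> T" for t
   using oriented_chain_nonzero(1)[of "ord t" "[x, y, z]"] ord[of t] that False fin3 by auto
   moreover have "x = y \<or> y = z \<or> x = z" using False by (auto simp: card_insert_if split: if_splits)
   hence "w x y + w y z + w z x = 0" using anti[of y x] anti[of z y] anti[of z x] by auto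
   ultimately show ?thesis by simp
  qed
  finally show ?thesis using s1 unfolding u_def by simp
 qed
 show ?thesis using expands_cochain_zero[OF exp u_K0 u_anti u_cocycle xy] by (fastforce simp: u_def ze_def)
qed

text \<open>Rotating the three vertices shows that three times the sum is the sum against the
  coboundary of \<open>D\<close>. That coboundary is dual to one triangle, which appears in its 6
  orderings; hence the factor 2.\<close>

lemma sum_over_triangles:
 fixes F :: "'v list => rat" and D :: "'v => 'v => rat"
 assumes alt: "!!x y z. F [y, x, z] = - F [x, y, z]" "!!x y z. F [x, z, y] = - F [x, y, z]"
  and F0: "!!x y z. {x, y, z} \<notin> K ==> F [x, y, z] = 0"
  and D: "!!x y z. {x, y, z} \<in> K ==> D x y + D y z + D z x = oriented_chain [a, b, c] [x, y, z]"
  and abc: "distinct [a, b, c]" "{a, b, c} \<in> K"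
 shows "(\<Sum>x\<in>V. \<Sum>y\<in>V. \<Sum>z\<in>V. F [z, x, y] * D x y) = 2 * F [a, b, c]"
proof -
 let ?S = "\<lambda>g. \<Sum>x\<in>V. \<Sum>y\<in>V. \<Sum>z\<in>V. (g x y z :: rat)"
 have cyc: "F [y, z, x] = F [x, y, z]" for x y z using alt(1)[of x y z] alt(2)[of y x z] by simp
 have "oriented_chain [a, b, c] \<in> simplicial_chains {{a, b, c}} 2" using abc by (intro oriented_chain_in_chains) auto
 note sw = chain_swap3[OF this]
 have "?S (\<lambda>x y z. F [z, x, y] * D x y) = ?S (\<lambda>x y z. F [x, y, z] * D x y)" by (simp add: cyc)
 moreover have "?S (\<lambda>x y z. F [z, x, y] * D x y) = ?S (\<lambda>x y z. F [x, y, z] * D y z)"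
  by (subst sum.swap[of _ V V, symmetric], rule sum.cong[OF refl]) (rule sum.swap)
 moreover have "?S (\<lambda>x y z. F [z, x, y] * D x y) = ?S (\<lambda>x y z. F [x, y, z] * D z x)"
 proof -
  have "?S (\<lambda>x y z. F [x, y, z] * D z x) = (\<Sum>x\<in>V. \<Sum>z\<in>V. \<Sum>y\<in>V. F [x, y, z] * D z x)"
   by (rule sum.cong[OF refl]) (rule sum.swap)
  also have "... = (\<Sum>z\<in>V. \<Sum>x\<in>V. \<Sum>y\<in>V. F [x, y, z] * D z x)" by (rule sum.swap)
  finally show ?thesis by (simp add: cyc)
 qed
 ultimately have "3 * ?S (\<lambda>x y z. F [z, x, y] * D x y) = ?S (\<lambda>x y z. F [x, y, z] * (D x y + D y z + D z x))"
  by (simp add: sum.distrib distrib_left)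
 also have "... = ?S (\<lambda>x y z. F [x, y, z] * oriented_chain [a, b, c] [x, y, z])"
 by (intro sum.cong refl; use F0 D in \<open>fastforce\<close>)
 also have "... = 6 * F [a, b, c]"
 proof -
  let ?f = "\<lambda>x y z. F [x, y, z] * oriented_chain [a, b, c] [x, y, z]"
  have 0: "?f x y z = 0" if "{x, y, z} ~= {a, b, c}" for x y z
   using oriented_chain_nonzero(1)[of "[a, b, c]" "[x, y, z]"] that by auto
  have sub: "{a, b, c} \<subseteq> V" using abc V by blast
  have r: "sum g V = sum g {a, b, c}" if "!!x. x \<in> V - {a, b, c} ==> g x = 0" for g :: "'v => rat"
   using that by (intro sum.mono_neutral_right finV sub) blast
  have A: "(\<Sum>z\<in>V. ?f x y z) = (\<Sum>z\<in>{a, b, c}. ?f x y z)" for x y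
  proof (rule r)
   fix z assume "z \<in> V - {a, b, c}"
   thus "?f x y z = 0" using 0 by auto
  qed
  have B: "(\<Sum>y\<in>V. \<Sum>z\<in>{a, b, c}. ?f x y z) = (\<Sum>y\<in>{a, b, c}. \<Sum>z\<in>{a, b, c}. ?f x y z)" for x
  proof (rule r)
   fix y assume "y \<in> V - {a, b, c}"
   hence "{x, y, z} ~= {a, b, c}" for z by blast
   thus "(\<Sum>z\<in>{a, b, c}. ?f x y z) = 0" using 0 by (intro sum.neutral ballI) blast
  qed
  have C: "(\<Sum>x\<in>V. \<Sum>y\<in>{a, b, c}. \<Sum>z\<in>{a, b, c}. ?f x y z) = (\<Sum>x\<in>{a, b, c}. \<Sum>y\<in>{a, b, c}. \<Sum>z\<in>{a, b, c}. ?f x y z)"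
  proof (rule r)
   fix x assume "x \<in> V - {a, b, c}"
   hence "{x, y, z} ~= {a, b, c}" for y z by blast
   thus "(\<Sum>y\<in>{a, b, c}. \<Sum>z\<in>{a, b, c}. ?f x y z) = 0" using 0 by (intro sum.neutral ballI) blast
  qed
  have "?S ?f = (\<Sum>x\<in>{a, b, c}. \<Sum>y\<in>{a, b, c}. \<Sum>z\<in>{a, b, c}. ?f x y z)" by (simp only: A B C)
  moreover have o1: "oriented_chain [a, b, c] [a, b, c] = 1" using abc by (intro oriented_chain_self)
  have o2: "oriented_chain [a, b, c] [b, a, c] = -1" "F [b, a, c] = - F [a, b, c]" using sw(1)[of b a c] alt(1)[of b a c] o1 by simp_all
  have o3: "oriented_chain [a, b, c] [a, c, b] = -1" "F [a, c, b] = - F [a, b, c]" using sw(2)[of a c b] alt(2)[of a c b] o1 by simp_all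
  have o5: "oriented_chain [a, b, c] [c, a, b] = 1" "F [c, a, b] = F [a, b, c]" using sw(1)[of c a b] alt(1)[of c a b] o3 by simp_all
  have deg: "F [x, y, x] = 0" "F [x, x, y] = 0" "F [y, x, x] = 0" for x y
   using alt(1)[of x x y] alt(2)[of y x x] alt(1)[of x y x] by simp_all
  have "(\<Sum>x\<in>{a, b, c}. \<Sum>y\<in>{a, b, c}. \<Sum>z\<in>{a, b, c}. ?f x y z) = 6 * F [a, b, c]" using abc(1) sw(2)[of b c a] alt(2)[of b c a] o2 sw(2)[of c b a] alt(2)[of c b a] o5 by (simp add: o1 o2 o3 o5 deg)
  ultimately show ?thesis by simp
 qed
 finally show ?thesis by simp
qed

text \<open>\<open>f1 x y x' y'\<close> stands for the coefficient of the edge from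
  \<open>x'\<close> to \<open>y'\<close> in the image of the edge from \<open>x\<close> to
  \<open>y\<close>, and \<open>f2\<close> for the same in degree 2. For fixed \<open>x'\<close> and
  \<open>y'\<close> this is a 1-cochain; it is decomposed and then evaluated at the edge itself.
  Summed up, the tree part counts fixed vertices, the triangle part gives the trace in degree 2, and
  the label part gives the exponents. Ordered pairs count each edge twice.\<close>

theorem trace_formula:
 fixes f1 :: "'v => 'v => 'v => 'v => rat" and f2 :: "'v list => 'v list => rat" and q r :: "nat => _ => rat" and ord :: "'v set => 'v list"
 assumes anti1: "!!x y x' y'. f1 y x x' y' = - f1 x y x' y'" and anti2: "!!x y x' y'. f1 x y y' x' = - f1 x y x' y'"
  and f10: "!!x y x' y'. {x, y} \<notin> K \<or> {x', y'} \<notin> K ==> f1 x y x' y' = 0"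
  and rel: "!!x y x' y'. {x, y} \<in> L ==> {x', y'} \<notin> L ==> f1 x y x' y' = 0"
  and bd: "!!x y y'. {x, y} \<in> K ==> (\<Sum>x'\<in>V. f1 x y x' y') = of_bool (ps y = y') - of_bool (ps x = y')"
  and tri: "!!x y z x' y'. distinct [x, y, z] ==> {x, y, z} \<in> K ==> f1 x y x' y' + f1 y z x' y' + f1 z x x' y' = (\<Sum>v\<in>V. f2 [x, y, z] [v, x', y'])"
  and alt: "!!xs x y z. f2 xs [y, x, z] = - f2 xs [x, y, z]" "!!xs x y z. f2 xs [x, z, y] = - f2 xs [x, y, z]"
  and f20: "!!xs x y z. {x, y, z} \<notin> K ==> f2 xs [x, y, z] = 0"
  and psL: "!!v. {v} \<in> L ==> {ps v} \<in> L" and cardL: "!!s. s \<in> L ==> card s \<le> 2"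
  and qL: "!!i v. {v} \<in> L ==> q i v = 0" and r0: "!!i. r i 0 = 0"
  and qr: "!!i x y. i < n ==> {x, y} \<in> K ==> (\<Sum>x'\<in>V. \<Sum>y'\<in>V. f1 x y x' y' * of_int (eps i (lam x' y'))) = 2 * (q i y + r i (lam x y) - q i x)"
  and ord: "!!t. t \<in> K ==> card t = 3 ==> distinct (ord t) \<and> set (ord t) = t"
 shows "of_nat (card {v \<in> V. {v} \<notin> L \<and> ps v = v}) - (\<Sum>(x, y) | {x, y} \<in> K - L \<and> x ~= y. f1 x y x y) / 2
  + (\<Sum>t | t \<in> K \<and> card t = 3. f2 (ord t) (ord t)) = - (\<Sum>i<n. r i (gen i))"
proof -
 define T where "T = {t \<in> Kh. card t = 3}"
 define TK where "TK = {t \<in> K. card t = 3}"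
 define E where "E = {(x, y). {x, y} \<in> K - L \<and> x ~= y}"
 have finT: "finite T" using fin by (simp add: T_def)
 have TKT: "TK \<subseteq> T" by (auto simp: TK_def T_def Kh)
 have EV: "E \<subseteq> V \<times> V" using KV by (auto simp: E_def)
 have finE: "finite E" by (rule finite_subset[OF EV]) (simp add: finV)
 have L_edge: "{x} \<in> L \<and> {y} \<in> L" if "{x, y} \<in> L" for x y using scomplexD[OF scL that] by simp
 \<comment> \<open>\<open>ord\<close> is given on \<open>K\<close> only; triangles of the cone
   receive an arbitrary orientation.\<close>
 define od where "od t = (if t \<in> K then ord t else (SOME xs. distinct xs \<and> set xs = t))" for t
 have od: "distinct (od t) \<and> set (od t) = t" if "t \<in> T" for t
 proof (cases "t \<in> K")
  case True thus ?thesis using ord[of t] that by (simp add: od_def T_def)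
 next
  case False
  have "finite t" using that unfolding T_def by (simp add: card_ge_0_finite)
  thus ?thesis using someI_ex[of "\<lambda>xs. distinct xs \<and> set xs = t"] False finite_distinct_list by (auto simp: od_def)
 qed
 have od3: "\<exists>a b c. od t = [a, b, c]" if "t \<in> T" for t
 using od distinct_card[of "od t"] that length_3 by (simp add: T_def)
 have "\<exists>w. (\<forall>u v. {u, v} \<in> K0 --> w u v = 0) \<and> (\<forall>u v. w v u = - w u v) \<and> (\<forall>u v. {u, v} \<notin> Kh --> w u v = 0)
  \<and> (\<forall>x y z. {x, y, z} \<in> Kh --> w x y + w y z + w z x = oriented_chain (od t) [x, y, z])" if "t \<in> T" for t
 proof (rule expands_coboundary[OF exp])
  show "scomplex K0" by (rule scK0)
  have m: "oriented_chain (od t) \<in> simplicial_chains {t} 2"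
   using od[OF that] od3[OF that] by (intro oriented_chain_in_chains) auto
  show "oriented_chain (od t) [y, x, z] = - oriented_chain (od t) [x, y, z]"
   "oriented_chain (od t) [x, z, y] = - oriented_chain (od t) [x, y, z]" for x y z by (rule chain_swap3[OF m])+
  show "oriented_chain (od t) [x, y, z] = 0" if "{x, y, z} \<in> K0" for x y z
  proof (rule ccontr)
   assume "oriented_chain (od t) [x, y, z] ~= 0"
   thus False using card_K0[OF that] \<open>t \<in> T\<close> oriented_chain_nonzero(1)[of "od t" "[x, y, z]"] od[OF \<open>t \<in> T\<close>] by (simp add: T_def)
  qed
 qed
 from bchoice[OF ballI, OF this] obtain D where DT: "\<forall>t\<in>T. (\<forall>u v. {u, v} \<in> K0 --> D t u v = 0) \<and> (\<forall>u v. D t v u = - D t u v) \<and> (\<forall>u v. {u, v} \<notin> Kh --> D t u v = (0::rat))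
  \<and> (\<forall>x y z. {x, y, z} \<in> Kh --> D t x y + D t y z + D t z x = oriented_chain (od t) [x, y, z])" ..
 have D: "{u, v} \<in> K0 ==> D t u v = 0" "D t v u = - D t u v" "{u, v} \<notin> Kh ==> D t u v = 0"
  "{x, y, z} \<in> Kh ==> D t x y + D t y z + D t z x = oriented_chain (od t) [x, y, z]" if "t \<in> T" for t u v x y z
  using bspec[OF DT that] by blast+
 \<comment> \<open>\<open>decomposition\<close> asks for vanishing on the graph and antisymmetry at
   every \<open>t\<close>, while \<open>D\<close> is known only on \<open>T\<close>.\<close>
 define Dd where "Dd t x y = (if t \<in> T then D t x y else 0)" for t x y
 define w where "w x' y' = (\<lambda>x y. f1 x y x' y')" for x' y'
 define Pr where "Pr x' y' = prim (w x' y')" for x' y'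
 define dw where "dw t x' y' = f1 (od t ! 0) (od t ! 1) x' y' + f1 (od t ! 1) (od t ! 2) x' y' + f1 (od t ! 2) (od t ! 0) x' y'" for t x' y'
 define ze where "ze i x' y' = f1 (src i) (tgt i) x' y' - Pr x' y' (tgt i) + Pr x' y' (src i)" for i x' y'
 define xx where "xx i x' y' = (of_int (eps i (lam x' y')) :: rat)" for i x' y'
 have main: "f1 x' y' x' y' = Pr x' y' y' - Pr x' y' x' + (\<Sum>t\<in>T. dw t x' y' * D t x' y') + (\<Sum>i<n. ze i x' y' * xx i x' y')"
  if "(x', y') \<in> E" for x' y'
 proof -
  have "w x' y' x' y' = prim (w x' y') y' - prim (w x' y') x' + (\<Sum>t\<in>T. dw t x' y' * Dd t x' y')
   + (\<Sum>i<n. (w x' y' (src i) (tgt i) - prim (w x' y') (tgt i) + prim (w x' y') (src i)) * of_int (eps i (lam x' y')))"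
  proof (rule decomposition[where ord = od and dw = "\<lambda>t. dw t x' y'" and D = Dd])
   show "w x' y' y x = - w x' y' x y" for x y unfolding w_def by (rule anti1)
   show "w x' y' x y = 0" if "{x, y} \<notin> K" for x y unfolding w_def using f10 that by simp
   show "Dd t x y = 0" if "{x, y} \<in> K0" for t x y using D(1) that by (simp add: Dd_def)
   show "Dd t y x = - Dd t x y" for t x y using D(2)[of t x y] by (simp add: Dd_def)
   show "Dd t x y + Dd t y z + Dd t z x = oriented_chain (od t) [x, y, z]" if "t \<in> T" "{x, y, z} \<in> Kh" for t x y z
    using D(4)[OF that] that by (simp add: Dd_def)
   show "dw t x' y' = w x' y' x y + w x' y' y z + w x' y' z x" if "od t = [x, y, z]" for x y z t
    unfolding dw_def that w_def by simp
   show "{x', y'} \<in> Kh" using that by (auto simp: E_def Kh)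
  qed (use od T_def in auto)
  moreover have "(\<Sum>t\<in>T. dw t x' y' * Dd t x' y') = (\<Sum>t\<in>T. dw t x' y' * D t x' y')" by (simp add: Dd_def)
  ultimately show ?thesis unfolding ze_def xx_def Pr_def by (simp add: w_def)
 qed
 have sumE: "(\<Sum>(x, y)\<in>E. g x y) = (\<Sum>x\<in>V. \<Sum>y\<in>V. g x y)" if "!!x y. x \<in> V ==> y \<in> V ==> (x, y) \<notin> E ==> g x y = 0" for g :: "'v => 'v => rat"
  unfolding sum.cartesian_product using that EV by (intro sum.mono_neutral_left) (auto simp: finV)
 have notE: "{x, y} \<notin> K \<or> x = y \<or> {x, y} \<in> L" if "(x, y) \<notin> E" for x y using that by (auto simp: E_def)
 have Pr_rec: "Pr x' y' v = Pr x' y' (par v) + f1 (par v) v x' y'" if "v \<in> V" for x' y' v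
  using prim(2)[OF that] by (simp add: Pr_def w_def)
 have Pr_root: "Pr x' y' om = 0" for x' y' by (simp add: Pr_def prim(1))
 have Pr_swap: "Pr y' x' v = - Pr x' y' v" if "v \<in> V" for x' y' v unfolding Pr_def[of y' x']
 proof (rule prim_eq[OF _ _ that])
  fix v assume "v \<in> V"
  thus "- Pr x' y' v = - Pr x' y' (par v) + w y' x' (par v) v"
   unfolding w_def using Pr_rec[of v x' y'] anti2[of "par v" v y' x'] by linarith
 qed (simp add: Pr_root)
 have f1_diag: "f1 x y z z = 0" for x y z using anti2[of x y z z] by simp
 have Pr_diag: "Pr z z v = 0" if "v \<in> V" for z v using Pr_swap[OF that, of z z] by simp
 have Pr_0: "Pr x' y' v = 0" if "v \<in> V" "{x', y'} \<notin> K" for x' y' v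
  unfolding Pr_def using that f10 by (intro prim_eq[of "\<lambda>v. 0"]) (simp_all add: w_def)
 have Pr_L: "Pr x' y' v = 0" if "{v} \<in> L" for x' y' v unfolding Pr_def by (rule prim_L[OF _ that]) (simp add: w_def f10)
 have omK: "{om, v} \<notin> K" "{v, om} \<notin> K" for v using om V by auto
 have xx0: "xx i x y = 0" if "x = y \<or> {x, y} \<in> L" for i x y
 proof (cases "x = y")
  case True
  have "eps i (lam x x) = eps i (- lam x x)" using lam_anti[of x x] by simp
  thus ?thesis using True by (simp add: xx_def)
 qed (use that lam_L in \<open>simp add: xx_def\<close>)
 \<comment> \<open>For fixed \<open>y'\<close> outside \<open>L\<close>, the primitives summed over
   \<open>x'\<close> have the same increments along the tree as the indicator of
   \<open>ps v = y'\<close>, by the boundary formula. At the vertex \<open>y'\<close> this gives 1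
   exactly if it is fixed.\<close>
 have part1: "(\<Sum>(x', y')\<in>E. Pr x' y' y' - Pr x' y' x') = 2 * of_nat (card {v \<in> V. {v} \<notin> L \<and> ps v = v})"
 proof -
  have E0: "Pr x y y = 0" if "x \<in> V" "y \<in> V" "(x, y) \<notin> E" for x y
   using notE[OF that(3)] Pr_0[OF that(2), of x y] Pr_diag[OF that(2), of y] Pr_L[of y x y] L_edge[of x y] by auto
  have sE: "(\<Sum>(x', y')\<in>E. Pr x' y' y') = (\<Sum>x'\<in>V. \<Sum>y'\<in>V. Pr x' y' y')" by (rule sumE) (rule E0)
  have "(\<Sum>(x', y')\<in>E. Pr x' y' x') = (\<Sum>x'\<in>V. \<Sum>y'\<in>V. Pr x' y' x')"
  proof (rule sumE)
   show "Pr x y x = 0" if "x \<in> V" "y \<in> V" "(x, y) \<notin> E" for x y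
    using E0[of y x] that Pr_swap[of x y x] by (auto simp: E_def insert_commute)
  qed
  also have "... = (\<Sum>y'\<in>V. \<Sum>x'\<in>V. Pr x' y' x')" by (rule sum.swap)
  also have "... = (\<Sum>y'\<in>V. \<Sum>x'\<in>V. - Pr y' x' x')" by (intro sum.cong refl Pr_swap)
  also have "... = - (\<Sum>(x', y')\<in>E. Pr x' y' y')" unfolding sE by (simp add: sum_negf)
  finally have "(\<Sum>(x', y')\<in>E. Pr x' y' y' - Pr x' y' x') = 2 * (\<Sum>(x', y')\<in>E. Pr x' y' y')"
   by (simp add: sum_subtractf case_prod_beta)
  also have "(\<Sum>(x', y')\<in>E. Pr x' y' y') = (\<Sum>y'\<in>V. \<Sum>x'\<in>V. Pr x' y' y')" unfolding sE by (rule sum.swap)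
  also have "... = (\<Sum>y'\<in>V. of_bool ({y'} \<notin> L \<and> ps y' = y'))"
  proof (rule sum.cong[OF refl])
   fix y' assume y': "y' \<in> V"
   show "(\<Sum>x'\<in>V. Pr x' y' y') = of_bool ({y'} \<notin> L \<and> ps y' = y')"
   proof (cases "{y'} \<in> L")
    case True
    thus ?thesis using Pr_L by simp
   next
    case False
    let ?Q = "\<lambda>v. if v = om then 0 else of_bool (ps v = y')"
    have "(\<Sum>x'\<in>V. Pr x' y' v) = ?Q v" if "v \<in> V" for v
    proof (rule primitive_unique[OF _ _ that])
     show "(\<Sum>x'\<in>V. Pr x' y' om) = ?Q om" by (simp add: Pr_root)
     fix v assume v: "v \<in> V"
     hence vw: "v ~= om" using om by auto
     have "(\<Sum>x'\<in>V. Pr x' y' v) - (\<Sum>x'\<in>V. Pr x' y' (par v)) = (\<Sum>x'\<in>V. f1 (par v) v x' y')"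
      unfolding sum_subtractf[symmetric] using Pr_rec[OF v] by simp
     also have "... = ?Q v - ?Q (par v)"
     proof (cases "par v = om")
      case True
      thus ?thesis using f10 omK psL[OF par_root[OF v True]] False by auto
     next
      case False
      thus ?thesis using bd[OF par_edge[OF v False]] vw by simp
     qed
     finally show "(\<Sum>x'\<in>V. Pr x' y' v) - (\<Sum>x'\<in>V. Pr x' y' (par v)) = ?Q v - ?Q (par v)" .
    qed
    from this[OF y'] show ?thesis using False y' om by auto
   qed
  qed
  also have "... = (\<Sum>v\<in>{v \<in> V. {v} \<notin> L \<and> ps v = v}. 1)"
   unfolding of_bool_def by (rule sum.inter_filter[OF finV, symmetric])
  also have "... = of_nat (card {v \<in> V. {v} \<notin> L \<and> ps v = v})" by simp
  finally show ?thesis .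
 qed
 have part2: "(\<Sum>(x', y')\<in>E. \<Sum>t\<in>T. dw t x' y' * D t x' y') = 2 * (\<Sum>t\<in>TK. f2 (ord t) (ord t))"
 proof -
  have "(\<Sum>(x', y')\<in>E. \<Sum>t\<in>T. dw t x' y' * D t x' y') = (\<Sum>t\<in>T. \<Sum>(x', y')\<in>E. dw t x' y' * D t x' y')"
   unfolding case_prod_beta by (rule sum.swap)
  also have "... = (\<Sum>t\<in>TK. \<Sum>(x', y')\<in>E. dw t x' y' * D t x' y')"
  proof (rule sum.mono_neutral_right[OF finT TKT], intro ballI sum.neutral)
   \<comment> \<open>A triangle of the cone has its sides in \<open>L\<close> or at
     \<open>om\<close>; since \<open>L\<close> is carried into \<open>L\<close>, no side reaches an
     edge of \<open>E\<close>.\<close>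
   fix t e assume t: "t \<in> T - TK" and e: "e \<in> E"
   obtain x' y' where xy: "e = (x', y')" by fastforce
   obtain s where s: "s \<in> L" "t = insert om s" using t by (auto simp: Kh T_def TK_def)
   have z: "f1 a b x' y' = 0" if "a \<in> t" "b \<in> t" for a b
   using f10 omK that s scomplexD[OF scL s(1)] rel e xy by (fastforce simp: E_def)
   obtain a b c where "od t = [a, b, c]" using od3 t by blast
   moreover have "set (od t) = t" using od t by blast
   ultimately have "dw t x' y' = 0" unfolding dw_def by (auto simp: z)
   thus "(case e of (x', y') => dw t x' y' * D t x' y') = 0" using xy by simp
  qed
  also have "... = (\<Sum>t\<in>TK. 2 * f2 (ord t) (ord t))"
  proof (rule sum.cong[OF refl])
   fix t assume t: "t \<in> TK"
   hence tT: "t \<in> T" and tK: "t \<in> K" using TKT by (auto simp: TK_def)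
   obtain a b c where abc: "od t = [a, b, c]" using od3[OF tT] by blast
   have st: "set [a, b, c] = t" "distinct [a, b, c]" using od[OF tT] abc by auto
   hence abcK: "{a, b, c} \<in> K" using tK by simp
   have "(\<Sum>(x', y')\<in>E. dw t x' y' * D t x' y') = (\<Sum>x\<in>V. \<Sum>y\<in>V. dw t x y * D t x y)"
   proof (rule sumE)
    fix x y assume xy: "x \<in> V" "y \<in> V" "(x, y) \<notin> E"
    have "D t x y = 0"
    proof (cases "{x, y} \<in> K")
     case False
     thus ?thesis using D(3)[OF tT] Kh_K[of "{x, y}"] xy om by auto
    next
     case True
     show ?thesis
     proof (cases "x = y")
      case True thus ?thesis using D(2)[OF tT, of x x] by simp
     next
      case False
      hence L: "{x, y} \<in> L" using notE[OF xy(3)] True by blast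
      \<comment> \<open>The cone triangle over the edge is different from \<open>t\<close>, and its
        two other sides belong to the graph, where \<open>D t\<close> is 0.\<close>
      hence K: "{om, x, y} \<in> Kh" unfolding Kh by blast
      show ?thesis using D(4)[OF tT K] oriented_chain_nonzero(1)[of "od t" "[om, x, y]"] od[OF tT] tK om V D(1)[OF tT cone_edge] D(2)[OF tT, of om y] L_edge[OF L] by fastforce
     qed
    qed
    thus "dw t x y * D t x y = 0" by simp
   qed
   also have "... = (\<Sum>x\<in>V. \<Sum>y\<in>V. \<Sum>z\<in>V. f2 [a, b, c] [z, x, y] * D t x y)"
    unfolding sum_distrib_right[symmetric] using tri[OF st(2) abcK] by (simp add: dw_def abc)
   also have "... = 2 * f2 [a, b, c] [a, b, c]"
   proof (rule sum_over_triangles[where F = "f2 [a, b, c]" and D = "D t", OF alt f20 _ st(2) abcK])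
    show "D t x y + D t y z + D t z x = oriented_chain [a, b, c] [x, y, z]" if "{x, y, z} \<in> K" for x y z
     using D(4)[OF tT, of x y z] that unfolding abc Kh by blast
   qed
   finally show "(\<Sum>(x', y')\<in>E. dw t x' y' * D t x' y') = 2 * f2 (ord t) (ord t)" using abc tK by (simp add: od_def)
  qed
  finally show ?thesis by (simp add: sum_distrib_left)
 qed
 \<comment> \<open>Against the exponents of the labels, the primitives at \<open>v\<close> sum to
   \<open>2 * q i v\<close>, again by comparing increments along the tree. So at the generator edge
   with index \<open>i\<close> the terms in \<open>q\<close> cancel and only
   \<open>r i (gen i)\<close> is left.\<close>
 have part3: "(\<Sum>(x', y')\<in>E. \<Sum>i<n. ze i x' y' * xx i x' y') = 2 * (\<Sum>i<n. r i (gen i))"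
 proof -
  have "(\<Sum>(x', y')\<in>E. \<Sum>i<n. ze i x' y' * xx i x' y') = (\<Sum>i<n. \<Sum>(x', y')\<in>E. ze i x' y' * xx i x' y')"
   unfolding case_prod_beta by (rule sum.swap)
  also have "... = (\<Sum>i<n. 2 * r i (gen i))"
  proof (rule sum.cong[OF refl])
   fix i assume "i \<in> {..<n}"
   hence i: "i < n" by simp
   have st: "src i \<in> V" "tgt i \<in> V" using KV[OF gens_K[OF i]] by auto
   have "(\<Sum>(x', y')\<in>E. ze i x' y' * xx i x' y') = (\<Sum>x\<in>V. \<Sum>y\<in>V. ze i x y * xx i x y)"
   proof (rule sumE)
    fix x y assume xy: "x \<in> V" "y \<in> V" "(x, y) \<notin> E"
    show "ze i x y * xx i x y = 0" using xx0[of x y i] notE[OF xy(3)] f10 Pr_0 st by (auto simp: ze_def)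
   qed
   also have "... = (\<Sum>x\<in>V. \<Sum>y\<in>V. f1 (src i) (tgt i) x y * xx i x y) - (\<Sum>x\<in>V. \<Sum>y\<in>V. Pr x y (tgt i) * xx i x y) + (\<Sum>x\<in>V. \<Sum>y\<in>V. Pr x y (src i) * xx i x y)"
    unfolding ze_def by (simp add: algebra_simps sum.distrib sum_subtractf)
   also have "(\<Sum>x\<in>V. \<Sum>y\<in>V. f1 (src i) (tgt i) x y * xx i x y) = 2 * (q i (tgt i) + r i (gen i) - q i (src i))"
    using qr[OF i gens_K[OF i]] lam_gen[OF i] by (simp add: xx_def)
   also have P: "(\<Sum>x\<in>V. \<Sum>y\<in>V. Pr x y v * xx i x y) = (if v = om then 0 else 2 * q i v)" (is "?P v = ?Q v") if "v \<in> V" for v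
   proof (rule primitive_unique[OF _ _ that])
    show "?P om = ?Q om" by (simp add: Pr_root)
    fix v assume v: "v \<in> V"
    hence vw: "v ~= om" using om by auto
    have "?P v - ?P (par v) = (\<Sum>x\<in>V. \<Sum>y\<in>V. f1 (par v) v x y * xx i x y)"
     unfolding sum_subtractf[symmetric] left_diff_distrib[symmetric] using Pr_rec[OF v] by simp
    also have "... = ?Q v - ?Q (par v)"
    proof (cases "par v = om")
     case True
     thus ?thesis using qL[OF par_root[OF v True]] f10 omK by simp
    next
     case False
     show ?thesis using qr[OF i par_edge[OF v False]] False vw r0 lam_anti[of "par v" v] lam_tree[OF v] by (simp add: xx_def)
    qed
    finally show "?P v - ?P (par v) = ?Q v - ?Q (par v)" .
   qed
   note P[OF st(2)] also note P[OF st(1)]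
   finally show "(\<Sum>(x', y')\<in>E. ze i x' y' * xx i x' y') = 2 * r i (gen i)" using st om by auto
  qed
  finally show ?thesis by (simp add: sum_distrib_left)
 qed
 have "(\<Sum>(x', y')\<in>E. f1 x' y' x' y') = (\<Sum>(x', y')\<in>E. Pr x' y' y' - Pr x' y' x' + (\<Sum>t\<in>T. dw t x' y' * D t x' y') + (\<Sum>i<n. ze i x' y' * xx i x' y'))"
  using main by (intro sum.cong refl) auto
 also have "... = (\<Sum>(x', y')\<in>E. Pr x' y' y' - Pr x' y' x') + (\<Sum>(x', y')\<in>E. \<Sum>t\<in>T. dw t x' y' * D t x' y') + (\<Sum>(x', y')\<in>E. \<Sum>i<n. ze i x' y' * xx i x' y')"
  unfolding case_prod_beta by (simp only: sum.distrib)
 finally show ?thesis unfolding part1 part2 part3 E_def[symmetric] TK_def[symmetric] by (simp add: field_simps)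
qed

end

section \<open>The chain map of a simplicial approximation\<close>

lemma chain_swap:
 assumes c: "c \<in> simplicial_chains K p" and ij: "i < length xs" "j < length xs" "i ~= j"
 shows "c (xs[i := xs ! j, j := xs ! i]) = - c xs"
proof (cases "distinct xs")
 case True
 have "map (Transposition.transpose (xs ! i) (xs ! j)) xs = xs[i := xs ! j, j := xs ! i]"
 proof (rule nth_equalityI)
  fix k assume "k < length (map (Transposition.transpose (xs ! i) (xs ! j)) xs)"
  hence k: "k < length xs" by simp
  show "map (Transposition.transpose (xs ! i) (xs ! j)) xs ! k = xs[i := xs ! j, j := xs ! i] ! k"
   using k ij True by (auto simp: Transposition.transpose_def nth_eq_iff_index_eq)
 qed simp
 moreover have "Transposition.transpose (xs ! i) (xs ! j) permutes set xs" using ij by (intro transpose_permutes_set) auto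
 hence "c (map (Transposition.transpose (xs ! i) (xs ! j)) xs) = of_int (sign (Transposition.transpose (xs ! i) (xs ! j))) * c xs"
  using c unfolding simplicial_chains_def by blast
 ultimately show ?thesis using True ij by (simp add: sign_swap_id nth_eq_iff_index_eq)
next
 case False
 hence "\<not> distinct (xs[i := xs ! j, j := xs ! i])" using ij by simp
 moreover have "c ys = 0" if "\<not> distinct ys" for ys using c that unfolding simplicial_chains_def by blast
 ultimately show ?thesis using False by simp
qed

lemma swap_swap:
 assumes "i < length xs" "j < length xs"
 shows "(xs[i := xs ! j, j := xs ! i])[i := xs[i := xs ! j, j := xs ! i] ! j, j := xs[i := xs ! j, j := xs ! i] ! i] = xs"
 using assms by (intro nth_equalityI) (auto simp: nth_list_update)

definition tuples :: "'v set set => nat => 'v list set"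
 where "tuples K' m = {xs. set xs \<subseteq> \<Union>K' \<and> length xs = m}"

text \<open>The induced chain map without the restrictions to simplices and to distinct image
  vertices. Degenerate terms cancel by antisymmetry (\<open>push_swap\<close>), and compatibility
  with the boundary becomes a regrouping of sums.\<close>

definition push :: "'v set set => ('v => 'w) => 'v chain => 'w chain"
 where "push K' ps c ys = (\<Sum>xs | xs \<in> tuples K' (length ys) \<and> map ps xs = ys. c xs)"

lemma finite_tuples: "finite (\<Union>K') ==> finite (tuples K' m)" unfolding tuples_def by (rule finite_lists_length_eq)

lemma push_swap:
 assumes c: "c \<in> simplicial_chains K' p" and ij: "i < length ys" "j < length ys" "i ~= j"
 shows "push K' ps c (ys[i := ys ! j, j := ys ! i]) = - push K' ps c ys"
proof -
 let ?sw = "\<lambda>xs. xs[i := xs ! j, j := xs ! i]"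
 have fwd: "?sw xs \<in> tuples K' (length ys) \<and> map ps (?sw xs) = ?sw (map ps xs)" if "xs \<in> tuples K' (length ys)" for xs
  using that ij by (auto simp: tuples_def map_update)
 have "push K' ps c (?sw ys) = (\<Sum>xs | xs \<in> tuples K' (length ys) \<and> map ps xs = ys. c (?sw xs))"
  unfolding push_def
 proof (rule sum.reindex_bij_witness[where i = ?sw and j = ?sw])
  fix xs assume a: "xs \<in> {xs. xs \<in> tuples K' (length (?sw ys)) \<and> map ps xs = ?sw ys}"
  hence l: "length xs = length ys" by (simp add: tuples_def)
  show "?sw (?sw xs) = xs" using ij l by (intro swap_swap) auto
  show "?sw xs \<in> {xs. xs \<in> tuples K' (length ys) \<and> map ps xs = ys}"
   using a fwd[of xs] swap_swap[of i ys j] ij by simp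
 next
  fix xs assume a: "xs \<in> {xs. xs \<in> tuples K' (length ys) \<and> map ps xs = ys}"
  hence l: "length xs = length ys" by (simp add: tuples_def)
  show "?sw (?sw xs) = xs" using ij l by (intro swap_swap) auto
  show "?sw xs \<in> {xs. xs \<in> tuples K' (length (?sw ys)) \<and> map ps xs = ?sw ys}" using a fwd[of xs] by simp
 next
  fix xs assume a: "xs \<in> {xs. xs \<in> tuples K' (length (?sw ys)) \<and> map ps xs = ?sw ys}"
  hence l: "length xs = length ys" by (simp add: tuples_def)
  show "c (?sw (?sw xs)) = c xs" using swap_swap[of i xs j] ij l by simp
 qed
 also have "... = (\<Sum>xs | xs \<in> tuples K' (length ys) \<and> map ps xs = ys. - c xs)"
  using ij by (intro sum.cong refl chain_swap[OF c]) (auto simp: tuples_def)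
 also have "... = - push K' ps c ys" by (simp add: push_def sum_negf)
 finally show ?thesis .
qed

lemma induced_chain_map_eq_push:
 assumes c: "c \<in> simplicial_chains K' p" and fin: "finite (\<Union>K')"
 shows "induced_chain_map K' ps c ys = push K' ps c ys"
proof (cases "distinct ys")
 case True
 have "c xs ~= 0 ==> set xs \<in> K'" for xs using c unfolding simplicial_chains_def by blast
 hence "(\<Sum>xs | set xs \<in> K' \<and> length xs = length ys \<and> map ps xs = ys. c xs) = push K' ps c ys"
  unfolding push_def by (intro sum.mono_neutral_left finite_subset[OF _ finite_tuples[OF fin, of "length ys"]]) (auto simp: tuples_def)
 thus ?thesis using True by (simp add: induced_chain_map_def)
next
 case False
 then obtain i j where ij: "i < length ys" "j < length ys" "i ~= j" "ys ! i = ys ! j" by (auto simp: distinct_conv_nth)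
 hence "ys[i := ys ! j, j := ys ! i] = ys" by (simp add: list_update_id) (metis list_update_id)
 thus ?thesis using False push_swap[OF c ij(1-3), of ps] by (simp add: induced_chain_map_def)
qed

lemma push_boundary:
 assumes fin: "finite (\<Union>K')" "finite W" and ps: "!!v. v \<in> \<Union>K' ==> ps v \<in> W"
 shows "(\<Sum>x\<in>W. push K' ps c (x # ys)) = push K' ps (simplicial_boundary K' c) ys"
proof -
 let ?A = "{xs. xs \<in> tuples K' (length ys) \<and> map ps xs = ys}"
 have finA: "finite ?A" using finite_tuples[OF fin(1)] by simp
 have "push K' ps c (x # ys) = (\<Sum>(a, xs)\<in>{a \<in> \<Union>K'. ps a = x} \<times> ?A. c (a # xs))" for x
  unfolding push_def by (rule sum.reindex_bij_witness[where i = "\<lambda>(a, xs). a # xs" and j = "\<lambda>xs. (hd xs, tl xs)"])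
   (auto simp: tuples_def Suc_length_conv)
 also have "...x = (\<Sum>a | a \<in> \<Union>K' \<and> ps a = x. \<Sum>xs\<in>?A. c (a # xs))" for x
  by (simp add: sum.cartesian_product)
 finally have "(\<Sum>x\<in>W. push K' ps c (x # ys)) = (\<Sum>x\<in>W. \<Sum>a | a \<in> \<Union>K' \<and> ps a = x. \<Sum>xs\<in>?A. c (a # xs))" by simp
 also have "... = (\<Sum>a\<in>\<Union>K'. \<Sum>xs\<in>?A. c (a # xs))" using fin ps by (intro sum.group) auto
 also have "... = push K' ps (simplicial_boundary K' c) ys" unfolding push_def simplicial_boundary_def by (rule sum.swap)
 finally show ?thesis .
qed

lemma oriented_chain_1: "oriented_chain [v] ys = of_bool (ys = [v])"
 using oriented_chain_nonzero[of "[v]" ys] oriented_chain_self[of "[v]"] by (cases ys) auto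

lemma boundary_edge:
 assumes "u ~= v" "finite (\<Union>K)" "u \<in> \<Union>K" "v \<in> \<Union>K"
 shows "simplicial_boundary K (oriented_chain [u, v]) = (\<lambda>ys. 1 * oriented_chain [v] ys + (-1) * oriented_chain [u] ys)"
proof
 fix ys
 have m: "oriented_chain [u, v] \<in> simplicial_chains {{u, v}} 1" using assms by (intro oriented_chain_in_chains) auto
 have 1: "oriented_chain [u, v] [u, v] = 1" using assms by (intro oriented_chain_self) auto
 have 2: "oriented_chain [u, v] [v, u] = -1" using chain_swap2[OF m, of v u] 1 by simp
 have 0: "oriented_chain [u, v] (w # ys) = of_bool (w = u \<and> ys = [v]) - of_bool (w = v \<and> ys = [u])" for w
 proof (cases "oriented_chain [u, v] (w # ys) = 0")
  case True
  thus ?thesis using 1 2 by auto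
 next
  case False
  show ?thesis using 1 2 assms(1) oriented_chain_nonzero[OF False] assms by (fastforce simp: length_Suc_conv)
 qed
 have s: "(\<Sum>w\<in>\<Union>K. of_bool (w = x \<and> P) :: rat) = of_bool P" if "x \<in> \<Union>K" for x P
  using assms(2) that by (cases P) (simp_all add: of_bool_def)
 show "simplicial_boundary K (oriented_chain [u, v]) ys = 1 * oriented_chain [v] ys + (-1) * oriented_chain [u] ys"
  unfolding simplicial_boundary_def 0 oriented_chain_1 sum_subtractf s[OF assms(3)] s[OF assms(4)] by simp
qed

lemma boundary_triangle:
 assumes d: "distinct [u, v, w]" and fin: "finite (\<Union>K)" and K: "{u, v, w} \<subseteq> \<Union>K"
 shows "simplicial_boundary K (oriented_chain [u, v, w]) =
  (\<lambda>ys. 1 * oriented_chain [u, v] ys + 1 * (1 * oriented_chain [v, w] ys + 1 * oriented_chain [w, u] ys))"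
proof
 fix ys
 let ?o = "oriented_chain [u, v, w]"
 have "?o \<in> simplicial_chains {{u, v, w}} 2" using assms by (intro oriented_chain_in_chains) auto
 note sw = chain_swap3[OF this]
 have 2: "oriented_chain [a, b] ys = of_bool (ys = [a, b]) - of_bool (ys = [b, a])" if "a ~= b" for a b :: 'a
 proof (cases "oriented_chain [a, b] ys = 0")
  case True
  have m: "oriented_chain [a, b] \<in> simplicial_chains {{a, b}} 1" using that by (intro oriented_chain_in_chains) auto
  have "oriented_chain [a, b] [a, b] = 1" using that by (intro oriented_chain_self) auto
  thus ?thesis using True chain_swap2[OF m, of b a] by auto
 next
  case False
  have m: "oriented_chain [a, b] \<in> simplicial_chains {{a, b}} 1" using that by (intro oriented_chain_in_chains) auto
  have 1: "oriented_chain [a, b] [a, b] = 1" using that by (intro oriented_chain_self) auto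
  hence 2: "oriented_chain [a, b] [b, a] = -1" using chain_swap2[OF m, of b a] by simp
  have z: "set ys = {a, b}" "length ys = 2" "distinct ys" using oriented_chain_nonzero[OF False] that by auto
  thus ?thesis using 1 2 that z by (fastforce simp: numeral_2_eq_2 length_Suc_conv)
 qed
 have o1: "?o [u, v, w] = 1" by (rule oriented_chain_self[OF d])
 have o2: "?o [v, u, w] = -1" using sw(1)[of v u w] o1 by simp
 have o3: "?o [u, w, v] = -1" using sw(2)[of u w v] o1 by simp
 have o4: "?o [v, w, u] = 1" using sw(2)[of v w u] o2 by simp
 have o5: "?o [w, u, v] = 1" using sw(1)[of w u v] o3 by simp
 have o6: "?o [w, v, u] = -1" using sw(2)[of w v u] o5 by simp
 have "?o (x # ys) = of_bool (x = w \<and> ys = [u, v]) - of_bool (x = w \<and> ys = [v, u]) + (of_bool (x = u \<and> ys = [v, w]) - of_bool (x = u \<and> ys = [w, v]))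
  + (of_bool (x = v \<and> ys = [w, u]) - of_bool (x = v \<and> ys = [u, w]))" for x
 proof (cases "x # ys \<in> {[u, v, w], [v, u, w], [u, w, v], [v, w, u], [w, u, v], [w, v, u]}")
  case True
  thus ?thesis using d by (elim insertE emptyE) (simp_all add: o1 o2 o3 o4 o5 o6)
 next
  case False
  have "?o (x # ys) = 0"
  proof (rule ccontr)
   assume nz: "?o (x # ys) ~= 0"
   have z: "insert x (set ys) = {u, v, w}" "length ys = 2" "distinct (x # ys)" using oriented_chain_nonzero[OF nz] d by simp_all
   obtain y1 y2 where y: "ys = [y1, y2]" using z(2) by (auto simp: numeral_2_eq_2 length_Suc_conv)
   have "x \<in> {u, v, w}" "y1 \<in> {u, v, w}" "y2 \<in> {u, v, w}" using z(1) unfolding y by auto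
   hence "x # ys \<in> {[u, v, w], [v, u, w], [u, w, v], [v, w, u], [w, u, v], [w, v, u]}"
    using z(3) unfolding y by (elim insertE emptyE) simp_all
   thus False using False by blast
  qed
  moreover have "\<not> (x = w \<and> ys = [u, v])" "\<not> (x = w \<and> ys = [v, u])" "\<not> (x = u \<and> ys = [v, w])" "\<not> (x = u \<and> ys = [w, v])"
   "\<not> (x = v \<and> ys = [w, u])" "\<not> (x = v \<and> ys = [u, w])" using False by blast+
  ultimately show ?thesis by (simp only: of_bool_eq)
 qed
 hence e: "(\<Sum>x\<in>\<Union>K. ?o (x # ys)) = (\<Sum>x\<in>\<Union>K. of_bool (x = w \<and> ys = [u, v]) - of_bool (x = w \<and> ys = [v, u]) + (of_bool (x = u \<and> ys = [v, w]) - of_bool (x = u \<and> ys = [w, v]))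
  + (of_bool (x = v \<and> ys = [w, u]) - of_bool (x = v \<and> ys = [u, w])))" by (rule sum.cong[OF refl])
 have s: "(\<Sum>w\<in>\<Union>K. of_bool (w = x \<and> P) :: rat) = of_bool P" if "x \<in> \<Union>K" for x P
  using fin that by (cases P) (simp_all add: of_bool_def)
 have ne: "u ~= v" "v ~= w" "w ~= u" and m: "u \<in> \<Union>K" "v \<in> \<Union>K" "w \<in> \<Union>K" using d K by auto
 show "simplicial_boundary K ?o ys = 1 * oriented_chain [u, v] ys + 1 * (1 * oriented_chain [v, w] ys + 1 * oriented_chain [w, u] ys)"
  unfolding simplicial_boundary_def e sum.distrib sum_subtractf s[OF m(1)] s[OF m(2)] s[OF m(3)] 2[OF ne(1)] 2[OF ne(2)] 2[OF ne(3)] by simp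
qed

locale approximated_complex =
 fixes k :: nat and K K' :: complex_of_points and ps :: "(nat => real) => nat => real"
  and sd :: "nat => (nat => real) chain => (nat => real) chain"
 assumes gK: "geometric_complex k K" and sub: "subdivision_of k K' K" and smap: "simplicial_map K' K ps" and sd: "subdivision_operator K K' sd"
begin

lemma gK': "geometric_complex k K'" using sub by (simp add: subdivision_of_def)

lemma finite_vertices: "finite (\<Union>K)" "finite (\<Union>K')" using gK gK' by (auto simp: geometric_complex_def)

lemma ps_vertex: assumes "v \<in> \<Union>K'" shows "ps v \<in> \<Union>K"
proof -
 obtain s where "s \<in> K'" "v \<in> s" using assms by blast
 hence "ps ` s \<in> K" "ps v \<in> ps ` s" using smap by (auto simp: simplicial_map_def)
 thus ?thesis by blast
qed

lemma face: "s \<in> K ==> t \<subseteq> s ==> t ~= {} ==> t \<in> K"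
 using gK unfolding geometric_complex_def by (elim conjE) blast

lemma sd_chains: "c \<in> simplicial_chains K p ==> sd p c \<in> simplicial_chains K' p"
 and sd_linear: "c \<in> simplicial_chains K p ==> d \<in> simplicial_chains K p ==>
  sd p (\<lambda>xs. a * c xs + b * d xs) = (\<lambda>xs. a * sd p c xs + b * sd p d xs)"
 and sd_boundary: "c \<in> simplicial_chains K (Suc p) ==> simplicial_boundary K' (sd (Suc p) c) = sd p (simplicial_boundary K c)"
 and sd_aug: "c \<in> simplicial_chains K 0 ==> augmentation K' (sd 0 c) = augmentation K c"
 and sd_carrier: "distinct xs ==> set xs \<in> K ==> length xs = Suc p ==> sd p (oriented_chain xs) ys ~= 0
   ==> convex hull (set ys) \<subseteq> convex hull (set xs)" using sd unfolding subdivision_operator_def by blast+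

text \<open>The carrier condition allows only the vertex itself, and the augmentation fixes its
  coefficient to 1. That \<open>v\<close> is a vertex of \<open>K'\<close> comes out of the same
  computation.\<close>

lemma sd_vertex:
 assumes "{v} \<in> K" shows "v \<in> \<Union>K'" "sd 0 (oriented_chain [v]) ys = of_bool (ys = [v])"
proof -
 have oc: "oriented_chain [v] \<in> simplicial_chains K 0" using assms by (intro oriented_chain_in_chains) auto
 note m = sd_chains[OF oc]
 have 0: "sd 0 (oriented_chain [v]) ys = 0" if "ys ~= [v]" for ys
 proof (rule ccontr)
  assume nz: "sd 0 (oriented_chain [v]) ys ~= 0"
  then obtain w where w: "ys = [w]" using m by (auto simp: length_Suc_conv simplicial_chains_def)
  have "convex hull (set ys) \<subseteq> convex hull (set [v])" by (rule sd_carrier[OF _ _ _ nz]) (use assms in auto)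
  thus False using w that by simp
 qed
 have s: "(\<Sum>w\<in>X. of_bool (w = v) :: rat) = of_bool (v \<in> X)" if "finite X" for X using that by simp
 have "augmentation K (oriented_chain [v]) = (\<Sum>w\<in>\<Union>K. of_bool (w = v))" by (simp add: augmentation_def oriented_chain_1)
 also have "... = 1" using s[OF finite_vertices(1)] assms by auto
 finally have 1: "(\<Sum>w\<in>\<Union>K'. sd 0 (oriented_chain [v]) [w]) = 1" using sd_aug[OF oc] by (simp add: augmentation_def)
 have "(\<Sum>w\<in>\<Union>K'. sd 0 (oriented_chain [v]) [w]) = (\<Sum>w\<in>\<Union>K'. if w = v then sd 0 (oriented_chain [v]) [v] else 0)"
  using 0 by (intro sum.cong refl) auto
 also have "... = (if v \<in> \<Union>K' then sd 0 (oriented_chain [v]) [v] else 0)" by (rule sum.delta[OF finite_vertices(2)])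
 finally have "v \<in> \<Union>K' \<and> sd 0 (oriented_chain [v]) [v] = 1" using 1 by (auto split: if_splits)
 thus "v \<in> \<Union>K'" "sd 0 (oriented_chain [v]) ys = of_bool (ys = [v])" using 0[of ys] by auto
qed

text \<open>The columns of \<open>simplicial_matrix\<close>, with the degree read off from the
  length of the list.\<close>

definition img :: "(nat => real) list => (nat => real) chain"
 where "img xs = induced_chain_map K' ps (sd (length xs - 1) (oriented_chain xs))"

lemma img_eq_push:
 assumes "distinct xs" "set xs \<in> K" "xs ~= []"
 shows "img xs ys = push K' ps (sd (length xs - 1) (oriented_chain xs)) ys" unfolding img_def using assms
 by (intro induced_chain_map_eq_push[OF sd_chains finite_vertices(2)] oriented_chain_in_chains) auto

lemma img_chain:
 assumes "distinct xs" "set xs \<in> K" "xs ~= []" "i < length ys" "j < length ys" "i ~= j"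
 shows "img xs (ys[i := ys ! j, j := ys ! i]) = - img xs ys" unfolding img_eq_push[OF assms(1-3)] using assms
 by (intro push_swap[OF sd_chains] oriented_chain_in_chains) auto

lemma img_support:
 assumes "distinct xs" "set xs \<in> K" "xs ~= []" "img xs ys ~= 0"
 obtains zs where "set zs \<in> K'" "length zs = length ys" "map ps zs = ys" "convex hull (set zs) \<subseteq> convex hull (set xs)"
proof -
 have "sum (sd (length xs - 1) (oriented_chain xs)) {zs. set zs \<in> K' \<and> length zs = length ys \<and> map ps zs = ys} ~= 0"
  using assms(4) unfolding img_def induced_chain_map_def by (simp split: if_splits)
 from sum.not_neutral_contains_not_neutral[OF this]
 obtain zs where zs: "set zs \<in> K'" "length zs = length ys" "map ps zs = ys" "sd (length xs - 1) (oriented_chain xs) zs ~= 0"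
  by auto
 have "convex hull (set zs) \<subseteq> convex hull (set xs)"
  by (rule sd_carrier[OF assms(1,2) _ zs(4)]) (use assms(3) in \<open>cases xs; simp\<close>)
 thus thesis using that zs by blast
qed

lemma img_vertex:
 assumes "{v} \<in> K" shows "img [v] [w] = of_bool (ps v = w)"
proof -
 have "img [v] [w] = (\<Sum>xs | xs \<in> tuples K' 1 \<and> map ps xs = [w]. of_bool (xs = [v]))"
  using img_eq_push[of "[v]" "[w]"] assms by (simp add: push_def sd_vertex)
 also have "... = (\<Sum>xs | xs \<in> tuples K' 1 \<and> map ps xs = [w]. if xs = [v] then 1 else 0)" by (simp add: of_bool_def)
 also have "... = (if [v] \<in> {xs. xs \<in> tuples K' 1 \<and> map ps xs = [w]} then 1 else 0)"
  by (rule sum.delta) (simp add: finite_tuples[OF finite_vertices(2)])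
 also have "... = of_bool (ps v = w)" using sd_vertex(1)[OF assms] by (simp add: tuples_def)
 finally show ?thesis .
qed

lemma sd_edge_boundary:
 assumes "u ~= v" "{u, v} \<in> K"
 shows "simplicial_boundary K' (sd 1 (oriented_chain [u, v])) ys = of_bool (ys = [v]) - of_bool (ys = [u])"
proof -
 have uv: "{u} \<in> K" "{v} \<in> K" using face[OF assms(2)] by auto
 have m: "oriented_chain [u, v] \<in> simplicial_chains K (Suc 0)" "oriented_chain [u] \<in> simplicial_chains K 0" "oriented_chain [v] \<in> simplicial_chains K 0"
  using assms uv by (auto intro!: oriented_chain_in_chains)
 have "simplicial_boundary K' (sd 1 (oriented_chain [u, v])) = sd 0 (\<lambda>ys. 1 * oriented_chain [v] ys + (-1) * oriented_chain [u] ys)"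
  unfolding One_nat_def sd_boundary[OF m(1)] using uv by (subst boundary_edge[OF assms(1) finite_vertices(1)]) blast+
 thus ?thesis using sd_linear[OF m(3,2), of 1 "-1"] uv by (simp add: sd_vertex)
qed

lemma img_edge_boundary:
 assumes "u ~= v" "{u, v} \<in> K"
 shows "(\<Sum>x\<in>\<Union>K. img [u, v] [x, y]) = of_bool (ps v = y) - of_bool (ps u = y)"
proof -
 have e: "push K' ps (\<lambda>ys. of_bool (ys = [w])) [y] = of_bool (ps w = y)" if "{w} \<in> K" for w
 using sd_vertex img_eq_push[of "[w]" "[y]"] img_vertex that by (simp add: push_def)
 have "(\<Sum>x\<in>\<Union>K. img [u, v] [x, y]) = (\<Sum>x\<in>\<Union>K. push K' ps (sd 1 (oriented_chain [u, v])) [x, y])"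
  using img_eq_push[of "[u, v]"] assms by simp
 also have "... = push K' ps (simplicial_boundary K' (sd 1 (oriented_chain [u, v]))) [y]"
  by (rule push_boundary[OF finite_vertices(2,1) ps_vertex])
 also have "... = push K' ps (\<lambda>ys. of_bool (ys = [v])) [y] - push K' ps (\<lambda>ys. of_bool (ys = [u])) [y]"
  unfolding push_def sum_subtractf[symmetric] sd_edge_boundary[OF assms] ..
 finally show ?thesis using e face[OF assms(2)] by simp
qed

lemma img_triangle_boundary:
 assumes d: "distinct [u, v, w]" and K: "{u, v, w} \<in> K"
 shows "img [u, v] [x, y] + img [v, w] [x, y] + img [w, u] [x, y] = (\<Sum>z\<in>\<Union>K. img [u, v, w] [z, x, y])"
proof -
 have e: "{u, v} \<in> K" "{v, w} \<in> K" "{w, u} \<in> K" using face[OF K] by auto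
 have m: "oriented_chain [u, v, w] \<in> simplicial_chains K (Suc 1)" "oriented_chain [u, v] \<in> simplicial_chains K 1"
  "oriented_chain [v, w] \<in> simplicial_chains K 1" "oriented_chain [w, u] \<in> simplicial_chains K 1"
  using assms e by (auto intro!: oriented_chain_in_chains)
 have mm: "(\<lambda>ys. 1 * oriented_chain [v, w] ys + 1 * oriented_chain [w, u] ys) \<in> simplicial_chains K 1"
 proof -
  have add: "(\<lambda>ys. c ys + c' ys) \<in> simplicial_chains K 1" if c: "c \<in> simplicial_chains K 1" "c' \<in> simplicial_chains K 1" for c c' :: "(nat => real) chain"
   unfolding simplicial_chains_def
  proof (intro CollectI conjI allI impI)
   fix xs assume "c xs + c' xs ~= 0"
   hence "c xs ~= 0 \<or> c' xs ~= 0" by auto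
   thus "distinct xs" "set xs \<in> K" "length xs = Suc 1" using c unfolding simplicial_chains_def by blast+
  next
   fix xs and pm :: "(nat => real) => nat => real" assume "pm permutes set xs"
   hence "c (map pm xs) = of_int (sign pm) * c xs" "c' (map pm xs) = of_int (sign pm) * c' xs"
    using c unfolding simplicial_chains_def by blast+
   thus "c (map pm xs) + c' (map pm xs) = of_int (sign pm) * (c xs + c' xs)" by (simp add: distrib_left)
  qed
  show ?thesis using add[OF m(3,4)] by simp
 qed
 have "simplicial_boundary K' (sd (Suc 1) (oriented_chain [u, v, w])) = sd 1 (simplicial_boundary K (oriented_chain [u, v, w]))"
  by (rule sd_boundary[OF m(1)])
 also have "simplicial_boundary K (oriented_chain [u, v, w]) =
  (\<lambda>ys. 1 * oriented_chain [u, v] ys + 1 * (1 * oriented_chain [v, w] ys + 1 * oriented_chain [w, u] ys))"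
  using K by (intro boundary_triangle[OF d finite_vertices(1)]) blast
 also have "sd 1 ... = (\<lambda>ys. 1 * sd 1 (oriented_chain [u, v]) ys + 1 * (1 * sd 1 (oriented_chain [v, w]) ys + 1 * sd 1 (oriented_chain [w, u]) ys))"
  unfolding sd_linear[OF m(2) mm] sd_linear[OF m(3,4)] ..
 finally have b: "simplicial_boundary K' (sd 2 (oriented_chain [u, v, w])) =
  (\<lambda>ys. sd 1 (oriented_chain [u, v]) ys + sd 1 (oriented_chain [v, w]) ys + sd 1 (oriented_chain [w, u]) ys)" by (simp add: numeral_2_eq_2 add.assoc)
 have "(\<Sum>z\<in>\<Union>K. img [u, v, w] [z, x, y]) = (\<Sum>z\<in>\<Union>K. push K' ps (sd 2 (oriented_chain [u, v, w])) [z, x, y])"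
  using img_eq_push[of "[u, v, w]"] assms by (simp add: numeral_2_eq_2)
 also have "... = push K' ps (simplicial_boundary K' (sd 2 (oriented_chain [u, v, w]))) [x, y]"
  by (rule push_boundary[OF finite_vertices(2,1) ps_vertex])
 also have "... = push K' ps (sd 1 (oriented_chain [u, v])) [x, y] + push K' ps (sd 1 (oriented_chain [v, w])) [x, y] + push K' ps (sd 1 (oriented_chain [w, u])) [x, y]"
  unfolding b push_def sum.distrib ..
 finally show ?thesis using img_eq_push[of "[u, v]"] img_eq_push[of "[v, w]"] img_eq_push[of "[w, u]"] e d by auto
qed

lemma img_swap_source:
 assumes "u ~= v" "{u, v} \<in> K" shows "img [v, u] ys = - img [u, v] ys"
proof -
 have m: "oriented_chain [u, v] \<in> simplicial_chains K 1" using assms by (auto intro!: oriented_chain_in_chains)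
 show ?thesis using sd_linear[OF m m, of "-1" 0] oriented_chain_swap[of u v] assms by (simp add: img_def induced_chain_map_def sum_negf)
qed

text \<open>If \<open>xx\<close> is the coboundary of \<open>g\<close> along the subdivided edge, its value on the image of the edge is read off at the two ends.\<close>

lemma img_edge_potential:
 fixes xx :: "(nat => real) => (nat => real) => rat"
 assumes uv: "u ~= v" "{u, v} \<in> K"
  and pot: "!!a b. {a, b} \<in> K' ==> convex hull {a, b} \<subseteq> convex hull {u, v} ==> xx (ps a) (ps b) = g b - g a"
 shows "(\<Sum>x\<in>\<Union>K. \<Sum>y\<in>\<Union>K. img [u, v] [x, y] * xx x y) = 2 * (g v - g u)"
proof -
 let ?c = "sd 1 (oriented_chain [u, v])" and ?W = "\<Union>K'"
 have m: "?c \<in> simplicial_chains K' 1" using uv by (intro sd_chains oriented_chain_in_chains) auto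
 have img: "img [u, v] [x, y] = (\<Sum>(a, b) | (a, b) \<in> ?W \<times> ?W \<and> (ps a, ps b) = (x, y). ?c [a, b])" for x y
 proof -
  have "img [u, v] [x, y] = push K' ps ?c [x, y]" using img_eq_push[of "[u, v]" "[x, y]"] uv by simp
  also have "... = (\<Sum>(a, b) | (a, b) \<in> ?W \<times> ?W \<and> (ps a, ps b) = (x, y). ?c [a, b])" unfolding push_def
   by (rule sum.reindex_bij_witness[where i = "\<lambda>(a, b). [a, b]" and j = "\<lambda>xs. (xs ! 0, xs ! 1)"])
    (auto simp: tuples_def length_Suc_conv)
  finally show ?thesis .
 qed
 have "(\<Sum>x\<in>\<Union>K. \<Sum>y\<in>\<Union>K. img [u, v] [x, y] * xx x y) = (\<Sum>(x, y)\<in>\<Union>K \<times> \<Union>K. img [u, v] [x, y] * xx x y)"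
  by (simp add: sum.cartesian_product)
 also have "... = (\<Sum>p\<in>\<Union>K \<times> \<Union>K. \<Sum>e | e \<in> ?W \<times> ?W \<and> (ps (fst e), ps (snd e)) = p. ?c [fst e, snd e] * xx (ps (fst e)) (ps (snd e)))"
  unfolding img case_prod_beta by (intro sum.cong refl) (auto simp: sum_distrib_right intro!: sum.cong)
 also have "... = (\<Sum>e\<in>?W \<times> ?W. ?c [fst e, snd e] * xx (ps (fst e)) (ps (snd e)))"
 proof (rule sum.group)
  show "(\<lambda>e. (ps (fst e), ps (snd e))) ` (?W \<times> ?W) \<subseteq> \<Union>K \<times> \<Union>K"
   using ps_vertex by (intro image_subsetI) (simp only: mem_Times_iff fst_conv snd_conv)
 qed (use finite_vertices in simp_all)
 also have "... = (\<Sum>e\<in>?W \<times> ?W. ?c [fst e, snd e] * (g (snd e) - g (fst e)))"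
 proof (intro sum.cong refl)
  fix e :: "(nat => real) \<times> (nat => real)"
  show "?c [fst e, snd e] * xx (ps (fst e)) (ps (snd e)) = ?c [fst e, snd e] * (g (snd e) - g (fst e))"
  proof (cases "?c [fst e, snd e] = 0")
   case False
   hence "set [fst e, snd e] \<in> K'" using m unfolding simplicial_chains_def by blast
   moreover have "convex hull (set [fst e, snd e]) \<subseteq> convex hull (set [u, v])"
    by (rule sd_carrier[OF _ _ _ False]) (use uv in auto)
   ultimately show ?thesis using pot by simp
  qed simp
 qed
 also have "... = (\<Sum>a\<in>?W. \<Sum>b\<in>?W. ?c [a, b] * g b) - (\<Sum>a\<in>?W. \<Sum>b\<in>?W. ?c [a, b] * g a)"
  by (simp add: sum.cartesian_product case_prod_beta right_diff_distrib sum_subtractf)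
 also have "(\<Sum>a\<in>?W. \<Sum>b\<in>?W. ?c [a, b] * g a) = - (\<Sum>a\<in>?W. \<Sum>b\<in>?W. ?c [b, a] * g a)"
  unfolding sum_negf[symmetric] by (intro sum.cong refl) (subst chain_swap2[OF m], simp)
 also have "(\<Sum>a\<in>?W. \<Sum>b\<in>?W. ?c [b, a] * g a) = (\<Sum>b\<in>?W. \<Sum>a\<in>?W. ?c [b, a] * g a)" by (rule sum.swap)
 also have "(\<Sum>b\<in>?W. \<Sum>a\<in>?W. ?c [b, a] * g a) - - (\<Sum>b\<in>?W. \<Sum>a\<in>?W. ?c [b, a] * g a) = 2 * (\<Sum>a\<in>?W. \<Sum>b\<in>?W. ?c [b, a] * g a)"
 using sum.swap by simp
 also have "(\<Sum>a\<in>?W. \<Sum>b\<in>?W. ?c [b, a] * g a) = (\<Sum>a\<in>?W. simplicial_boundary K' ?c [a] * g a)"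
  by (simp add: simplicial_boundary_def sum_distrib_right)
 also have "... = (\<Sum>a\<in>?W. (if a = v then g v else 0) - (if a = u then g u else 0))"
  unfolding sd_edge_boundary[OF uv] by (intro sum.cong refl) auto
 also have "... = g v - g u"
 proof -
  have "{u} \<in> K" "{v} \<in> K" by (rule face[OF uv(2)]; simp)+
  hence "u \<in> ?W" "v \<in> ?W" using sd_vertex(1) by blast+
  thus ?thesis unfolding sum_subtractf sum.delta[OF finite_vertices(2)] by simp
 qed
 finally show ?thesis .
qed

end

section \<open>Consequences of the surface hypothesis for a triangulation\<close>

section \<open>Surfaces with boundary\<close>

lemma half_plane_chartD:
 assumes "half_plane_chart Z W h"
 obtains V where "openin Z W" "openin (top_of_set {z. 0 \<le> Im z}) V" "homeomorphic_map (subtopology Z W) (top_of_set V) h"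
  "inj_on h W" "h ` W = V" "V \<subseteq> {z. 0 \<le> Im z}" "W \<subseteq> topspace Z"
proof -
 obtain V where V: "openin Z W" "openin (top_of_set {z. 0 \<le> Im z}) V" "homeomorphic_map (subtopology Z W) (top_of_set V) h"
  using assms unfolding half_plane_chart_def by blast
 have W: "W \<subseteq> topspace Z" by (rule openin_subset[OF V(1)])
 hence t: "topspace (subtopology Z W) = W" by auto
 show thesis using that V W homeomorphic_imp_surjective_map[OF V(3)] homeomorphic_imp_injective_map[OF V(3)] t openin_subset[OF V(2)] by simp
qed

lemma chart_openin_preimage:
 assumes "half_plane_chart Z W h" "openin (top_of_set {z. 0 \<le> Im z}) Q"
 shows "openin Z {x \<in> W. h x \<in> Q}"
proof -
 obtain V where V: "openin Z W" "openin (top_of_set {z. 0 \<le> Im z}) V" "homeomorphic_map (subtopology Z W) (top_of_set V) h"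
  "inj_on h W" "h ` W = V" "V \<subseteq> {z. 0 \<le> Im z}" "W \<subseteq> topspace Z" using half_plane_chartD[OF assms(1)] .
 have "openin (top_of_set V) (Q \<inter> V)" using assms(2) V(2,6) by (metis inf_le2 openin_Int openin_subset_trans)
 hence "openin (subtopology Z W) {x \<in> topspace (subtopology Z W). h x \<in> Q \<inter> V}"
  using homeomorphic_imp_continuous_map[OF V(3)] openin_continuous_map_preimage by blast
 moreover have "{x \<in> topspace (subtopology Z W). h x \<in> Q \<inter> V} = {x \<in> W. h x \<in> Q}" using V(5,7) by auto
 ultimately show ?thesis using openin_trans_full[OF _ V(1)] by simp
qed

text \<open>In a chart \<open>et\<close> becomes a continuous injection between planar sets. By
  invariance of domain its image is open in the plane, and an open set inside the closed half plane
  cannot touch the line \<open>Im z = 0\<close>.\<close>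

lemma surface_invariance:
 fixes et :: "complex => 'a"
 assumes Z: "surface_with_boundary Z" and O: "open S" and et: "continuous_map (top_of_set S) Z et" "inj_on et S"
 shows "openin Z (et ` S)" "et ` S \<inter> surface_boundary Z = {}"
proof -
 have main: "\<exists>T. openin Z T \<and> et z \<in> T \<and> T \<subseteq> et ` S \<and> Im (h (et z)) > 0" if z: "z \<in> S" and ch: "half_plane_chart Z W h" "et z \<in> W" for z W h
 proof -
  obtain V where V: "openin Z W" "openin (top_of_set {z. 0 \<le> Im z}) V" "homeomorphic_map (subtopology Z W) (top_of_set V) h"
   "inj_on h W" "h ` W = V" "V \<subseteq> {z. 0 \<le> Im z}" "W \<subseteq> topspace Z" using half_plane_chartD[OF ch(1)] .
  define S' where "S' = {y \<in> S. et y \<in> W}"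
  have oS': "open S'" using O openin_continuous_map_preimage[OF et(1) V(1)] by (simp add: S'_def openin_open_eq)
  have "continuous_map (top_of_set S') (subtopology Z W) et"
   using continuous_map_from_subtopology[OF et(1), of S'] by (auto simp: continuous_map_in_subtopology subtopology_subtopology S'_def Int_absorb1)
  hence c: "continuous_on S' (h \<circ> et)" using homeomorphic_imp_continuous_map[OF V(3)] continuous_map_compose by fastforce
  have i: "inj_on (h \<circ> et) S'" using et(2) V(4) by (auto simp: inj_on_def S'_def)
  define Q where "Q = (h \<circ> et) ` S'"
  have oQ: "open Q" unfolding Q_def by (rule invariance_of_domain[OF c oS' i])
  have QV: "Q \<subseteq> V" using V(5) by (auto simp: Q_def S'_def)
  have pos: "Im w > 0" if w: "w \<in> Q" for w
  proof -
   obtain e where e: "e > 0" "ball w e \<subseteq> Q" using oQ w by (meson openE)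
   have "w - \<i> * complex_of_real (e / 2) \<in> ball w e" using e(1) by (simp add: norm_mult)
   thus ?thesis using e(1) e(2) QV V(6) by fastforce
  qed
  have "openin (top_of_set {z. 0 \<le> Im z}) Q" using oQ QV V(6) by (meson open_subset subset_trans)
  hence "openin Z {x \<in> W. h x \<in> Q}" by (rule chart_openin_preimage[OF ch(1)])
  moreover have "{x \<in> W. h x \<in> Q} \<subseteq> et ` S" using V(4) by (auto simp: Q_def S'_def inj_on_def)
  moreover have "h (et z) \<in> Q" using z ch(2) by (auto simp: Q_def S'_def)
  ultimately show ?thesis using pos ch(2) by blast
 qed
 show "openin Z (et ` S)"
 proof (subst openin_subopen, intro ballI)
  fix x assume "x \<in> et ` S"
  then obtain z where z: "z \<in> S" "x = et z" by blast
  hence "x \<in> topspace Z" using et(1) by (auto simp: continuous_map_def)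
  thus "\<exists>T. openin Z T \<and> x \<in> T \<and> T \<subseteq> et ` S" using main[OF z(1)] z(2) Z by (metis surface_with_boundary_def)
 qed
 show "et ` S \<inter> surface_boundary Z = {}"
 proof (rule ccontr)
  assume "et ` S \<inter> surface_boundary Z ~= {}"
  then obtain z where z: "z \<in> S" "et z \<in> surface_boundary Z" by blast
  thus False using main[OF z(1)] by (fastforce simp: surface_boundary_def)
 qed
qed

lemma half_ball:
 assumes "half_plane_chart Z W h" "x \<in> W"
 obtains e where "e > 0" "ball (h x) e \<inter> {z. 0 \<le> Im z} \<subseteq> h ` W"
proof -
 obtain V where V: "openin (top_of_set {z. 0 \<le> Im z}) V" "h ` W = V" using half_plane_chartD[OF assms(1)] by metis
 thus thesis using that V(2) assms(2) by (fastforce simp: openin_contains_ball)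
qed

text \<open>A half disc around a boundary point contains a segment of the real line.\<close>

lemma infinite_surface_boundary:
 assumes "surface_with_boundary Z" shows "infinite (surface_boundary Z)"
proof -
 obtain x W h where x: "half_plane_chart Z W h" "x \<in> W" "Im (h x) = 0"
  using assms unfolding surface_with_boundary_def surface_boundary_def by blast
 obtain e where e: "e > 0" "ball (h x) e \<inter> {z. 0 \<le> Im z} \<subseteq> h ` W" using half_ball[OF x(1,2)] .
 have "h x + complex_of_real t \<in> h ` surface_boundary Z" if t: "t \<in> {0<..<e}" for t
 proof -
  have "h x + complex_of_real t \<in> ball (h x) e \<inter> {z. 0 \<le> Im z}" using t x(3) by (simp add: dist_norm)
  then obtain y where y: "y \<in> W" "h y = h x + complex_of_real t" using e(2) by (metis imageE subsetD)
  thus ?thesis using y(2) x(1) x(3) by (force simp: surface_boundary_def)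
 qed
 hence "(\<lambda>t. h x + complex_of_real t) ` {0<..<e} \<subseteq> h ` surface_boundary Z" by blast
 moreover have "infinite ((\<lambda>t. h x + complex_of_real t) ` {0<..<e})"
  using e(1) by (subst finite_image_iff) (auto simp: inj_on_def infinite_Ioo)
 ultimately show ?thesis using finite_subset by blast
qed

text \<open>A half disc is convex and not contained in a line, so it stays connected when countably
  many points are removed.\<close>

lemma chart_connected_nbhd:
 assumes Z: "surface_with_boundary Z" and x: "x \<in> topspace Z" and P: "finite P"
 obtains N where "openin Z N" "x \<in> N" "connectedin Z (N - P)"
proof -
 obtain W h where W: "half_plane_chart Z W h" "x \<in> W" using Z x unfolding surface_with_boundary_def by blast
 obtain V where V: "openin Z W" "openin (top_of_set {z. 0 \<le> Im z}) V" "homeomorphic_map (subtopology Z W) (top_of_set V) h"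
  "inj_on h W" "h ` W = V" "V \<subseteq> {z. 0 \<le> Im z}" "W \<subseteq> topspace Z" using half_plane_chartD[OF W(1)] .
 obtain e where e: "e > 0" "ball (h x) e \<inter> {z. 0 \<le> Im z} \<subseteq> h ` W" using half_ball[OF W] .
 define B where "B = ball (h x) e \<inter> {z. 0 \<le> Im z}"
 define N where "N = {y \<in> W. h y \<in> B}"
 have "openin (top_of_set {z. 0 \<le> Im z}) B" unfolding B_def by (metis inf_commute open_ball openin_open_Int)
 hence oN: "openin Z N" unfolding N_def by (rule chart_openin_preimage[OF W(1)])
 have hx: "h x \<in> B" "Im (h x) \<ge> 0" using W(2) V(5,6) e(1) by (auto simp: B_def)
 have cvx: "convex B" unfolding B_def by (intro convex_Int convex_ball convex_halfspace_Im_ge)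
 have "\<not> collinear B"
 proof
  assume c: "collinear B"
  have "collinear {h x + complex_of_real (e/2), h x, h x + \<i> * complex_of_real (e/2)}" using c hx(1) bot.extremum collinear_subset insert_subset hx by (fastforce simp: B_def dist_norm norm_mult)
  hence "collinear {0, complex_of_real (e/2), \<i> * complex_of_real (e/2)}" by (subst (asm) collinear_3) simp_all
  thus False using e(1) by (auto simp: collinear_lemma complex_eq_iff)
 qed
 hence con: "connected (B - h ` (P \<inter> W))" using P by (intro connected_convex_diff_countable cvx countable_finite) auto
 obtain g where g: "homeomorphic_maps (subtopology Z W) (top_of_set V) h g" using V(3) homeomorphic_map_maps by metis
 have BV: "B \<subseteq> V" using e(2) V(5) by (simp add: B_def)
 have "connectedin (top_of_set V) (B - h ` (P \<inter> W))" using con BV by (auto simp: connectedin_subtopology)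
 hence "connectedin (subtopology Z W) (g ` (B - h ` (P \<inter> W)))"
  using connectedin_continuous_map_image g unfolding homeomorphic_maps_def by blast
 moreover have "g ` (B - h ` (P \<inter> W)) = N - P"
 proof -
  have gh: "g (h y) = y" if "y \<in> W" for y using g that V(7) by (auto simp: homeomorphic_maps_def)
  have "B - h ` (P \<inter> W) = h ` (N - P)" using BV V(5) V(4) by (auto simp: N_def inj_on_def)
  thus ?thesis using gh by (force simp: N_def image_image)
 qed
 ultimately have "connectedin Z (N - P)" by (simp add: connectedin_subtopology)
 thus thesis using that oN W(2) hx(1) by (simp add: N_def)
qed

lemma surface_open_infinite:
 assumes Z: "surface_with_boundary Z" and U: "openin Z U" "x \<in> U" shows "infinite U"
proof -
 obtain W h where W: "half_plane_chart Z W h" "x \<in> W" using Z openin_subset[OF U(1)] U(2) by (fastforce simp: surface_with_boundary_def)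
 obtain V where V: "openin Z W" "openin (top_of_set {z. 0 \<le> Im z}) V" "homeomorphic_map (subtopology Z W) (top_of_set V) h"
  "inj_on h W" "h ` W = V" "V \<subseteq> {z. 0 \<le> Im z}" "W \<subseteq> topspace Z" using half_plane_chartD[OF W(1)] .
 have "openin (top_of_set {z. 0 \<le> Im z}) (h ` (U \<inter> W))" using openin_trans[OF _ V(2)] homeomorphic_map_openness[OF V(3), of "U \<inter> W"] V(7) U(1) by (auto simp: openin_subtopology_Int)
 moreover have hx: "h x \<in> h ` (U \<inter> W)" using U(2) W(2) by blast
 ultimately obtain e where e: "e > 0" "ball (h x) e \<inter> {z. 0 \<le> Im z} \<subseteq> h ` (U \<inter> W)" unfolding openin_contains_ball by blast
 have "(\<lambda>t. h x + complex_of_real t) ` {0<..<e} \<subseteq> h ` (U \<inter> W)" using e(2) W(2) V(5,6) by (force simp: dist_norm)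
 moreover have "infinite ((\<lambda>t. h x + complex_of_real t) ` {0<..<e})"
  using e(1) by (subst finite_image_iff) (auto simp: inj_on_def infinite_Ioo)
 ultimately have "infinite (h ` (U \<inter> W))" using finite_subset by blast
 thus ?thesis by (meson finite_Int finite_imageI)
qed

text \<open>Small neighbourhoods without \<open>P\<close> are connected, so each lies in
  \<open>E1\<close> or in \<open>E2\<close>. Which of the two is a locally constant choice, because
  overlapping neighbourhoods share infinitely many points; so it is the same on the whole connected
  surface.\<close>

lemma connected_surface_minus_finite:
 assumes Z: "surface_with_boundary Z" "connected_space Z" and P: "finite P"
  and E: "openin Z E1" "openin Z E2" "topspace Z - P \<subseteq> E1 \<union> E2" "E1 \<inter> E2 \<subseteq> P" "E1 - P ~= {}"
 shows "topspace Z - P \<subseteq> E1"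
proof -
 have "\<exists>N. openin Z N \<and> x \<in> N \<and> connectedin Z (N - P)" if "x \<in> topspace Z" for x using chart_connected_nbhd[OF Z(1) that P] by blast
 then obtain N where N: "!!x. x \<in> topspace Z ==> openin Z (N x) \<and> x \<in> N x \<and> connectedin Z (N x - P)" by metis
 have one: "N x - P \<subseteq> E1 \<or> N x - P \<subseteq> E2" if x: "x \<in> topspace Z" for x
 proof (rule ccontr)
  assume "\<not> ?thesis"
  moreover have "N x - P \<subseteq> E1 \<union> E2" using N[OF x] openin_subset E(3) by blast
  ultimately have "E1 \<inter> (N x - P) ~= {}" "E2 \<inter> (N x - P) ~= {}" "N x - P \<subseteq> E1 \<union> E2" "E1 \<inter> E2 \<inter> (N x - P) = {}" using E(4) by blast+
  thus False using N[OF x] E(1,2) unfolding connectedin by blast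
 qed
 define D where "D F = {x \<in> topspace Z. N x - P \<subseteq> F}" for F
 have opn: "openin Z (D F)" if F: "F = E1 \<or> F = E2" for F
 proof (subst openin_subopen, intro ballI)
  fix x assume x: "x \<in> D F"
  hence xZ: "x \<in> topspace Z" by (simp add: D_def)
  have "N x \<subseteq> D F"
  proof
   fix y assume y: "y \<in> N x"
   hence yZ: "y \<in> topspace Z" using N[OF xZ] openin_subset by blast
   have "infinite (N x \<inter> N y)" using N[OF xZ] N[OF yZ] y by (intro surface_open_infinite[OF Z(1), of _ y] openin_Int) auto
   hence "N x \<inter> N y - P ~= {}" using P by (metis Diff_eq_empty_iff finite_subset)
   moreover have "N x - P \<subseteq> F" using x by (simp add: D_def)
   ultimately have "N y - P \<subseteq> F" using one[OF yZ] F E(4) by blast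
   thus "y \<in> D F" using yZ by (simp add: D_def)
  qed
  thus "\<exists>T. openin Z T \<and> x \<in> T \<and> T \<subseteq> D F" using N[OF xZ] by blast
 qed
 have "D E1 \<inter> D E2 = {}"
 proof (rule ccontr)
  assume "D E1 \<inter> D E2 ~= {}"
  then obtain x where x: "x \<in> topspace Z" "N x - P \<subseteq> E1" "N x - P \<subseteq> E2" by (auto simp: D_def)
  hence "N x \<subseteq> P" using E(4) by blast
  thus False using surface_open_infinite[OF Z(1), of "N x" x] N[OF x(1)] P finite_subset by blast
 qed
 moreover have "topspace Z \<subseteq> D E1 \<union> D E2" using one by (auto simp: D_def)
 moreover obtain x where "x \<in> E1 - P" using E(5) by blast
 hence x: "x \<in> topspace Z" "x \<in> N x - P" "x \<notin> E2" using N openin_subset[OF E(1)] E(4) by auto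
 hence "x \<in> D E1" using one[OF x(1)] by (auto simp: D_def)
 ultimately have "D E2 = {}" using Z(2) opn unfolding connected_space_def by blast
 thus ?thesis using N \<open>topspace Z \<subseteq> D E1 \<union> D E2\<close> by (auto simp: D_def)
qed

section \<open>Triangulations of a surface with one point removed\<close>

definition bary :: "'v set => 'v => real" where "bary s = (\<lambda>v. if v \<in> s then 1 / real (card s) else 0)"

lemma realizI: assumes "supp x = s" "s \<in> K" "!!v. v \<in> s ==> 0 < x v" "sum x s = 1" shows "x \<in> realiz K"
proof -
 have "0 \<le> x v" for v using assms(1) assms(3)[of v] by (cases "v \<in> s") (auto simp: supp_def)
 thus ?thesis using assms by (simp add: realiz_def)
qed

lemma compact_closed_fun: assumes "compact S" shows "closed (S :: ('v => real) set)"
proof -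
 have "Hausdorff_space (product_topology (\<lambda>_::'v. euclidean :: real topology) UNIV)" by (simp add: Hausdorff_space_product_topology)
 thus ?thesis using compactin_imp_closedin assms closed_closedin compactin_euclidean_iff by (metis euclidean_product_topology)
qed

lemma path_enters:
 fixes w :: "real => 'v => real"
 assumes w: "!!v. continuous_on UNIV (\<lambda>e. w e v)" and T: "open T" "w 0 \<in> T" and de: "0 < de"
 obtains e where "0 < e" "e < de" "w e \<in> T"
proof -
 have "continuous_on UNIV w" by (rule continuous_on_coordinatewise_then_product) (rule w)
 hence "open (w -` T)" using T(1) by (rule open_vimage[rotated])
 moreover have "0 \<in> w -` T" using T(2) by simp
 ultimately obtain r where r: "r > 0" "ball 0 r \<subseteq> w -` T" unfolding open_contains_ball by blast
 have "w (min r de / 2) \<in> T" using r(2) r(1) de by force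
 moreover have "0 < min r de / 2" "min r de / 2 < de" using r(1) de by auto
 ultimately show thesis using that by blast
qed

lemma bary: assumes "s \<in> K" "finite s" "s ~= {}" shows "supp (bary s) = s" "bary s \<in> realiz K" "v \<in> s ==> 0 < bary s v"
proof -
 show 1: "supp (bary s) = s" using assms by (auto simp: supp_def bary_def)
 show 2: "v \<in> s ==> 0 < bary s v" for v using assms by (auto simp: bary_def)
 show "bary s \<in> realiz K" by (rule realizI[OF 1 assms(1)]) (use 2 assms in \<open>simp_all add: bary_def\<close>)
qed

lemma continuous_on_fun_iff:
 fixes f :: "'z::topological_space => 'v => real"
 shows "(!!v. continuous_on S (\<lambda>x. f x v)) ==> continuous_on S f" by (rule continuous_on_coordinatewise_then_product)

text \<open>\<open>L\<close> is the part of the compactification at infinity, \<open>p\<close> the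
  point at infinity of the surface, and \<open>om\<close> a spare vertex, the future apex of the
  cone over \<open>L\<close>.\<close>

locale surface_cells =
 fixes K L :: "'v set set" and A :: "('v => real) set" and Z :: "'a topology" and p :: 'a and om :: 'v and j :: "('v => real) => 'a"
 assumes finK: "finite K" and scK: "scomplex K" and LK: "L \<subseteq> K" and A: "A = {x \<in> realiz K. supp x \<notin> L}"
  and j: "homeomorphic_map (top_of_set A) (subtopology Z (topspace Z - {p})) j" and p: "p \<in> topspace Z"
  and surf: "surface_with_boundary Z" and conn: "connected_space Z" and comp: "compact_space Z" and dense: "realiz K \<subseteq> closure A"
  and om: "om \<notin> \<Union>K"
begin

lemma haus: "Hausdorff_space Z" using surf by (simp add: surface_with_boundary_def)

lemma open_p: "openin Z (topspace Z - {p})"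
 using haus p Hausdorff_imp_t1_space by (metis closedin_t1_singleton openin_diff openin_topspace)

lemma j_cont: "continuous_map (top_of_set A) Z j"
 using homeomorphic_imp_continuous_map[OF j] by (simp add: continuous_map_in_subtopology)

lemma j_inj: "inj_on j A" and j_image: "j ` A = topspace Z - {p}"
 using homeomorphic_imp_injective_map[OF j] homeomorphic_imp_surjective_map[OF j] by auto

lemma j_open: assumes "openin (top_of_set A) B" shows "openin Z (j ` B)"
using homeomorphic_map_openness[OF j, of B] assms openin_subset[OF assms] openin_trans_full[OF _ open_p] by simp

lemma j_preimage: assumes "openin Z T" shows "openin (top_of_set A) {x \<in> A. j x \<in> T}"
 using openin_continuous_map_preimage[OF j_cont assms] by simp

lemma disc:
 fixes ka :: "complex => 'v => real"
 assumes "open S" "continuous_on S ka" "inj_on ka S" "ka ` S \<subseteq> A"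
 shows "openin (top_of_set A) (ka ` S)" "j ` ka ` S \<inter> surface_boundary Z = {}"
proof -
 have "continuous_map (top_of_set S) (top_of_set A) ka" using assms by (simp add: image_subset_iff_funcset)
 hence c: "continuous_map (top_of_set S) Z (j \<circ> ka)" using j_cont continuous_map_compose by blast
 have i: "inj_on (j \<circ> ka) S" using assms(3,4) j_inj by (meson comp_inj_on inj_on_subset)
 note si = surface_invariance[OF surf assms(1) c i]
 have "{x \<in> A. j x \<in> (j \<circ> ka) ` S} = ka ` S" using assms(4) j_inj by (auto simp: inj_on_def)
 thus "openin (top_of_set A) (ka ` S)" using j_preimage[OF si(1)] by simp
 show "j ` ka ` S \<inter> surface_boundary Z = {}" using si(2) by (simp add: image_comp)
qed

text \<open>A locally compact dense subspace is open.\<close>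

lemma A_nbhd: assumes "x \<in> A" obtains T where "open T" "x \<in> T" "T \<inter> realiz K \<subseteq> A"
proof -
 have "j x \<in> topspace Z - {p}" using assms j_image by blast
 then obtain U C where UC: "openin Z U" "closedin Z C" "j x \<in> U" "U \<subseteq> C" "C \<subseteq> topspace Z - {p}" using open_p compact_Hausdorff_imp_regular_space[OF comp haus] neighbourhood_base_of_closedin by (metis neighbourhood_base_of)
 obtain g where g: "homeomorphic_maps (top_of_set A) (subtopology Z (topspace Z - {p})) j g" using j homeomorphic_map_maps by metis
 hence "compactin (top_of_set A) (g ` C)" using image_compactin UC(5) comp UC(2) closedin_compact_space by (metis homeomorphic_maps_def compactin_subtopology)
 hence cC: "compact (g ` C)" "g ` C \<subseteq> A" by (auto simp: compactin_subtopology)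
 have gC: "y \<in> g ` C" if "y \<in> A" "j y \<in> C" for y using g that by (force simp: homeomorphic_maps_def)
 obtain T where T: "open T" "{y \<in> A. j y \<in> U} = A \<inter> T" using j_preimage[OF UC(1)] by (auto simp: openin_open)
 have "T \<inter> realiz K \<subseteq> closure (T \<inter> A)" using dense open_Int_closure_subset[OF T(1), of A] by blast
 also have "... \<subseteq> g ` C" using T(2) gC UC(4) compact_closed_fun[OF cC(1)] by (intro closure_minimal) blast+
 also have "... \<subseteq> A" by (rule cC)
 finally show thesis using that[OF T(1)] T(2) assms UC(3) by blast
qed

lemma bary': "s \<in> K ==> supp (bary s) = s" "s \<in> K ==> bary s \<in> realiz K" "s \<in> K ==> v \<in> s ==> 0 < bary s v"
 using bary[of s K] scomplex_finite[OF scK, of s] scomplex_nonempty[OF scK, of s] by blast+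

text \<open>If a face \<open>t\<close> of \<open>s\<close> were not in \<open>L\<close>, its
  barycentre would lie in \<open>A\<close>. As \<open>A\<close> is open in the polyhedron, nearby
  interior points of \<open>s\<close> would be in \<open>A\<close> too, although \<open>s\<close> is
  in \<open>L\<close>.\<close>

lemma scL: "scomplex L" unfolding scomplex_def
proof (intro ballI conjI allI impI)
 fix s assume sL: "s \<in> L"
 hence s: "s \<in> K" using LK by blast
 thus fs: "finite s" "s ~= {}" using scomplex_finite[OF scK] scomplex_nonempty[OF scK] by auto
 fix t assume t: "t \<subseteq> s \<and> t ~= {}"
 show "t \<in> L"
 proof (rule ccontr)
  assume tL: "t \<notin> L"
  have tK: "t \<in> K" using scomplexD[OF scK s] t by blast
  hence "bary t \<in> A" using bary' tL by (simp add: A)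
  then obtain T where T: "open T" "bary t \<in> T" "T \<inter> realiz K \<subseteq> A" using A_nbhd by blast
  define w where "w e v = (1 - e) * bary t v + e * bary s v" for e :: real and v
  have "w 0 = bary t" by (simp add: w_def fun_eq_iff)
  hence "w 0 \<in> T" using T(2) by simp
  moreover have "continuous_on UNIV (\<lambda>e. w e v)" for v unfolding w_def by (intro continuous_intros)
  ultimately obtain e where e: "0 < e" "e < 1" "w e \<in> T" using path_enters[OF _ T(1) _ zero_less_one, of w] by blast
  have nn: "0 \<le> bary t v" for v by (simp add: bary_def)
  have pos: "0 < w e v" if "v \<in> s" for v
   unfolding w_def using e bary'(3)[OF s that] nn[of v] by (intro add_nonneg_pos mult_nonneg_nonneg mult_pos_pos) auto
  have "w e v = 0" if "v \<notin> s" for v using that t by (auto simp: w_def bary_def)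
  hence "w e v ~= 0 \<longleftrightarrow> v \<in> s" for v using pos[of v] by (cases "v \<in> s") auto
  hence sup: "supp (w e) = s" by (simp add: supp_def)
  show False using sup sL T(3) e(3) pos realizI[OF sup s] realiz_sum[OF bary'(2)[OF tK], of s] realiz_sum[OF bary'(2)[OF s], of s] bary'(1) tK s fs(1) t by (auto simp: A w_def sum.distrib sum_distrib_left[symmetric])
 qed
qed

text \<open>Four vertices leave three directions of motion around the barycentre. The disc spanned
  by two of them would be open in \<open>A\<close> by invariance of domain, but the third direction
  leaves it at once.\<close>

lemma card_A: assumes s: "s \<in> K" "s \<notin> L" shows "card s \<le> 3"
proof (rule ccontr)
 assume "\<not> card s \<le> 3"
 hence c4: "4 \<le> card s" by simp
 have fs: "finite s" using scomplex_finite[OF scK s(1)] .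
 obtain Q where "Q \<subseteq> s" "card Q = 4" by (rule obtain_subset_with_card_n[OF c4])
 then obtain xs where xs: "set xs = Q" "distinct xs" using finite_distinct_list finite_subset fs by metis
 hence "length xs = Suc (Suc (Suc (Suc 0)))" using distinct_card[of xs] \<open>card Q = 4\<close> by simp
 then obtain a b c d where "xs = [a, b, c, d]" unfolding length_Suc_conv by blast
 hence abcd: "{a, b, c, d} \<subseteq> s" "distinct [a, b, c, d]" using xs \<open>Q \<subseteq> s\<close> by auto
 define m where "m = 1 / real (card s)"
 have m: "m > 0" using c4 by (simp add: m_def)
 \<comment> \<open>The barycentre moved in three independent directions; \<open>d\<close>
   compensates so that the weights still sum to 1. Bounds of \<open>m / 3\<close> keep the weight of
   \<open>d\<close> positive.\<close>
 define X where "X r y t v = bary s v + (if v = a then r else 0) + (if v = b then y else 0) + (if v = c then t else 0) + (if v = d then - r - y - t else 0)" for r y t :: real and v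
 have X: "X r y t a = m + r" "X r y t b = m + y" "X r y t c = m + t" "X r y t d = m - r - y - t"
  "v \<notin> {a, b, c, d} ==> X r y t v = bary s v" for r y t v using abcd by (auto simp: X_def bary_def m_def)
 have XA: "X r y t \<in> A" if small: "\<bar>r\<bar> < m / 3" "\<bar>y\<bar> < m / 3" "\<bar>t\<bar> < m / 3" for r y t
 proof -
  have pos: "0 < X r y t v" if v: "v \<in> s" for v
  by (cases "v \<in> {a, b, c, d}"; use small X(1-4) X(5) bary'(3)[OF s(1) v] in \<open>auto\<close>)
  have "X r y t v = 0" if "v \<notin> s" for v using that abcd(1) X(5)[of v] by (auto simp: bary_def)
  hence "X r y t v ~= 0 \<longleftrightarrow> v \<in> s" for v using pos[of v] by (cases "v \<in> s") auto
  hence sup: "supp (X r y t) = s" by (simp add: supp_def)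
  show ?thesis using sup s(2) pos realizI[OF sup s(1)] abcd(1) fs realiz_sum[OF bary'(2)[OF s(1)] fs] bary'(1)[OF s(1)] by (simp add: A X_def sum.distrib)
 qed
 define ka where "ka z = X (Re z) (Im z) 0" for z
 have cX: "continuous_on UNIV (\<lambda>z. X (f z) (g z) (h z) v)" if "continuous_on UNIV f" "continuous_on UNIV g" "continuous_on UNIV h" for f g h :: "'z::topological_space => real" and v
  using that unfolding X_def by (intro continuous_intros) (cases "v = a"; cases "v = b"; cases "v = c"; cases "v = d"; auto intro!: continuous_intros)+
 have "openin (top_of_set A) (ka ` ball 0 (m / 3))"
 proof (rule disc(1))
  show "continuous_on (ball 0 (m / 3)) ka"
   unfolding ka_def by (rule continuous_on_fun_iff, rule continuous_on_subset[OF cX]) (auto intro!: continuous_intros)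
  show "inj_on ka (ball 0 (m / 3))"
  proof (rule inj_onI)
   fix x y assume "ka x = ka y"
   thus "x = y" by (smt (verit) ka_def X complex_eq_iff)
  qed
  show "ka ` ball 0 (m / 3) \<subseteq> A"
  proof (rule image_subsetI)
   fix z :: complex assume "z \<in> ball 0 (m / 3)"
   thus "ka z \<in> A" unfolding ka_def using abs_Re_le_cmod[of z] abs_Im_le_cmod[of z] m by (intro XA) auto
  qed
 qed simp
 then obtain T where T: "open T" "ka ` ball 0 (m / 3) = A \<inter> T" by (auto simp: openin_open)
 have "X 0 0 0 \<in> ka ` ball 0 (m / 3)" using m by (intro image_eqI[of _ _ 0]) (auto simp: ka_def)
 hence "X 0 0 0 \<in> T" using T(2) by blast
 moreover have "0 < m / 3" using m by simp
 moreover have "continuous_on UNIV (\<lambda>t. X 0 0 t v)" for v using cX[of "\<lambda>_. 0" "\<lambda>_. 0" "\<lambda>t. t::real"] by simp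
 ultimately obtain t where t: "0 < t" "t < m / 3" "X 0 0 t \<in> T" using path_enters[OF _ T(1), of "X 0 0" "m / 3"] by blast
 then obtain z where "X 0 0 t = ka z" using T(2) XA by fastforce
 thus False using t(1) by (smt (verit) ka_def X)
qed

text \<open>Near the barycentre of a largest simplex \<open>t\<close> containing \<open>s\<close>,
  every support contains \<open>t\<close> and so equals it. Density of \<open>A\<close> provides a
  point of \<open>A\<close> there.\<close>

lemma in_A_simplex: assumes "s \<in> K" obtains t where "t \<in> K" "t \<notin> L" "s \<subseteq> t"
proof -
 define M where "M = {t \<in> K. s \<subseteq> t}"
 have "finite (card ` M)" "card ` M ~= {}" using finK assms by (auto simp: M_def)
 hence "Max (card ` M) \<in> card ` M" by (rule Max_in)
 then obtain t where t: "t \<in> M" "card t = Max (card ` M)" by auto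
 have tK: "t \<in> K" using t by (simp add: M_def)
 have ft: "finite t" using scomplex_finite[OF scK tK] .
 define T where "T = (\<Inter>v\<in>t. {x::'v => real. 0 < x v})"
 have "open T" unfolding T_def using ft by (intro open_INT ballI open_Collect_less) auto
 moreover have "bary t \<in> T" using bary'(3)[OF tK] by (simp add: T_def)
 moreover have "bary t \<in> closure A" using dense bary'(2)[OF tK] by blast
 ultimately obtain x where x: "x \<in> T" "x \<in> A" by (meson closure_iff_nhds_not_empty disjoint_iff subset_refl)
 hence "t \<subseteq> supp x" "supp x \<in> K" "supp x \<notin> L" by (auto simp: T_def supp_def A realiz_def)
 moreover from this have "supp x \<in> M" using t(1) by (auto simp: M_def)
 hence "card (supp x) \<le> card t" using t(2) \<open>finite (card ` M)\<close> by simp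
 ultimately have "t = supp x" using scomplex_finite[OF scK] by (metis card_seteq)
 thus thesis using that tK \<open>supp x \<notin> L\<close> t(1) by (simp add: M_def)
qed

lemma card_K: assumes "s \<in> K" shows "card s \<le> 3"
proof -
 obtain t where t: "t \<in> K" "t \<notin> L" "s \<subseteq> t" using in_A_simplex[OF assms] .
 thus ?thesis using card_A[OF t(1,2)] card_mono[OF scomplex_finite[OF scK t(1)] t(3)] by simp
qed

lemma card_L: assumes "s \<in> L" shows "card s \<le> 2"
proof -
 obtain t where t: "t \<in> K" "t \<notin> L" "s \<subseteq> t" using in_A_simplex assms LK by blast
 thus ?thesis using card_A[OF t(1,2)] psubset_card_mono[OF scomplex_finite[OF scK t(1)], of s] assms by fastforce
qed

text \<open>Two triangles with a common edge form a disc, parametrised by \<open>\<bar>Re z\<bar> + \<bar>Im z\<bar> < 1\<close> with the edge on the real axis.\<close>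

definition dia :: "'v => 'v => 'v => 'v => complex => 'v => real"
 where "dia a b c c' z = (\<lambda>v. if v = a then (1 - \<bar>Im z\<bar> + Re z) / 2 else if v = b then (1 - \<bar>Im z\<bar> - Re z) / 2
  else if v = c then max (Im z) 0 else if v = c' then max (- Im z) 0 else 0)"

lemma dia_cont: "continuous_on S (dia a b c c')" unfolding dia_def by (rule continuous_on_coordinatewise_then_product)
  (rename_tac v, case_tac "v = a"; case_tac "v = b"; case_tac "v = c"; case_tac "v = c'"; auto intro!: continuous_intros)

lemma dia_props:
 assumes d: "distinct [a, b, c, c']" and z: "\<bar>Re z\<bar> + \<bar>Im z\<bar> < 1"
 shows "supp (dia a b c c' z) = (if Im z > 0 then {a, b, c} else if Im z < 0 then {a, b, c'} else {a, b})"
  "supp (dia a b c c' z) \<in> K ==> dia a b c c' z \<in> realiz K"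
  "Re z = dia a b c c' z a - dia a b c c' z b" "Im z = dia a b c c' z c - dia a b c c' z c'"
proof -
 have ab: "0 < (1 - \<bar>Im z\<bar> + Re z) / 2" "0 < (1 - \<bar>Im z\<bar> - Re z) / 2" using z by simp_all
 show s: "supp (dia a b c c' z) = (if Im z > 0 then {a, b, c} else if Im z < 0 then {a, b, c'} else {a, b})"
  using ab d by (auto simp: supp_def dia_def)
 have "sum (dia a b c c' z) (supp (dia a b c c' z)) = 1" unfolding s using d by (auto simp: dia_def field_simps)
 thus "supp (dia a b c c' z) \<in> K ==> dia a b c c' z \<in> realiz K" using ab by (simp add: realiz_def dia_def)
 show "Re z = dia a b c c' z a - dia a b c c' z b" "Im z = dia a b c c' z c - dia a b c c' z c'"
  using d by (auto simp: dia_def field_simps)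
qed

lemma dia_surj:
 assumes d: "distinct [a, b, c, c']" and x: "x \<in> realiz K" "supp x = {a, b, c} \<or> supp x = {a, b, c'} \<or> supp x = {a, b}"
 obtains z where "\<bar>Re z\<bar> + \<bar>Im z\<bar> < 1" "x = dia a b c c' z"
proof -
 have pos: "0 \<le> x v" for v using x by (simp add: realiz_def)
 have sup: "x v ~= 0 \<longleftrightarrow> v \<in> supp x" for v by (simp add: supp_def)
 have ab: "x a > 0" "x b > 0" using pos[of a] pos[of b] sup[of a] sup[of b] x(2) by force+
 have "sum x {a, b, c, c'} = 1" using x(2) by (intro realiz_sum[OF x(1)]) auto
 hence s: "x a + x b + x c + x c' = 1" using d by simp
 have o: "x v = 0" if "v \<notin> {a, b, c, c'}" for v using sup[of v] x(2) that by auto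
 let ?z = "Complex (x a - x b) (x c - x c')"
 have "x = dia a b c c' ?z" using s o pos[of c] pos[of c'] sup[of c] sup[of c'] x(2) d by (fastforce simp: dia_def)
 thus thesis using that ab s pos[of c] pos[of c'] by force
qed

lemma dia_disc:
 assumes d: "distinct [a, b, c, c']" and S: "open S" "S \<subseteq> {z. \<bar>Re z\<bar> + \<bar>Im z\<bar> < 1}"
  and sA: "!!z. z \<in> S ==> supp (dia a b c c' z) \<in> K - L"
 shows "openin (top_of_set A) (dia a b c c' ` S)" "j ` dia a b c c' ` S \<inter> surface_boundary Z = {}"
proof -
 have i: "inj_on (dia a b c c') S"
 proof (rule inj_onI)
  fix x y assume "x \<in> S" "y \<in> S" "dia a b c c' x = dia a b c c' y"
  moreover from this have "\<bar>Re x\<bar> + \<bar>Im x\<bar> < 1" "\<bar>Re y\<bar> + \<bar>Im y\<bar> < 1" using S(2) by auto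
  ultimately show "x = y" using dia_props(3,4)[OF d, of x] dia_props(3,4)[OF d, of y] by (simp add: complex_eq_iff)
 qed
 have "dia a b c c' ` S \<subseteq> A" using dia_props(2)[OF d] sA S(2) by (auto simp: A)
 thus "openin (top_of_set A) (dia a b c c' ` S)" "j ` dia a b c c' ` S \<inter> surface_boundary Z = {}"
  using disc[OF S(1) dia_cont i] by blast+
qed

lemma cell3:
 assumes t: "t \<in> K" "card t = 3"
 shows "openin (top_of_set A) {x \<in> A. supp x = t}" "j ` {x \<in> A. supp x = t} \<inter> surface_boundary Z = {}"
proof -
 obtain a b c where abc: "t = {a, b, c}" "a ~= b" "b ~= c" "a ~= c" using t(2) by (auto simp: card_3_iff)
 \<comment> \<open>\<open>om\<close> is a dummy for the missing fourth vertex; the half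
   \<open>0 < Im z\<close> of the disc does not use it.\<close>
 have d: "distinct [a, b, c, om]" using abc t(1) om by auto
 let ?S = "{z. \<bar>Re z\<bar> + \<bar>Im z\<bar> < 1} \<inter> {z. 0 < Im z}"
 have S: "open ?S" by (intro open_Int open_Collect_less continuous_intros)
 have tL: "t \<notin> L" using card_L[of t] t(2) by auto
 have sup: "supp (dia a b c om z) = t" if "z \<in> ?S" for z using that dia_props(1)[OF d, of z] abc(1) by auto
 have "{x \<in> A. supp x = t} = dia a b c om ` ?S"
 proof (intro equalityI subsetI)
  fix x assume x: "x \<in> {x \<in> A. supp x = t}"
  then obtain z where z: "\<bar>Re z\<bar> + \<bar>Im z\<bar> < 1" "x = dia a b c om z" using dia_surj[OF d] by (auto simp: A abc)
  have "c \<in> supp (dia a b c om z)" using x z abc by simp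
  hence "0 < Im z" using dia_props(1)[OF d z(1)] d by (auto split: if_splits)
  thus "x \<in> dia a b c om ` ?S" using z by blast
 next
  fix x assume "x \<in> dia a b c om ` ?S"
  then obtain z where z: "z \<in> ?S" "x = dia a b c om z" by blast
  show "x \<in> {x \<in> A. supp x = t}" using dia_props(2)[OF d, of z] sup[OF z(1)] t(1) tL z(2) z(1) by (auto simp: A)
 qed
 thus "openin (top_of_set A) {x \<in> A. supp x = t}" "j ` {x \<in> A. supp x = t} \<inter> surface_boundary Z = {}"
  using dia_disc[OF d S] sup t(1) tL by auto
qed

lemma cell2:
 assumes t: "{a, b, c} \<in> K" "{a, b, c'} \<in> K" and d: "distinct [a, b, c, c']" and e: "{a, b} \<notin> L"
 defines "N \<equiv> {x \<in> A. supp x = {a, b, c} \<or> supp x = {a, b, c'} \<or> supp x = {a, b}}"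
 shows "openin (top_of_set A) N" "j ` N \<inter> surface_boundary Z = {}"
proof -
 let ?S = "{z. \<bar>Re z\<bar> + \<bar>Im z\<bar> < 1}"
 have S: "open ?S" by (intro open_Collect_less continuous_intros)
 have "card {a, b, c} = 3" "card {a, b, c'} = 3" using d by simp_all
 hence tL: "{a, b, c} \<notin> L" "{a, b, c'} \<notin> L" using card_L[of "{a, b, c}"] card_L[of "{a, b, c'}"] by force+
 have sup: "supp (dia a b c c' z) \<in> K - L \<and> (supp (dia a b c c' z) = {a, b, c} \<or> supp (dia a b c c' z) = {a, b, c'} \<or> supp (dia a b c c' z) = {a, b})"
  if "z \<in> ?S" for z using that dia_props(1)[OF d, of z] t tL e scomplexD[OF scK t(1), of "{a, b}"] by simp
 have "N = dia a b c c' ` ?S"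
 proof (intro equalityI subsetI)
  fix x assume x: "x \<in> N"
  then obtain z where z: "\<bar>Re z\<bar> + \<bar>Im z\<bar> < 1" "x = dia a b c c' z" using dia_surj[OF d] by (auto simp: A N_def)
  thus "x \<in> dia a b c c' ` ?S" by blast
 next
  fix x assume "x \<in> dia a b c c' ` ?S"
  then obtain z where z: "z \<in> ?S" "x = dia a b c c' z" by blast
  thus "x \<in> N" using dia_props(2)[OF d, of z] sup[OF z(1)] by (simp add: A N_def)
 qed
 moreover have "supp (dia a b c c' z) \<in> K - L" if "z \<in> ?S" for z using sup[OF that] by blast
 note dia_disc[OF d S subset_refl this]
 ultimately show "openin (top_of_set A) N" "j ` N \<inter> surface_boundary Z = {}" by simp_all
qed

text \<open>This is where the nonempty boundary enters. If no such edge existed, every edge of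
  \<open>T\<close> outside \<open>L\<close> would lie on two triangles of \<open>T\<close>, and the
  open triangles and edges of \<open>T\<close> would form an open set \<open>Y\<close> without
  boundary points. Away from finitely many vertices \<open>Y\<close> is also closed, so it is almost
  the whole connected surface, and the boundary would be finite.\<close>

lemma free_A_edge:
 assumes T: "T \<subseteq> {t \<in> K. card t = 3}" "T ~= {}"
 shows "\<exists>t\<in>T. \<exists>e\<subseteq>t. card e = 2 \<and> e \<notin> L \<and> (\<forall>t'\<in>T. e \<subseteq> t' --> t' = t)"
proof (rule ccontr)
 assume no: "\<not> ?thesis"
 define Y where "Y = {x \<in> A. supp x \<in> T \<or> (card (supp x) = 2 \<and> (\<exists>t\<in>T. supp x \<subseteq> t))}"
 define C where "C = {x \<in> A. \<exists>t\<in>T. supp x \<subseteq> t}"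
 define V0 where "V0 = {x \<in> A. card (supp x) = 1}"
 have nb: "\<exists>N. openin (top_of_set A) N \<and> x \<in> N \<and> N \<subseteq> Y \<and> j ` N \<inter> surface_boundary Z = {}" if x: "x \<in> Y" for x
 proof (cases "supp x \<in> T")
  case True
  hence "supp x \<in> K" "card (supp x) = 3" using T by auto
  note cell3[OF this]
  moreover have "{y \<in> A. supp y = supp x} \<subseteq> Y" using True by (auto simp: Y_def)
  ultimately show ?thesis using x by (intro exI[of _ "{y \<in> A. supp y = supp x}"]) (auto simp: Y_def)
 next
  case False
  then obtain t where t: "t \<in> T" "supp x \<subseteq> t" "card (supp x) = 2" and xA: "x \<in> A" using x by (auto simp: Y_def)
  have eL: "supp x \<notin> L" using xA by (simp add: A)
  obtain t' where t': "t' \<in> T" "supp x \<subseteq> t'" "t' ~= t" using t eL no by metis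
  have K: "t \<in> K" "card t = 3" "t' \<in> K" "card t' = 3" using T t(1) t'(1) by auto
  obtain a b c where abc: "t = {a, b, c}" "supp x = {a, b}" "a ~= b" "b ~= c" "a ~= c" using card_3_minus_2[OF K(2) t(2,3)] .
  obtain a' b' c' where abc': "t' = {a', b', c'}" "supp x = {a', b'}" "a' ~= b'" "b' ~= c'" "a' ~= c'" using card_3_minus_2[OF K(4) t'(2) t(3)] .
  have t'2: "t' = {a, b, c'}" using abc(2) abc'(1,2) by auto
  have d: "distinct [a, b, c, c']" using abc(3-5) t'2 abc(1) t'(3) abc' abc(2) by fastforce
  have eL': "{a, b} \<notin> L" using eL abc(2) by simp
  note c2 = cell2[OF K(1)[unfolded abc(1)] K(3)[unfolded t'2] d eL']
  let ?N = "{x \<in> A. supp x = {a, b, c} \<or> supp x = {a, b, c'} \<or> supp x = {a, b}}"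
  have "?N \<subseteq> Y" using abc t(1) t'(1) t'2 by (fastforce simp: Y_def)
  thus ?thesis using c2 xA abc(2) by blast
 qed
 have finV0: "finite V0"
 proof -
  have "x = pt v" if "x \<in> V0" "supp x = {v}" for x v
  proof
   have "x v = 1" using that by (simp add: V0_def A realiz_def)
   thus "x w = pt v w" for w using that(2) by (cases "w = v") (auto simp: pt_other supp_def)
  qed
  moreover have "\<exists>v. supp x = {v} \<and> v \<in> \<Union>K" if "x \<in> V0" for x using that by (auto simp: V0_def A realiz_def card_1_singleton_iff)
  ultimately have "V0 \<subseteq> pt ` \<Union>K" by blast
  moreover have "finite (\<Union>K)" using finK scomplex_finite[OF scK] by blast
  ultimately show ?thesis using finite_subset by blast
 qed
 have oY: "openin (top_of_set A) Y" by (subst openin_subopen) (use nb in blast)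
 have "closed {x::'v => real. supp x \<subseteq> t}" for t
 proof -
  have "{x::'v => real. supp x \<subseteq> t} = (\<Inter>v\<in>-t. {x. x v = 0})" by (auto simp: supp_def)
  also have "closed ..." by (intro closed_INT ballI closed_Collect_eq) auto
  finally show ?thesis .
 qed
 moreover have "finite T" using T(1) finK by (metis (no_types, lifting) finite_subset mem_Collect_eq subsetD subsetI)
 ultimately have "closed (\<Union>t\<in>T. {x::'v => real. supp x \<subseteq> t})" by blast
 hence "closedin (top_of_set A) (A \<inter> (\<Union>t\<in>T. {x. supp x \<subseteq> t}))" by (rule closedin_closed_Int)
 moreover have "A \<inter> (\<Union>t\<in>T. {x. supp x \<subseteq> t}) = C" by (auto simp: C_def)
 ultimately have oC: "openin (top_of_set A) (A - C)" by (simp add: openin_diff)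
 have cov: "x \<in> Y \<or> x \<in> A - C \<or> x \<in> V0" if "x \<in> A" for x
 proof (cases "x \<in> C")
  case True
  then obtain t where t: "t \<in> T" "supp x \<subseteq> t" by (auto simp: C_def)
  have t3: "t \<in> K" "card t = 3" "finite t" using T t(1) by auto
  have "supp x ~= {}" "finite (supp x)" using scomplex_finite[OF scK] that by (auto simp: A realiz_def)
  moreover have "card (supp x) \<le> 3" using card_mono[OF t3(3) t(2)] t3(2) by simp
  ultimately consider "card (supp x) = 1" | "card (supp x) = 2" | "card (supp x) = 3"
   by (metis One_nat_def Suc_1 card_gt_0_iff le_Suc_eq le_zero_eq less_numeral_extra(3) numeral_3_eq_3)
  thus ?thesis
  proof cases
   case 3
   thus ?thesis using t(1) that card_subset_eq[OF t3(3) t(2)] t3(2) by (simp add: Y_def)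
  qed (use that t in \<open>auto simp: Y_def V0_def\<close>)
 qed (use that in blast)
 have subs: "Y \<subseteq> A" "V0 \<subseteq> A" by (auto simp: Y_def V0_def)
 obtain t where t: "t \<in> T" using T(2) by blast
 hence tK: "t \<in> K" "card t = 3" using T(1) by auto
 have ty: "bary t \<in> Y" using bary'(1,2)[OF tK(1)] t card_L[of t] tK(2) by (auto simp: Y_def A)
 have tV: "bary t \<notin> V0" using bary'(1)[OF tK(1)] tK(2) by (simp add: V0_def)
 let ?P = "insert p (j ` V0)"
 have "topspace Z - ?P \<subseteq> j ` Y"
 proof (rule connected_surface_minus_finite[OF surf conn])
  show "openin Z (j ` Y)" "openin Z (j ` (A - C))" by (rule j_open[OF oY], rule j_open[OF oC])
  show "finite ?P" using finV0 by simp
  show "topspace Z - ?P \<subseteq> j ` Y \<union> j ` (A - C)" using j_image cov by blast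
  have "j ` Y \<inter> j ` (A - C) = j ` (Y \<inter> (A - C))" by (rule inj_on_image_Int[OF j_inj, symmetric]) (use subs in auto)
  thus "j ` Y \<inter> j ` (A - C) \<subseteq> ?P" by (auto simp: Y_def C_def)
  have "j (bary t) \<notin> j ` V0" using tV subs ty j_inj by (meson inj_on_image_mem_iff subsetD)
  thus "j ` Y - ?P ~= {}" using ty j_image subs by blast
 qed
 moreover have "j ` Y \<inter> surface_boundary Z = {}" using nb by blast
 moreover have "surface_boundary Z \<subseteq> topspace Z"
  unfolding surface_boundary_def half_plane_chart_def using openin_subset by blast
 ultimately have "surface_boundary Z \<subseteq> ?P" by blast
 thus False using infinite_surface_boundary[OF surf] finV0 finite_subset by auto
qed

definition Kh :: "'v set set" where "Kh = K \<union> {{om}} \<union> insert om ` L"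

lemma scKh: "scomplex Kh" unfolding scomplex_def
proof (intro ballI conjI allI impI)
 fix s assume s: "s \<in> Kh"
 show "finite s" "s ~= {}" using s scomplex_finite[OF scK] scomplex_nonempty[OF scK] LK by (auto simp: Kh_def)
 fix t assume t: "t \<subseteq> s \<and> t ~= {}"
 show "t \<in> Kh"
 proof (cases "s \<in> K")
  case True
  thus ?thesis using t scomplexD[OF scK True] by (auto simp: Kh_def)
 next
  case False
  then obtain r where r: "r = {} \<or> r \<in> L" "s = insert om r" using s by (auto simp: Kh_def)
  have "t - {om} = {} \<or> t - {om} \<in> L" using scomplexD[OF scL, of r "t - {om}"] r t by auto
  thus ?thesis
  proof
   assume "t - {om} = {}"
   thus ?thesis using t by (auto simp: Kh_def)
  next
   assume tL: "t - {om} \<in> L"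
   show ?thesis
   proof (cases "om \<in> t")
    case True hence "t = insert om (t - {om})" by blast
    thus ?thesis using tL unfolding Kh_def by blast
   next
    case False thus ?thesis using tL LK by (auto simp: Kh_def)
   qed
  qed
 qed
qed

lemma finKh: "finite Kh" using finK finite_subset[OF LK] by (simp add: Kh_def)

lemma card_Kh: assumes "s \<in> Kh" shows "card s \<le> 3" using card_L card_insert_le_m1 assms card_K by (fastforce simp: Kh_def)

text \<open>An edge outside \<open>L\<close> lies in no triangle of the cone, so a free edge found
  inside \<open>K\<close> remains free. If only triangles of the cone are left, each of them is free
  at its base.\<close>

lemma free_Kh: "free_faces Kh om" unfolding free_faces_def
proof (intro allI impI)
 fix T assume T: "T \<subseteq> {t \<in> Kh. card t = 3} \<and> T ~= {}"
 show "\<exists>t\<in>T. \<exists>e\<subseteq>t. card e = 2 \<and> om \<notin> e \<and> (\<forall>t'\<in>T. e \<subseteq> t' --> t' = t)"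
 proof (cases "T \<inter> K = {}")
  case False
  have "T \<inter> K \<subseteq> {t \<in> K. card t = 3}" using T by auto
  from free_A_edge[OF this False] obtain t e where te': "t \<in> T \<inter> K" "e \<subseteq> t \<and> card e = 2 \<and> e \<notin> L \<and> (\<forall>t'\<in>T \<inter> K. e \<subseteq> t' --> t' = t)"
   by (elim bexE exE)
  note te = te'(1) conjunct1[OF te'(2)] conjunct1[OF conjunct2[OF te'(2)]] conjunct1[OF conjunct2[OF conjunct2[OF te'(2)]]]
   mp[OF bspec[OF conjunct2[OF conjunct2[OF conjunct2[OF te'(2)]]]]]
  have we: "om \<notin> e" using te om by blast
  have "t' = t" if t': "t' \<in> T" "e \<subseteq> t'" for t'
  proof (cases "t' \<in> K")
   case True thus ?thesis using te(5) t' by blast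
  next
   case False
   have "e ~= {}" using te(3) by auto
   then obtain r where r: "r \<in> L" "t' = insert om r" using False t'(1) T t'(2) we by (auto simp: Kh_def)
   thus ?thesis using te(4) scomplexD[OF scL r(1)] \<open>e ~= {}\<close> t'(2) we by auto
  qed
  thus ?thesis using te we by blast
 next
  case True
  have cone: "\<exists>r\<in>L. t = insert om r \<and> om \<notin> r \<and> card r = 2" if "t \<in> T" for t
  proof -
   have "t \<in> Kh" "card t = 3" "t \<notin> K" using that T True by auto
   then obtain r where r: "r \<in> L" "t = insert om r" by (auto simp: Kh_def)
   hence "om \<notin> r" "finite r" using LK om scomplex_finite[OF scL] by auto
   thus ?thesis using r \<open>card t = 3\<close> by auto
  qed
  obtain t where t: "t \<in> T" using T by blast
  obtain r where r: "r \<in> L" "t = insert om r" "om \<notin> r" "card r = 2" using cone[OF t] by blast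
  have "t' = t" if t': "t' \<in> T" "r \<subseteq> t'" for t'
  proof -
   obtain r' where r': "r' \<in> L" "t' = insert om r'" "om \<notin> r'" "card r' = 2" using cone[OF t'(1)] by blast
   thus ?thesis using r card_subset_eq[OF scomplex_finite[OF scL r'(1)]] t'(2) by auto
  qed
  thus ?thesis using t r by blast
 qed
qed

text \<open>The simplices that cannot be reached from \<open>om\<close> form a compact part of
  \<open>A\<close> that is also open in \<open>A\<close>. Its image in the connected surface is open
  and closed but misses \<open>p\<close>, so it is empty.\<close>

lemma edge_connected_Kh: "edge_connected Kh om"
proof -
 define E where "E = {(u, v). {u, v} \<in> Kh}"
 define R where "R = {v. (om, v) \<in> E\<^sup>*}"
 define S where "S = {s \<in> K. s \<inter> R = {}}"
 define S' where "S' = {s \<in> K. s \<subseteq> R}"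
 have step: "w \<in> R" if "v \<in> R" "{v, w} \<in> Kh" for v w using that unfolding R_def E_def by (auto intro: rtrancl_into_rtrancl)
 have LR: "s \<subseteq> R" if "s \<in> L" for s
 proof
  fix v assume "v \<in> s"
  hence "{om, v} \<in> Kh" using scomplexD[OF scL that] by (simp add: Kh_def)
  thus "v \<in> R" by (rule step[rotated]) (simp add: R_def)
 qed
 have KS: "K = S \<union> S'"
 proof -
  have "s \<in> S'" if s: "s \<in> K" "v \<in> s" "v \<in> R" for s v
  proof -
   have "w \<in> R" if "w \<in> s" for w using scomplexD[OF scK s(1), of "{v, w}"] s that by (intro step[OF s(3)]) (auto simp: Kh_def)
   thus ?thesis using s(1) by (auto simp: S'_def)
  qed
  thus ?thesis by (auto simp: S_def S'_def)
 qed
 have sc: "scomplex S" "scomplex S'" using scK unfolding scomplex_def S_def S'_def by blast+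
 have fin: "finite S" "finite S'" using finK by (auto simp: S_def S'_def)
 have SL: "s \<notin> L" if "s \<in> S" for s using that LR[of s] scomplex_nonempty[OF sc(1) that] by (auto simp: S_def)
 hence SA: "realiz S \<subseteq> A" using KS by (auto simp: A realiz_def)
 have dis: "realiz S \<inter> realiz S' = {}" using scomplex_nonempty[OF sc(1)] by (fastforce simp: realiz_def S_def S'_def)
 have un: "A \<subseteq> realiz S \<union> realiz S'" unfolding realiz_Un[symmetric] KS[symmetric] by (auto simp: A)
 have "openin (top_of_set A) (A - A \<inter> realiz S')" using closedin_closed_Int[OF closed_realiz[OF fin(2) sc(2)]] by (simp add: openin_diff)
 moreover have "A - A \<inter> realiz S' = realiz S" using un dis SA by blast
 ultimately have o: "openin Z (j ` realiz S)" using j_open by simp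
 have "compactin (top_of_set A) (realiz S)" using compact_realiz[OF fin(1) sc(1)] SA by (simp add: compactin_subtopology)
 hence "j ` realiz S = {} \<or> j ` realiz S = topspace Z" using conn o compactin_imp_closedin haus image_compactin j_cont by (metis connected_space_clopen_in)
 moreover have "p \<notin> j ` realiz S" using SA j_image by blast
 ultimately have e: "realiz S = {}" using p by blast
 have "S = {}"
 proof (rule ccontr)
  assume "S ~= {}"
  then obtain s where "s \<in> S" by blast
  thus False using e bary[of s S] scomplex_finite[OF sc(1)] scomplex_nonempty[OF sc(1)] by simp
 qed
 hence "v \<in> R" if "{v} \<in> Kh" for v
 proof (cases "v = om")
  case False
  thus ?thesis using KS \<open>S = {}\<close> that LK by (auto simp: S'_def Kh_def)
 qed (simp add: R_def)
 thus ?thesis by (simp add: edge_connected_def R_def E_def)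
qed

end

section \<open>From the given triangulation to the labelled complex\<close>

section \<open>Barycentric coordinates on a geometric complex\<close>

lemma scaleR_apply: "(r *\<^sub>R f) i = r *\<^sub>R f i" by (simp add: scaleR_fun_def)

lemma sum_scaleR_apply: "(\<Sum>v\<in>S. u v *\<^sub>R (f v :: nat => real)) i = (\<Sum>v\<in>S. u v * f v i)"
 by (induction S rule: infinite_finite_induct) (simp_all add: scaleR_apply)

lemma affine_weights_unique:
 fixes s :: "'a::real_vector set"
 assumes "finite s" "\<not> affine_dependent s" "sum u s = sum w s" "(\<Sum>v\<in>s. u v *\<^sub>R v) = (\<Sum>v\<in>s. w v *\<^sub>R v)" "v \<in> s"
 shows "u v = w v"
proof (rule ccontr)
 assume "u v ~= w v"
 moreover have "sum (\<lambda>v. u v - w v) s = 0" using assms(3) by (simp add: sum_subtractf)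
 moreover have "(\<Sum>v\<in>s. (u v - w v) *\<^sub>R v) = 0" using assms(4) by (simp add: scaleR_diff_left sum_subtractf)
 ultimately have "affine_dependent s" unfolding affine_dependent_explicit_finite[OF assms(1)]
  using assms(5) by (intro exI[of _ "\<lambda>v. u v - w v"]) auto
 thus False using assms(2) by simp
qed

text \<open>Vertices are renamed by natural numbers: the covering complexes need a countable type of
  vertices, and a new vertex for the cone must be at hand.\<close>

locale geo =
 fixes k :: nat and K :: complex_of_points and idx :: "(nat => real) => nat"
 assumes gK: "geometric_complex k K" and idx: "inj_on idx (\<Union>K)"
begin

definition Ka :: "nat set set" where "Ka = (`) idx ` K"

definition bt :: "(nat => real) => nat => real" where "bt x = (\<Sum>v\<in>\<Union>K. x (idx v) *\<^sub>R v)"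

lemmas gKD = gK[unfolded geometric_complex_def]

lemma fin: "finite K" "s \<in> K ==> finite s" "s \<in> K ==> s ~= {}" "finite (\<Union>K)"
 and indep: "s \<in> K ==> \<not> affine_dependent s" using conjunct1[OF conjunct2[OF gKD]] conjunct1[OF gKD] by auto

lemma face: "s \<in> K ==> t \<subseteq> s ==> t ~= {} ==> t \<in> K" using conjunct1[OF conjunct2[OF conjunct2[OF gKD]]] by blast

lemma meet: "s \<in> K ==> t \<in> K ==> convex hull s \<inter> convex hull t = convex hull (s \<inter> t)"
 using conjunct2[OF conjunct2[OF conjunct2[OF gKD]]] by simp

lemma idx_eq: "v \<in> \<Union>K ==> w \<in> \<Union>K ==> idx v = idx w \<longleftrightarrow> v = w"
 using idx by (auto simp: inj_on_def)

lemma idx_image_eq: "s \<subseteq> \<Union>K ==> t \<subseteq> \<Union>K ==> idx ` s = idx ` t \<longleftrightarrow> s = t"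
 using idx by (meson inj_on_image_eq_iff)

lemma idx_mem: "v \<in> \<Union>K ==> s \<subseteq> \<Union>K ==> idx v \<in> idx ` s \<longleftrightarrow> v \<in> s"
 using idx by (meson inj_on_image_mem_iff)

lemma Ka_iff: "s \<subseteq> \<Union>K ==> idx ` s \<in> Ka \<longleftrightarrow> s \<in> K"
using idx_image_eq by (auto simp: Ka_def)

lemma sc_Ka: "scomplex Ka" unfolding scomplex_def
proof (intro ballI conjI allI impI)
 fix s' assume "s' \<in> Ka"
 then obtain s where s: "s \<in> K" "s' = idx ` s" by (auto simp: Ka_def)
 thus "finite s'" "s' ~= {}" using fin by auto
 fix t' assume "t' \<subseteq> s' \<and> t' ~= {}"
 thus "t' \<in> Ka" using face[OF s(1)] s(2) by (auto simp: Ka_def subset_image_iff)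
qed

lemma fin_Ka: "finite Ka" using fin(1) by (simp add: Ka_def)

lemma card_idx: "s \<in> K ==> card (idx ` s) = card s" using idx by (intro card_image) (auto simp: inj_on_def)

lemma realiz_supp: assumes "x \<in> realiz Ka" obtains s where "s \<in> K" "supp x = idx ` s"
 using assms by (auto simp: realiz_def Ka_def)

lemma supp_idx: "supp x = idx ` s ==> s \<subseteq> \<Union>K ==> v \<in> \<Union>K ==> x (idx v) ~= 0 \<longleftrightarrow> v \<in> s"
 using idx_mem[of v s] by (auto simp: supp_def)

lemma bt_restrict:
 assumes "supp x \<subseteq> idx ` s" "s \<in> K" shows "bt x = (\<Sum>v\<in>s. x (idx v) *\<^sub>R v)" unfolding bt_def
proof (rule sum.mono_neutral_right[OF fin(4)])
 show "\<forall>v\<in>\<Union>K - s. x (idx v) *\<^sub>R v = 0" using assms(1) idx_mem assms(2) by (auto simp: supp_def)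
qed (use assms in blast)

lemma weights_sum:
 assumes "x \<in> realiz Ka" "supp x \<subseteq> idx ` s" "s \<in> K" shows "(\<Sum>v\<in>s. x (idx v)) = 1"
proof -
 have "(\<Sum>v\<in>s. x (idx v)) = sum x (idx ` s)" using idx assms(3) by (subst sum.reindex) (auto simp: inj_on_def)
 thus ?thesis using realiz_sum[OF assms(1) _ assms(2)] fin(2)[OF assms(3)] by simp
qed

lemma weights_realiz:
 assumes s: "s \<in> K" and u: "\<forall>v\<in>s. 0 \<le> u v" "sum u s = 1"
 obtains x where "x \<in> realiz Ka" "supp x \<subseteq> idx ` s" "\<forall>v\<in>s. x (idx v) = u v" "bt x = (\<Sum>v\<in>s. u v *\<^sub>R v)"
proof -
 define x where "x i = (if i \<in> idx ` s then u (inv_into s idx i) else 0)" for i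
 have ij: "inj_on idx s" using idx s by (auto simp: inj_on_def)
 have xv: "x (idx v) = u v" if "v \<in> s" for v using that ij by (simp add: x_def)
 have sx: "supp x \<subseteq> idx ` s" by (auto simp: supp_def x_def)
 have nn: "0 \<le> x i" for i using u(1) by (auto simp: x_def inv_into_into)
 have 1: "sum x (idx ` s) = 1" using u(2) ij xv by (simp add: sum.reindex)
 have "x \<in> realiz (faces (idx ` s))" using fin(2)[OF s] nn 1 by (subst realiz_faces) (auto simp: x_def)
 hence "x \<in> realiz Ka" using scomplexD[OF sc_Ka] s by (auto simp: realiz_def faces_def Ka_def)
 moreover have "bt x = (\<Sum>v\<in>s. u v *\<^sub>R v)" using bt_restrict[OF sx s] xv by simp
 ultimately show thesis using that sx xv by blast
qed

lemma hull_eq: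
 assumes s: "s \<in> K" shows "convex hull s = bt ` {x \<in> realiz Ka. supp x \<subseteq> idx ` s}"
proof (intro equalityI subsetI)
 fix y assume "y \<in> convex hull s"
 then obtain u where u: "\<forall>v\<in>s. 0 \<le> u v" "sum u s = 1" "(\<Sum>v\<in>s. u v *\<^sub>R v) = y"
  unfolding convex_hull_finite[OF fin(2)[OF s]] by blast
 obtain x where "x \<in> realiz Ka" "supp x \<subseteq> idx ` s" "bt x = (\<Sum>v\<in>s. u v *\<^sub>R v)" by (rule weights_realiz[OF s u(1,2)])
 thus "y \<in> bt ` {x \<in> realiz Ka. supp x \<subseteq> idx ` s}" using u(3) by (intro image_eqI[of _ _ x]) simp_all
next
 fix y assume "y \<in> bt ` {x \<in> realiz Ka. supp x \<subseteq> idx ` s}"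
 then obtain x where x: "x \<in> realiz Ka" "supp x \<subseteq> idx ` s" "y = bt x" by blast
 show "y \<in> convex hull s" using weights_sum[OF x(1,2) s] bt_restrict[OF x(2) s] x(3) x(1) by (auto simp: convex_hull_finite[OF fin(2)[OF s]] realiz_def)
qed

lemma bt_hull: "x \<in> realiz Ka ==> supp x \<subseteq> idx ` s ==> s \<in> K ==> bt x \<in> convex hull s"
 unfolding hull_eq by simp

lemma bt_image: "bt ` realiz Ka = polyhedron_of K"
proof (intro equalityI subsetI)
 fix y assume "y \<in> bt ` realiz Ka"
 then obtain x where x: "x \<in> realiz Ka" "y = bt x" by blast
 obtain s where s: "s \<in> K" "supp x = idx ` s" using realiz_supp[OF x(1)] .
 thus "y \<in> polyhedron_of K" using bt_hull[OF x(1)] x(2) by (auto simp: polyhedron_of_def)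
next
 fix y assume "y \<in> polyhedron_of K"
 thus "y \<in> bt ` realiz Ka" by (auto simp: hull_eq polyhedron_of_def)
qed

text \<open>A point of two closed simplices lies in the hull of their common vertices; affine
  independence then forces all its weights onto these vertices, and determines them.\<close>

lemma bt_inj: "inj_on bt (realiz Ka)"
proof (rule inj_onI)
 have sub: "s \<subseteq> t" if x: "x \<in> realiz Ka" "supp x = idx ` s" "s \<in> K" and y: "y \<in> realiz Ka" "supp y = idx ` t" "t \<in> K" and e: "bt x = bt y" for x y s t
 proof
  fix v assume v: "v \<in> s"
  have sK: "s \<subseteq> \<Union>K" using x(3) by blast
  have "finite (s \<inter> t)" using fin(2)[OF x(3)] by simp
  then obtain u where u: "sum u (s \<inter> t) = 1" "(\<Sum>v\<in>s \<inter> t. u v *\<^sub>R v) = bt x" using meet[OF x(3) y(3)] bt_hull[of x s] bt_hull[of y t] x y e by (fastforce simp: convex_hull_finite[OF \<open>finite (s \<inter> t)\<close>])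
  define u' where "u' v = (if v \<in> t then u v else 0)" for v
  have "sum u' s = 1" "(\<Sum>v\<in>s. u' v *\<^sub>R v) = bt x"
   using u fin(2)[OF x(3)] by (simp_all add: u'_def sum.inter_restrict if_distrib[of "\<lambda>c. c *\<^sub>R _"] cong: if_cong)
  moreover have "(\<Sum>v\<in>s. x (idx v)) = 1" "bt x = (\<Sum>v\<in>s. x (idx v) *\<^sub>R v)"
   using weights_sum[OF x(1) _ x(3)] bt_restrict[OF _ x(3), of x] x(2) by simp_all
  ultimately have "x (idx v) = u' v"
   by (intro affine_weights_unique[OF fin(2)[OF x(3)] indep[OF x(3)] _ _ v, where u = "\<lambda>v. x (idx v)" and w = u']) simp_all
  moreover have "x (idx v) ~= 0" using supp_idx[OF x(2) sK, of v] v sK by blast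
  ultimately show "v \<in> t" by (auto simp: u'_def split: if_splits)
 qed
 fix x y assume x: "x \<in> realiz Ka" and y: "y \<in> realiz Ka" and e: "bt x = bt y"
 obtain s where s: "s \<in> K" "supp x = idx ` s" using realiz_supp[OF x] .
 obtain t where t: "t \<in> K" "supp y = idx ` t" using realiz_supp[OF y] .
 have st: "s = t" using sub[OF x s(2,1) y t(2,1) e] sub[OF y t(2,1) x s(2,1) e[symmetric]] by blast
 have w: "x (idx v) = y (idx v)" if "v \<in> s" for v
  using that weights_sum[OF x _ s(1)] weights_sum[OF y _ s(1)] bt_restrict[OF _ s(1), of x] bt_restrict[OF _ s(1), of y] s(2) t(2) st e
  by (intro affine_weights_unique[OF fin(2)[OF s(1)] indep[OF s(1)], where u = "\<lambda>v. x (idx v)" and w = "\<lambda>v. y (idx v)"]) simp_all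
 show "x = y"
 proof
  fix i show "x i = y i" by (cases "i \<in> idx ` s"; use w s(2) t(2) st in \<open>fastforce simp: supp_def\<close>)
 qed
qed

definition br :: "(nat => real) => nat => real" where "br = inv_into (realiz Ka) bt"

lemma br_bt: "x \<in> realiz Ka ==> br (bt x) = x" and bt_br: "y \<in> polyhedron_of K ==> bt (br y) = y"
 and br_realiz: "y \<in> polyhedron_of K ==> br y \<in> realiz Ka" and bt_poly: "x \<in> realiz Ka ==> bt x \<in> polyhedron_of K"
 unfolding br_def using bt_inj bt_image by (auto simp: f_inv_into_f intro: inv_into_into)

lemma bt_cont: "continuous_on S bt"
proof (rule continuous_on_coordinatewise_then_product)
 fix i
 have c: "continuous_on S (\<lambda>x::nat => real. x j)" for j by (rule continuous_on_subset[OF continuous_on_product_coordinates]) simp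
 show "continuous_on S (\<lambda>x. bt x i)" unfolding bt_def sum_scaleR_apply by (intro continuous_intros c)
qed

lemma br_cont: "continuous_on (polyhedron_of K) br" unfolding bt_image[symmetric]
 by (rule continuous_on_inv[OF bt_cont compact_realiz[OF fin_Ka sc_Ka]]) (simp add: br_bt)

lemma in_open_simplex:
 assumes x: "x \<in> realiz Ka" and s: "s \<in> K" shows "bt x \<in> open_simplex s \<longleftrightarrow> supp x = idx ` s"
proof
 assume a: "supp x = idx ` s"
 have "0 < x (idx v)" if "v \<in> s" for v
 proof -
  have "0 \<le> x (idx v)" using x by (simp add: realiz_def)
  thus ?thesis using supp_idx[OF a, of v] that s by fastforce
 qed
 thus "bt x \<in> open_simplex s" unfolding open_simplex_def
  using weights_sum[OF x _ s] bt_restrict[OF _ s, of x] a by (intro CollectI exI[of _ "\<lambda>v. x (idx v)"]) auto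
next
 assume "bt x \<in> open_simplex s"
 then obtain u where u: "\<forall>v\<in>s. 0 < u v" "sum u s = 1" "bt x = (\<Sum>v\<in>s. u v *\<^sub>R v)" unfolding open_simplex_def by blast
 then obtain x' where x': "x' \<in> realiz Ka" "supp x' \<subseteq> idx ` s" "\<forall>v\<in>s. x' (idx v) = u v" "bt x' = (\<Sum>v\<in>s. u v *\<^sub>R v)" using weights_realiz[OF s _ u(2)] by (auto simp: less_imp_le)
 show "supp x = idx ` s" using x'(2) bt_inj x x'(1,4) u(3) x'(3) u(1) by (fastforce simp: inj_on_def supp_def)
qed

lemma in_open_star:
 assumes x: "x \<in> realiz Ka" and v: "v \<in> \<Union>K" shows "bt x \<in> open_star K v \<longleftrightarrow> x (idx v) ~= 0"
proof -
 obtain s where s: "s \<in> K" "supp x = idx ` s" using realiz_supp[OF x] .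
 have "bt x \<in> open_simplex t \<longleftrightarrow> t = s" if "t \<in> K" for t
  using in_open_simplex[OF x that] s idx_image_eq[of s t] that by (metis Union_upper)
 thus ?thesis using supp_idx[OF s(2) _ v] s(1) by (auto simp: open_star_def)
qed

lemma br_vertex: assumes "{v} \<in> K" shows "br v = pt (idx v)"
using assms pt_realiz bt_restrict[of "pt (idx v)" "{v}"] br_bt by (fastforce simp: Ka_def)

lemma br_hull: assumes "s \<in> K" "y \<in> convex hull s" shows "supp (br y) \<subseteq> idx ` s" "y \<in> polyhedron_of K"
using assms hull_eq br_bt by (auto simp: polyhedron_of_def)

end

lemma subspace_of_Rn_eq: assumes "S \<subseteq> Rn k" shows "subspace_of_Rn k S = top_of_set S"
using assms topspace_Euclidean_space euclidean_product_topology subtopology_subtopology Int_absorb1 by (smt (verit) Euclidean_space_def)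

lemma polyhedron_subset: assumes "geometric_complex k K" shows "polyhedron_of K \<subseteq> Rn k"
proof -
 have "convex hull s \<subseteq> Rn k" if "s \<in> K" for s
 proof (rule hull_minimal)
  show "s \<subseteq> Rn k" using assms that by (auto simp: geometric_complex_def)
  show "convex (Rn k)" by (auto simp: topspace_Euclidean_space convex_def scaleR_apply)
 qed
 thus ?thesis by (auto simp: polyhedron_of_def)
qed

section \<open>Labels of lifts along edges\<close>

context lifted_map
begin

lemma Q_ex: assumes "x \<in> realiz Kt" obtains N where "x \<in> Q N"
 and "\<exists>r. \<forall>x\<in>realiz Kt. \<forall>v g. x (v, g) ~= 0 --> x \<in> Q (len g + r)"
proof -
 obtain r where r: "!!W s v g. s \<in> Kt ==> (v, g) \<in> s ==> \<forall>h\<in>FG n. len (- g + h) \<le> r --> h \<in> W ==> s \<in> P W"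
  by (rule radius) blast
 have *: "x \<in> Q (len g + r)" if x: "x \<in> realiz Kt" "x (v, g) ~= 0" for x v g
 proof -
  have "supp x \<in> P (B (len g + r))"
  proof (rule r[of _ v g])
   show "supp x \<in> Kt" using x by (simp add: realiz_def)
   show "(v, g) \<in> supp x" using x by (simp add: supp_def)
   have "len h \<le> len g + r" if "len (- g + h) \<le> r" for h using len_plus[of g "- g + h"] that by simp
   thus "\<forall>h\<in>FG n. len (- g + h) \<le> r --> h \<in> B (len g + r)" by (simp add: B_def)
  qed
  thus ?thesis unfolding Q_def by (rule realizP_I[OF x(1)])
 qed
 show thesis using that * *[OF assms] cover_pt_ex[OF assms] by metis
qed

text \<open>The lift on the whole cover, glued from the lifts on the finite pieces;
  \<open>FL_eq\<close> makes the choice of the piece immaterial.\<close>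

definition FL :: "('v \<times> fgrp => real) => 'v \<times> fgrp => real"
 where "FL x = fl (SOME N. x \<in> Q N) x"

lemma FL_eq: assumes "x \<in> Q N" shows "FL x = fl N x"
proof -
 let ?M = "SOME N. x \<in> Q N"
 have M: "x \<in> Q ?M" using assms by (rule someI)
 show ?thesis using fl_agree[OF _ M, of "max N ?M"] fl_agree[OF _ assms, of "max N ?M"] by (simp add: FL_def)
qed

lemma FL: assumes "x \<in> realiz Kt" shows "FL x \<in> realiz Kt" "proj (FL x) = F (proj x)"
proof -
 obtain N where N: "x \<in> Q N" using Q_ex[OF assms] by metis
 show "FL x \<in> realiz Kt" "proj (FL x) = F (proj x)" unfolding FL_eq[OF N] using fl_realiz[OF N] fl_proj[OF N] by auto
qed

lemma FL_shift: assumes "x \<in> realiz Kt" "y \<in> FG n" shows "FL (shift y x) = shift (ph y) (FL x)"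
proof -
 obtain N where N: "x \<in> Q N" using Q_ex[OF assms(1)] by metis
 have "shift y x \<in> Q (len y + N)" by (rule shift_Q[OF N assms(2)]) simp
 thus ?thesis using FL_eq FL_eq[OF N] fl_shift[OF assms(2) order_refl N] by simp
qed

lemma FL_cont:
 assumes "continuous_on S c" "!!t. t \<in> S ==> c t \<in> realiz Kt" "!!t. t \<in> S ==> \<exists>v. c t (v, 0) ~= 0 \<or> c t (v, g) ~= 0"
 shows "continuous_on S (\<lambda>t. FL (c t))"
proof -
 obtain r where r: "!!x v g. x \<in> realiz Kt ==> x (v, g) ~= 0 ==> x \<in> Q (len g + r)" using Q_ex by metis
 have Q: "c t \<in> Q (len g + r)" if "t \<in> S" for t
  using assms(3)[OF that] r[OF assms(2)[OF that], of _ 0] r[OF assms(2)[OF that], of _ g] Q_mono[of "len 0 + r" "len g + r"] by auto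
 have "continuous_on S (\<lambda>t. fl (len g + r) (c t))" by (rule continuous_on_compose2[OF fl_cont assms(1)]) (use Q in auto)
 thus ?thesis using FL_eq[OF Q] by simp
qed

text \<open>The sheet over the vertex \<open>al\<close> at the lifted image of \<open>x\<close>; it
  is determined when the image of \<open>proj x\<close> has a nonzero coordinate at
  \<open>al\<close>.\<close>

definition lab :: "('v \<times> fgrp => real) => 'v => fgrp" where "lab x al = (SOME h. FL x (al, h) ~= 0)"

lemma lab_ex: assumes "x \<in> realiz Kt" "F (proj x) al ~= 0" shows "FL x (al, lab x al) ~= 0"
using proj_zero[of "FL x" al] FL(2)[OF assms(1)] assms(2) someI_ex by (simp add: lab_def)

lemma lab_eq: assumes "x \<in> realiz Kt" "FL x (al, h) ~= 0" shows "lab x al = h"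
proof -
 have "FL x (al, lab x al) ~= 0" unfolding lab_def by (rule someI[of "\<lambda>h. FL x (al, h) ~= 0", OF assms(2)])
 note c = cover_pt[OF FL(1)[OF assms(1)] assms(2) this]
 show ?thesis using c(1) lam_self c(3) by auto
qed

lemma lab_shift: assumes "x \<in> realiz Kt" "y \<in> FG n" "F (proj x) al ~= 0" shows "lab (shift y x) al = ph y + lab x al"
by (rule lab_eq; use shift_realiz[OF assms(1,2)] FL_shift[OF assms(1,2)] lab_ex[OF assms(1,3)] in \<open>auto\<close>)

text \<open>Keeping \<open>al\<close> on its initial sheet gives a lift of the same path, so
  uniqueness identifies it with \<open>FL\<close> along the path.\<close>

lemma label_constant:
 fixes c :: "real => 'v \<times> fgrp => real"
 assumes S: "connected S" "a \<in> S" "m \<in> S" and c: "continuous_on S c" "!!t. t \<in> S ==> c t \<in> realiz Kt"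
  and cF: "continuous_on S (\<lambda>t. FL (c t))" "continuous_on S (\<lambda>t. F (proj (c t)))" and al: "!!t. t \<in> S ==> F (proj (c t)) al ~= 0"
 shows "lab (c m) al = lab (c a) al"
proof -
 let ?g = "lab (c a) al"
 have g: "FL (c a) (al, ?g) ~= 0" by (rule lab_ex[OF c(2) al]) (rule S(2))+
 have gF: "?g \<in> FG n" using cover_pt(2)[OF FL(1)[OF c(2)[OF S(2)]] g g] .
 have FK: "F (proj (c t)) \<in> realiz K" if "t \<in> S" for t by (rule FK[OF proj_realiz[OF c(2)[OF that]]])
 have "FL (c m) = lift_at al ?g (F (proj (c m)))"
 proof (rule lift_unique[OF S(1) cF(1) FL(1)[OF c(2)] _ _ _ S(2) _ S(3)])
  show "continuous_on S (\<lambda>t. lift_at al ?g (F (proj (c t))))" by (rule continuous_on_lift_at[OF cF(2)])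
  show "lift_at al ?g (F (proj (c t))) \<in> realiz Kt" if "t \<in> S" for t by (rule lift_at_realiz[OF FK[OF that] al[OF that] gF])
  show "proj (FL (c t)) = proj (lift_at al ?g (F (proj (c t))))" if "t \<in> S" for t using FL(2)[OF c(2)[OF that]] by (simp add: proj_lift_at)
  show "FL (c a) = lift_at al ?g (F (proj (c a)))" using eq_lift_at[OF FL(1)[OF c(2)[OF S(2)]] g] FL(2)[OF c(2)[OF S(2)]] by simp
 qed
 moreover have "lam al al = 0" using lam_self FK[OF S(3)] al[OF S(3)] by (auto simp: realiz_def supp_def)
 ultimately have "FL (c m) (al, ?g) ~= 0" using al[OF S(3)] by simp
 thus ?thesis by (rule lab_eq[OF c(2)[OF S(3)]])
qed

lemma edge_lift:
 assumes uv: "{u, v} \<in> K" and y: "y \<in> realiz K" "supp y \<subseteq> {u, v}"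
 shows "lift_at u 0 y \<in> realiz Kt" "lift_at u 0 y (u, 0) ~= 0 \<or> lift_at u 0 y (v, lam u v) ~= 0" "lift_at u 0 (pt v) = pt (v, lam u v)"
proof -
 have l0: "lam u u = 0" "lam v v = 0" using lam_self[OF uv] by auto
 show p: "lift_at u 0 (pt v) = pt (v, lam u v)" by (auto simp: pt_def)
 have "lift_at u 0 y \<in> realiz Kt \<and> (lift_at u 0 y (u, 0) ~= 0 \<or> lift_at u 0 y (v, lam u v) ~= 0)"
 proof (cases "y u = 0")
  case False
  thus ?thesis using lift_at_realiz[OF y(1) False, of 0] l0 by simp
 next
  case True
  hence sv: "supp y \<subseteq> {v}" using y(2) by (auto simp: supp_def)
  hence s: "y w = 0" if "w ~= v" for w using that by (auto simp: supp_def)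
  have "y = pt v" using s realiz_sum[OF y(1) _ sv] by (auto simp: pt_def)
  moreover have "pt (v, lam u v) = shift (lam u v) (lift_at v 0 (pt v))" using l0 by (simp add: shift_lift_at) (auto simp: fun_eq_iff pt_def)
  moreover have "{v} \<in> K" using scomplexD[OF scK uv] by simp
  hence "lift_at v 0 (pt v) \<in> realiz Kt" by (intro lift_at_realiz) (simp_all add: pt_realiz)
  ultimately show ?thesis using shift_realiz[of "lift_at v 0 (pt v)" "lam u v"] lam_FG[of u v] p l0 by simp
 qed
 thus "lift_at u 0 y \<in> realiz Kt" "lift_at u 0 y (u, 0) ~= 0 \<or> lift_at u 0 y (v, lam u v) ~= 0" by auto
qed

text \<open>The vertex \<open>al\<close> can be followed along the path except at its end,
  \<open>be\<close> except at its start. At the midpoint both belong to the support of the image,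
  where their sheets differ by \<open>lam al be\<close>.\<close>

lemma edge_potential:
 fixes c :: "real => 'v => real"
 assumes uv: "{u, v} \<in> K" and c: "continuous_on {0..1} c" "!!t. t \<in> {0..1} ==> c t \<in> realiz K" "!!t. t \<in> {0..1} ==> supp (c t) \<subseteq> {u, v}"
  and al: "!!t. t \<in> {0..<1} ==> F (c t) al ~= 0" and be: "!!t. t \<in> {0<..1} ==> F (c t) be ~= 0"
 shows "lab (lift_at u 0 (c 1)) be = lab (lift_at u 0 (c 0)) al + lam al be"
proof -
 let ?e = "\<lambda>t. lift_at u 0 (c t)"
 have e: "?e t \<in> realiz Kt" if "t \<in> {0..1}" for t using edge_lift(1)[OF uv c(2,3)] that by blast
 have cF: "continuous_on {0..1} (\<lambda>t. F (c t))" by (rule continuous_on_compose2[OF contF c(1)]) (use c(2) in auto)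
 have ce: "continuous_on {0..1} ?e" by (rule continuous_on_lift_at[OF c(1)])
 have cFL: "continuous_on {0..1} (\<lambda>t. FL (?e t))"
  by (rule FL_cont[OF ce e, of "lam u v"]) (use edge_lift(2)[OF uv c(2,3)] in blast)+
 have 1: "lab (?e (1/2)) al = lab (?e 0) al"
  by (rule label_constant[of "{0..<1}"]) (use al in \<open>auto intro: continuous_on_subset[OF ce] continuous_on_subset[OF cFL] continuous_on_subset[OF cF] e simp: proj_lift_at\<close>)
 have 2: "lab (?e (1/2)) be = lab (?e 1) be"
  by (rule label_constant[of "{0<..1}"]) (use be in \<open>auto intro: continuous_on_subset[OF ce] continuous_on_subset[OF cFL] continuous_on_subset[OF cF] e simp: proj_lift_at\<close>)
 have h: "?e (1/2) \<in> realiz Kt" by (rule e) simp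
 have "FL (?e (1/2)) (al, lab (?e (1/2)) al) ~= 0" "FL (?e (1/2)) (be, lab (?e (1/2)) be) ~= 0"
  by (rule lab_ex[OF h]; simp add: proj_lift_at al be)+
 thus ?thesis using 1 2 cover_pt(1)[OF FL(1)[OF h]] by simp
qed

lemma pt_Kt: assumes "{v} \<in> K" shows "pt (v, 0) \<in> realiz Kt"
 using edge_lift(1)[of v v "pt v"] edge_lift(3)[of v v "pt v"] assms lam_self[of "{v}" v] by (simp add: pt_realiz)

lemma edge_ends:
 assumes uv: "{u, v} \<in> K"
 shows "lift_at u 0 (pt u) = pt (u, 0)" "F (pt v) be ~= 0 ==> lab (lift_at u 0 (pt v)) be = ph (lam u v) + lab (pt (v, 0)) be"
proof -
 have s: "{u} \<in> K" "{v} \<in> K" using scomplexD[OF scK uv] by auto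
 show "lift_at u 0 (pt u) = pt (u, 0)" using edge_lift(3)[of u u "pt u"] s lam_self[of "{u}" u] by (simp add: pt_realiz)
 assume "F (pt v) be ~= 0"
 moreover have "lift_at u 0 (pt v) = shift (lam u v) (pt (v, 0))" using edge_lift(3)[OF uv, of "pt v"] s by (simp add: pt_realiz)
 ultimately show "lab (lift_at u 0 (pt v)) be = ph (lam u v) + lab (pt (v, 0)) be"
  using lab_shift[OF pt_Kt[OF s(2)] lam_FG[of u v], of be] by simp
qed

lemma ph_zero: "ph 0 = 0" using ph_plus[of 0 0] by (intro idem_zero) simp

text \<open>Labels vanish on \<open>C\<close>, so \<open>Z0\<close> lifts \<open>C\<close> to sheet
  0. The maps \<open>FL \<circ> Z0\<close> and \<open>Z0 \<circ> F\<close> lift the same map and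
  agree at the base point, hence everywhere on the connected \<open>C\<close>.\<close>

lemma lab_C: assumes v: "{v} \<in> C" "F (pt v) al ~= 0" shows "lab (pt (v, 0)) al = 0"
proof -
 define Z0 where "Z0 y = (\<lambda>(w, h). if h = (0::fgrp) then y w else 0)" for y :: "'v => real"
 have Zl: "Z0 y = lift_at w 0 y \<and> y w ~= 0 \<and> y \<in> realiz K" if "y \<in> realiz C" "y w ~= 0" for y w
 proof -
  have "lam w u = 0" if "y u ~= 0" for u
   using lamC[of "supp y" w u] \<open>y \<in> realiz C\<close> \<open>y w ~= 0\<close> that by (auto simp: realiz_def supp_def)
  thus ?thesis using realiz_mono[OF CK] that by (auto simp: fun_eq_iff Z0_def)
 qed
 have ex: "\<exists>w. y w ~= 0" if "y \<in> realiz C" for y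
 proof (rule ccontr)
  assume "\<nexists>w. y w ~= 0"
  thus False using that by (simp add: realiz_def)
 qed
 have ZK: "Z0 y \<in> realiz Kt" "proj (Z0 y) = y" if "y \<in> realiz C" for y
  using ex[OF that] Zl[OF that] lift_at_realiz[of y _ 0] proj_lift_at by (metis FG_zero)+
 have cZ: "continuous_on S (\<lambda>y. Z0 (G y))" if "continuous_on S G" for S and G :: "('v => real) => 'v => real"
 proof (rule continuous_on_coordinatewise_then_product)
  fix p :: "'v \<times> fgrp"
  show "continuous_on S (\<lambda>y. Z0 (G y) p)"
   by (cases p; cases "snd p = 0") (simp_all add: Z0_def continuous_on_product_then_coordinatewise[OF that])
 qed
 have Zpt: "Z0 (pt w) = pt (w, 0)" for w by (auto simp: Z0_def pt_def)
 have cF: "continuous_on (realiz C) F" by (rule continuous_on_subset[OF contF realiz_mono[OF CK]])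
 have "FL (Z0 (pt v)) = Z0 (F (pt v))"
 proof (rule lift_unique[of "realiz C" "\<lambda>y. FL (Z0 y)" "\<lambda>y. Z0 (F y)" "pt om" "pt v", OF connC])
  show "continuous_on (realiz C) (\<lambda>y. FL (Z0 y))"
  by (rule FL_cont[OF cZ[OF continuous_on_id] ZK(1), of _ 0]; use ex in \<open>auto simp: Z0_def\<close>)
  show "continuous_on (realiz C) (\<lambda>y. Z0 (F y))" by (rule cZ[OF cF])
  show "FL (Z0 y) \<in> realiz Kt" "Z0 (F y) \<in> realiz Kt" "proj (FL (Z0 y)) = proj (Z0 (F y))" if "y \<in> realiz C" for y
   using FL[OF ZK(1)[OF that]] ZK[OF FC[OF that]] ZK(2)[OF that] by simp_all
  show "pt om \<in> realiz C" "pt v \<in> realiz C" using omC v by (simp_all add: pt_realiz)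
  have "FL (pt (om, 0)) = pt (om, 0)" using FL_eq[OF pt_Q[of 0 0]] fl(2) by simp
  thus "FL (Z0 (pt om)) = Z0 (F (pt om))" unfolding Fom Zpt .
 qed
 hence e: "FL (pt (v, 0)) = Z0 (F (pt v))" by (simp add: Zpt)
 have "FL (pt (v, 0)) (al, 0) ~= 0" unfolding e using v(2) by (simp add: Z0_def)
 thus ?thesis using pt_Kt v(1) CK by (intro lab_eq) auto
qed

end

section \<open>Extension to the cone\<close>

locale cone =
 fixes K L :: "'v set set" and om :: 'v and F :: "('v => real) => 'v => real"
 assumes finK: "finite K" and scK: "scomplex K" and scL: "scomplex L" and LK: "L \<subseteq> K" and om: "om \<notin> \<Union>K"
  and contF: "continuous_on (realiz K) F" and FK: "x \<in> realiz K ==> F x \<in> realiz K" and FL: "x \<in> realiz L ==> F x \<in> realiz L"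
begin

definition Cn :: "'v set set" where "Cn = L \<union> {{om}} \<union> insert om ` L"

text \<open>The point at height \<open>s\<close> on the segment from \<open>z\<close> to the
  apex.\<close>

definition cp :: "real => ('v => real) => 'v => real" where "cp s z = (\<lambda>w. if w = om then s else (1 - s) * z w)"

text \<open>Projection from the apex. At the apex itself the division by 0 returns 0, which is
  harmless because \<open>cp 1 z\<close> does not depend on \<open>z\<close>.\<close>

definition base :: "('v => real) => 'v => real" where "base x = (\<lambda>w. if w = om then 0 else x w / (1 - x om))"

lemma off: "x \<in> realiz K ==> x om = 0" using om by (auto simp: realiz_def supp_def)

lemma realizL: "x \<in> realiz L ==> x \<in> realiz K" using realiz_mono[OF LK] by blast

lemma cp_0: "x \<in> realiz K ==> cp 0 x = x" using off by (auto simp: cp_def fun_eq_iff)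
lemma cp_1: "cp 1 z = pt om" by (auto simp: cp_def fun_eq_iff pt_def)

lemma cp_realiz: assumes z: "z \<in> realiz L" and s: "0 \<le> s" "s \<le> 1" shows "cp s z \<in> realiz Cn"
proof -
 have zK: "supp z \<in> L" "z om = 0" "!!v. 0 \<le> z v" "sum z (supp z) = 1" using z off[OF realizL[OF z]] by (auto simp: realiz_def)
 have f: "finite (supp z)" "om \<notin> supp z" using scomplex_finite[OF scL zK(1)] zK(2) by (auto simp: supp_def)
 consider "s = 0" | "s = 1" | "0 < s" "s < 1" using s by linarith
 thus ?thesis
 proof cases
  case 1
  thus ?thesis using cp_0[OF realizL[OF z]] z realiz_mono[of L Cn] by (auto simp: Cn_def)
 next
  case 2
  thus ?thesis by (simp add: cp_1 pt_realiz Cn_def)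
 next
  case 3
  have sup: "supp (cp s z) = insert om (supp z)" using 3 by (auto simp: supp_def cp_def)
  have "sum (cp s z) (supp z) = sum (\<lambda>w. (1 - s) * z w) (supp z)" using f(2) by (intro sum.cong refl) (auto simp: cp_def)
  hence "sum (cp s z) (insert om (supp z)) = 1" using f zK(4) by (simp add: cp_def sum_distrib_left[symmetric])
  moreover have "0 \<le> cp s z v" for v using zK(3) 3 by (simp add: cp_def)
  ultimately show ?thesis using zK(1) sup by (simp add: Cn_def realiz_def)
 qed
qed

lemma base: assumes x: "x \<in> realiz Cn" "x om ~= 1" shows "base x \<in> realiz L" "x = cp (x om) (base x)" "0 \<le> x om" "x om < 1"
proof -
 have nn: "0 \<le> x v" for v using x(1) by (simp add: realiz_def)
 have sx: "supp x \<in> Cn" "sum x (supp x) = 1" using x(1) by (auto simp: realiz_def)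
 have fs: "finite (supp x)" using sx(1) scomplex_finite[OF scL] by (auto simp: Cn_def)
 have SL: "supp x - {om} \<in> L" using sx(2) x(2) sx(1) LK om by (auto simp: Cn_def)
 have "sum x (insert om (supp x - {om})) = x om + sum x (supp x - {om})" by (rule sum.insert) (use fs in auto)
 hence s: "sum x (supp x - {om}) = 1 - x om" using realiz_sum[OF x(1), of "insert om (supp x - {om})"] fs by fastforce
 thus lt: "x om < 1" using x(2) sum_nonneg[of "supp x - {om}" x] nn by simp
 show "0 \<le> x om" by (rule nn)
 have sb: "supp (base x) = supp x - {om}" using x(2) by (auto simp: supp_def base_def)
 have "sum (base x) (supp x - {om}) = sum (\<lambda>w. x w / (1 - x om)) (supp x - {om})" by (intro sum.cong refl) (auto simp: base_def)
 also have "... = 1" using s lt by (simp add: sum_divide_distrib[symmetric])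
 finally show "base x \<in> realiz L" using SL nn lt by (simp add: realiz_def sb) (simp add: base_def)
 show "x = cp (x om) (base x)" using lt by (auto simp: cp_def base_def)
qed

lemma top: assumes "x \<in> realiz Cn" "x om = 1" shows "x = pt om"
proof
 have nn: "0 \<le> x v" for v using assms(1) by (simp add: realiz_def)
 have fs: "finite (supp x)" using assms(1) scomplex_finite[OF scL] by (auto simp: Cn_def realiz_def)
 fix w show "x w = pt om w"
 proof (cases "w = om")
  case False
  have "sum x (insert w (insert om (supp x))) = 1" by (rule realiz_sum[OF assms(1)]) (use fs in auto)
  moreover have "sum x {w, om} \<le> sum x (insert w (insert om (supp x)))" using fs nn by (intro sum_mono2) auto
  ultimately have "x w + x om \<le> 1" using False by simp
  thus ?thesis using assms(2) nn[of w] False by (simp add: pt_other)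
 qed (simp add: assms)
qed

lemma connected_Cn: "connected (realiz Cn)"
proof -
 define SS where "SS = insert {pt om} ((\<lambda>z. (\<lambda>s. cp s z) ` {0..1}) ` realiz L)"
 have c: "continuous_on {0..1} (\<lambda>s. cp s z)" for z
  unfolding cp_def by (rule continuous_on_coordinatewise_then_product, rename_tac v, case_tac "v = om") (auto intro!: continuous_intros)
 have "\<Union>SS = realiz Cn"
 proof (intro equalityI subsetI)
  fix x assume "x \<in> \<Union>SS"
  thus "x \<in> realiz Cn" using cp_realiz by (auto simp: SS_def pt_realiz Cn_def)
 next
  fix x assume x: "x \<in> realiz Cn"
  show "x \<in> \<Union>SS"
  proof (cases "x om = 1")
   case True thus ?thesis using top[OF x] by (simp add: SS_def)
  next
   case False
   note b = base[OF x False]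
   have "x \<in> (\<lambda>s. cp s (base x)) ` {0..1}" using b(2-4) by (intro image_eqI[of _ _ "x om"]) auto
   thus ?thesis using b(1) by (auto simp: SS_def)
  qed
 qed
 moreover have "connected (\<Union>SS)"
 proof (rule connected_Union)
  fix S assume "S \<in> SS"
  thus "connected S" using c by (auto simp: SS_def intro!: connected_continuous_image)
 next
  have "pt om \<in> (\<lambda>s. cp s z) ` {0..1}" for z using cp_1[of z] by (intro image_eqI[of _ _ 1]) auto
  thus "\<Inter>SS ~= {}" by (simp add: SS_def)
 qed
 ultimately show ?thesis by simp
qed

definition Fh :: "('v => real) => 'v => real"
 where "Fh x = (if x \<in> realiz K then F x else cp (x om) (F (base x)))"

lemma Fh_Cn: assumes "x \<in> realiz Cn" shows "Fh x = cp (x om) (F (base x))"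
using off base[OF assms] cp_0 realizL cp_0[OF FK[OF realizL]] by (fastforce simp: Fh_def)

lemma Fh_pt: "Fh (pt om) = pt om" using pt_realiz Fh_Cn cp_1 by (fastforce simp: Cn_def)

lemma Fh_maps: "x \<in> realiz Cn ==> Fh x \<in> realiz Cn" "x \<in> realiz (K \<union> Cn) ==> Fh x \<in> realiz (K \<union> Cn)"
proof -
 show 1: "Fh x \<in> realiz Cn" if x: "x \<in> realiz Cn" for x
 proof (cases "x om = 1")
  case True
  thus ?thesis using top[OF x] Fh_pt x by simp
 next
  case False
  note b = base[OF x False]
  show ?thesis unfolding Fh_Cn[OF x] by (rule cp_realiz[OF FL[OF b(1)]]) (use b in auto)
 qed
 show "x \<in> realiz (K \<union> Cn) ==> Fh x \<in> realiz (K \<union> Cn)" using 1[of x] FK[of x] unfolding realiz_Un by (cases "x \<in> realiz K") (auto simp: Fh_def)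
qed

text \<open>Only the apex needs care: \<open>F (base x)\<close> need not have a limit there, but its
  coordinates stay between 0 and 1 while the factor \<open>1 - x om\<close> tends to 0.\<close>

lemma Fh_cont: "continuous_on (realiz (K \<union> Cn)) Fh"
proof -
 have finL: "finite L" using finK LK finite_subset by blast
 have scC: "scomplex Cn" unfolding scomplex_def Cn_def
 proof (intro ballI conjI allI impI)
  fix s assume s: "s \<in> L \<union> {{om}} \<union> insert om ` L"
  show "finite s" "s ~= {}" using s scomplex_finite[OF scL] scomplex_nonempty[OF scL] by auto
  fix t assume t: "t \<subseteq> s \<and> t ~= {}"
  obtain r where r: "r = {} \<or> r \<in> L" "s = r \<or> s = insert om r" using s by auto
  have d: "t - {om} = {} \<or> t - {om} \<in> L" using t scomplexD[OF scL, of r "t - {om}"] r by auto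
  show "t \<in> L \<union> {{om}} \<union> insert om ` L"
  proof (cases "om \<in> t")
   case True
   hence "t = insert om (t - {om})" by blast
   thus ?thesis using d by (metis UnCI imageI singletonI)
  next
   case False
   thus ?thesis using d t by auto
  qed
 qed
 have "continuous_on (realiz Cn) Fh"
 proof (rule continuous_on_coordinatewise_then_product)
  fix w
  have cc: "continuous_on S (\<lambda>x::'v => real. x v)" for S v by (rule continuous_on_subset[OF continuous_on_product_coordinates]) simp
  let ?t = "\<lambda>x. (1 - x om) * F (base x) w"
  have "continuous_on (realiz Cn) ?t" unfolding continuous_on_def
  proof
   fix x assume x: "x \<in> realiz Cn"
   show "(?t \<longlongrightarrow> ?t x) (at x within realiz Cn)"
   proof (cases "x om = 1")
    case True
    have "((\<lambda>y. 1 - y om) \<longlongrightarrow> 1 - x om) (at x within realiz Cn)"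
     using cc[of "realiz Cn" om] x by (intro tendsto_intros) (auto simp: continuous_on_def)
    hence lim: "((\<lambda>y. 1 - y om) \<longlongrightarrow> 0) (at x within realiz Cn)" using True by simp
    have "\<forall>\<^sub>F y in at x within realiz Cn. norm (?t y) \<le> 1 - y om" unfolding eventually_at_topological
    proof (intro exI[of _ UNIV] conjI ballI impI)
     fix y assume y: "y \<in> realiz Cn"
     show "norm (?t y) \<le> 1 - y om"
     proof (cases "y om = 1")
      case False
      note b = base[OF y False]
      show ?thesis using b(4) FL[OF b(1)] realiz_le_1[OF FL[OF b(1)] scL] by (simp add: realiz_def)
     qed simp
    qed auto
    thus ?thesis using True Lim_null_comparison[OF _ lim] by fastforce
   next
    case False
    let ?S = "realiz Cn \<inter> {y. y om < 1}"
    have "continuous_on ?S base"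
     unfolding base_def by (rule continuous_on_coordinatewise_then_product, rename_tac v, case_tac "v = om") (auto intro!: continuous_intros cc)
    hence "continuous_on ?S (\<lambda>y. F (base y))" using base(1) realizL by (intro continuous_on_compose2[OF contF]) auto
    hence "continuous_on ?S (\<lambda>y. F (base y) w)" by (rule continuous_on_product_then_coordinatewise)
    hence "continuous_on ?S ?t" by (intro continuous_intros cc)
    moreover have "x \<in> ?S" using base(4)[OF x False] x by simp
    ultimately have "(?t \<longlongrightarrow> ?t x) (at x within ?S)" by (auto simp: continuous_on_def)
    moreover have "open {y::'v => real. y om < 1}" by (intro open_Collect_less) auto
    hence "at x within ?S = at x within realiz Cn" using base(4)[OF x False] by (intro at_within_nhd[of x "{y. y om < 1}"]) auto
    ultimately show ?thesis by simp
   qed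
  qed
  hence "continuous_on (realiz Cn) (\<lambda>x. if w = om then x om else ?t x)" using cc by (cases "w = om") auto
  thus "continuous_on (realiz Cn) (\<lambda>x. Fh x w)" by (rule continuous_on_eq) (simp add: Fh_Cn cp_def)
 qed
 moreover have "continuous_on (realiz K) Fh" using contF by (rule continuous_on_eq) (simp add: Fh_def)
 ultimately show ?thesis unfolding realiz_Un
  using closed_realiz[OF finK scK] closed_realiz[of Cn] scC finL by (intro continuous_on_closed_Un) (auto simp: Cn_def)
qed

end

section \<open>The combinatorial Lefschetz number as a trace on the free group\<close>

lemma open_simplex_hull: assumes "finite s" shows "open_simplex s \<subseteq> convex hull s"
 unfolding open_simplex_def convex_hull_finite[OF assms] by (auto intro: less_imp_le)

lemma open_simplex_nonempty: assumes "finite s" "s ~= {}" shows "open_simplex s ~= {}"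
proof -
 have "(\<Sum>v\<in>s. (1 / real (card s)) *\<^sub>R v) \<in> open_simplex s"
  unfolding open_simplex_def using assms by (intro CollectI exI[of _ "\<lambda>_. 1 / real (card s)"]) (auto simp: card_gt_0_iff)
 thus ?thesis by blast
qed

lemma segment_in_open_star:
 assumes "{a, b} \<in> K'" "{a} \<in> K'" "0 \<le> t" "t < 1" shows "(1 - t) *\<^sub>R a + t *\<^sub>R b \<in> open_star K' a"
proof (cases "t = 0 \<or> a = b")
 case True
 hence "(1 - t) *\<^sub>R a + t *\<^sub>R b = a" by auto
 moreover have "a \<in> open_simplex {a}" unfolding open_simplex_def by (intro CollectI exI[of _ "\<lambda>_. 1"]) simp
 ultimately show ?thesis using assms(2) unfolding open_star_def by auto
next
 case False
 hence "(1 - t) *\<^sub>R a + t *\<^sub>R b \<in> open_simplex {a, b}" unfolding open_simplex_def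
  using assms(3,4) by (intro CollectI exI[of _ "\<lambda>v. if v = a then 1 - t else t"]) auto
 thus ?thesis using assms(1) unfolding open_star_def by auto
qed

locale lefschetz = G: geo k K idx + C: approximated_complex k K K' ps sd
 for k :: nat and K K' :: complex_of_points and idx :: "(nat => real) => nat" and ps :: "(nat => real) => nat => real"
  and sd :: "nat => (nat => real) chain => (nat => real) chain" +
 fixes fi :: "(nat => real) => nat => real" and ord :: "(nat => real) set => (nat => real) list"
  and T :: complex_of_points and A0 :: "(nat => real) set" and Z :: "'a topology" and p :: 'a and j :: "(nat => real) => 'a"
 assumes idx0: "0 \<notin> idx ` \<Union>K"
  and fi: "continuous_on (polyhedron_of K) fi" "fi ` polyhedron_of K \<subseteq> polyhedron_of K"
  and sa: "simplicial_approximation K' K fi ps" and orient: "orientation K ord"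
  and A0: "T \<subseteq> K" "A0 = (\<Union>s\<in>T. open_simplex s)"
  and fiA: "fi ` A0 \<subseteq> A0" "fi ` (polyhedron_of K - A0) \<subseteq> polyhedron_of K - A0"
  and j: "homeomorphic_map (top_of_set A0) (subtopology Z (topspace Z - {p})) j" and p: "p \<in> topspace Z"
  and Z: "surface_with_boundary Z" "connected_space Z" "compact_space Z" and dense: "polyhedron_of K \<subseteq> closure A0"
begin

abbreviation Ka where "Ka \<equiv> G.Ka"
definition LL where "LL = {s \<in> K. \<not> open_simplex s \<subseteq> A0}"
definition La where "La = (`) idx ` LL"
definition Aa where "Aa = {x \<in> realiz Ka. supp x \<notin> La}"
definition Fa where "Fa x = G.br (fi (G.bt x))"
definition V where "V = \<Union>Ka"
definition vt where "vt = inv_into (\<Union>K) idx"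

lemma A0_poly: "A0 \<subseteq> polyhedron_of K" using A0 open_simplex_hull[OF G.fin(2)] unfolding polyhedron_of_def by blast

lemma LaKa: "La \<subseteq> Ka" by (auto simp: La_def G.Ka_def LL_def)

lemma La_iff: "s \<in> K ==> idx ` s \<in> La \<longleftrightarrow> s \<in> LL"
proof
 assume s: "s \<in> K" "idx ` s \<in> La"
 then obtain t where t: "t \<in> LL" "idx ` s = idx ` t" by (auto simp: La_def)
 thus "s \<in> LL" using G.idx_image_eq[of s t] s(1) by (auto simp: LL_def)
qed (simp add: La_def)

lemma bt_A0: assumes x: "x \<in> realiz Ka" shows "G.bt x \<in> A0 \<longleftrightarrow> supp x \<notin> La"
proof -
 obtain s where s: "s \<in> K" "supp x = idx ` s" using G.realiz_supp[OF x] .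
 have "s = t" if t: "t \<in> K" "G.bt x \<in> open_simplex t" for t
  using G.in_open_simplex[OF x t(1)] t(2) s(2) G.idx_image_eq[of s t] s(1) t(1) by blast
 hence "open_simplex s \<subseteq> A0" if "G.bt x \<in> A0" using that A0 by (metis UN_E UN_upper subsetD)
 thus ?thesis using La_iff[OF s(1)] s(2) s(1) G.in_open_simplex[OF x s(1)] by (auto simp: LL_def)
qed

lemma Aa_A0: "G.bt ` Aa = A0" "G.br ` A0 = Aa"
proof -
 show 1: "G.bt ` Aa = A0"
 proof (intro equalityI subsetI)
  fix y assume "y \<in> A0"
  hence "y \<in> polyhedron_of K" using A0_poly by blast
  thus "y \<in> G.bt ` Aa" using bt_A0[OF G.br_realiz] G.bt_br G.br_realiz \<open>y \<in> A0\<close>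
   by (intro image_eqI[of _ _ "G.br y"]) (simp_all add: Aa_def)
 qed (use bt_A0 in \<open>auto simp: Aa_def\<close>)
 have "G.br ` A0 = G.br ` G.bt ` Aa" by (simp only: 1)
 also have "... = (\<lambda>x. G.br (G.bt x)) ` Aa" by (rule image_image)
 also have "... = (\<lambda>x. x) ` Aa" using G.br_bt by (intro image_cong refl) (simp add: Aa_def)
 finally show "G.br ` A0 = Aa" by simp
qed

lemma Fa: "continuous_on (realiz Ka) Fa" "x \<in> realiz Ka ==> Fa x \<in> realiz Ka" "x \<in> realiz Ka ==> G.bt (Fa x) = fi (G.bt x)"
 "x \<in> realiz Ka ==> supp x \<in> La ==> supp (Fa x) \<in> La"
proof -
 show "continuous_on (realiz Ka) Fa" unfolding Fa_def
  by (rule continuous_on_compose2[OF G.br_cont continuous_on_compose2[OF fi(1) G.bt_cont]]) (use fi(2) G.bt_poly in auto)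
 assume x: "x \<in> realiz Ka"
 have p: "G.bt x \<in> polyhedron_of K" "fi (G.bt x) \<in> polyhedron_of K" using fi(2) G.bt_poly[OF x] by auto
 show r: "Fa x \<in> realiz Ka" and b: "G.bt (Fa x) = fi (G.bt x)" using p G.br_realiz G.bt_br by (simp_all add: Fa_def)
 assume "supp x \<in> La"
 thus "supp (Fa x) \<in> La" using bt_A0[OF r] b fiA(2) p(1) bt_A0[OF x] by auto
qed

lemma surface_cells: "surface_cells Ka La Aa Z p 0 (j \<circ> G.bt)"
proof
 show "finite Ka" "scomplex Ka" "La \<subseteq> Ka" by (rule G.fin_Ka G.sc_Ka LaKa)+
 show "Aa = {x \<in> realiz Ka. supp x \<notin> La}" by (rule Aa_def)
 have "homeomorphic_maps (top_of_set Aa) (top_of_set A0) G.bt G.br" unfolding homeomorphic_maps_def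
 proof (intro conjI ballI)
  show "continuous_map (top_of_set Aa) (top_of_set A0) G.bt" using G.bt_cont Aa_A0(1) by auto
  show "continuous_map (top_of_set A0) (top_of_set Aa) G.br" using continuous_on_subset[OF G.br_cont A0_poly] Aa_A0(2) by auto
 qed (use G.br_bt G.bt_br A0_poly in \<open>auto simp: Aa_def\<close>)
 thus "homeomorphic_map (top_of_set Aa) (subtopology Z (topspace Z - {p})) (j \<circ> G.bt)" using j homeomorphic_map_compose homeomorphic_map_maps by blast
 show "p \<in> topspace Z" "surface_with_boundary Z" "connected_space Z" "compact_space Z" by (rule p Z)+
 show "0 \<notin> \<Union>Ka" using idx0 by (auto simp: G.Ka_def)
 show "realiz Ka \<subseteq> closure Aa"
 proof -
  have "closed (polyhedron_of K)" unfolding G.bt_image[symmetric]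
   by (intro compact_closed_fun compact_continuous_image G.bt_cont compact_realiz G.fin_Ka G.sc_Ka)
  hence e: "closure A0 = polyhedron_of K" using dense closure_minimal[OF A0_poly] by blast
  have "G.br ` closure A0 \<subseteq> closure (G.br ` A0)"
   by (rule image_closure_subset) (simp_all add: e G.br_cont closure_subset)
  moreover have "realiz Ka \<subseteq> G.br ` polyhedron_of K" using G.br_bt G.bt_poly by (metis image_eqI subsetI)
  ultimately show ?thesis unfolding e Aa_A0(2) by blast
 qed
qed

sublocale S: surface_cells Ka La Aa Z p 0 "j \<circ> G.bt" by (rule surface_cells)

abbreviation Kh where "Kh \<equiv> S.Kh"

sublocale N: cone Ka La 0 Fa
proof
 show "x \<in> realiz La ==> Fa x \<in> realiz La" for x using realiz_mono[OF LaKa] Fa(2,4) by (auto simp: realiz_def)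
qed (use S.finK S.scK S.scL S.LK S.om Fa in auto)

lemma Kh_Cn: "Ka \<union> N.Cn = Kh" using LaKa by (auto simp: S.Kh_def N.Cn_def)

lemma vt: "v \<in> \<Union>K ==> vt (idx v) = v" "x \<in> V ==> idx (vt x) = x" "x \<in> V ==> vt x \<in> \<Union>K" "bij_betw vt V (\<Union>K)"
proof -
 have V: "V = idx ` \<Union>K" by (auto simp: V_def G.Ka_def)
 show "v \<in> \<Union>K ==> vt (idx v) = v" unfolding vt_def by (rule inv_into_f_f[OF G.idx])
 show "x \<in> V ==> idx (vt x) = x" unfolding vt_def V by (simp add: f_inv_into_f)
 show "x \<in> V ==> vt x \<in> \<Union>K" unfolding vt_def V by (rule inv_into_into)
 show "bij_betw vt V (\<Union>K)" unfolding vt_def V using G.idx by (intro bij_betw_inv_into) (simp add: bij_betw_def)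
qed

lemma vt_image: "s \<subseteq> V ==> idx ` vt ` s = s" using vt(2) by (force simp: image_image)

lemma Ka_K: assumes "s \<subseteq> V" shows "s \<in> Ka \<longleftrightarrow> vt ` s \<in> K" "s \<in> La \<longleftrightarrow> vt ` s \<in> LL"
proof -
 show 1: "s \<in> Ka \<longleftrightarrow> vt ` s \<in> K" using G.Ka_iff[of "vt ` s"] vt_image[OF assms] assms vt(3) by fastforce
 show "s \<in> La \<longleftrightarrow> vt ` s \<in> LL"
 proof (cases "vt ` s \<in> K")
  case True thus ?thesis using La_iff[OF True] vt_image[OF assms] by simp
 next
  case False thus ?thesis using 1 LaKa by (auto simp: LL_def)
 qed
qed

lemma Ka_V: "s \<in> Ka ==> s \<subseteq> V" by (auto simp: V_def)

lemma K_idx: "s \<in> K ==> idx ` s \<in> Ka" by (simp add: G.Ka_def)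

lemma fi_star: assumes x: "x \<in> open_star K' v" "v \<in> \<Union>K'" shows "G.br (fi x) (idx (ps v)) ~= 0" "x \<in> polyhedron_of K"
proof -
 obtain s where s: "s \<in> K'" "x \<in> open_simplex s" using x unfolding open_star_def by blast
 have "finite s" using C.gK' s(1) by (simp add: geometric_complex_def)
 thus xp: "x \<in> polyhedron_of K" using C.sub s open_simplex_hull by (fastforce simp: subdivision_of_def polyhedron_of_def)
 show "G.br (fi x) (idx (ps v)) ~= 0" using G.in_open_star[OF G.br_realiz C.ps_vertex[OF x(2)]] G.bt_br sa x fi(2) xp by (force simp: simplicial_approximation_def)
qed

text \<open>An interior point of \<open>s'\<close> is at infinity, hence so is its image. By
  simplicial approximation the support of that image contains the images of all vertices of
  \<open>s'\<close>, and \<open>La\<close> is closed under faces.\<close>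

lemma ps_LL: assumes s': "s' \<in> K'" "convex hull s' \<subseteq> convex hull s" and s: "s \<in> LL" shows "ps ` s' \<in> LL"
proof -
 have f: "finite s'" "s' ~= {}" using C.gK' s'(1) by (auto simp: geometric_complex_def)
 obtain x where x: "x \<in> open_simplex s'" using open_simplex_nonempty[OF f] by blast
 have sK: "s \<in> K" using s by (simp add: LL_def)
 have xs: "x \<in> convex hull s" using x open_simplex_hull[OF f(1)] s'(2) by blast
 have xp: "x \<in> polyhedron_of K" by (rule G.br_hull(2)[OF sK xs])
 have FL: "supp (Fa (G.br x)) \<in> La" using Fa(4)[OF G.br_realiz[OF xp]] G.br_hull(1)[OF sK xs] scomplexD[OF S.scL] G.br_realiz[OF xp] scomplex_nonempty[OF G.sc_Ka] La_iff[OF sK] s by (simp add: realiz_def)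
 have "idx ` ps ` s' \<subseteq> supp (Fa (G.br x))"
 using x s'(1) fi_star(1) G.bt_br[OF xp] by (auto simp: open_star_def Fa_def supp_def)
 hence "idx ` ps ` s' \<in> La" using scomplexD[OF S.scL FL] f(2) by blast
 moreover have "ps ` s' \<in> K" using C.smap s'(1) by (simp add: simplicial_map_def)
 ultimately show ?thesis using La_iff by blast
qed

lemma K'_face: "s \<in> K' ==> t \<subseteq> s ==> t ~= {} ==> t \<in> K'"
 using C.gK' unfolding geometric_complex_def by (elim conjE) blast

definition psa where "psa x = idx (ps (vt x))"

lemma psa_La: assumes "{v} \<in> La" shows "{psa v} \<in> La"
proof -
 have vV: "{v} \<subseteq> V" using assms LaKa Ka_V by blast
 hence L: "{vt v} \<in> LL" using Ka_K(2) assms by simp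
 hence K: "{vt v} \<in> K" by (simp add: LL_def)
 have "{vt v} \<in> K'" using K'_face C.sd_vertex(1)[OF K] by auto
 thus ?thesis using La_iff[of "{ps (vt v)}"] ps_LL[OF _ _ L] by (fastforce simp: LL_def psa_def)
qed

text \<open>The tests return 0 on degenerate or foreign arguments, where the chain has no meaning;
  \<open>trace_formula\<close> demands antisymmetry without side conditions.\<close>

definition f1 :: "nat => nat => nat => nat => rat"
 where "f1 x y x' y' = (if x ~= y \<and> {x, y} \<in> Ka \<and> x' \<in> V \<and> y' \<in> V then C.img [vt x, vt y] [vt x', vt y'] else 0)"

definition f2 :: "nat list => nat list => rat"
 where "f2 xs ys = (if distinct xs \<and> set xs \<in> Ka \<and> xs ~= [] \<and> set ys \<subseteq> V then C.img (map vt xs) (map vt ys) else 0)"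

lemma edge_vt: assumes "x ~= y" "{x, y} \<in> Ka" shows "vt x ~= vt y" "{vt x, vt y} \<in> K" "x \<in> V" "y \<in> V"
proof -
 show V: "x \<in> V" "y \<in> V" using assms(2) by (auto simp: V_def)
 show "vt x ~= vt y" using vt(2)[OF V(1)] vt(2)[OF V(2)] assms(1) by metis
 show "{vt x, vt y} \<in> K" using Ka_K(1)[of "{x, y}"] V assms(2) by simp
qed

lemma map_vt: assumes "distinct xs" "set xs \<in> Ka" shows "distinct (map vt xs)" "set (map vt xs) \<in> K"
proof -
 have V: "set xs \<subseteq> V" using assms(2) by (rule Ka_V)
 show "distinct (map vt xs)" unfolding distinct_map using assms(1) inj_on_subset[OF bij_betw_imp_inj_on[OF vt(4)] V] by simp
 show "set (map vt xs) \<in> K" using Ka_K(1)[OF V] assms(2) by simp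
qed

lemma f1_props: "f1 y x x' y' = - f1 x y x' y'" "f1 x y y' x' = - f1 x y x' y'"
 "{x, y} \<notin> Ka \<or> {x', y'} \<notin> Ka ==> f1 x y x' y' = 0" "{x, y} \<in> La ==> {x', y'} \<notin> La ==> f1 x y x' y' = 0"
proof -
 show "f1 y x x' y' = - f1 x y x' y'"
 proof (cases "x ~= y \<and> {x, y} \<in> Ka")
  case True
  moreover have "y ~= x \<and> {y, x} \<in> Ka" using True by (auto simp: insert_commute)
  moreover have "C.img [vt y, vt x] zs = - C.img [vt x, vt y] zs" for zs using True edge_vt[of x y] by (intro C.img_swap_source) auto
  ultimately show ?thesis unfolding f1_def by simp
 next
  case False
  thus ?thesis by (auto simp: f1_def insert_commute)
 qed
 show "f1 x y y' x' = - f1 x y x' y'"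
 using C.img_chain[of "[vt x, vt y]" 0 "[vt x', vt y']" 1] edge_vt[of x y] by (simp add: f1_def)
 have supp: "\<exists>zs. set zs \<in> K' \<and> convex hull (set zs) \<subseteq> convex hull {vt x, vt y} \<and> ps ` set zs = {vt x', vt y'}" if "f1 x y x' y' ~= 0"
 proof -
  have e: "x ~= y" "{x, y} \<in> Ka" "C.img [vt x, vt y] [vt x', vt y'] ~= 0" using that by (auto simp: f1_def split: if_splits)
  have d: "distinct [vt x, vt y]" "set [vt x, vt y] \<in> K" "[vt x, vt y] ~= []" using edge_vt[OF e(1,2)] by simp_all
  obtain zs where zs: "set zs \<in> K'" "length zs = length [vt x', vt y']" "map ps zs = [vt x', vt y']" "convex hull (set zs) \<subseteq> convex hull (set [vt x, vt y])"
   by (rule C.img_support[OF d e(3)])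
  show ?thesis using zs by auto
 qed
 have V: "x' \<in> V \<and> y' \<in> V \<and> x \<in> V \<and> y \<in> V" if "f1 x y x' y' ~= 0" using that edge_vt[of x y] by (auto simp: f1_def split: if_splits)
 show "f1 x y x' y' = 0" if "{x, y} \<notin> Ka \<or> {x', y'} \<notin> Ka"
 proof (rule ccontr)
  assume nz: "f1 x y x' y' ~= 0"
  obtain zs where "set zs \<in> K'" "ps ` set zs = {vt x', vt y'}" using supp[OF nz] by blast
  hence "{x', y'} \<in> Ka" using Ka_K(1)[of "{x', y'}"] V[OF nz] C.smap by (auto simp: simplicial_map_def)
  moreover have "{x, y} \<in> Ka" using nz by (auto simp: f1_def split: if_splits)
  ultimately show False using that by blast
 qed
 show "f1 x y x' y' = 0" if L: "{x, y} \<in> La" "{x', y'} \<notin> La"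
 proof (rule ccontr)
  assume nz: "f1 x y x' y' ~= 0"
  obtain zs where zs: "set zs \<in> K'" "convex hull (set zs) \<subseteq> convex hull {vt x, vt y}" "ps ` set zs = {vt x', vt y'}" using supp[OF nz] by blast
  show False using Ka_K(2)[of "{x', y'}"] V[OF nz] L(2) ps_LL[OF zs(1,2)] zs(3) Ka_K(2)[of "{x, y}"] L(1) by simp
 qed
qed

lemma f1_boundary: assumes "{x, y} \<in> Ka" shows "(\<Sum>x'\<in>V. f1 x y x' y') = of_bool (psa y = y') - of_bool (psa x = y')"
proof -
 have xyV: "x \<in> V" "y \<in> V" using assms by (auto simp: V_def)
 have psV: "psa z \<in> V" if "z \<in> V" for z
 proof -
  have "ps (vt z) \<in> \<Union>K" using C.ps_vertex C.sd_vertex(1) vt(3)[OF that] G.face by auto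
  thus ?thesis by (auto simp: psa_def V_def G.Ka_def)
 qed
 show ?thesis
 proof (cases "y' \<in> V \<and> x ~= y")
  case False
  thus ?thesis using psV xyV by (auto simp: f1_def)
 next
  case True
  note e = edge_vt[OF _ assms]
  have iff: "ps (vt z) = vt y' \<longleftrightarrow> psa z = y'" if "z \<in> V" for z
  proof -
   show ?thesis using vt(1) vt(2)[of y'] True psa_def C.ps_vertex C.sd_vertex(1) vt(3)[OF that] G.face by auto
  qed
  have "(\<Sum>x'\<in>V. f1 x y x' y') = (\<Sum>x'\<in>V. C.img [vt x, vt y] [vt x', vt y'])" using True assms by (intro sum.cong refl) (simp add: f1_def)
  also have "... = (\<Sum>v\<in>\<Union>K. C.img [vt x, vt y] [v, vt y'])" by (rule sum.reindex_bij_betw[OF vt(4)])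
  also have "... = of_bool (ps (vt y) = vt y') - of_bool (ps (vt x) = vt y')" using e True by (intro C.img_edge_boundary) auto
  also have "... = of_bool (psa y = y') - of_bool (psa x = y')" unfolding iff[OF xyV(1)] iff[OF xyV(2)] ..
  finally show ?thesis .
 qed
qed

lemma f1_triangle: assumes d: "distinct [x, y, z]" and K: "{x, y, z} \<in> Ka"
 shows "f1 x y x' y' + f1 y z x' y' + f1 z x x' y' = (\<Sum>v\<in>V. f2 [x, y, z] [v, x', y'])"
proof (cases "x' \<in> V \<and> y' \<in> V")
 case True
 have e: "{x, y} \<in> Ka" "{y, z} \<in> Ka" "{z, x} \<in> Ka" using scomplexD[OF G.sc_Ka K] by auto
 note m = map_vt[OF d, simplified, OF K]
 have "(\<Sum>v\<in>V. f2 [x, y, z] [v, x', y']) = (\<Sum>v\<in>V. C.img [vt x, vt y, vt z] [vt v, vt x', vt y'])"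
  using True d K by (intro sum.cong refl) (simp add: f2_def)
 also have "... = (\<Sum>v\<in>\<Union>K. C.img [vt x, vt y, vt z] [v, vt x', vt y'])" by (rule sum.reindex_bij_betw[OF vt(4)])
 also have "... = C.img [vt x, vt y] [vt x', vt y'] + C.img [vt y, vt z] [vt x', vt y'] + C.img [vt z, vt x] [vt x', vt y']"
  using m by (intro C.img_triangle_boundary[symmetric]) auto
 finally show ?thesis using True d e by (simp add: f1_def)
qed (auto simp: f1_def f2_def)

lemma f2_props: "f2 xs [y, x, z] = - f2 xs [x, y, z]" "f2 xs [x, z, y] = - f2 xs [x, y, z]" "{x, y, z} \<notin> Ka ==> f2 xs [x, y, z] = 0"
proof -
 have m: "distinct (map vt xs) \<and> set (map vt xs) \<in> K \<and> map vt xs ~= []" if "distinct xs \<and> set xs \<in> Ka \<and> xs ~= []"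
  using that map_vt by simp
 show "f2 xs [y, x, z] = - f2 xs [x, y, z]" using m C.img_chain[of "map vt xs" 0 "[vt x, vt y, vt z]" 1] by (auto simp: f2_def)
 show "f2 xs [x, z, y] = - f2 xs [x, y, z]" using m C.img_chain[of "map vt xs" 1 "[vt x, vt y, vt z]" 2] by (auto simp: f2_def)
 show "f2 xs [x, y, z] = 0" if "{x, y, z} \<notin> Ka"
 proof (rule ccontr)
  assume nz: "f2 xs [x, y, z] ~= 0"
  hence c: "distinct xs \<and> set xs \<in> Ka \<and> xs ~= []" and V: "{x, y, z} \<subseteq> V" and i: "C.img (map vt xs) [vt x, vt y, vt z] ~= 0"
   by (auto simp: f2_def split: if_splits)
  note d = m[OF c]
  obtain zs where zs: "set zs \<in> K'" "length zs = length [vt x, vt y, vt z]" "map ps zs = [vt x, vt y, vt z]" "convex hull (set zs) \<subseteq> convex hull (set (map vt xs))"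
   by (rule C.img_support[OF conjunct1[OF d] conjunct1[OF conjunct2[OF d]] conjunct2[OF conjunct2[OF d]] i])
  show False using Ka_K(1)[OF V] that arg_cong[OF zs(3), of set] C.smap zs(1) by (auto simp: simplicial_map_def)
 qed
qed

definition orda where "orda t = map idx (ord (vt ` t))"

lemma ord: "s \<in> K ==> distinct (ord s)" "s \<in> K ==> set (ord s) = s" using orient by (auto simp: orientation_def)

lemma orda: assumes "t \<in> Ka" shows "distinct (orda t)" "set (orda t) = t" "map vt (orda t) = ord (vt ` t)"
proof -
 have V: "t \<subseteq> V" by (rule Ka_V[OF assms])
 have K: "vt ` t \<in> K" using Ka_K(1)[OF V] assms by simp
 show "set (orda t) = t" using ord(2)[OF K] vt_image[OF V] by (simp add: orda_def)
 show "distinct (orda t)" using ord[OF K] G.idx K by (auto simp: orda_def distinct_map intro: inj_on_subset)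
 have "vt (idx v) = v" if "v \<in> set (ord (vt ` t))" for v using that ord(2)[OF K] K by (intro vt(1)) blast
 thus "map vt (orda t) = ord (vt ` t)" by (simp add: orda_def map_idI)
qed

text \<open>Simplices have at most three vertices, so only three degrees contribute. In degree 1 the
  two orders of an edge give the same diagonal value, since source and target both change
  sign.\<close>

lemma alternating_trace_eq:
 "alternating_trace K A0 (simplicial_matrix K' sd ps ord) = of_nat (card {v \<in> V. {v} \<notin> La \<and> psa v = v})
  - (\<Sum>(x, y) | {x, y} \<in> Ka - La \<and> x ~= y. f1 x y x y) / 2 + (\<Sum>t | t \<in> Ka \<and> card t = 3. f2 (orda t) (orda t))"
proof -
 define A where "A m = {s \<in> K - LL. card s = m}" for m
 define Sp where "Sp m = (\<Sum>s\<in>A m. C.img (ord s) (ord s))" for m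
 have c3: "card s \<le> 3" if "s \<in> K" for s using S.card_K[OF K_idx[OF that]] G.card_idx[OF that] by simp
 have finA: "finite (A m)" for m using G.fin(1) by (simp add: A_def)
 have len: "length (ord s) = card s" if "s \<in> K" for s using ord[OF that] distinct_card[of "ord s"] by simp
 have "alternating_trace K A0 (simplicial_matrix K' sd ps ord) = (\<Sum>m<card (\<Union>K). (-1) ^ m * Sp (Suc m))"
  unfolding alternating_trace_def Sp_def simplicial_matrix_def
 by (intro sum.cong refl arg_cong2[of _ _ _ _ "(*)"]; use len C.img_def in \<open>auto simp: A_def LL_def\<close>)
 \<comment> \<open>The range is first enlarged to at least three degrees, so that it can be cut to
   exactly three even if there are fewer vertices.\<close>
 also have "... = (\<Sum>m<max 3 (card (\<Union>K)). (-1) ^ m * Sp (Suc m))"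
 proof (rule sum.mono_neutral_left)
  show "\<forall>m\<in>{..<max 3 (card (\<Union>K))} - {..<card (\<Union>K)}. (-1) ^ m * Sp (Suc m) = 0"
  proof
   fix m assume "m \<in> {..<max 3 (card (\<Union>K))} - {..<card (\<Union>K)}"
   hence "\<not> card s = Suc m" if "s \<in> K" for s using card_mono[OF G.fin(4) Union_upper[OF that]] by auto
   hence "A (Suc m) = {}" by (auto simp: A_def)
   thus "(-1) ^ m * Sp (Suc m) = 0" by (simp add: Sp_def)
  qed
 qed auto
 also have "... = (\<Sum>m<3. (-1) ^ m * Sp (Suc m))"
 proof (rule sum.mono_neutral_right)
  show "\<forall>m\<in>{..<max 3 (card (\<Union>K))} - {..<3}. (-1) ^ m * Sp (Suc m) = 0"
  proof
   fix m assume "m \<in> {..<max 3 (card (\<Union>K))} - {..<3}"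
   hence "A (Suc m) = {}" using c3 by (fastforce simp: A_def)
   thus "(-1) ^ m * Sp (Suc m) = 0" by (simp add: Sp_def)
  qed
 qed auto
 also have "... = Sp 1 - Sp 2 + Sp 3" by (simp add: eval_nat_numeral)
 finally have tr: "alternating_trace K A0 (simplicial_matrix K' sd ps ord) = Sp 1 - Sp 2 + Sp 3" .
 have 1: "Sp 1 = of_nat (card {v \<in> V. {v} \<notin> La \<and> psa v = v})"
 proof -
  define W where "W = {v \<in> V. {v} \<notin> La}"
  have fW: "finite W" using S.finK scomplex_finite[OF G.sc_Ka] by (auto simp: W_def V_def)
  have W: "vt v \<in> \<Union>K" "{vt v} \<in> K - LL" if "v \<in> W" for v
  proof -
   have v: "v \<in> V" "{v} \<notin> La" using that by (auto simp: W_def)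
   show u: "vt v \<in> \<Union>K" by (rule vt(3)[OF v(1)])
   thus "{vt v} \<in> K - LL" using Ka_K(2)[of "{v}"] v G.face by auto
  qed
  have "Sp 1 = (\<Sum>v\<in>W. of_bool (psa v = v))" unfolding Sp_def
  proof (rule sum.reindex_bij_witness[where j = "\<lambda>s. idx (the_elem s)" and i = "\<lambda>v. {vt v}"])
   fix s assume s: "s \<in> A 1"
   then obtain v where v: "s = {v}" by (auto simp: A_def card_1_singleton_iff)
   have vK: "v \<in> \<Union>K" "{v} \<in> K" using s v by (auto simp: A_def)
   show "{vt (idx (the_elem s))} = s" using v vt(1)[OF vK(1)] by simp
   show "idx (the_elem s) \<in> W" using v K_idx[OF vK(2)] La_iff[OF vK(2)] s by (auto simp: W_def V_def A_def)
   have "ord {v} = [v]" using ord[OF vK(2)] len[OF vK(2)] by (cases "ord {v}") auto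
   hence "C.img (ord s) (ord s) = of_bool (ps v = v)" using C.img_vertex[OF vK(2)] v by simp
   moreover have "psa (idx v) = idx v \<longleftrightarrow> ps v = v" using G.idx_eq[OF _ vK(1)] vt(1)[OF vK(1)] C.ps_vertex C.sd_vertex(1)[OF vK(2)] by (simp add: psa_def)
   ultimately show "of_bool (psa (idx (the_elem s)) = idx (the_elem s)) = C.img (ord s) (ord s)" using v by simp
  next
   fix v assume v: "v \<in> W"
   thus "idx (the_elem {vt v}) = v" using vt(2) by (simp add: W_def)
   show "{vt v} \<in> A 1" using W(2)[OF v] by (simp add: A_def)
  qed
  also have "... = (\<Sum>v\<in>{v \<in> W. psa v = v}. 1)" unfolding of_bool_def by (rule sum.inter_filter[OF fW, symmetric])
  also have "... = of_nat (card {v \<in> W. psa v = v})" by simp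
  also have "{v \<in> W. psa v = v} = {v \<in> V. {v} \<notin> La \<and> psa v = v}" by (auto simp: W_def)
  finally show ?thesis .
 qed
 have 2: "(\<Sum>(x, y) | {x, y} \<in> Ka - La \<and> x ~= y. f1 x y x y) = 2 * Sp 2"
 proof -
  define EE where "EE = {(x, y). {x, y} \<in> Ka - La \<and> x ~= y}"
  have finE: "finite EE"
  proof (rule finite_subset)
   show "EE \<subseteq> V \<times> V" by (auto simp: EE_def V_def)
   show "finite (V \<times> V)" using S.finK scomplex_finite[OF G.sc_Ka] by (auto simp: V_def)
  qed
  have EE: "{vt x, vt y} \<in> A 2 \<and> vt x ~= vt y \<and> x \<in> V \<and> y \<in> V" if "(x, y) \<in> EE" for x y
  using that edge_vt Ka_K(2)[of "{x, y}"] by (auto simp: EE_def A_def)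
  have "(\<Sum>(x, y)\<in>EE. f1 x y x y) = (\<Sum>s\<in>A 2. \<Sum>e\<in>{e \<in> EE. {vt (fst e), vt (snd e)} = s}. f1 (fst e) (snd e) (fst e) (snd e))"
   unfolding case_prod_beta using finE finA EE by (intro sum.group[symmetric]) auto
  also have "... = (\<Sum>s\<in>A 2. 2 * C.img (ord s) (ord s))"
  proof (rule sum.cong[OF refl])
   fix s assume s: "s \<in> A 2"
   hence sK: "s \<in> K" "s \<notin> LL" "card s = 2" by (auto simp: A_def)
   obtain u v where uv: "ord s = [u, v]" using len[OF sK(1)] sK(3) by (auto simp: numeral_2_eq_2 length_Suc_conv)
   have ne: "u ~= v" and s_eq: "s = {u, v}" using ord[OF sK(1)] uv by auto
   have uvK: "u \<in> \<Union>K" "v \<in> \<Union>K" using sK(1) s_eq by auto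
   have iV: "idx u \<in> V" "idx v \<in> V" using K_idx[OF sK(1)] s_eq by (auto simp: V_def)
   have ine: "idx u ~= idx v" using G.idx_eq[OF uvK] ne by simp
   have eK: "{idx u, idx v} \<in> Ka" using K_idx[OF sK(1)] s_eq by simp
   have "{e \<in> EE. {vt (fst e), vt (snd e)} = s} = {(idx u, idx v), (idx v, idx u)}"
   proof (intro equalityI subsetI)
    fix e assume e: "e \<in> {e \<in> EE. {vt (fst e), vt (snd e)} = s}"
    obtain x y where xy: "e = (x, y)" by (cases e)
    have "x \<in> V" "y \<in> V" "{vt x, vt y} = {u, v}" using e xy EE[of x y] s_eq by auto
    hence x: "idx (vt x) = x" and y: "idx (vt y) = y" and c: "vt x = u \<and> vt y = v \<or> vt x = v \<and> vt y = u" using vt(2) by (simp_all add: doubleton_eq_iff)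
    have "x = idx u \<and> y = idx v \<or> x = idx v \<and> y = idx u"
     using c by (elim disjE conjE) (use x y in \<open>simp_all only: refl simp_thms\<close>)
    thus "e \<in> {(idx u, idx v), (idx v, idx u)}" using xy by blast
   next
    fix e assume e: "e \<in> {(idx u, idx v), (idx v, idx u)}"
    have c: "{idx v, idx u} = {idx u, idx v}" "{v, u} = {u, v}" by blast+
    have "(idx u, idx v) \<in> EE" "(idx v, idx u) \<in> EE" using eK ine[symmetric] La_iff[OF sK(1)] sK(2) s_eq by (auto simp: EE_def c(1))
    moreover have "{vt (idx u), vt (idx v)} = s" "{vt (idx v), vt (idx u)} = s" unfolding vt(1)[OF uvK(1)] vt(1)[OF uvK(2)] s_eq by (rule refl c(2))+
    ultimately show "e \<in> {e \<in> EE. {vt (fst e), vt (snd e)} = s}" using e by (elim insertE emptyE) simp_all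
   qed
   hence "(\<Sum>e\<in>{e \<in> EE. {vt (fst e), vt (snd e)} = s}. f1 (fst e) (snd e) (fst e) (snd e)) = f1 (idx u) (idx v) (idx u) (idx v) + f1 (idx v) (idx u) (idx v) (idx u)"
    using ine by simp
   also have "f1 (idx v) (idx u) (idx v) (idx u) = f1 (idx u) (idx v) (idx u) (idx v)"
    using f1_props(1)[of "idx u" "idx v" "idx v" "idx u"] f1_props(2)[of "idx u" "idx v" "idx u" "idx v"] by linarith
   also have "f1 (idx u) (idx v) (idx u) (idx v) = C.img (ord s) (ord s)"
    using ine eK iV vt(1)[OF uvK(1)] vt(1)[OF uvK(2)] uv by (simp add: f1_def)
   finally show "(\<Sum>e\<in>{e \<in> EE. {vt (fst e), vt (snd e)} = s}. f1 (fst e) (snd e) (fst e) (snd e)) = 2 * C.img (ord s) (ord s)" by simp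
  qed
  also have "... = 2 * Sp 2" by (simp add: Sp_def sum_distrib_left)
  finally show ?thesis by (simp add: EE_def)
 qed
 have 3: "(\<Sum>t | t \<in> Ka \<and> card t = 3. f2 (orda t) (orda t)) = Sp 3" unfolding Sp_def
 proof (rule sum.reindex_bij_witness[where i = "\<lambda>s. idx ` s" and j = "\<lambda>t. vt ` t"])
  fix t assume "t \<in> {t. t \<in> Ka \<and> card t = 3}"
  hence t: "t \<in> Ka" "card t = 3" by auto
  have V: "t \<subseteq> V" by (rule Ka_V[OF t(1)])
  show e: "idx ` vt ` t = t" by (rule vt_image[OF V])
  have tK: "vt ` t \<in> K" using Ka_K(1)[OF V] t(1) by simp
  show "vt ` t \<in> A 3" using tK Ka_K(2)[OF V] S.card_L[of t] t(2) G.card_idx[OF tK] e by (auto simp: A_def)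
  show "C.img (ord (vt ` t)) (ord (vt ` t)) = f2 (orda t) (orda t)" using orda[OF t(1)] t(1) V t(2) by (auto simp: f2_def)
 next
  fix s assume "s \<in> A 3"
  hence s: "s \<in> K" "card s = 3" by (auto simp: A_def)
  thus "idx ` s \<in> {t. t \<in> Ka \<and> card t = 3}" using K_idx G.card_idx by simp
  have "(\<lambda>v. vt (idx v)) ` s = (\<lambda>v. v) ` s" using s(1) by (intro image_cong refl vt(1)) blast
  thus "vt ` idx ` s = s" by (simp add: image_image)
 qed
 show ?thesis unfolding tr 1 2 3 by simp
qed

end

locale lefschetz_lift = lefschetz k K K' idx ps sd fi ord T A0 Z p j
 for k K K' idx ps sd fi ord T A0 and Z :: "'a topology" and p j +
 fixes K0 :: "nat set set" and par :: "nat => nat" and ht :: "nat => nat" and n :: nat and src tgt :: "nat => nat"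
  and lam :: "nat => nat => fgrp" and P :: "fgrp set => (nat \<times> fgrp) set set"
 assumes tb: "tree_basis Ka Kh K0 0 par ht n src tgt lam V La" and lm: "lifted_map Kh lam n K0 N.Cn P 0 N.Fh"
begin

sublocale TB: tree_basis Ka Kh K0 0 par ht n src tgt lam V La by (rule tb)
sublocale LM: lifted_map Kh lam n K0 N.Cn P 0 N.Fh by (rule lm)

end

context lefschetz_lift
begin

lemma Ka_Kh: "s \<in> Ka ==> s \<in> Kh" by (simp add: S.Kh_def)

lemma Fh_br: assumes "y \<in> polyhedron_of K" shows "N.Fh (G.br y) = G.br (fi y)" "G.br y \<in> realiz Kh"
using G.br_realiz[OF assms] G.bt_br[OF assms] N.Fh_def Ka_Kh by (auto simp: Fa_def realiz_def)

text \<open>The two ingredients of a potential for the exponents: \<open>q\<close> records the sheet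
  that the image of a vertex of sheet 0 reaches, \<open>r\<close> the action of the lift on the
  sheets themselves.\<close>

definition q :: "nat => nat => rat" where "q i v = of_int (eps i (LM.lab (pt (v, 0)) (psa v)))"
definition r :: "nat => fgrp => rat" where "r i g = of_int (eps i (LM.ph g))"

lemma r_zero: "r i 0 = 0" by (simp add: r_def LM.ph_zero)

lemma vertex_image: assumes "{v} \<in> Ka" shows "N.Fh (pt v) (psa v) ~= 0"
proof -
 have vV: "v \<in> V" using assms by (auto simp: V_def)
 hence K: "{vt v} \<in> K" using Ka_K(1)[of "{v}"] assms by simp
 have K': "vt v \<in> \<Union>K'" by (rule C.sd_vertex(1)[OF K])
 hence vK': "{vt v} \<in> K'" using K'_face by blast
 have "vt v \<in> open_star K' (vt v)" using segment_in_open_star[of "vt v" "vt v" K' 0] vK' by simp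
 note s = fi_star[OF this K']
 show ?thesis using s(1) Fh_br(1)[OF s(2)] G.br_vertex[OF K] vt(2)[OF vV] by (simp add: psa_def)
qed

text \<open>The star condition of a simplicial approximation: on the segment from \<open>a\<close>
  to \<open>b\<close> the image keeps a nonzero coordinate at \<open>ps a\<close> except possibly at
  the end, and at \<open>ps b\<close> except possibly at the start.\<close>

lemma subdivided_edge_potential:
 assumes xy: "{x, y} \<in> Ka" and ab: "{a, b} \<in> K'" "convex hull {a, b} \<subseteq> convex hull {vt x, vt y}"
 shows "LM.lab (LM.lift_at x 0 (G.br b)) (idx (ps b)) = LM.lab (LM.lift_at x 0 (G.br a)) (idx (ps a)) + lam (idx (ps a)) (idx (ps b))"
proof -
 have V: "x \<in> V" "y \<in> V" using xy by (auto simp: V_def)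
 have K: "{vt x, vt y} \<in> K" using Ka_K(1)[of "{x, y}"] xy V by simp
 have vK': "{a} \<in> K'" "{b} \<in> K'" "{b, a} \<in> K'" using K'_face[OF ab(1)] by auto
 have UK': "a \<in> \<Union>K'" "b \<in> \<Union>K'" using ab(1) by auto
 define c where "c t = (1 - t) *\<^sub>R a + t *\<^sub>R b" for t :: real
 have c_hull: "c t \<in> convex hull {vt x, vt y}" if "t \<in> {0..1}" for t
 using that hull_subset[of "{a, b}" convex] convex_convex_hull[of "{a, b}"] convexD ab(2) by (fastforce simp: c_def)
 hence cP: "c t \<in> polyhedron_of K" if "t \<in> {0..1}" for t using G.br_hull(2)[OF K] that by blast
 have cc: "continuous_on {0..1} c"
  unfolding c_def by (rule continuous_on_coordinatewise_then_product) (auto simp: scaleR_apply intro!: continuous_intros)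
 have "LM.lab (LM.lift_at x 0 (G.br (c 1))) (idx (ps b)) = LM.lab (LM.lift_at x 0 (G.br (c 0))) (idx (ps a)) + lam (idx (ps a)) (idx (ps b))"
 proof (rule LM.edge_potential[where c = "\<lambda>t. G.br (c t)"])
  show "{x, y} \<in> Kh" by (rule Ka_Kh[OF xy])
  show "continuous_on {0..1} (\<lambda>t. G.br (c t))" by (rule continuous_on_compose2[OF G.br_cont cc]) (use cP in auto)
  show "G.br (c t) \<in> realiz Kh" if "t \<in> {0..1}" for t by (rule Fh_br(2)[OF cP[OF that]])
  show "supp (G.br (c t)) \<subseteq> {x, y}" if "t \<in> {0..1}" for t using G.br_hull(1)[OF K c_hull[OF that]] vt(2) V by simp
  show "N.Fh (G.br (c t)) (idx (ps a)) ~= 0" if t: "t \<in> {0..<1}" for t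
  using t segment_in_open_star ab vK' fi_star[OF _ UK'(1)] Fh_br(1) by (simp add: c_def)
  show "N.Fh (G.br (c t)) (idx (ps b)) ~= 0" if t: "t \<in> {0<..1}" for t
  proof -
   have "(1 - (1 - t)) *\<^sub>R b + (1 - t) *\<^sub>R a \<in> open_star K' b" using t by (intro segment_in_open_star vK') auto
   thus ?thesis using fi_star[OF _ UK'(2)] Fh_br(1) by (simp add: c_def add.commute)
  qed
 qed
 thus ?thesis by (simp add: c_def)
qed

text \<open>Along the subdivided edge the exponents of the labels telescope to a difference between
  the two ends. The far end lies on sheet \<open>lam x y\<close>, to which the lift applies
  \<open>ph\<close>; this is the term with \<open>r\<close>.\<close>

lemma edge_sum:
 assumes xy: "{x, y} \<in> Ka"
 shows "(\<Sum>x'\<in>V. \<Sum>y'\<in>V. f1 x y x' y' * of_int (eps i (lam x' y'))) = 2 * (q i y + r i (lam x y) - q i x)"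
proof (cases "x = y")
 case True
 show ?thesis using True r_zero LM.lam_self[OF Ka_Kh[OF xy], of x] by (simp add: f1_def)
next
 case False
 note e = edge_vt[OF False xy]
 have s: "{x} \<in> Ka" "{y} \<in> Ka" using scomplexD[OF G.sc_Ka xy] by auto
 define xx where "xx u v = (of_int (eps i (lam (idx u) (idx v))) :: rat)" for u v
 define g where "g a = (of_int (eps i (LM.lab (LM.lift_at x 0 (G.br a)) (idx (ps a)))) :: rat)" for a
 have "(\<Sum>x'\<in>V. \<Sum>y'\<in>V. f1 x y x' y' * of_int (eps i (lam x' y'))) = (\<Sum>x'\<in>V. \<Sum>y'\<in>V. C.img [vt x, vt y] [vt x', vt y'] * xx (vt x') (vt y'))"
  using False xy vt(2) by (intro sum.cong refl) (simp add: f1_def xx_def)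
 also have "... = (\<Sum>x'\<in>V. \<Sum>v\<in>\<Union>K. C.img [vt x, vt y] [vt x', v] * xx (vt x') v)"
  by (intro sum.cong refl) (rule sum.reindex_bij_betw[OF vt(4)])
 also have "... = (\<Sum>u\<in>\<Union>K. \<Sum>v\<in>\<Union>K. C.img [vt x, vt y] [u, v] * xx u v)" by (rule sum.reindex_bij_betw[OF vt(4)])
 also have "... = 2 * (g (vt y) - g (vt x))"
 proof (rule C.img_edge_potential[OF e(1,2)])
  fix a b assume ab: "{a, b} \<in> K'" "convex hull {a, b} \<subseteq> convex hull {vt x, vt y}"
  show "xx (ps a) (ps b) = g b - g a"
   unfolding g_def xx_def subdivided_edge_potential[OF xy ab] by (simp add: eps_plus)
 qed
 finally have sum: "(\<Sum>x'\<in>V. \<Sum>y'\<in>V. f1 x y x' y' * of_int (eps i (lam x' y'))) = 2 * (g (vt y) - g (vt x))" .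
 have g: "g (vt z) = of_int (eps i (LM.lab (LM.lift_at x 0 (pt z)) (psa z)))" if "{z} \<in> Ka" for z
 proof -
  have z: "z \<in> V" using that by (auto simp: V_def)
  hence "{vt z} \<in> K" using Ka_K(1)[of "{z}"] that by simp
  thus ?thesis using G.br_vertex vt(2)[OF z] by (simp add: g_def psa_def)
 qed
 show ?thesis unfolding sum g[OF s(1)] g[OF s(2)] using LM.edge_ends[OF Ka_Kh[OF xy]] vertex_image[OF s(2)] by (simp add: q_def r_def eps_plus)
qed

theorem trace_eq: "alternating_trace K A0 (simplicial_matrix K' sd ps ord) = - (\<Sum>i<n. of_int (eps i (LM.ph (gen i))))"
proof -
 have qL: "q i v = 0" if "{v} \<in> La" for i v using that LaKa vertex_image LM.lab_C N.Cn_def by (auto simp: q_def)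
 have "of_nat (card {v \<in> V. {v} \<notin> La \<and> psa v = v}) - (\<Sum>(x, y) | {x, y} \<in> Ka - La \<and> x ~= y. f1 x y x y) / 2
  + (\<Sum>t | t \<in> Ka \<and> card t = 3. f2 (orda t) (orda t)) = - (\<Sum>i<n. r i (gen i))"
  by (rule TB.trace_formula[OF f1_props f1_boundary f1_triangle f2_props psa_La S.card_L qL r_zero edge_sum])
   (simp_all add: orda)
 thus ?thesis unfolding alternating_trace_eq r_def .
qed

theorem fixed_point:
 assumes "alternating_trace K A0 (simplicial_matrix K' sd ps ord) \<ge> 1"
 shows "\<exists>x\<in>A0. fi x = x"
proof -
 \<comment> \<open>\<open>ph\<close> is a homomorphism on \<open>FG n\<close> only, while
   \<open>twisted\<close> asks for one on the whole group; the remaining generators are sent to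
   0.\<close>
 define h where "h = hom_ext (\<lambda>i. if i < n then LM.ph (gen i) else 0)"
 have phFG: "LM.ph x \<in> FG n" if "x \<in> FG n" for x using LM.ph(1)[OF that] .
 interpret twisted n h
 proof
  show "h (x + y) = h x + h y" for x y by (simp add: h_def hom_ext_plus)
  show "h x \<in> FG n" for x unfolding h_def by (rule hom_ext_FG) (simp add: phFG)
 qed
 have h: "h x = LM.ph x" if "x \<in> FG n" for x unfolding h_def by (rule hom_ext_eq[OF LM.ph_plus that]) simp_all
 have "of_int (\<Sum>i<n. eps i (h (gen i))) \<le> (-1 :: rat)" using assms unfolding trace_eq by (simp add: h_def)
 hence "(\<Sum>i<n. eps i (h (gen i))) \<le> -1" by linarith
 then obtain ga where ga: "ga \<in> FG n" "!!g. g \<in> FG n ==> ga + h g ~= g"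
  "!!k. \<exists>N. \<forall>x\<in>FG n. N \<le> len x --> \<not> prefix (take (len x - k) (word x)) (word (ga + h x))"
  by (rule inward_class) blast
 have "\<exists>x\<in>realiz Kh - realiz N.Cn. N.Fh x = x"
 by (rule LM.fixed_point_of_inward_lift[OF ga(1)]; use ga(2) h ga(3) in \<open>auto\<close>)
 then obtain x where x: "x \<in> realiz Kh" "x \<notin> realiz N.Cn" "N.Fh x = x" by blast
 have xK: "x \<in> realiz Ka" using x(1,2) unfolding Kh_Cn[symmetric] realiz_Un by blast
 show ?thesis using bt_A0[OF xK] x(2) xK Fa(3)[OF xK] x(3) by (fastforce simp: realiz_def N.Cn_def N.Fh_def)
qed

end

section \<open>Choice of the spanning tree and of the labels, and the theorem\<close>

theorem (in lefschetz) fixed_point_of_positive_trace: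
 assumes "alternating_trace K A0 (simplicial_matrix K' sd ps ord) \<ge> 1"
 shows "\<exists>x\<in>A0. fi x = x"
proof -
 obtain K0 where K0: "expands K0 Kh" "scomplex K0" "\<forall>s\<in>K0. card s \<le> 2" "edge_connected K0 0"
  "\<forall>v. {v} \<in> Kh --> {v} \<in> K0" "\<forall>v. {0, v} \<in> Kh --> {0, v} \<in> K0"
  using expands_from_graph[OF S.finKh S.scKh _ S.free_Kh S.edge_connected_Kh] S.card_Kh by blast
 have sub: "K0 \<subseteq> Kh" using expands_scomplex[OF K0(1,2)] by blast
 have fin0: "finite K0" using S.finKh sub finite_subset by blast
 have w0: "{0} \<in> K0" using K0(5) by (auto simp: S.Kh_def)
 obtain V' and par :: "nat => nat" and ht :: "nat => nat" and n :: nat and src tgt :: "nat => nat" where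
  V': "V' = {v. {v} \<in> K0}" "finite V'" and par: "!!v. v \<in> V' - {0} ==> par v \<in> V' \<and> ht (par v) < ht v \<and> {v, par v} \<in> K0"
  and gens: "!!i. i < n ==> src i \<in> V' \<and> tgt i \<in> V' \<and> src i ~= tgt i \<and> {src i, tgt i} \<in> K0"
   "!!i v. i < n ==> v \<in> V' - {0} ==> {src i, tgt i} ~= {v, par v}"
   "!!i j. i < n ==> j < n ==> {src i, tgt i} = {src j, tgt j} ==> i = j"
  and K0_eq: "K0 = (\<lambda>v. {v}) ` V' \<union> (\<lambda>v. {v, par v}) ` (V' - {0}) \<union> (\<lambda>i. {src i, tgt i}) ` {..<n}"
  and par0: "!!v. v ~= 0 ==> {0, v} \<in> K0 ==> par v = 0"
 proof (rule spanning_tree[OF fin0 K0(2,3,4) w0], goal_cases)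
  case (1 V' par ht n src tgt)
  show ?case by (rule that) (fact 1)+
 qed
 have zV: "0 \<notin> V" using S.om by (simp add: V_def)
 have V'V: "V' = insert 0 V"
 proof (intro equalityI subsetI)
  fix v assume "v \<in> V'"
  thus "v \<in> insert 0 V" using LaKa V'(1) sub by (auto simp: S.Kh_def V_def)
 next
  fix v assume "v \<in> insert 0 V"
  thus "v \<in> V'" using K0(5) V'(1) scomplexD[OF G.sc_Ka, of _ "{v}"] by (auto simp: S.Kh_def V_def)
 qed
 have V'0: "V' - {0} = V" using V'V zV by auto
 \<comment> \<open>The labels on the graph: the edge off the tree with index \<open>i\<close>
   carries generator \<open>i\<close> in one direction and its inverse in the other, and all other
   pairs carry 0. The index picked by \<open>SOME\<close> is unique because different indices have
   different edges.\<close>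
 define lam0 where "lam0 u v = (if \<exists>i<n. src i = u \<and> tgt i = v then gen (SOME i. i < n \<and> src i = u \<and> tgt i = v)
  else if \<exists>i<n. src i = v \<and> tgt i = u then - gen (SOME i. i < n \<and> src i = v \<and> tgt i = u) else 0)" for u v
 have uniq: "(SOME i'. i' < n \<and> src i' = src i \<and> tgt i' = tgt i) = i" if "i < n" for i using that gens(3) by auto
 have no: "\<not> (\<exists>i'<n. src i' = tgt i \<and> tgt i' = src i)" if i: "i < n" for i
 proof
  assume "\<exists>i'<n. src i' = tgt i \<and> tgt i' = src i"
  then obtain i' where i': "i' < n" "src i' = tgt i" "tgt i' = src i" by blast
  hence "i' = i" by (intro gens(3)[OF i'(1) i]) auto
  thus False using i' gens(1)[OF i] by simp
 qed
 have l_gen: "lam0 (src i) (tgt i) = gen i" if "i < n" for i using uniq[OF that] that by (auto simp: lam0_def)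
 have l_gen': "lam0 (tgt i) (src i) = - gen i" if "i < n" for i using uniq[OF that] no[OF that] that by (auto simp: lam0_def)
 have l_else: "lam0 u v = 0" if "!!i. i < n ==> {src i, tgt i} ~= {u, v}" for u v using that by (auto simp: lam0_def)
 have cases: "(\<exists>i<n. u = src i \<and> v = tgt i) \<or> (\<exists>i<n. u = tgt i \<and> v = src i) \<or> (\<forall>i<n. {src i, tgt i} ~= {u, v})" for u v
  by (auto simp: doubleton_eq_iff)
 have l_anti: "lam0 v u = - lam0 u v" for u v using cases[of u v]
 by (elim disjE exE conjE; use l_else[of u v] l_else[of v u] insert_commute l_gen l_gen' in \<open>fastforce\<close>)
 have l_FG: "lam0 u v \<in> FG n" for u v using cases[of u v]
 by (elim disjE exE conjE; use l_else[of u v] l_gen l_gen' in \<open>auto\<close>)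
 have l_refl: "lam0 v v = 0" for v by (rule l_else; use gens(1) in \<open>fastforce\<close>)
 have "\<exists>lam. (\<forall>u v. {u, v} \<in> K0 --> lam u v = lam0 u v) \<and> (\<forall>u v w. {u, v, w} \<in> Kh --> lam u w = lam u v + lam v w)
  \<and> (\<forall>u v. lam u v \<in> FG n) \<and> (\<forall>u v. lam v u = - lam u v)"
  by (rule expands_cocycle[OF K0(1-3)]; (rule l_anti l_FG l_refl | simp add: FG_plus))
 then obtain lam where lam': "(\<forall>u v. {u, v} \<in> K0 --> lam u v = lam0 u v) \<and> (\<forall>u v w. {u, v, w} \<in> Kh --> lam u w = lam u v + lam v w)
  \<and> (\<forall>u v. lam u v \<in> FG n) \<and> (\<forall>u v. lam v u = - lam u v)" by (rule exE)
 have lam: "!!u v. {u, v} \<in> K0 ==> lam u v = lam0 u v" "!!u v w. {u, v, w} \<in> Kh ==> lam u w = lam u v + lam v w"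
  "!!u v. lam u v \<in> FG n" "!!u v. lam v u = - lam u v" using lam' by blast+
 have lam_tree: "lam v (par v) = 0" if v: "v \<in> V" for v using v V'0 par lam(1) gens(2) l_else by simp
 have lam_gen: "lam (src i) (tgt i) = gen i" if "i < n" for i using lam(1) gens(1)[OF that] l_gen[OF that] by simp
 have par_La: "par v = 0" if "{v} \<in> La" for v
 proof -
  have "v ~= 0" using zV that LaKa by (auto simp: V_def)
  moreover have "{0, v} \<in> Kh" using that by (auto simp: S.Kh_def)
  ultimately show ?thesis using par0 K0(6) by blast
 qed
 have tb: "tree_basis Ka Kh K0 0 par ht n src tgt lam V La"
 proof
  show "expands K0 Kh" "finite Kh" "scomplex La" "scomplex Ka" "V = \<Union>Ka" "0 \<notin> V" "La \<subseteq> Ka"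
   by (rule K0(1) S.finKh S.scL G.sc_Ka V_def zV LaKa)+
  show "Kh = Ka \<union> {{0}} \<union> insert 0 ` La" by (rule S.Kh_def)
  show "K0 = (\<lambda>v. {v}) ` insert 0 V \<union> (\<lambda>v. {v, par v}) ` V \<union> (\<lambda>i. {src i, tgt i}) ` {..<n}"
  using V'V V'0 K0_eq by simp
  show "par v \<in> insert 0 V \<and> ht (par v) < ht v" if "v \<in> V" for v using that V'0 par V'V by simp
  show "par v = 0" if "{v} \<in> La" for v by (rule par_La[OF that])
  show "src i ~= tgt i" if "i < n" for i using gens(1)[OF that] by simp
  show "lam v (par v) = 0" if "v \<in> V" for v by (rule lam_tree[OF that])
  show "lam (src i) (tgt i) = gen i" if "i < n" for i by (rule lam_gen[OF that])
  show "lam u w = lam u v + lam v w" if "{u, v, w} \<in> Kh" for u v w by (rule lam(2)[OF that])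
  show "lam v u = - lam u v" for u v by (rule lam(4))
 qed
 interpret TB: tree_basis Ka Kh K0 0 par ht n src tgt lam V La by (rule tb)
 interpret LB: labelled Kh lam n by standard (use S.scKh S.finKh lam(2,3) in auto)
 have "LB.family K0 K0 (\<lambda>W. {s \<in> cover n lam K0. snd ` s \<subseteq> W})"
 proof (rule LB.family_base[OF V'(2) _ _ _ K0_eq K0(2) sub])
  show "0 \<in> V'" using V'V by simp
  show "par v \<in> V' \<and> ht (par v) < ht v \<and> lam v (par v) = 0" if "v \<in> V' - {0}" for v
   using par[OF that] lam_tree[of v] that V'0 by simp
  show "src i \<in> V' \<and> tgt i \<in> V' \<and> src i ~= tgt i \<and> lam (src i) (tgt i) = gen i" if "i < n" for i
   using gens(1)[OF that] lam_gen[OF that] by simp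
 qed
 from LB.family_expands[OF K0(1,2) this subset_refl] obtain P where P: "LB.family K0 Kh P" by (rule exE)
 have lm: "lifted_map Kh lam n K0 N.Cn P 0 N.Fh"
 proof
  show "LB.family K0 Kh P" by (rule P)
  show "{0} \<in> K0" "K0 \<subseteq> Kh" by (rule w0 sub)+
  show "N.Cn \<subseteq> Kh" using Kh_Cn by blast
  show "{0} \<in> N.Cn" by (simp add: N.Cn_def)
  show "connected (realiz N.Cn)" by (rule N.connected_Cn)
  show "continuous_on (realiz Kh) N.Fh" using N.Fh_cont Kh_Cn by simp
  show "N.Fh x \<in> realiz Kh" if "x \<in> realiz Kh" for x using N.Fh_maps(2)[of x] Kh_Cn that by simp
  show "N.Fh x \<in> realiz N.Cn" if "x \<in> realiz N.Cn" for x by (rule N.Fh_maps(1)[OF that])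
  show "N.Fh (pt 0) = pt 0" by (rule N.Fh_pt)
  show "lam u v = 0" if s: "s \<in> N.Cn" "u \<in> s" "v \<in> s" for s u v
  proof -
   have L0: "lam u 0 = 0" "lam 0 u = 0" if "{u} \<in> La \<or> u = 0" for u
   proof -
    show "lam u 0 = 0" using that lam_tree[of u] LB.lam_self[of "{0}" 0] w0 sub LaKa par_La by (fastforce simp: V_def)
    thus "lam 0 u = 0" using lam(4)[of 0 u] by simp
   qed
   have sing: "{u} \<in> La \<or> u = 0" if "s \<in> N.Cn" "u \<in> s" for s u
    using that scomplexD[OF S.scL, of _ "{u}"] by (auto simp: N.Cn_def)
   show ?thesis
   using L0(1)[OF sing[OF s(1,2)]] L0(2)[OF sing[OF s(1,3)]] s scomplexD[OF S.scL, of _ "{u, v}"] N.Cn_def TB.lam_L by auto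
  qed
 qed
 interpret lefschetz_lift k K K' idx ps sd fi ord T A0 Z p j K0 par ht n src tgt lam P
  by (intro lefschetz_lift.intro lefschetz_lift_axioms.intro lefschetz_axioms tb lm)
 show ?thesis by (rule fixed_point[OF assms])
qed

theorem theorem5p16:
  fixes D :: "nat \<Rightarrow> (nat \<Rightarrow> real) set set"
    and n :: nat
    and U :: "(nat \<Rightarrow> real) set"
    and f :: "(nat \<Rightarrow> real) \<Rightarrow> (nat \<Rightarrow> real)"
    and L :: rat
  assumes "o_minimal_structure D"
    and "U \<in> D n"
    and "closedin (Euclidean_space n) U"
    and "compact_space (Alexandroff_compactification (subspace_of_Rn n U))"
    and "connected_space (Alexandroff_compactification (subspace_of_Rn n U))"
    and "surface_with_boundary (Alexandroff_compactification (subspace_of_Rn n U))"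
    and "homeomorphic_map (subspace_of_Rn n U) (subspace_of_Rn n U) f"
    and "has_Lambda_comb D n U f L"
    and "L \<ge> 1"
  shows "\<exists>x\<in>U. f x = x"
proof -
 let ?Z = "Alexandroff_compactification (subspace_of_Rn n U)"
 have U: "U \<subseteq> Rn n" by (rule closedin_subset[OF assms(3)])
 hence tU: "topspace (subspace_of_Rn n U) = U" by auto
 obtain m X i f' where X: "definable_compactification D n U m X i"
  and f': "continuous_map (subspace_of_Rn m X) (subspace_of_Rn m X) f'" "\<forall>x\<in>U. f' (i x) = i (f x)" "f' ` (X - i ` U) \<subseteq> X - i ` U"
  and HL: "has_Lambda D m X (i ` U) f' L" and fU: "continuous_map (subspace_of_Rn n U) (subspace_of_Rn n U) f"
  using assms(8) unfolding has_Lambda_comb_def by blast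
 obtain k K ta K' ps sd ord T where K: "geometric_complex k K"
  "homeomorphic_map (subspace_of_Rn k (polyhedron_of K)) (subspace_of_Rn m X) ta"
  "T \<subseteq> K" "{x \<in> polyhedron_of K. ta x \<in> i ` U} = (\<Union>s\<in>T. open_simplex s)"
  "subdivision_of k K' K" "simplicial_approximation K' K (inv_into (polyhedron_of K) ta \<circ> f' \<circ> ta) ps"
  "subdivision_operator K K' sd" "orientation K ord"
  "L = alternating_trace K {x \<in> polyhedron_of K. ta x \<in> i ` U} (simplicial_matrix K' sd ps ord)"
  using HL unfolding has_Lambda_def by (elim conjE exE) (rule that; assumption)
 define P where "P = polyhedron_of K"
 define A0 where "A0 = {x \<in> P. ta x \<in> i ` U}"
 define fi where "fi = inv_into P ta \<circ> f' \<circ> ta"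
 have XR: "X \<subseteq> Rn m" using X unfolding definable_compactification_def by (simp add: compactin_def)
 have PR: "P \<subseteq> Rn k" unfolding P_def by (rule polyhedron_subset[OF K(1)])
 note sX = subspace_of_Rn_eq[OF XR] and sP = subspace_of_Rn_eq[OF PR]
 have ta: "homeomorphic_map (top_of_set P) (top_of_set X) ta" using K(2) unfolding P_def[symmetric] sX sP .
 have taP: "ta ` P = X" "inj_on ta P" using homeomorphic_imp_surjective_map[OF ta] homeomorphic_imp_injective_map[OF ta] by simp_all
 have cta: "continuous_on P ta" using homeomorphic_imp_continuous_map[OF ta] by simp
 obtain g where g: "homeomorphic_maps (top_of_set P) (top_of_set X) ta g" using ta homeomorphic_map_maps by metis
 have gX: "g y \<in> P" "ta (g y) = y" if "y \<in> X" for y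
  using g that unfolding homeomorphic_maps_def by (auto simp: continuous_map_def)
 have gta: "g (ta x) = x" if "x \<in> P" for x using g that unfolding homeomorphic_maps_def by auto
 have cg: "continuous_on X g" using g unfolding homeomorphic_maps_def by simp
 have inv: "inv_into P ta y = g y" if "y \<in> X" for y using gX[OF that] taP(2) by (intro inv_into_f_eq) auto
 have f'c: "continuous_on X f'" "f' ` X \<subseteq> X" using f'(1) unfolding sX by (auto simp: continuous_map_in_subtopology)
 have taX: "ta x \<in> X" "f' (ta x) \<in> X" if "x \<in> P" for x using taP(1) f'c(2) that by auto
 have fi: "fi x = g (f' (ta x))" "fi x \<in> P" "ta (fi x) = f' (ta x)" if "x \<in> P" for x
  using inv[OF taX(2)[OF that]] gX[OF taX(2)[OF that]] by (simp_all add: fi_def)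
 have "continuous_on P (\<lambda>x. g (f' (ta x)))"
  by (rule continuous_on_compose2[OF cg continuous_on_compose2[OF f'c(1) cta]]) (use taX in auto)
 hence cfi: "continuous_on P fi" by (rule continuous_on_eq) (simp add: fi(1))
 have iUX: "i ` U \<subseteq> X" using X tU unfolding definable_compactification_def embedding_map_def
  by (metis (no_types, lifting) closure_of_subset_topspace inf.cobounded1 homeomorphic_imp_surjective_map topspace_subtopology subset_trans sX topspace_euclidean_subtopology)
 have ih: "homeomorphic_map (subspace_of_Rn n U) (top_of_set (i ` U)) i" using X tU iUX by (simp add: definable_compactification_def embedding_map_def sX subtopology_subtopology Int_absorb1)
 hence inj_i: "inj_on i U" using homeomorphic_imp_injective_map[OF ih] tU by simp
 obtain i' where "homeomorphic_maps (subspace_of_Rn n U) (top_of_set (i ` U)) i i'" using ih homeomorphic_map_maps by metis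
 hence i': "homeomorphic_map (top_of_set (i ` U)) (subspace_of_Rn n U) i'"
  using homeomorphic_maps_sym homeomorphic_map_maps by blast
 have "ta ` (topspace (top_of_set P) \<inter> A0) = topspace (top_of_set X) \<inter> i ` U"
  using taP(1) by (auto simp: A0_def)
 hence "homeomorphic_map (subtopology (top_of_set P) A0) (subtopology (top_of_set X) (i ` U)) ta"
  by (rule homeomorphic_map_subtopologies[OF ta])
 moreover have "A0 \<subseteq> P" by (auto simp: A0_def)
 ultimately have taA: "homeomorphic_map (top_of_set A0) (top_of_set (i ` U)) ta"
  using iUX by (simp add: subtopology_subtopology Int_absorb1)
 have So: "homeomorphic_map (subspace_of_Rn n U) (subtopology ?Z (topspace ?Z - {None})) Some" using embedding_map_Some[of "subspace_of_Rn n U"] tU by (simp add: embedding_map_def)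
 have "X \<inter> i ` U = i ` U" using iUX by blast
 hence "X \<inter> closure (i ` U) = X" using X unfolding definable_compactification_def sX by (simp add: closure_of_subtopology)
 hence "X \<subseteq> closure (i ` U)" by blast
 moreover have "closed X" using X XR unfolding definable_compactification_def
  by (metis compactin_subtopology compact_closed_fun compactin_euclidean_iff compactin_absolute sX)
 ultimately have clo: "closure (i ` U) = X" using closure_minimal[OF iUX] by blast
 have gA: "g ` i ` U \<subseteq> A0" using gX iUX by (auto simp: A0_def)
 \<comment> \<open>\<open>U\<close> is dense in its compactification, and \<open>g\<close> carries
   this density to the polyhedron.\<close>
 have "g ` closure (i ` U) \<subseteq> closure A0" by (rule image_closure_subset) (use cg clo gA closure_subset in auto)
 hence dense: "P \<subseteq> closure A0" unfolding clo using gta taX(1) by force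
 have fUU: "f u \<in> U" if "u \<in> U" for u using fU that tU by (auto simp: continuous_map_def)
 have fiA: "fi ` A0 \<subseteq> A0" using fi(2) fUU fi(3) f'(2) by (auto simp: A0_def)
 have fiA': "fi ` (P - A0) \<subseteq> P - A0"
 by (rule image_subsetI; use taX(1) fi(2,3) f'(3) in \<open>fastforce simp: A0_def\<close>)
 note tafi = fi(3)
 have "finite (\<Union>K)" using K(1) by (auto simp: geometric_complex_def)
 then obtain e :: "(nat => real) => nat" where e: "inj_on e (\<Union>K)" using finite_imp_inj_to_nat_seg by metis
 \<comment> \<open>The successor keeps 0 free for the apex of the cone.\<close>
 define idx where "idx x = Suc (e x)" for x
 interpret lefschetz k K K' idx ps sd fi ord T A0 ?Z None "Some \<circ> (i' \<circ> ta)"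
 proof
  show "geometric_complex k K" "subdivision_of k K' K" "subdivision_operator K K' sd" "orientation K ord" "T \<subseteq> K"
   by (rule K)+
  show "inj_on idx (\<Union>K)" using e by (simp add: inj_on_def idx_def)
  show "simplicial_map K' K ps" using K(6) by (simp add: simplicial_approximation_def)
  show "0 \<notin> idx ` \<Union>K" by (auto simp: idx_def)
  show "simplicial_approximation K' K fi ps" using K(6) by (simp add: fi_def P_def)
  show "continuous_on (polyhedron_of K) fi" "fi ` polyhedron_of K \<subseteq> polyhedron_of K" "fi ` (polyhedron_of K - A0) \<subseteq> polyhedron_of K - A0"
   "polyhedron_of K \<subseteq> closure A0" using cfi fi(2) fiA' dense unfolding P_def by auto
  show "A0 = (\<Union>s\<in>T. open_simplex s)" using K(4) by (simp add: A0_def P_def)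
  show "fi ` A0 \<subseteq> A0" by (rule fiA)
  show "homeomorphic_map (top_of_set A0) (subtopology ?Z (topspace ?Z - {None})) (Some \<circ> (i' \<circ> ta))" using homeomorphic_map_compose[OF homeomorphic_map_compose[OF taA i'] So] by simp
 qed (use assms(4-6) in auto)
 have "\<exists>x\<in>A0. fi x = x"
  by (rule fixed_point_of_positive_trace) (use K(9) assms(9) in \<open>simp add: A0_def P_def\<close>)
 then obtain x u where x: "x \<in> P" "u \<in> U" "ta x = i u" "fi x = x" by (auto simp: A0_def)
 thus ?thesis using x(2) inj_i fUU[OF x(2)] tafi[OF x(1)] f'(2) by (metis inj_on_def)
qed

end
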